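(* (1) $\mathrm{SOM}(Q^{\star}_{\mathrm{REG}^s},+,\times)\equiv \mathrm{LIN\text{-}MODPH}$, i.e., the languages definable in $\mathrm{SOM}(Q^{\star}_{\mathrm{REG}^s},+,\times)$ are exactly those in the linear modular polynomial hierarchy. (2) $\mathrm{SOM}(Q^{\star}_{\mathrm{CFL}^s})\equiv\mathrm{LIN\text{-}CH}$, i.e., the languages definable in $\mathrm{SOM}(Q^{\star}_{\mathrm{CFL}^s})$ are exactly those in the linear counting hierarchy.
   Context: Strings as structures: a nonempty string $b_0\cdots b_{n-1}$ over the ordered alphabet $(a_1,\dots,a_s)$ is the structure with universe $\{0,\dots,n-1\}$, natural order $<$, and unary predicates $P_{a_i}=\{j:b_j=a_i\}$. FO uses $=$, $<$, these predicates, $\min,\max$, connectives, $\exists,\forall$; SOM adds unary second-order variables and quantifiers. "$+,\times$" means the ternary relations $i+j=k$, $i\cdot j=k$ are additionally built in. Quantifier $Q^{\star}_L$ for a language $L$ over $(a_1,\dots,a_s)$ binding distinct unary variables $\overline X=(X_1,\dots,X_k)$: over universe $\{0,\dots,n-1\}$, encode an assignment $(A_1,\dots,A_k)$ by $s^1_0\cdots s^1_{n-1}\cdots s^k_0\cdots s^k_{n-1}$ ($s^i_j=1$ iff $j\in A_i$), order the $2^{nk}$ assignments lexicographically by code; $\mathcal A\models Q^{\star}_L\overline X[\varphi_1,\dots,\varphi_{s-1}]$ iff the word of length $2^{nk}$ whose $i$-th letter is $a_j$ for the least $j$ with $\varphi_j$ true at the $i$-th assignment (and $a_s$ if none) lies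 in $L$. A language is symmetric (commutative) if it is closed under permuting the letters of its words. $\mathrm{REG}^s$ and $\mathrm{CFL}^s$ denote the symmetric regular and symmetric context-free languages. $\mathrm{SOM}(Q^{\star}_{\mathrm{REG}^s},+,\times)$ is SOM with built-in $+,\times$ closed under (nested) application of $Q^\star_L$ for $L\in\mathrm{REG}^s$; $\mathrm{SOM}(Q^{\star}_{\mathrm{CFL}^s})$ is SOM (only $<$ built in) closed under (nested) application of $Q^\star_L$ for $L\in\mathrm{CFL}^s$. Equivalence of a logic with a class means the languages (over any alphabet) definable by sentences of the logic are exactly the languages of the class. $\mathrm{LIN\text{-}CH}$ is the linear-time analogue of the counting hierarchy: the oracle hierarchy whose first level is the class of languages accepted by nondeterministic linear-time Turing machines accepting iff more than half of the computation paths accept (linear-time PP), each next level consisting of languages accepted by such linear-time majority machines with an oracle from the previous level. $\mathrm{LIN\text{-}MODPH}$ is the linear-time analogue of the modular polynomial hierarchy: the oracle hierarchy whose building block is linear-time NP together with linear-time $\mathrm{Mod}_q\mathrm{P}$ ($q>1$), the $(k+1)$-th level being obtained by allowing such linear-time machines access to oracles from the Boolean closure of the $k$-th level. *)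

theory Defs
  imports Main "HOL-Library.Multiset"
begin

text \<open>The ordered alphabet (a_1,...,a_s) is represented by the letters 0,...,s-1
  (letter j-1 stands for a_j).  A language over this alphabet is a set of
  words, i.e. a subset of lists {..<s}.  Languages together with their alphabet
  size are pairs (s, L).\<close>

type_synonym lang = "nat list set"

definition symmetric_lang :: "lang \<Rightarrow> bool" where
  "symmetric_lang L \<longleftrightarrow> (\<forall>w\<in>L. \<forall>v. mset v = mset w \<longrightarrow> v \<in> L)"

definition regular_lang :: "nat \<Rightarrow> lang \<Rightarrow> bool" where
  "regular_lang s L \<longleftrightarrow> L \<subseteq> lists {..<s} \<and>
     (\<exists>(n::nat) (q0::nat) (\<delta>::nat \<Rightarrow> nat \<Rightarrow> nat) (F::nat set).
        q0 < n \<and> (\<forall>q<n. \<forall>a<s. \<delta> q a < n) \<and>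
        L = {w \<in> lists {..<s}. fold (\<lambda>a q. \<delta> q a) w q0 \<in> F})"

definition cfg_step :: "(nat \<times> (nat + nat) list) set \<Rightarrow> (nat + nat) list \<Rightarrow> (nat + nat) list \<Rightarrow> bool" where
  "cfg_step P u v \<longleftrightarrow> (\<exists>xs ys A rhs. (A, rhs) \<in> P \<and> u = xs @ [Inl A] @ ys \<and> v = xs @ rhs @ ys)"

definition context_free_lang :: "nat \<Rightarrow> lang \<Rightarrow> bool" where
  "context_free_lang s L \<longleftrightarrow> L \<subseteq> lists {..<s} \<and>
     (\<exists>P S. finite P \<and> L = {w \<in> lists {..<s}. (cfg_step P)\<^sup>*\<^sup>* [Inl S] (map Inr w)})"

definition REG_sym :: "nat \<Rightarrow> lang \<Rightarrow> bool" where
  "REG_sym s L \<longleftrightarrow> regular_lang s L \<and> symmetric_lang L"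

definition CFL_sym :: "nat \<Rightarrow> lang \<Rightarrow> bool" where
  "CFL_sym s L \<longleftrightarrow> context_free_lang s L \<and> symmetric_lang L"

datatype trm = V nat | TMin | TMax

datatype fm =
    Eq trm trm | Lt trm trm
  | Pr nat trm            \<comment> \<open>P_a(t), a the letter index\<close>
  | Mem nat trm
  | Plus trm trm trm
  | Times trm trm trm
  | Neg fm | Conj fm fm | Disj fm fm
  | Ex nat fm | All nat fm
  | ExS nat fm | AllS nat fm
  | QStar nat lang "nat list" "fm list"
      \<comment> \<open>QStar s L [X_1..X_k] [phi_1..phi_(s-1)]\<close>

fun fv_fo :: "fm \<Rightarrow> nat set" and fv_trm :: "trm \<Rightarrow> nat set" where
  "fv_trm (V i) = {i}" | "fv_trm TMin = {}" | "fv_trm TMax = {}"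
| "fv_fo (Eq a b) = fv_trm a \<union> fv_trm b"
| "fv_fo (Lt a b) = fv_trm a \<union> fv_trm b"
| "fv_fo (Pr _ a) = fv_trm a"
| "fv_fo (Mem _ a) = fv_trm a"
| "fv_fo (Plus a b c) = fv_trm a \<union> fv_trm b \<union> fv_trm c"
| "fv_fo (Times a b c) = fv_trm a \<union> fv_trm b \<union> fv_trm c"
| "fv_fo (Neg f) = fv_fo f"
| "fv_fo (Conj f g) = fv_fo f \<union> fv_fo g"
| "fv_fo (Disj f g) = fv_fo f \<union> fv_fo g"
| "fv_fo (Ex i f) = fv_fo f - {i}"
| "fv_fo (All i f) = fv_fo f - {i}"
| "fv_fo (ExS _ f) = fv_fo f"
| "fv_fo (AllS _ f) = fv_fo f"
| "fv_fo (QStar _ _ _ fs) = \<Union>(set (map fv_fo fs))"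

fun fv_so :: "fm \<Rightarrow> nat set" where
  "fv_so (Mem X _) = {X}"
| "fv_so (Neg f) = fv_so f"
| "fv_so (Conj f g) = fv_so f \<union> fv_so g"
| "fv_so (Disj f g) = fv_so f \<union> fv_so g"
| "fv_so (Ex _ f) = fv_so f"
| "fv_so (All _ f) = fv_so f"
| "fv_so (ExS X f) = fv_so f - {X}"
| "fv_so (AllS X f) = fv_so f - {X}"
| "fv_so (QStar _ _ Xs fs) = \<Union>(set (map fv_so fs)) - set Xs"
| "fv_so _ = {}"

definition sentence :: "fm \<Rightarrow> bool" where
  "sentence f \<longleftrightarrow> fv_fo f = {} \<and> fv_so f = {}"

fun in_logic :: "bool \<Rightarrow> (nat \<Rightarrow> lang \<Rightarrow> bool) \<Rightarrow> fm \<Rightarrow> bool" where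
  "in_logic ar al (Plus _ _ _) = ar"
| "in_logic ar al (Times _ _ _) = ar"
| "in_logic ar al (Neg f) = in_logic ar al f"
| "in_logic ar al (Conj f g) = (in_logic ar al f \<and> in_logic ar al g)"
| "in_logic ar al (Disj f g) = (in_logic ar al f \<and> in_logic ar al g)"
| "in_logic ar al (Ex _ f) = in_logic ar al f"
| "in_logic ar al (All _ f) = in_logic ar al f"
| "in_logic ar al (ExS _ f) = in_logic ar al f"
| "in_logic ar al (AllS _ f) = in_logic ar al f"
| "in_logic ar al (QStar s L Xs fs) =
     (al s L \<and> 1 \<le> s \<and> L \<subseteq> lists {..<s} \<and> length fs = s - 1 \<and>
      distinct Xs \<and> Xs \<noteq> [] \<and> list_all id (map (in_logic ar al) fs))"
| "in_logic ar al _ = True"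

fun eval_trm :: "nat list \<Rightarrow> (nat \<Rightarrow> nat) \<Rightarrow> trm \<Rightarrow> nat" where
  "eval_trm w fo (V i) = fo i"
| "eval_trm w fo TMin = 0"
| "eval_trm w fo TMax = length w - 1"

text \<open>The i-th assignment (in the lexicographic order of codes
  s^1_0..s^1_(n-1) ... s^k_0..s^k_(n-1)) to X_1..X_k over universe {0..<n}:
  bit number p (counted from the left, 0-based) of the nk-bit binary
  representation of i; X_(l+1) gets bits l*n .. l*n+n-1.\<close>

definition assign_set :: "nat \<Rightarrow> nat \<Rightarrow> nat \<Rightarrow> nat \<Rightarrow> nat set" where
  "assign_set n k i l = {j. j < n \<and> odd (i div 2 ^ (n * k - 1 - (l * n + j)))}"

definition assign_upd :: "(nat \<Rightarrow> nat set) \<Rightarrow> nat list \<Rightarrow> nat \<Rightarrow> nat \<Rightarrow> nat \<Rightarrow> nat set" where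
  "assign_upd so Xs n i =
     fold (\<lambda>(l, X) g. g(X := assign_set n (length Xs) i l)) (enumerate 0 Xs) so"

fun sat :: "nat list \<Rightarrow> (nat \<Rightarrow> nat) \<Rightarrow> (nat \<Rightarrow> nat set) \<Rightarrow> fm \<Rightarrow> bool" where
  "sat w fo so (Eq a b) = (eval_trm w fo a = eval_trm w fo b)"
| "sat w fo so (Lt a b) = (eval_trm w fo a < eval_trm w fo b)"
| "sat w fo so (Pr c a) = (eval_trm w fo a < length w \<and> w ! eval_trm w fo a = c)"
| "sat w fo so (Mem X a) = (eval_trm w fo a \<in> so X)"
| "sat w fo so (Plus a b c) = (eval_trm w fo a + eval_trm w fo b = eval_trm w fo c)"
| "sat w fo so (Times a b c) = (eval_trm w fo a * eval_trm w fo b = eval_trm w fo c)"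
| "sat w fo so (Neg f) = (\<not> sat w fo so f)"
| "sat w fo so (Conj f g) = (sat w fo so f \<and> sat w fo so g)"
| "sat w fo so (Disj f g) = (sat w fo so f \<or> sat w fo so g)"
| "sat w fo so (Ex i f) = (\<exists>a<length w. sat w (fo(i := a)) so f)"
| "sat w fo so (All i f) = (\<forall>a<length w. sat w (fo(i := a)) so f)"
| "sat w fo so (ExS X f) = (\<exists>A\<subseteq>{..<length w}. sat w fo (so(X := A)) f)"
| "sat w fo so (AllS X f) = (\<forall>A\<subseteq>{..<length w}. sat w fo (so(X := A)) f)"
| "sat w fo so (QStar s L Xs fs) =
     (map (\<lambda>i. length (takeWhile Not
                  (map (\<lambda>f. sat w fo (assign_upd so Xs (length w) i) f) fs)))
          [0..<2 ^ (length w * length Xs)] \<in> L)"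

text \<open>The letter of the i-th position is the least j (0-based) such that
  phi_(j+1) holds, and s-1 (i.e. a_s) if none holds (length fs = s-1).\<close>

definition definable :: "bool \<Rightarrow> (nat \<Rightarrow> lang \<Rightarrow> bool) \<Rightarrow> nat \<Rightarrow> lang \<Rightarrow> bool" where
  "definable ar al s L \<longleftrightarrow>
     (\<exists>f. in_logic ar al f \<and> sentence f \<and>
          L = {w \<in> lists {..<s}. w \<noteq> [] \<and> sat w (\<lambda>_. 0) (\<lambda>_. {}) f})"

text \<open>Tape symbols are 0..<nsyms, 0 is the blank; an input letter a is
  written as a+1.  Tape 0 holds the input, the last tape is the oracle query
  tape.  delta q syms gives the list of nondeterministic choices
  (new state, written symbols, head moves in {-1,0,1}).  A configuration
  halts if its state is qacc or it has no successor; it accepts iff its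
  state is qacc.  In state qqry the oracle is consulted: the next state is
  qyes/qno according to whether the query word is in the oracle, and the
  query tape is erased with head reset to 0.\<close>

record tm =
  nstates :: nat
  nsyms :: nat
  ntapes :: nat
  delta :: "nat \<Rightarrow> nat list \<Rightarrow> (nat \<times> nat list \<times> int list) list"
  q_init :: nat
  q_acc :: nat
  q_qry :: nat
  q_yes :: nat
  q_no :: nat

type_synonym config = "nat \<times> ((nat \<Rightarrow> nat) \<times> nat) list"

definition wf_tm :: "tm \<Rightarrow> bool" where
  "wf_tm M \<longleftrightarrow> 2 \<le> ntapes M \<and> 1 \<le> nsyms M \<and>
     q_init M < nstates M \<and> q_acc M < nstates M \<and> q_qry M < nstates M \<and>
     q_yes M < nstates M \<and> q_no M < nstates M \<and> q_acc M \<noteq> q_qry M \<and>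
     (\<forall>q<nstates M. \<forall>syms. length syms = ntapes M \<and> set syms \<subseteq> {..<nsyms M} \<longrightarrow>
        (\<forall>(q', ws, ms) \<in> set (delta M q syms).
           q' < nstates M \<and> length ws = ntapes M \<and> set ws \<subseteq> {..<nsyms M} \<and>
           length ms = ntapes M \<and> set ms \<subseteq> {-1, 0, 1}))"

definition query_word :: "(nat \<Rightarrow> nat) \<Rightarrow> nat list" where
  "query_word f = map (\<lambda>i. f i - 1) [0..<(LEAST m. f m = 0)]"

definition step :: "tm \<Rightarrow> lang \<Rightarrow> config \<Rightarrow> config list" where
  "step M Or c =
     (let q = fst c; tps = snd c in
      if q = q_acc M then []
      else if q = q_qry M then
        [(if query_word (fst (last tps)) \<in> Or then q_yes M else q_no M,
          butlast tps @ [(\<lambda>_. 0, 0)])]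
      else map (\<lambda>(q', ws, ms).
                 (q', map (\<lambda>((f, h), (a, m)). (f(h := a), nat (int h + m)))
                          (zip tps (zip ws ms))))
               (delta M q (map (\<lambda>(f, h). f h) tps)))"

definition init_config :: "tm \<Rightarrow> nat list \<Rightarrow> config" where
  "init_config M x =
     (q_init M, ((\<lambda>i. if i < length x then x ! i + 1 else 0), 0) #
                 replicate (ntapes M - 1) (\<lambda>_. 0, 0))"

fun halts_within :: "tm \<Rightarrow> lang \<Rightarrow> nat \<Rightarrow> config \<Rightarrow> bool" where
  "halts_within M Or 0 c = (step M Or c = [])"
| "halts_within M Or (Suc t) c =
     (step M Or c = [] \<or> (\<forall>c' \<in> set (step M Or c). halts_within M Or t c'))"

fun acc_paths :: "tm \<Rightarrow> lang \<Rightarrow> nat \<Rightarrow> config \<Rightarrow> nat" where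
  "acc_paths M Or 0 c = (if step M Or c = [] \<and> fst c = q_acc M then 1 else 0)"
| "acc_paths M Or (Suc t) c =
     (if step M Or c = [] then (if fst c = q_acc M then 1 else 0)
      else sum_list (map (acc_paths M Or t) (step M Or c)))"

fun rej_paths :: "tm \<Rightarrow> lang \<Rightarrow> nat \<Rightarrow> config \<Rightarrow> nat" where
  "rej_paths M Or 0 c = (if step M Or c = [] \<and> fst c \<noteq> q_acc M then 1 else 0)"
| "rej_paths M Or (Suc t) c =
     (if step M Or c = [] then (if fst c \<noteq> q_acc M then 1 else 0)
      else sum_list (map (rej_paths M Or t) (step M Or c)))"

datatype mode = NPm | ModPm nat | PPm

fun mode_accepts :: "mode \<Rightarrow> nat \<Rightarrow> nat \<Rightarrow> bool" where
  "mode_accepts NPm a r = (0 < a)"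
| "mode_accepts (ModPm q) a r = (a mod q \<noteq> 0)"
| "mode_accepts PPm a r = (r < a)"

definition lin_class :: "mode \<Rightarrow> (nat \<times> lang) set \<Rightarrow> (nat \<times> lang) set" where
  "lin_class md Os = {(s, L). L \<subseteq> lists {..<s} \<and>
     (\<exists>M Or s' c. (s', Or) \<in> Os \<and> wf_tm M \<and> s < nsyms M \<and>
        (\<forall>x \<in> lists {..<s}.
           halts_within M Or (c * (length x + 1)) (init_config M x) \<and>
           (x \<in> L \<longleftrightarrow> mode_accepts md (acc_paths M Or (c * (length x + 1)) (init_config M x))
                                     (rej_paths M Or (c * (length x + 1)) (init_config M x)))))}"

inductive_set bool_closure :: "(nat \<times> lang) set \<Rightarrow> (nat \<times> lang) set" for C where
  bc_base: "p \<in> C \<Longrightarrow> p \<in> bool_closure C"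
| bc_compl: "(s, L) \<in> bool_closure C \<Longrightarrow> (s, lists {..<s} - L) \<in> bool_closure C"
| bc_union: "(s, L1) \<in> bool_closure C \<Longrightarrow> (s, L2) \<in> bool_closure C \<Longrightarrow> (s, L1 \<union> L2) \<in> bool_closure C"

text \<open>Level 0 is the trivial oracle (the empty language), i.e. no oracle.\<close>

fun CH_level :: "nat \<Rightarrow> (nat \<times> lang) set" where
  "CH_level 0 = {(1, {})}"
| "CH_level (Suc k) = lin_class PPm (CH_level k)"

definition LIN_CH :: "(nat \<times> lang) set" where
  "LIN_CH = (\<Union>k. CH_level (Suc k))"

fun MODPH_level :: "nat \<Rightarrow> (nat \<times> lang) set" where
  "MODPH_level 0 = {(1, {})}"
| "MODPH_level (Suc k) =
     lin_class NPm (bool_closure (MODPH_level k)) \<union>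
     (\<Union>q\<in>{q. 1 < q}. lin_class (ModPm q) (bool_closure (MODPH_level k)))"

definition LIN_MODPH :: "(nat \<times> lang) set" where
  "LIN_MODPH = (\<Union>k. MODPH_level (Suc k))"

end

(* Both directions pass through counting.  A symmetric quantifier Q*_L only sees the numbers of
   assignments carrying each letter.  By Parikh's theorem the count vectors of L form a semilinear
   set, so the quantifier reduces to finitely many linear inequalities and congruences between counts of
   assignments (only congruences and thresholds if L is regular).  Each of these is decided by one more
   level of majority or modular counting machines that guess an assignment in linear time and ask the
   previous level about it.

   Conversely, a computation path of linear length is a word over a finite alphabet of events, that is, a
   tuple of subsets of {0,...,K*n-1}, and distinct paths are distinct tuples, so the acceptance mode of the
   machine is a count of tuples.  Whether a tuple is a path is definable once the head positions are, and
   these are iterations of a definable function.  An iteration of length T is cut into sqrt T rows of length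
   sqrt T; every row is encoded by two sets, since its sqrt T values below T have two digits each in base
   sqrt T.  Multiplication by b on [0,b) needs no built-in product: x = s*b with s < b iff b divides x and b+1
   divides x+s, where the multiples of b and b+1 below b^2 are guessed as sets.  The same iteration eliminates
   the product from the logic with arithmetic. *)

theory Submission
  imports "HOL-Library.Nat_Bijection" Defs
begin

subsection \<open>Parikh images of context-free languages\<close>

text \<open>The majority levels come without existential machines and without a Boolean closure, so
  connectives and quantifiers must themselves be counts: a disjunction is the positivity of a sum of
  truth values, and unsatisfiable summands turn positivity into a strict comparison. The
  coefficients of a linear set cannot be quantified as elements, since counts reach
  \<open>2 ^ (n * k)\<close>; a number is represented by a tuple of sets, namely as its rank in a
  definable order. A machine has a single oracle, so all subformulas share one language in which
  every letter carries the index of the formula to be evaluated. In the other direction the running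
  time exceeds the universe. Relations are therefore defined over \<open>K\<close> blocks of length
  \<open>n\<close>, and \<open>K\<close> changes with every oracle level because a query may be
  longer than the input. Parikh's theorem is obtained from multisets of rule applications: balance
  is a linear system, and the only further condition, reachability, depends on the support
  alone.\<close>

inductive_set reach :: "(nat \<times> (nat + nat) list) set => nat set => nat set" for Y A where
  reach_base: "B \<in> A ==> B \<in> reach Y A"
| reach_step: "B \<in> reach Y A ==> (B, rhs) \<in> Y ==> Inl C \<in> set rhs ==> C \<in> reach Y A"

definition nts :: "(nat + nat) list => nat set" where
  "nts \<alpha> = {A. Inl A \<in> set \<alpha>}"

text \<open>Balance only counts symbols and cannot tell a derivation from a derivation plus detached
  cycles of rules; connecting every used left side to the sentential form excludes such cycles. This
  is the firing criterion of communication-free Petri nets.\<close>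

definition fireable :: "(nat \<times> (nat + nat) list) multiset => (nat + nat) list => bool" where
  "fireable y \<alpha> \<longleftrightarrow> (\<forall>\<rho>\<in>set_mset y. fst \<rho> \<in> reach (set_mset y) (nts \<alpha>))"

definition balanced :: "(nat \<times> (nat + nat) list) multiset => (nat + nat) list => nat list => bool" where
  "balanced y \<alpha> w \<longleftrightarrow>
     mset \<alpha> + (\<Sum>\<rho>\<in>#y. mset (snd \<rho>)) = image_mset (%\<rho>. Inl (fst \<rho>)) y + mset (map Inr w)"

lemma reach_mono: "Y \<subseteq> Y' ==> A \<subseteq> reach Y' A' ==> reach Y A \<subseteq> reach Y' A'"
proof
  fix x assume Y: "Y \<subseteq> Y'" "A \<subseteq> reach Y' A'" and "x \<in> reach Y A"
  show "x \<in> reach Y' A'" using \<open>x \<in> reach Y A\<close>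
    by (induction) (use Y in \<open>auto intro: reach_step\<close>)
qed

text \<open>Prepending a step adds one left side and one right side to the balance, and every
  nonterminal of the next sentential form is reached through that rule or was present
  before.\<close>

lemma derivation_balanced:
  assumes "(cfg_step P)\<^sup>*\<^sup>* \<alpha> (map Inr w)"
  shows "\<exists>y. set_mset y \<subseteq> P \<and> balanced y \<alpha> w \<and> fireable y \<alpha>"
  using assms
proof (induction rule: converse_rtranclp_induct)
  case base
  have "balanced {#} (map Inr w) w" "fireable {#} (map Inr w)"
    by (auto simp: balanced_def fireable_def)
  then show ?case by (intro exI[of _ "{#}"]) auto
next
  case (step \<alpha> \<beta>)
  then obtain y where y: "set_mset y \<subseteq> P" "balanced y \<beta> w" "fireable y \<beta>" by blast
  obtain xs ys A rhs where r: "(A, rhs) \<in> P" "\<alpha> = xs @ [Inl A] @ ys" "\<beta> = xs @ rhs @ ys"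
    using step.hyps(1) unfolding cfg_step_def by blast
  let ?y = "add_mset (A, rhs) y"
  have "balanced ?y \<alpha> w" using y(2) r by (auto simp: balanced_def algebra_simps)
  moreover have "fireable ?y \<alpha>"
  proof -
    have A: "A \<in> reach (set_mset ?y) (nts \<alpha>)" by (rule reach_base) (auto simp: nts_def r)
    have "nts \<beta> \<subseteq> reach (set_mset ?y) (nts \<alpha>)"
    proof
      fix x assume "x \<in> nts \<beta>"
      then have "Inl x \<in> set rhs \<or> x \<in> nts \<alpha>" by (auto simp: nts_def r)
      then show "x \<in> reach (set_mset ?y) (nts \<alpha>)"
      proof
        assume "Inl x \<in> set rhs"
        then show ?thesis by (rule reach_step[OF A, rotated]) simp
      qed (rule reach_base)
    qed
    then have "reach (set_mset y) (nts \<beta>) \<subseteq> reach (set_mset ?y) (nts \<alpha>)"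
      by (intro reach_mono) auto
    then show ?thesis using y(3) A by (auto simp: fireable_def)
  qed
  ultimately show ?case using y(1) r(1) by (intro exI[of _ ?y]) auto
qed

text \<open>The rule to apply first can be chosen so that the remaining rules stay reachable: if a rule
  of \<open>A\<close> leads back to \<open>A\<close>, use it; otherwise balance forces every occurrence of \<open>A\<close> to be consumed
  by the rules of \<open>A\<close>, so \<open>A\<close> has only one rule left or still occurs elsewhere.\<close>

lemma fireable_choice:
  assumes bal: "balanced y \<alpha> w" and fire: "fireable y \<alpha>" and ne: "y \<noteq> {#}"
  shows "\<exists>\<rho> xs ys. \<rho> \<in># y \<and> \<alpha> = xs @ [Inl (fst \<rho>)] @ ys \<and> fireable (y - {#\<rho>#}) (xs @ snd \<rho> @ ys)"
proof -
  let ?Y = "set_mset y"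
  \<comment> \<open>Only the left side of the chosen rule has to be rechecked. Any other chain that
    used \<rho> can restart at the symbols of its right side, which now occur in the form
    itself.\<close>
  define good where "good \<rho> xs ys \<longleftrightarrow> \<rho> \<in># y \<and> \<alpha> = xs @ [Inl (fst \<rho>)] @ ys \<and> 
     (\<forall>\<sigma>\<in>#y - {#\<rho>#}. fst \<sigma> = fst \<rho> --> fst \<rho> \<in> reach (set_mset (y - {#\<rho>#})) (nts (xs @ snd \<rho> @ ys)))" for \<rho> xs ys
  have goodD: "fireable (y - {#\<rho>#}) (xs @ snd \<rho> @ ys)" if g: "good \<rho> xs ys" for \<rho> xs ys
  proof -
    let ?R = "reach (set_mset (y - {#\<rho>#})) (nts (xs @ snd \<rho> @ ys))"
    have "C \<in> ?R \<or> C = fst \<rho>" if "C \<in> reach ?Y (nts \<alpha>)" for C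
      using that
    proof (induction)
      case (reach_base B)
      then show ?case using g by (auto simp: good_def nts_def intro!: reach.reach_base)
    next
      case (reach_step B rhs C)
      show ?case
      proof (cases "(B, rhs) = \<rho>")
        case True
        then show ?thesis using reach_step.hyps by (auto simp: nts_def intro!: reach.reach_base)
      next
        case False
        then have *: "(B, rhs) \<in># y - {#\<rho>#}"
          using reach_step.hyps(2) by (simp add: in_diff_count)
        have "B \<in> ?R"
        proof (cases "B = fst \<rho>")
          case True
          then show ?thesis using g * unfolding good_def by (metis fst_conv)
        qed (use reach_step.IH in auto)
        then show ?thesis using * reach_step.hyps(3) by (auto intro: reach.reach_step)
      qed
    qed
    then show ?thesis using fire g unfolding fireable_def good_def
      by (metis in_diffD)
  qed
  obtain A where A: "A \<in> nts \<alpha>"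
  proof -
    obtain \<rho> where "\<rho> \<in># y" using ne by blast
    then have "fst \<rho> \<in> reach ?Y (nts \<alpha>)" using fire by (auto simp: fireable_def)
    then have "nts \<alpha> \<noteq> {}" by (induction) auto
    then show ?thesis using that by auto
  qed
  obtain xs ys where sp: "\<alpha> = xs @ [Inl A] @ ys"
    using A by (auto simp: nts_def dest: split_list)
  have cnt: "count (mset \<alpha>) (Inl A) + (\<Sum>\<rho>\<in>#y. count (mset (snd \<rho>)) (Inl A))
      = count (image_mset (%\<rho>. Inl (fst \<rho>)) y) (Inl A :: nat+nat)"
  proof -
    have "count (mset (map Inr w)) (Inl A :: nat + nat) = 0" by (auto simp: count_eq_zero_iff)
    moreover have "count (\<Sum>\<rho>\<in>#y. mset (snd \<rho>)) (Inl A) = (\<Sum>\<rho>\<in>#y. count (mset (snd \<rho>)) (Inl A))"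
      by (induction y) auto
    ultimately show ?thesis using arg_cong[OF bal[unfolded balanced_def], of "%m. count m (Inl A)"] by simp
  qed
  have ex: "\<exists>\<rho>\<in>#y. fst \<rho> = A"
  proof (rule ccontr)
    assume "\<not> ?thesis"
    then have "count (image_mset (%\<rho>. Inl (fst \<rho>)) y) (Inl A :: nat+nat) = 0"
      by (auto simp: count_eq_zero_iff)
    then show False using cnt sp by auto
  qed
  show ?thesis
  proof (cases "\<exists>\<rho>\<in>#y. fst \<rho> = A \<and> A \<in> reach {\<sigma>\<in>?Y. fst \<sigma> \<noteq> A} (nts (xs @ snd \<rho> @ ys))")
    case True
    then obtain \<rho> where \<rho>: "\<rho> \<in># y" "fst \<rho> = A" "A \<in> reach {\<sigma>\<in>?Y. fst \<sigma> \<noteq> A} (nts (xs @ snd \<rho> @ ys))"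
      by blast
    have "reach {\<sigma>\<in>?Y. fst \<sigma> \<noteq> A} (nts (xs @ snd \<rho> @ ys)) \<subseteq> reach (set_mset (y - {#\<rho>#})) (nts (xs @ snd \<rho> @ ys))"
    proof (rule reach_mono)
      show "{\<sigma>\<in>?Y. fst \<sigma> \<noteq> A} \<subseteq> set_mset (y - {#\<rho>#})" using \<rho>(2) by (auto simp: in_diff_count)
    qed (auto intro: reach_base)
    then have "good \<rho> xs ys" using \<rho> sp by (auto simp: good_def)
    then show ?thesis using goodD \<rho> sp by blast
  next
    case False
    obtain \<rho> where \<rho>: "\<rho> \<in># y" "fst \<rho> = A" using ex by blast
    \<comment> \<open>On a chain from \<alpha> to a rule producing \<open>A\<close>, the part after
      the last use of a rule of \<open>A\<close> would lead from that rule back to \<open>A\<close>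
      without rules of \<open>A\<close>, which this case excludes.\<close>
    have noA: "Inl A \<notin> set (snd \<sigma>)" if \<sigma>: "\<sigma> \<in># y" for \<sigma>
    proof
      assume in\<sigma>: "Inl A \<in> set (snd \<sigma>)"
      have key: "(\<exists>\<rho>\<in>#y. fst \<rho> = A \<and> C \<in> reach {\<sigma>\<in>?Y. fst \<sigma> \<noteq> A} (nts (xs @ snd \<rho> @ ys))) \<or> C = A"
        if "C \<in> reach ?Y (nts \<alpha>)" for C
        using that
      proof (induction)
        case (reach_base B)
        then show ?case using sp \<rho> by (auto simp: nts_def intro!: reach.reach_base)
      next
        case (reach_step B rhs C)
        show ?case
        proof (cases "B = A")
          case True
          then show ?thesis using reach_step.hyps
            by (intro disjI1 bexI[of _ "(B, rhs)"]) (auto simp: nts_def intro!: reach.reach_base)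
        next
          case False
          then obtain \<rho>' where "\<rho>'\<in>#y" "fst \<rho>' = A" "B \<in> reach {\<sigma>\<in>?Y. fst \<sigma> \<noteq> A} (nts (xs @ snd \<rho>' @ ys))"
            using reach_step.IH by blast
          moreover have "(B, rhs) \<in> {\<sigma>\<in>?Y. fst \<sigma> \<noteq> A}" using reach_step.hyps False by simp
          ultimately have "C \<in> reach {\<sigma>\<in>?Y. fst \<sigma> \<noteq> A} (nts (xs @ snd \<rho>' @ ys))"
            using reach_step.hyps(3) by (blast intro: reach.reach_step)
          then show ?thesis using \<open>\<rho>'\<in>#y\<close> \<open>fst \<rho>' = A\<close> by blast
        qed
      qed
      have "fst \<sigma> \<in> reach ?Y (nts \<alpha>)" using fire \<sigma> by (auto simp: fireable_def)
      from key[OF this] show False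
      proof
        assume "\<exists>\<rho>\<in>#y. fst \<rho> = A \<and> fst \<sigma> \<in> reach {\<sigma>\<in>?Y. fst \<sigma> \<noteq> A} (nts (xs @ snd \<rho> @ ys))"
        then obtain \<rho>' where r: "\<rho>'\<in>#y" "fst \<rho>' = A" "fst \<sigma> \<in> reach {\<sigma>\<in>?Y. fst \<sigma> \<noteq> A} (nts (xs @ snd \<rho>' @ ys))"
          by blast
        show False
        proof (cases "fst \<sigma> = A")
          case True
          then show False using False \<sigma> in\<sigma> by (auto simp: nts_def intro!: reach.reach_base)
        next
          case ne: False
          have "A \<in> reach {\<sigma>\<in>?Y. fst \<sigma> \<noteq> A} (nts (xs @ snd \<rho>' @ ys))"
            using r \<sigma> in\<sigma> ne by (intro reach.reach_step[OF r(3), of "snd \<sigma>"]) auto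
          then show False using False r by blast
        qed
      next
        assume "fst \<sigma> = A"
        then show False using False \<sigma> in\<sigma> by (auto simp: nts_def intro!: reach.reach_base)
      qed
    qed
    have A1: "Inl A \<notin> set (xs @ ys)"
    proof -
      have "A \<notin> nts (xs @ snd \<rho> @ ys)" 
      proof
        assume "A \<in> nts (xs @ snd \<rho> @ ys)"
        then have "A \<in> reach {\<sigma>\<in>?Y. fst \<sigma> \<noteq> A} (nts (xs @ snd \<rho> @ ys))" by (rule reach_base)
        then show False using False \<rho> by blast
      qed
      then show ?thesis by (auto simp: nts_def)
    qed
    \<comment> \<open>Nothing produces \<open>A\<close> and it occurs once, so by balance
      \<open>y\<close> contains exactly one rule of \<open>A\<close>, and after firing it no
      remaining rule has left side \<open>A\<close>.\<close>
    have "(\<Sum>\<rho>\<in>#y. count (mset (snd \<rho>)) (Inl A)) = 0"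
      using noA by (auto simp: sum_mset_0_iff count_eq_zero_iff count_list_0_iff)
    moreover have "count (mset \<alpha>) (Inl A) = 1" using A1 sp by (auto simp: count_eq_zero_iff)
    ultimately have one: "count (image_mset (%\<rho>. Inl (fst \<rho>)) y) (Inl A :: nat+nat) = 1" using cnt by linarith
    have "\<forall>\<sigma>\<in>#y - {#\<rho>#}. fst \<sigma> \<noteq> A"
    proof (rule ccontr)
      assume "\<not> ?thesis"
      then obtain \<sigma> where s: "\<sigma> \<in># y - {#\<rho>#}" "fst \<sigma> = A" by blast
      then obtain z where "y = add_mset \<rho> (add_mset \<sigma> z)"
        by (metis \<rho>(1) insert_DiffM)
      then show False using one s \<rho> by simp
    qed
    then have "good \<rho> xs ys" using \<rho> sp by (auto simp: good_def)
    then show ?thesis using goodD \<rho> sp by blast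
  qed
qed

text \<open>Firing the rule supplied by \<open>fireable_choice\<close> preserves balance and
  fireability while \<open>y\<close> shrinks. Only multisets are tracked, hence the terminal word is
  \<open>w\<close> up to a permutation.\<close>

lemma balanced_derivation:
  assumes "set_mset y \<subseteq> P" "balanced y \<alpha> w" "fireable y \<alpha>"
  shows "\<exists>v. mset v = mset w \<and> (cfg_step P)\<^sup>*\<^sup>* \<alpha> (map Inr v)"
  using assms
proof (induction "size y" arbitrary: y \<alpha>)
  case 0
  then have "mset \<alpha> = mset (map Inr w)" by (simp add: balanced_def)
  then have "set \<alpha> \<subseteq> range Inr" using mset_eq_setD by fastforce
  then have \<alpha>: "\<alpha> = map Inr (map projr \<alpha>)" by (auto simp: comp_def intro!: map_idI[symmetric])
  have "mset (map projr \<alpha>) = mset w"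
    using arg_cong[OF \<open>mset \<alpha> = mset (map Inr w)\<close>, of "image_mset projr"] by (simp add: multiset.map_comp comp_def)
  then show ?case using \<alpha> by (intro exI[of _ "map projr \<alpha>"]) auto
next
  case (Suc n)
  then have "y \<noteq> {#}" by auto
  from fireable_choice[OF Suc.prems(2,3) this] obtain \<rho> xs ys
    where r: "\<rho> \<in># y" "\<alpha> = xs @ [Inl (fst \<rho>)] @ ys" "fireable (y - {#\<rho>#}) (xs @ snd \<rho> @ ys)" by blast
  obtain z where z: "y = add_mset \<rho> z" using r(1) by (metis insert_DiffM)
  have "balanced z (xs @ snd \<rho> @ ys) w"
    using Suc.prems(2) unfolding balanced_def r(2) z by (auto simp: algebra_simps)
  then obtain v where v: "mset v = mset w" "(cfg_step P)\<^sup>*\<^sup>* (xs @ snd \<rho> @ ys) (map Inr v)"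
    using Suc.hyps(1)[of z] Suc.hyps(2) Suc.prems r(3) by (auto simp: z)
  have "cfg_step P \<alpha> (xs @ snd \<rho> @ ys)"
    unfolding cfg_step_def r(2) using r(1) Suc.prems(1)
    by (intro exI[of _ xs] exI[of _ ys] exI[of _ "fst \<rho>"] exI[of _ "snd \<rho>"]) auto
  then show ?case using v by (meson converse_rtranclp_into_rtranclp)
qed

section \<open>Semilinear sets from linear systems\<close>

lemma dickson:
  fixes S :: "('a => nat) set"
  assumes "finite U"
  shows "\<exists>F. finite F \<and> F \<subseteq> S \<and> (\<forall>y\<in>S. \<exists>f\<in>F. \<forall>u\<in>U. f u \<le> y u)"
  using assms
proof (induction U arbitrary: S)
  case empty
  show ?case
  proof (cases "S = {}")
    case False
    then obtain s where "s \<in> S" by blast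
    then show ?thesis by (intro exI[of _ "{s}"]) auto
  qed auto
next
  case (insert u U)
  obtain F0 where F0: "finite F0" "F0 \<subseteq> S" "\<forall>y\<in>S. \<exists>f\<in>F0. \<forall>u\<in>U. f u \<le> y u"
    using insert.IH[of S] by (elim exE conjE)
  \<comment> \<open>From \<open>m\<close> on in coordinate \<open>u\<close>, the finite set found
    for the other coordinates already dominates; below \<open>m\<close> there are finitely many
    slices, each treated by the induction hypothesis.\<close>
  define m where "m = Max (insert 0 ((%f. f u) ` F0))"
  have m: "f u \<le> m" if "f \<in> F0" for f using that F0(1) by (auto simp: m_def)
  have "\<forall>k. \<exists>F. finite F \<and> F \<subseteq> {y\<in>S. y u = k} \<and> (\<forall>y\<in>{y\<in>S. y u = k}. \<exists>f\<in>F. \<forall>u\<in>U. f u \<le> y u)"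
    by (intro allI insert.IH)
  from choice[OF this] obtain G where G': "\<forall>k. finite (G k) \<and> G k \<subseteq> {y\<in>S. y u = k} \<and> (\<forall>y\<in>{y\<in>S. y u = k}. \<exists>f\<in>G k. \<forall>u\<in>U. f u \<le> y u)"
    by blast
  have G: "finite (G k)" "G k \<subseteq> {y\<in>S. y u = k}" "\<forall>y\<in>{y\<in>S. y u = k}. \<exists>f\<in>G k. \<forall>u\<in>U. f u \<le> y u" for k
    using G' by simp_all
  let ?F = "F0 \<union> (\<Union>k<m. G k)"
  have "\<exists>f\<in>?F. \<forall>u\<in>insert u U. f u \<le> y u" if y: "y \<in> S" for y
  proof (cases "y u < m")
    case True
    then obtain f where "f \<in> G (y u)" "\<forall>u\<in>U. f u \<le> y u" using G(3)[of "y u"] y by blast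
    then show ?thesis using True G(2)[of "y u"] by (intro bexI[of _ f]) auto
  next
    case False
    obtain f where "f \<in> F0" "\<forall>u\<in>U. f u \<le> y u" using F0(3) y by blast
    then show ?thesis using m[of f] False by (intro bexI[of _ f]) auto
  qed
  moreover have "finite ?F" using F0(1) G(1) by blast
  moreover have "?F \<subseteq> S" using F0(2) G(2) by blast
  ultimately show ?case by (intro exI[of _ ?F]) simp
qed

text \<open>Subtracting a nonzero element that lies below stays in \<open>H\<close> and lowers the
  sum over \<open>U\<close>. Hence the finite dominating set of Dickson's lemma generates
  \<open>H\<close>, like a Hilbert basis of a homogeneous system.\<close>

lemma finitely_generated:
  fixes H :: "('a => nat) set"
  assumes fin: "finite U" and supp: "\<And>h x. h \<in> H ==> x \<notin> U ==> h x = 0"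
    and diff: "\<And>h f. h \<in> H ==> f \<in> H ==> (\<forall>x. f x \<le> h x) ==> (%x. h x - f x) \<in> H"
  shows "\<exists>gs. set gs \<subseteq> H \<and> (\<forall>h\<in>H. \<exists>ns. length ns = length gs \<and> (\<forall>x. h x = (\<Sum>i<length gs. ns!i * (gs!i) x)))"
proof -
  obtain F where F: "finite F" "F \<subseteq> H - {%_. 0}" "\<forall>y\<in>H - {%_. 0}. \<exists>f\<in>F. \<forall>u\<in>U. f u \<le> y u"
    using dickson[OF fin, of "H - {%_. 0}"] by blast
  obtain gs where gs: "set gs = F" using finite_list[OF F(1)] by blast
  have "\<exists>ns. length ns = length gs \<and> (\<forall>x. h x = (\<Sum>i<length gs. ns!i * (gs!i) x))" if "h \<in> H" for h
    using that
  proof (induction "sum h U" arbitrary: h rule: less_induct)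
    case less
    show ?case
    proof (cases "h = (%_. 0)")
      case True
      then show ?thesis by (intro exI[of _ "replicate (length gs) 0"]) auto
    next
      case False
      then obtain f where f: "f \<in> F" "\<forall>u\<in>U. f u \<le> h u" using F(3) less.prems by blast
      then have fH: "f \<in> H" "f \<noteq> (%_. 0)" using F(2) by auto
      have le: "f x \<le> h x" for x using f(2) supp[OF fH(1)] by (cases "x \<in> U") auto
      obtain z where z: "f z \<noteq> 0" using fH(2) by auto
      then have zU: "z \<in> U" using supp[OF fH(1), of z] by (cases "z \<in> U") auto
      have "(\<Sum>x\<in>U. h x - f x) < sum h U"
      proof (rule sum_strict_mono_ex1[OF fin])
        show "\<exists>a\<in>U. h a - f a < h a" using z zU le[of z] by (intro bexI[of _ z]) auto
      qed auto
      from less.hyps[OF this diff[OF less.prems fH(1)]] obtain ns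
        where ns: "length ns = length gs" "\<And>x. h x - f x = (\<Sum>i<length gs. ns!i * (gs!i) x)"
        using le by blast
      obtain j where j: "j < length gs" "gs ! j = f" using f(1) gs by (metis in_set_conv_nth)
      let ?ns = "ns[j := Suc (ns ! j)]"
      have "h x = (\<Sum>i<length gs. ?ns!i * (gs!i) x)" for x
      proof -
        have "(\<Sum>i<length gs. ?ns!i * (gs!i) x) = (\<Sum>i<length gs. ns!i * (gs!i) x + (if i = j then (gs!i) x else 0))"
          using ns(1) j by (intro sum.cong) (auto simp: nth_list_update)
        also have "\<dots> = (h x - f x) + f x" using j ns(2) by (simp add: sum.distrib)
        finally show ?thesis using le[of x] by simp
      qed
      then show ?thesis using ns(1) by (intro exI[of _ ?ns]) auto
    qed
  qed
  then show ?thesis using gs F(2) by (intro exI[of _ gs]) auto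
qed

definition linear_set :: "(nat => nat) => (nat => nat) list => (nat => nat) set" where
  "linear_set b ps = {c. \<exists>ns. length ns = length ps \<and> (\<forall>a. c a = b a + (\<Sum>i<length ps. ns!i * (ps!i) a))}"

text \<open>Zero periods have to go because coefficients are later bounded by letter counts, which
  needs every period to be nonzero at some letter.\<close>

lemma linear_set_drop_zero:
  "linear_set b ps = linear_set b (filter (%p. p \<noteq> (%_. 0)) ps)"
proof (induction ps arbitrary: b)
  case (Cons p ps)
  have step: "c \<in> linear_set b (p # qs) \<longleftrightarrow> (\<exists>k. c \<in> linear_set (%a. b a + k * p a) qs)" for c b qs
  proof
    assume "c \<in> linear_set b (p # qs)"
    then obtain ns where ns: "length ns = Suc (length qs)" "\<forall>a. c a = b a + (\<Sum>i<Suc (length qs). ns!i * ((p#qs)!i) a)"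
      by (auto simp: linear_set_def)
    then obtain k ks where "ns = k # ks" by (cases ns) auto
    then show "\<exists>k. c \<in> linear_set (%a. b a + k * p a) qs" using ns
      by (intro exI[of _ k]) (auto simp: linear_set_def sum.lessThan_Suc_shift simp del: sum.lessThan_Suc intro!: exI[of _ ks])
  next
    assume "\<exists>k. c \<in> linear_set (%a. b a + k * p a) qs"
    then obtain k ks where "length ks = length qs" "\<forall>a. c a = b a + k * p a + (\<Sum>i<length qs. ks!i * (qs!i) a)"
      by (auto simp: linear_set_def)
    then show "c \<in> linear_set b (p # qs)"
      by (auto simp: linear_set_def sum.lessThan_Suc_shift simp del: sum.lessThan_Suc intro!: exI[of _ "k # ks"])
  qed
  show ?case
  proof (cases "p = (%_. 0)")
    case True
    then show ?thesis using Cons.IH[of b] step[of _ b ps] by auto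
  next
    case False
    have "c \<in> linear_set b (p # ps) \<longleftrightarrow> c \<in> linear_set b (p # filter (%p. p \<noteq> (%_. 0)) ps)" for c
      unfolding step using Cons.IH by blast
    then show ?thesis using False by auto
  qed
qed simp

lemma sum_mset_count:
  fixes f :: "'a => nat"
  assumes "finite U" "set_mset y \<subseteq> U"
  shows "(\<Sum>\<rho>\<in>#y. f \<rho>) = (\<Sum>\<rho>\<in>U. count y \<rho> * f \<rho>)"
  using assms(2)
proof (induction y)
  case (add x y)
  have "(\<Sum>\<rho>\<in>U. count (add_mset x y) \<rho> * f \<rho>) = (\<Sum>\<rho>\<in>U. (if \<rho> = x then f \<rho> else 0) + count y \<rho> * f \<rho>)"
    by (intro sum.cong) auto
  then show ?case using add assms(1) by (simp add: sum.distrib)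
qed simp

lemma balanced_count:
  assumes "finite U" "set_mset y \<subseteq> U"
  shows "balanced y \<alpha> w \<longleftrightarrow>
    (\<forall>x. count (mset \<alpha>) x + (\<Sum>\<rho>\<in>U. count y \<rho> * count (mset (snd \<rho>)) x)
       = (\<Sum>\<rho>\<in>U. count y \<rho> * (if Inl (fst \<rho>) = x then 1 else 0)) + count (mset (map Inr w)) x)"
proof -
  have 1: "count (\<Sum>\<rho>\<in>#y. mset (snd \<rho>)) x = (\<Sum>\<rho>\<in>U. count y \<rho> * count (mset (snd \<rho>)) x)" for x
  proof -
    have "count (\<Sum>\<rho>\<in>#y. mset (snd \<rho>)) x = (\<Sum>\<rho>\<in>#y. count (mset (snd \<rho>)) x)" by (induction y) auto
    then show ?thesis using sum_mset_count[OF assms] by simp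
  qed
  have 2: "count (image_mset (%\<rho>. Inl (fst \<rho>)) y) x = (\<Sum>\<rho>\<in>U. count y \<rho> * (if Inl (fst \<rho>) = x then 1 else 0))" for x
  proof -
    have "count (image_mset (%\<rho>. Inl (fst \<rho>)) y) x = (\<Sum>\<rho>\<in>#y. (if Inl (fst \<rho>) = x then 1 else 0))" by (induction y) auto
    then show ?thesis using sum_mset_count[OF assms] by simp
  qed
  show ?thesis unfolding balanced_def multiset_eq_iff by (simp only: count_union 1 2)
qed

text \<open>For a fixed support \<open>U\<close>, fireability is a property of \<open>U\<close> alone and balance is a linear
  system, so the admissible rule multiplicities form a semilinear set by Dickson's lemma.\<close>

theorem parikh:
  assumes cf: "context_free_lang s L"
  shows "\<exists>F. finite F \<and> (\<forall>(b, ps)\<in>F. (\<forall>a\<ge>s. b a = 0) \<and> (\<forall>p\<in>set ps. (\<exists>a<s. p a \<noteq> 0) \<and> (\<forall>a\<ge>s. p a = 0))) \<and>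
    (\<forall>w\<in>lists {..<s}. (\<exists>v\<in>L. mset v = mset w) \<longleftrightarrow> (\<exists>(b, ps)\<in>F. count (mset w) \<in> linear_set b ps))"
proof -
  note [simp del] = split_paired_All split_paired_Ex
  obtain P S where P: "finite P" and L: "L = {w \<in> lists {..<s}. (cfg_step P)\<^sup>*\<^sup>* [Inl S] (map Inr w)}"
    using cf unfolding context_free_lang_def by blast
  define term_count :: "(nat \<times> (nat + nat) list => nat) => nat => nat" where
    "term_count h a = (\<Sum>\<rho>\<in>P. h \<rho> * count (mset (snd \<rho>)) (Inr a))" for h a
  \<comment> \<open>\<open>c\<close> is 1 for the rule multiplicities of a derivation from
    \<open>S\<close> and 0 for the homogeneous system, whose solutions become the periods. Terminals
    \<open>\<ge> s\<close> must not be produced, as the words of \<open>L\<close> lie in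
    \<open>lists {..<s}\<close>.\<close>
  define lin where "lin U c h \<longleftrightarrow> (\<forall>x. x \<notin> U --> h x = 0) \<and> (\<forall>A. (if A = S then c else 0)
       + (\<Sum>\<rho>\<in>P. h \<rho> * count (mset (snd \<rho>)) (Inl A)) = (\<Sum>\<rho>\<in>P. h \<rho> * (if fst \<rho> = A then 1 else 0))) \<and>
       (\<forall>a\<ge>s. term_count h a = 0)" for U and c :: nat and h
  have linA: "(if A = S then c else 0) + (\<Sum>\<rho>\<in>P. h \<rho> * count (mset (snd \<rho>)) (Inl A))
      = (\<Sum>\<rho>\<in>P. h \<rho> * (if fst \<rho> = A then 1 else 0))" if "lin U c h" for U c h A
    using that unfolding lin_def by blast
  define good where "good U \<longleftrightarrow> (\<forall>\<rho>\<in>U. fst \<rho> \<in> reach U {S})" for U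
  have cntInr: "count (mset (map Inr w)) (Inr a :: nat + nat) = count (mset w) a" for w :: "nat list" and a
    by (induction w) auto
  have cntInl: "count (mset (map Inr w)) (Inl a :: nat + nat) = 0" for w :: "nat list" and a
    by (auto simp: count_eq_zero_iff)
  have main: "(\<exists>v\<in>L. mset v = mset w) \<longleftrightarrow> 
     (\<exists>U\<in>Pow P. good U \<and> (\<exists>h. lin U 1 h \<and> (\<forall>x\<in>U. h x > 0) \<and> count (mset w) = term_count h))" (is "?l = ?r")
    if w: "w \<in> lists {..<s}" for w
  proof
    have w0: "count (mset w) a = 0" if "a \<ge> s" for a using w that by (auto simp: count_eq_zero_iff)
    have nS: "nts [Inl S] = {S}" by (auto simp: nts_def)
    {
      assume ?l
      then obtain v where v: "(cfg_step P)\<^sup>*\<^sup>* [Inl S] (map Inr v)" "mset v = mset w" using L by blast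
      from derivation_balanced[OF v(1)] obtain y where y: "set_mset y \<subseteq> P" "balanced y [Inl S] v" "fireable y [Inl S]" by blast
      have eq: "count (mset [Inl S]) x + (\<Sum>\<rho>\<in>P. count y \<rho> * count (mset (snd \<rho>)) x)
       = (\<Sum>\<rho>\<in>P. count y \<rho> * (if Inl (fst \<rho>) = x then 1 else 0)) + count (mset (map Inr v)) x" for x
        using y(2) balanced_count[OF P y(1)] by blast
      have tc: "count (mset w) = term_count (count y)"
      proof
        fix a show "count (mset w) a = term_count (count y) a"
          using eq[of "Inr a"] v(2) by (simp add: term_count_def cntInr del: mset_map)
      qed
      have "lin (set_mset y) 1 (count y)" unfolding lin_def tc[symmetric]
      proof (intro conjI allI impI)
        fix A show "(if A = S then 1 else 0) + (\<Sum>\<rho>\<in>P. count y \<rho> * count (mset (snd \<rho>)) (Inl A)) 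
             = (\<Sum>\<rho>\<in>P. count y \<rho> * (if fst \<rho> = A then 1 else 0))"
          using eq[of "Inl A"] by (simp add: cntInl del: mset_map split: if_splits)
      qed (use w0 in \<open>auto simp: not_in_iff\<close>)
      then show ?r using y(1,3) tc nS
        by (intro bexI[of _ "set_mset y"] conjI exI[of _ "count y"]) (auto simp: good_def fireable_def)
    }
    assume ?r
    then obtain U h where U: "U \<subseteq> P" "good U" "lin U 1 h" "\<forall>x\<in>U. h x > 0" "count (mset w) = term_count h" by blast
    have finU: "finite U" using U(1) P by (rule finite_subset)
    have h0: "h x = 0" if "x \<notin> U" for x using U(3) that unfolding lin_def by blast
    have "{x. h x > 0} \<subseteq> U" using h0 by (metis (mono_tags) mem_Collect_eq not_less_zero subsetI)
    then have "finite {x. h x > 0}" using finU by (rule finite_subset)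
    define y where "y = Abs_multiset h"
    have cy: "count y = h" unfolding y_def using \<open>finite {x. h x > 0}\<close> by simp
    have sy: "set_mset y = U" using \<open>{x. h x > 0} \<subseteq> U\<close> U(4) unfolding set_mset_def cy by blast
    have "balanced y [Inl S] w"
      unfolding balanced_count[OF P, of y, unfolded sy, OF U(1)] cy
    proof
      fix x :: "nat + nat"
      show "count (mset [Inl S]) x + (\<Sum>\<rho>\<in>P. h \<rho> * count (mset (snd \<rho>)) x)
       = (\<Sum>\<rho>\<in>P. h \<rho> * (if Inl (fst \<rho>) = x then 1 else 0)) + count (mset (map Inr w)) x"
      proof (cases x)
        case (Inl A)
        then show ?thesis using linA[OF U(3), of A] by (cases "A = S") (simp_all add: cntInl del: mset_map)
      next
        case (Inr a)
        then show ?thesis using U(5) by (simp add: term_count_def cntInr del: mset_map)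
      qed
    qed
    moreover have "fireable y [Inl S]" using U(2) nS by (auto simp: good_def fireable_def sy)
    ultimately obtain v where v: "mset v = mset w" "(cfg_step P)\<^sup>*\<^sup>* [Inl S] (map Inr v)"
      using balanced_derivation[of y P "[Inl S]" w] U(1) sy by auto
    have "set v = set w" using v(1) by (rule mset_eq_setD)
    then show ?l using v w L by auto
  qed
  \<comment> \<open>Applied with \<open>c = d = 1\<close>, where two derivation vectors differ by a
    homogeneous solution, and with \<open>c = d = 0\<close>, where homogeneous solutions are closed
    under differences.\<close>
  have sub: "lin U (c - d) (%x. h x - f x)" if "lin U c h" "lin U d f" "\<forall>x. f x \<le> h x" "d \<le> c" for U c d h f
  proof -
    have d: "(\<Sum>\<rho>\<in>P. (h \<rho> - f \<rho>) * g \<rho>) = (\<Sum>\<rho>\<in>P. h \<rho> * g \<rho>) - (\<Sum>\<rho>\<in>P. f \<rho> * g \<rho>)" for g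
      unfolding diff_mult_distrib using that(3) by (intro sum_subtractf_nat mult_le_mono1) blast
    have ar: "c1 + a = b ==> d1 + a' = b' ==> a' \<le> a ==> b' \<le> b ==> d1 \<le> c1 ==> (c1 - d1) + (a - a') = b - b'"
      for a b c1 d1 a' b' :: nat by linarith
    have le: "(\<Sum>\<rho>\<in>P. f \<rho> * g \<rho>) \<le> (\<Sum>\<rho>\<in>P. h \<rho> * g \<rho>)" for g
      using that(3) by (intro sum_mono) simp
    show ?thesis unfolding lin_def term_count_def d
    proof (intro conjI allI impI)
      fix A
      have "(if A = S then c else 0) + (\<Sum>\<rho>\<in>P. h \<rho> * count (mset (snd \<rho>)) (Inl A)) = (\<Sum>\<rho>\<in>P. h \<rho> * (if fst \<rho> = A then 1 else 0))"
        "(if A = S then d else 0) + (\<Sum>\<rho>\<in>P. f \<rho> * count (mset (snd \<rho>)) (Inl A)) = (\<Sum>\<rho>\<in>P. f \<rho> * (if fst \<rho> = A then 1 else 0))"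
        using linA[OF that(1)] linA[OF that(2)] by blast+
      moreover note le[of "%\<rho>. count (mset (snd \<rho>)) (Inl A)"] le[of "%\<rho>. if fst \<rho> = A then 1 else 0"]
      ultimately show "(if A = S then c - d else 0) + ((\<Sum>\<rho>\<in>P. h \<rho> * count (mset (snd \<rho>)) (Inl A)) - (\<Sum>\<rho>\<in>P. f \<rho> * count (mset (snd \<rho>)) (Inl A)))
          = (\<Sum>\<rho>\<in>P. h \<rho> * (if fst \<rho> = A then 1 else 0)) - (\<Sum>\<rho>\<in>P. f \<rho> * (if fst \<rho> = A then 1 else 0))"
        using ar[of "if A = S then c else 0" _ _ "if A = S then d else 0"] that(4) by (cases "A = S") simp_all
    qed (use that in \<open>auto simp: lin_def term_count_def simp del: split_paired_All sum.not_neutral_contains_not_neutral\<close>)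
  qed
  have semi: "\<exists>F. finite F \<and> (\<forall>(b, ps)\<in>F. (\<forall>a\<ge>s. b a = 0) \<and> (\<forall>p\<in>set ps. (\<exists>a<s. p a \<noteq> 0) \<and> (\<forall>a\<ge>s. p a = 0))) \<and>
     (\<forall>c. (\<exists>h. lin U 1 h \<and> (\<forall>x\<in>U. h x > 0) \<and> c = term_count h) \<longleftrightarrow> (\<exists>(b, ps)\<in>F. c \<in> linear_set b ps))"
    if U: "U \<in> Pow P" for U
  proof -
    have finU: "finite U" using U P finite_subset by auto
    \<comment> \<open>The bases form a finite dominating set of solutions with support exactly
      \<open>U\<close>. Adding homogeneous solutions supported in \<open>U\<close> keeps that
      support, and with it reachability.\<close>
    let ?S = "{h. lin U 1 h \<and> (\<forall>x\<in>U. h x > 0)}" and ?H = "{h. lin U 0 h}"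
    obtain B where B: "finite B" "B \<subseteq> ?S" "\<forall>y\<in>?S. \<exists>f\<in>B. \<forall>u\<in>U. f u \<le> y u"
      using dickson[OF finU, of ?S] by blast
    obtain gs where gs: "set gs \<subseteq> ?H"
      "\<forall>h\<in>?H. \<exists>ns. length ns = length gs \<and> (\<forall>x. h x = (\<Sum>i<length gs. ns!i * (gs!i) x))"
      using finitely_generated[of U ?H] finU sub[of U 0 _ 0] by (fastforce simp: lin_def)
    define ps where "ps = map term_count gs"
    define ps' where "ps' = filter (%p. p \<noteq> (%_. 0)) ps"
    let ?F = "(%b. (term_count b, ps')) ` B"
    have lc: "lin U c (%x. b x + (\<Sum>i<length gs. ns!i * (gs!i) x)) \<and>
         term_count (%x. b x + (\<Sum>i<length gs. ns!i * (gs!i) x)) a = term_count b a + (\<Sum>i<length ps. ns!i * (ps!i) a)"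
      if b: "lin U c b" for b c ns a
    proof -
      have H: "lin U 0 (gs ! i)" if "i < length gs" for i using gs(1) that by (auto dest: nth_mem)
      have d: "(\<Sum>\<rho>\<in>P. (b \<rho> + (\<Sum>i<length gs. ns!i * (gs!i) \<rho>)) * g \<rho>) 
          = (\<Sum>\<rho>\<in>P. b \<rho> * g \<rho>) + (\<Sum>i<length gs. ns!i * (\<Sum>\<rho>\<in>P. (gs!i) \<rho> * g \<rho>))" for g
        by (simp add: distrib_right sum.distrib sum_distrib_left sum_distrib_right mult.assoc sum.swap[of _ P])
      have t: "term_count (%x. b x + (\<Sum>i<length gs. ns!i * (gs!i) x)) a = term_count b a + (\<Sum>i<length ps. ns!i * (ps!i) a)" for a
        unfolding term_count_def d by (simp add: ps_def term_count_def)
      have "(\<Sum>i<length ps. ns!i * (ps!i) a) = 0" if "a \<ge> s" for a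
        using H that by (auto simp: ps_def lin_def)
      moreover have "(\<Sum>i<length gs. ns!i * (\<Sum>\<rho>\<in>P. (gs!i) \<rho> * count (mset (snd \<rho>)) (Inl A))) = 
        (\<Sum>i<length gs. ns!i * (\<Sum>\<rho>\<in>P. (gs!i) \<rho> * (if fst \<rho> = A then 1 else 0)))" for A
        using H by (intro sum.cong) (auto simp: lin_def)
      ultimately have "lin U c (%x. b x + (\<Sum>i<length gs. ns!i * (gs!i) x))"
        unfolding lin_def t d using b H by (auto simp: lin_def)
      then show ?thesis using t by blast
    qed
    have "(\<exists>h. lin U 1 h \<and> (\<forall>x\<in>U. h x > 0) \<and> c = term_count h) \<longleftrightarrow> (\<exists>b\<in>B. c \<in> linear_set (term_count b) ps)" for c
    proof
      assume "\<exists>h. lin U 1 h \<and> (\<forall>x\<in>U. h x > 0) \<and> c = term_count h"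
      then obtain h where h: "lin U 1 h" "\<forall>x\<in>U. h x > 0" "c = term_count h" by blast
      then obtain b where b: "b \<in> B" "\<forall>u\<in>U. b u \<le> h u" using B(3) by blast
      have bl: "lin U 1 b" using b(1) B(2) by blast
      then have le: "\<forall>x. b x \<le> h x" using b(2) by (metis le0 lin_def)
      then have "(%x. h x - b x) \<in> ?H" using sub[OF h(1) bl] by simp
      then obtain ns where ns: "length ns = length gs" "\<forall>x. h x - b x = (\<Sum>i<length gs. ns!i * (gs!i) x)"
        using gs(2) by meson
      have "h = (%x. b x + (\<Sum>i<length gs. ns!i * (gs!i) x))" using ns(2) le by (metis le_add_diff_inverse)
      then have "c a = term_count b a + (\<Sum>i<length ps. ns!i * (ps!i) a)" for a using lc[OF bl] h(3) by simp
      then show "\<exists>b\<in>B. c \<in> linear_set (term_count b) ps"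
        using ns(1) b(1) by (auto simp: linear_set_def ps_def)
    next
      assume "\<exists>b\<in>B. c \<in> linear_set (term_count b) ps"
      then obtain b ns where b: "b \<in> B" "\<forall>a. c a = term_count b a + (\<Sum>i<length ps. ns!i * (ps!i) a)"
        by (auto simp: linear_set_def)
      have bl: "lin U 1 b" "\<forall>x\<in>U. b x > 0" using b(1) B(2) by blast+
      then show "\<exists>h. lin U 1 h \<and> (\<forall>x\<in>U. h x > 0) \<and> c = term_count h"
        using lc[OF bl(1), of ns] b(2) by (intro exI[of _ "%x. b x + (\<Sum>i<length gs. ns!i * (gs!i) x)"]) auto
    qed
    moreover have "term_count b a = 0" if "b \<in> B" "a \<ge> s" for a b
      using B(2) that by (auto simp: lin_def)
    moreover have "(\<exists>a<s. p a \<noteq> 0) \<and> (\<forall>a\<ge>s. p a = 0)" if p: "p \<in> set ps'" for p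
    proof -
      obtain g where g: "lin U 0 g" "p = term_count g" "p \<noteq> (%_. 0)" using p gs(1) by (auto simp: ps_def ps'_def)
      then obtain a where "p a \<noteq> 0" by auto
      then show ?thesis using g(1,2) by (metis lin_def not_less)
    qed
    ultimately show ?thesis using B(1) linear_set_drop_zero[of _ ps]
      by (intro exI[of _ ?F]) (auto simp: ps'_def)
  qed
  have "\<forall>U\<in>Pow P. \<exists>F. finite F \<and> (\<forall>(b, ps)\<in>F. (\<forall>a\<ge>s. b a = 0) \<and> (\<forall>p\<in>set ps. (\<exists>a<s. p a \<noteq> 0) \<and> (\<forall>a\<ge>s. p a = 0))) \<and>
     (\<forall>c. (\<exists>h. lin U 1 h \<and> (\<forall>x\<in>U. h x > 0) \<and> c = term_count h) \<longleftrightarrow> (\<exists>(b, ps)\<in>F. c \<in> linear_set b ps))"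
    by (intro ballI semi)
  from bchoice[OF this] obtain FF where "\<forall>U\<in>Pow P. finite (FF U) \<and> (\<forall>(b, ps)\<in>FF U. (\<forall>a\<ge>s. b a = 0) \<and> (\<forall>p\<in>set ps. (\<exists>a<s. p a \<noteq> 0) \<and> (\<forall>a\<ge>s. p a = 0))) \<and>
     (\<forall>c. (\<exists>h. lin U 1 h \<and> (\<forall>x\<in>U. h x > 0) \<and> c = term_count h) \<longleftrightarrow> (\<exists>(b, ps)\<in>FF U. c \<in> linear_set b ps))"
    by (elim exE)
  then have FF: "finite (FF U)" "\<forall>(b, ps)\<in>FF U. (\<forall>a\<ge>s. b a = 0) \<and> (\<forall>p\<in>set ps. (\<exists>a<s. p a \<noteq> 0) \<and> (\<forall>a\<ge>s. p a = 0))"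
     "\<And>c. (\<exists>h. lin U 1 h \<and> (\<forall>x\<in>U. h x > 0) \<and> c = term_count h) \<longleftrightarrow> (\<exists>(b, ps)\<in>FF U. c \<in> linear_set b ps)"
    if "U \<in> Pow P" for U using that by simp_all
  let ?F = "\<Union>U\<in>{U\<in>Pow P. good U}. FF U"
  have r1: "(\<exists>v\<in>L. mset v = mset w) \<longleftrightarrow> (\<exists>(b, ps)\<in>?F. count (mset w) \<in> linear_set b ps)" if w: "w \<in> lists {..<s}" for w
  proof -
    have "(\<exists>v\<in>L. mset v = mset w) \<longleftrightarrow> (\<exists>U\<in>Pow P. good U \<and> (\<exists>(b, ps)\<in>FF U. count (mset w) \<in> linear_set b ps))"
      unfolding main[OF w] using FF(3) by (intro bex_cong refl conj_cong) simp
    then show ?thesis by blast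
  qed
  have r2: "\<forall>(b, ps)\<in>?F. (\<forall>a\<ge>s. b a = 0) \<and> (\<forall>p\<in>set ps. (\<exists>a<s. p a \<noteq> 0) \<and> (\<forall>a\<ge>s. p a = 0))"
  proof
    fix x assume "x \<in> ?F"
    then obtain U where "U \<in> Pow P" "x \<in> FF U" by auto
    then show "case x of (b, ps) => (\<forall>a\<ge>s. b a = 0) \<and> (\<forall>p\<in>set ps. (\<exists>a<s. p a \<noteq> 0) \<and> (\<forall>a\<ge>s. p a = 0))"
      using FF(2)[of U] by (simp only: Ball_def)
  qed
  have r3: "finite ?F" using FF(1) P by auto
  show ?thesis by (rule exI[of _ ?F], rule conjI[OF r3 conjI[OF r2]], rule ballI, rule r1)
qed

subsection \<open>Letter counts of symmetric regular languages\<close>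

lemma funpow_less: "\<forall>q<n. f q < n ==> q < n ==> (f ^^ c) q < (n::nat)"
  by (induction c) auto

text \<open>By pigeonhole every orbit enters, within \<open>n\<close> steps, a cycle of length at
  most \<open>n\<close>. The factorial is a multiple of all such lengths, so one period serves all
  states and all letters.\<close>

lemma funpow_period:
  fixes f :: "nat => nat"
  assumes f: "\<forall>q<n. f q < n" and q: "q < n" and c: "n \<le> c"
  shows "(f ^^ (c + fact (Suc n))) q = (f ^^ c) q"
proof -
  have "(%i. (f ^^ i) q) ` {..n} \<subseteq> {..<n}" using funpow_less[OF f q] by auto
  then have "card ((%i. (f ^^ i) q) ` {..n}) < card {..n}"
    using card_mono[of "{..<n}" "(%i. (f ^^ i) q) ` {..n}"] by simp
  then have "\<not> inj_on (%i. (f ^^ i) q) {..n}" using pigeonhole by blast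
  then obtain i0 j0 where ij0: "i0 \<le> n" "j0 \<le> n" "i0 \<noteq> j0" "(f ^^ i0) q = (f ^^ j0) q"
    by (auto simp: inj_on_def)
  define i where "i = min i0 j0"
  define d where "d = max i0 j0 - i"
  have ij: "i \<le> n" "0 < d" "d \<le> n" "(f ^^ (i + d)) q = (f ^^ i) q"
    using ij0 by (auto simp: i_def d_def min_def max_def)
  have per: "(f ^^ (m + d)) q = (f ^^ m) q" if "i \<le> m" for m
  proof -
    have "(f ^^ (m + d)) q = (f ^^ ((m - i) + (i + d))) q" using that by simp
    also have "\<dots> = (f ^^ (m - i)) ((f ^^ (i + d)) q)" by (simp only: funpow_add comp_apply)
    also have "\<dots> = (f ^^ ((m - i) + i)) q" unfolding ij(4) by (simp only: funpow_add comp_apply)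
    finally show ?thesis using that by simp
  qed
  have perk: "(f ^^ (c + k * d)) q = (f ^^ c) q" for k
  proof (induction k)
    case (Suc k)
    have "(f ^^ (c + Suc k * d)) q = (f ^^ ((c + k * d) + d)) q" by (simp add: algebra_simps)
    also have "\<dots> = (f ^^ (c + k * d)) q" by (rule per) (use c ij in simp)
    finally show ?case using Suc by simp
  qed simp
  have "d dvd fact (Suc n)" using ij by (intro dvd_fact) auto
  then obtain k where "fact (Suc n) = k * d" by (metis dvdE mult.commute)
  then show ?thesis using perk by simp
qed

text \<open>The congruence of finite index on the natural numbers with threshold \<open>N\<close>
  and period \<open>p\<close>, familiar from regular languages over one letter.\<close>

definition count_sim :: "nat => nat => nat => nat => bool" where
  "count_sim N p c d \<longleftrightarrow> c = d \<or> N \<le> c \<and> N \<le> d \<and> c mod p = d mod p"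

lemma funpow_count_sim:
  fixes f :: "nat => nat"
  assumes f: "\<forall>q<n. f q < n" and q: "q < n" and s: "count_sim n (fact (Suc n)) c d"
  shows "(f ^^ c) q = (f ^^ d) q"
proof -
  have *: "(f ^^ d) q = (f ^^ c) q" if cd: "n \<le> c" "c \<le> d" "c mod fact (Suc n) = d mod fact (Suc n)" for c d
  proof -
    obtain k where k: "d = c + k * fact (Suc n)"
      using cd(2,3) by (metis mod_eq_nat1E mult.commute)
    have "(f ^^ (c + k * fact (Suc n))) q = (f ^^ c) q" for k
    proof (induction k)
      case (Suc k)
      have "(f ^^ (c + Suc k * fact (Suc n))) q = (f ^^ ((c + k * fact (Suc n)) + fact (Suc n))) q"
        by (simp add: algebra_simps)
      also have "\<dots> = (f ^^ (c + k * fact (Suc n))) q"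
        by (rule funpow_period[OF f q]) (use cd in simp)
      finally show ?case using Suc by simp
    qed simp
    then show ?thesis using k by simp
  qed
  show ?thesis using s unfolding count_sim_def
    by (metis "*" nat_le_linear)
qed

lemma mset_concat_replicate:
  assumes "w \<in> lists {..<s}"
  shows "mset (concat (map (%a. replicate (count (mset w) a) a) [0..<s])) = mset w"
proof (rule multiset_eqI)
  fix x :: nat
  have "count (mset (concat (map (%a. replicate (c a) a) as))) x = (if x \<in> set as then c x else 0)"
    if "distinct as" for c as using that by (induction as) auto
  then have "count (mset (concat (map (%a. replicate (count (mset w) a) a) [0..<s]))) x = (if x < s then count (mset w) x else 0)"
    by simp
  then show "count (mset (concat (map (%a. replicate (count (mset w) a) a) [0..<s]))) x = count (mset w) x"
    using assms by (auto simp: count_eq_zero_iff)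
qed

text \<open>By symmetry a word may be sorted. The automaton then reads one block per letter, that
  is, it iterates a single map on its states, and block lengths matter only up to threshold and
  period.\<close>

lemma REG_sym_count_sim:
  assumes "REG_sym s L"
  shows "\<exists>N p. 1 < p \<and> (\<forall>v\<in>lists {..<s}. \<forall>w\<in>lists {..<s}.
    (\<forall>a<s. count_sim N p (count (mset v) a) (count (mset w) a)) --> (v \<in> L \<longleftrightarrow> w \<in> L))"
proof -
  obtain n q0 :: nat and \<delta> F where n: "q0 < n" "\<forall>q<n. \<forall>a<s. \<delta> q a < n"
      and L: "L = {w \<in> lists {..<s}. fold (%a q. \<delta> q a) w q0 \<in> F}"
    using assms unfolding REG_sym_def regular_lang_def by blast
  have sym: "mset v = mset w ==> v \<in> L \<longleftrightarrow> w \<in> L" for v w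
    using assms unfolding REG_sym_def symmetric_lang_def by metis
  have lt: "fold (%a q. \<delta> q a) w q < n" if "w \<in> lists {..<s}" "q < n" for w q
    using that by (induction w arbitrary: q) (use n in auto)
  have rep: "fold (%a q. \<delta> q a) (replicate c a) q = ((%q. \<delta> q a) ^^ c) q" for c a q
    by (induction c arbitrary: q) (simp_all add: funpow_Suc_right del: funpow.simps(2))
  have cat: "fold (%a q. \<delta> q a) (concat (map (%a. replicate (c a) a) as)) q
      = fold (%a q. \<delta> q a) (concat (map (%a. replicate (d a) a) as)) q"
    if "\<forall>a\<in>set as. a < s \<and> count_sim n (fact (Suc n)) (c a) (d a)" "q < n" for c d as q
    using that
  proof (induction as arbitrary: q)
    case (Cons a as)
    have "((%q. \<delta> q a) ^^ c a) q = ((%q. \<delta> q a) ^^ d a) q"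
      using Cons.prems n by (intro funpow_count_sim[of n]) auto
    moreover have "((%q. \<delta> q a) ^^ d a) q < n" using Cons.prems n by (intro funpow_less) auto
    ultimately show ?case using Cons by (simp add: rep)
  qed simp
  have "v \<in> L \<longleftrightarrow> w \<in> L" if v: "v \<in> lists {..<s}" and w: "w \<in> lists {..<s}"
    and vw: "\<forall>a<s. count_sim n (fact (Suc n)) (count (mset v) a) (count (mset w) a)" for v w
  proof -
    let ?c = "%w. concat (map (%a. replicate (count (mset w) a) a) [0..<s])"
    have "?c w \<in> lists {..<s}" for w by auto
    moreover have "fold (%a q. \<delta> q a) (?c v) q0 = fold (%a q. \<delta> q a) (?c w) q0"
      using vw n(1) by (intro cat) auto
    ultimately have "?c v \<in> L \<longleftrightarrow> ?c w \<in> L" by (simp add: L)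
    then show ?thesis using sym[OF mset_concat_replicate[OF v]] sym[OF mset_concat_replicate[OF w]] by simp
  qed
  moreover have "1 < (fact (Suc n) :: nat)" using fact_ge_self[of "Suc n"] n(1) by linarith
  ultimately show ?thesis by blast
qed

subsection \<open>Counting tuples of sets\<close>

definition tuples :: "nat => nat => nat set list set" where
  "tuples n k = {As. set As \<subseteq> Pow {..<n} \<and> length As = k}"

definition upds :: "(nat => nat set) => nat list => nat set list => nat => nat set" where
  "upds so Xs As = fold (%(X, A) g. g(X := A)) (zip Xs As) so"

lemma finite_tuples: "finite (tuples n k)"
  unfolding tuples_def by (intro finite_lists_length_eq) simp

lemma card_tuples: "card (tuples n k) = 2 ^ (n * k)"
  unfolding tuples_def using card_lists_length_eq[of "Pow {..<n}" k] by (simp add: card_Pow power_mult)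

text \<open>The bits of \<open>i\<close> are exactly the memberships in the sets, which gives
  injectivity; surjectivity follows from the cardinalities. Counting assignments thereby becomes
  counting tuples, without any order.\<close>

lemma bij_betw_assign_set:
  "bij_betw (%i. map (assign_set n k i) [0..<k]) {..<2 ^ (n * k)} (tuples n k)"
proof -
  let ?f = "%i. map (assign_set n k i) [0..<k]"
  have "i = i'" if i: "i < 2 ^ (n * k)" "i' < 2 ^ (n * k)" and eq: "?f i = ?f i'" for i i'
  proof (rule bit_eqI)
    fix e
    show "bit i e \<longleftrightarrow> bit i' e"
    proof (cases "e < n * k")
      case True
      define m where "m = n * k - 1 - e"
      have m: "m < n * k" "e = n * k - 1 - m" using True by (auto simp: m_def)
      have n: "n > 0" using True by (cases n) auto
      have l: "m div n < k" using m n by (simp add: div_less_iff_less_mult mult.commute)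
      have "assign_set n k i (m div n) = assign_set n k i' (m div n)"
        using eq l by (auto simp: list_eq_iff_nth_eq)
      then have "m mod n \<in> assign_set n k i (m div n) \<longleftrightarrow> m mod n \<in> assign_set n k i' (m div n)" by simp
      then show ?thesis using n m by (simp add: assign_set_def bit_iff_odd mult.commute)
    next
      case False
      then have "(2::nat) ^ (n * k) \<le> 2 ^ e" by (intro power_increasing) auto
      then have "i < 2 ^ e" "i' < 2 ^ e" using i by linarith+
      then have "i div 2 ^ e = 0" "i' div 2 ^ e = 0" by simp_all
      then show ?thesis by (simp add: bit_iff_odd)
    qed
  qed
  then have inj: "inj_on ?f {..<2 ^ (n * k)}" by (auto simp: inj_on_def)
  moreover have "?f ` {..<2 ^ (n * k)} \<subseteq> tuples n k" by (auto simp: tuples_def assign_set_def)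
  then have "?f ` {..<2 ^ (n * k)} = tuples n k"
    by (intro card_subset_eq finite_tuples) (simp_all add: card_image[OF inj] card_tuples)
  ultimately show ?thesis by (simp add: bij_betw_def)
qed

lemma assign_upd_upds:
  "assign_upd so Xs n i = upds so Xs (map (assign_set n (length Xs) i) [0..<length Xs])"
proof -
  have "zip Xs (map g [0..<length Xs]) = map (%(l, X). (X, g l)) (enumerate 0 Xs)" for g :: "nat => nat set"
    by (intro nth_equalityI) (auto simp: enumerate_eq_zip)
  then show ?thesis unfolding assign_upd_def upds_def by (simp add: fold_map comp_def case_prod_unfold)
qed

definition letter :: "nat list => (nat => nat) => fm list => (nat => nat set) => nat" where
  "letter w fo fs so = length (takeWhile Not (map (%f. sat w fo so f) fs))"

lemma image_filter: "f ` {i \<in> A. P (f i)} = {x \<in> f ` A. P x}"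
  by blast

text \<open>Replaces the sequence of letters by counts of set tuples; a symmetric quantifier is used
  only in this form from here on.\<close>

lemma sat_QStar_counts:
  assumes "symmetric_lang L" "length fs = s - 1" "1 \<le> s"
  shows "\<exists>u\<in>lists {..<s}. (sat w fo so (QStar s L Xs fs) \<longleftrightarrow> u \<in> L) \<and>
    (\<forall>a. count (mset u) a = card {As \<in> tuples (length w) (length Xs). letter w fo fs (upds so Xs As) = a})"
proof -
  let ?n = "length w" and ?k = "length Xs"
  let ?f = "%i. map (assign_set ?n ?k i) [0..<?k]"
  let ?u = "map (%i. letter w fo fs (upds so Xs (?f i))) [0..<2 ^ (?n * ?k)]"
  have lt: "letter w fo fs so < s" for so
    using assms length_takeWhile_le[of Not "map (%f. sat w fo so f) fs"] by (simp add: letter_def)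
  have "count (mset ?u) a = card {As \<in> tuples ?n ?k. letter w fo fs (upds so Xs As) = a}" for a
  proof -
    have "count (mset ?u) a = card {i \<in> {..<2 ^ (?n * ?k)}. letter w fo fs (upds so Xs (?f i)) = a}"
      unfolding count_mset count_list_eq_length_filter filter_map length_map length_filter_conv_card
      by (rule arg_cong[where f = card]) auto
    also have "\<dots> = card {As \<in> tuples ?n ?k. letter w fo fs (upds so Xs As) = a}"
    proof (rule bij_betw_same_card[OF bij_betw_subset[OF bij_betw_assign_set]])
      have "?f ` {..<2 ^ (?n * ?k)} = tuples ?n ?k" using bij_betw_assign_set by (rule bij_betw_imp_surj_on)
      then show "?f ` {i \<in> {..<2 ^ (?n * ?k)}. letter w fo fs (upds so Xs (?f i)) = a}
         = {As \<in> tuples ?n ?k. letter w fo fs (upds so Xs As) = a}"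
        using image_filter[of ?f "{..<2 ^ (?n * ?k)}" "%As. letter w fo fs (upds so Xs As) = a"] by simp
    qed auto
    finally show ?thesis .
  qed
  moreover have "sat w fo so (QStar s L Xs fs) \<longleftrightarrow> ?u \<in> L"
    by (simp add: letter_def assign_upd_upds)
  moreover have "?u \<in> lists {..<s}" using lt by auto
  ultimately show ?thesis by blast
qed

subsection \<open>One-pass counter transducers with a final oracle query\<close>

text \<open>The outcomes form a list rather than a set because paths are counted with multiplicity.
  One output letter per input letter keeps the query word aligned with the input.\<close>

fun runs :: "('q => nat => bool => ('q \<times> nat \<times> int) list) => 'q => nat => nat list => ('q \<times> nat \<times> nat list) list" where
  "runs \<delta> p c [] = [(p, c, [])]"
| "runs \<delta> p c (a # x) = concat (map (%(p', b, m).
     map (%(r, d, y). (r, d, b # y)) (runs \<delta> p' (nat (int c + m)) x)) (\<delta> p a (c = 0)))"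

text \<open>Tape 0 is the input tape, tape 1 the counter (its cell 0 carries a mark, so that the
  counter can be tested for zero), tape 2 the query tape.  As the state is lost in a query, the
  acceptance condition for both answers is saved in the first blank cell of the input tape.\<close>

locale onepass =
  fixes Q :: "'q set" and g :: "'q => nat" and p0 :: 'q and s S' :: nat
    and \<delta> :: "'q => nat => bool => ('q \<times> nat \<times> int) list"
    and acc :: "'q => bool => bool => bool"
  assumes finQ: "finite Q" and g: "bij_betw g Q {..<card Q}" and p0: "p0 \<in> Q"
    and \<delta>: "\<And>p a z r. p \<in> Q ==> a < s ==> r \<in> set (\<delta> p a z) ==>
              fst r \<in> Q \<and> fst (snd r) < S' \<and> snd (snd r) \<in> {-1, 0, 1}"
    and \<delta>_ne: "\<And>p a z. p \<in> Q ==> a < s ==> \<delta> p a z \<noteq> []"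
begin

text \<open>Two bits packed into one tape symbol: acceptance after a positive and after a negative
  answer. Therefore the values 1 and 3 accept in state 3, and the values 2 and 3 in state 4.\<close>

definition flag :: "'q => bool => nat" where
  "flag p z = (if acc p z True then 1 else 0) + (if acc p z False then 2 else 0)"

text \<open>States 0 to 4 are the start, acceptance, query and two answer states; the simulated
  states begin at 5. A blank on the input tape means that the input is exhausted.\<close>

definition tr :: "nat => nat list => (nat \<times> nat list \<times> int list) list" where
  "tr q sy = (if q = 0 then [(5 + g p0, [sy!0, 1, sy!2], [0, 0, 0])]
     else if q = 3 then (if sy!0 = 1 \<or> sy!0 = 3 then [(1, sy, [0, 0, 0])] else [])
     else if q = 4 then (if sy!0 = 2 \<or> sy!0 = 3 then [(1, sy, [0, 0, 0])] else [])
     else if q < 5 then []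
     else let p = the_inv_into Q g (q - 5); z = (sy!1 = 1) in
       if sy!0 = 0 then [(2, [flag p z, sy!1, sy!2], [0, 0, 0])]
       else if s < sy!0 then []
       else map (%(p', b, m). (5 + g p', [sy!0, sy!1, b + 1], [1, m, 1])) (\<delta> p (sy!0 - 1) z))"

definition M :: tm where
  "M = \<lparr>nstates = 5 + card Q, nsyms = s + S' + 5, ntapes = 3, delta = tr,
        q_init = 0, q_acc = 1, q_qry = 2, q_yes = 3, q_no = 4\<rparr>"

lemma M_simps [simp]: "nstates M = 5 + card Q" "nsyms M = s + S' + 5" "ntapes M = 3" "delta M = tr"
  "q_init M = 0" "q_acc M = 1" "q_qry M = 2" "q_yes M = 3" "q_no M = 4"
  by (simp_all add: M_def)

lemma g_less: "p \<in> Q ==> g p < card Q"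
  using g by (auto simp: bij_betw_def)

lemma g_inv: "p \<in> Q ==> the_inv_into Q g (g p) = p"
  using g by (auto simp: bij_betw_def intro: the_inv_into_f_f)

lemma inv_Q: "q < card Q ==> the_inv_into Q g q \<in> Q"
  using g by (auto simp: bij_betw_def intro: the_inv_into_into)

lemma flag_less: "flag p z < 4" by (simp add: flag_def)

lemma wf_M: "wf_tm M"
  unfolding wf_tm_def
proof (intro conjI allI impI)
  fix q sy
  assume q: "q < nstates M" and sy: "length sy = ntapes M \<and> set sy \<subseteq> {..<nsyms M}"
  obtain a b c where abc: "sy = [a, b, c]"
    using sy by (auto simp: numeral_3_eq_3 length_Suc_conv)
  have n: "a < s + S' + 5" "b < s + S' + 5" "c < s + S' + 5" using sy abc by auto
  let ?p = "the_inv_into Q g (q - 5)"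
  show "\<forall>(q', ws, ms)\<in>set (delta M q sy). q' < nstates M \<and> length ws = ntapes M \<and>
     set ws \<subseteq> {..<nsyms M} \<and> length ms = ntapes M \<and> set ms \<subseteq> {- 1, 0, 1}"
  proof (cases "5 \<le> q \<and> a \<noteq> 0 \<and> a \<le> s")
    case True
    have "?p \<in> Q" using q True by (auto intro!: inv_Q)
    then have "\<forall>r\<in>set (\<delta> ?p (a - 1) z). g (fst r) < card Q \<and> fst (snd r) < S' \<and> snd (snd r) \<in> {-1, 0, 1}" for z
      using \<delta>[of ?p "a - 1"] True g_less by (metis (no_types, lifting) One_nat_def Suc_le_eq Suc_pred bot_nat_0.not_eq_extremum le_trans)
    then show ?thesis using True n by (fastforce simp: tr_def Let_def abc)
  next
    case False
    then show ?thesis using n p0 g_less[OF p0] flag_less[of ?p "b = 1"]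
      by (auto simp: tr_def Let_def abc)
  qed
qed auto

definition ctape :: "nat => nat" where "ctape = (%_. 0)(0 := 1)"

definition qtape :: "nat list => nat => nat" where
  "qtape y = (%j. if j < length y then y ! j + 1 else 0)"

definition conf :: "nat list => 'q => nat => nat => nat list => config" where
  "conf x p c i y = (5 + g p, [(qtape x, i), (ctape, c), (qtape y, length y)])"

lemma qtape_snoc: "(qtape y)(length y := Suc b) = qtape (y @ [b])"
  by (auto simp: qtape_def nth_append fun_eq_iff)

lemma qtape_length: "qtape y (length y) = 0" "(qtape y)(length y := 0) = qtape y"
  by (auto simp: qtape_def fun_eq_iff)

lemma qtape_nth: "i < length y ==> qtape y i = Suc (y ! i)"
  by (simp add: qtape_def)

lemma query_word_qtape: "query_word (qtape y) = y"
proof -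
  have "(LEAST m. qtape y m = 0) = length y"
    by (rule Least_equality) (auto simp: qtape_def not_less split: if_splits)
  then show ?thesis unfolding query_word_def by (auto simp: qtape_def intro!: nth_equalityI)
qed

lemma ctape_1: "ctape c = Suc 0 \<longleftrightarrow> c = 0" by (auto simp: ctape_def)

lemma step_conf:
  assumes p: "p \<in> Q" and i: "i < length x" and x: "x \<in> lists {..<s}"
  shows "step M Or (conf x p c i y)
    = map (%(p', b, m). conf x p' (nat (int c + m)) (Suc i) (y @ [b])) (\<delta> p (x ! i) (c = 0))"
proof -
  have a: "x ! i < s" using x i by (auto simp: in_lists_conv_set)
  show ?thesis using p i a
    by (auto simp: step_def conf_def tr_def Let_def g_inv ctape_1 qtape_snoc case_prod_unfold
        qtape_nth fun_upd_idem nat_add_distrib)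
qed

lemma step_end:
  assumes p: "p \<in> Q"
  shows "step M Or (conf x p c (length x) y) = 
    [(2, [((qtape x)(length x := flag p (c = 0)), length x), (ctape, c), (qtape y, length y)])]"
  using p by (simp add: step_def conf_def tr_def Let_def g_inv ctape_1 qtape_length)

lemma end_phase:
  assumes p: "p \<in> Q"
  shows "halts_within M Or (Suc (Suc (Suc k))) (conf x p c (length x) y)"
    "acc_paths M Or (Suc (Suc (Suc k))) (conf x p c (length x) y) = (if acc p (c = 0) (y \<in> Or) then 1 else 0)"
    "rej_paths M Or (Suc (Suc (Suc k))) (conf x p c (length x) y) = (if acc p (c = 0) (y \<in> Or) then 0 else 1)"
proof -
  define q2 :: nat where "q2 = (if y \<in> Or then 3 else 4)"
  let ?t = "[((qtape x)(length x := flag p (c = 0)), length x), (ctape, c), (qtape y, length y)]"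
  let ?t' = "[((qtape x)(length x := flag p (c = 0)), length x), (ctape, c), (%_. 0, 0)]"
  note s1 = step_end[OF p, of Or x c y]
  have s2: "step M Or (2, ?t) = [(q2, ?t')]" by (simp add: step_def query_word_qtape q2_def)
  have s3: "step M Or (q2, ?t') = (if acc p (c = 0) (y \<in> Or) then [(1, ?t')] else [])"
    by (simp add: step_def tr_def flag_def fun_upd_idem q2_def)
  have s4: "step M Or (1, t) = []" for t by (simp add: step_def)
  have k: "halts_within M Or k (1, t)" "acc_paths M Or k (1, t) = 1" "rej_paths M Or k (1, t) = 0" for t
    by (cases k; simp add: s4[unfolded One_nat_def])+
  have 2: "q2 \<noteq> 1" by (simp add: q2_def)
  show "halts_within M Or (Suc (Suc (Suc k))) (conf x p c (length x) y)"
    using k by (simp add: s1 s2 s3 del: One_nat_def)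
  show "acc_paths M Or (Suc (Suc (Suc k))) (conf x p c (length x) y) = (if acc p (c = 0) (y \<in> Or) then 1 else 0)"
    using k 2 by (simp add: s1 s2 s3 del: One_nat_def)
  show "rej_paths M Or (Suc (Suc (Suc k))) (conf x p c (length x) y) = (if acc p (c = 0) (y \<in> Or) then 0 else 1)"
    using k 2 by (simp add: s1 s2 s3 del: One_nat_def)
qed

definition good :: "nat list set => nat list => 'q \<times> nat \<times> nat list => bool" where
  "good Or y = (%(r, d, o'). acc r (d = 0) (y @ o' \<in> Or))"

lemma good_Cons: "good Or y (r, d, b # o') = good Or (y @ [b]) (r, d, o')"
  by (simp add: good_def)

lemma main_phase:
  assumes x: "x \<in> lists {..<s}"
  shows "p \<in> Q ==> i + l = length x ==>
    halts_within M Or (l + Suc (Suc (Suc k))) (conf x p c i y) \<and>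
    acc_paths M Or (l + Suc (Suc (Suc k))) (conf x p c i y) = length (filter (good Or y) (runs \<delta> p c (drop i x))) \<and>
    rej_paths M Or (l + Suc (Suc (Suc k))) (conf x p c i y) = length (filter (%r. \<not> good Or y r) (runs \<delta> p c (drop i x)))"
proof (induction l arbitrary: p c i y)
  case 0
  then have "i = length x" by simp
  with end_phase[OF 0(1), of Or k x c y] show ?case by (simp add: good_def del: halts_within.simps acc_paths.simps rej_paths.simps)
next
  case (Suc l)
  have i: "i < length x" using Suc.prems by simp
  have dr: "drop i x = x ! i # drop (Suc i) x" using i by (simp add: Cons_nth_drop_Suc)
  have a: "x ! i < s" using x i by (auto simp: in_lists_conv_set)
  note st = step_conf[OF Suc.prems(1) i x, of Or c y]
  have IH: "halts_within M Or (l + Suc (Suc (Suc k))) (conf x p' (nat (int c + m)) (Suc i) (y @ [b]))"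
    "acc_paths M Or (l + Suc (Suc (Suc k))) (conf x p' (nat (int c + m)) (Suc i) (y @ [b])) =
       length (filter (good Or (y @ [b])) (runs \<delta> p' (nat (int c + m)) (drop (Suc i) x)))"
    "rej_paths M Or (l + Suc (Suc (Suc k))) (conf x p' (nat (int c + m)) (Suc i) (y @ [b])) =
       length (filter (%r. \<not> good Or (y @ [b]) r) (runs \<delta> p' (nat (int c + m)) (drop (Suc i) x)))"
    if "(p', b, m) \<in> set (\<delta> p (x ! i) (c = 0))" for p' b m
    using Suc.IH[of p' "Suc i"] Suc.prems \<delta>[OF Suc.prems(1) a that] by auto
  have fil: "filter P (map (%(r, d, o'). (r, d, b # o')) rs) = map (%(r, d, o'). (r, d, b # o')) (filter (%(r, d, o'). P (r, d, b # o')) rs)"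
    for P b and rs :: "('q \<times> nat \<times> nat list) list"
    by (induction rs) auto
  have len: "length (filter (good Or y) (runs \<delta> p c (drop i x))) = 
      sum_list (map (%(p', b, m). length (filter (good Or (y @ [b])) (runs \<delta> p' (nat (int c + m)) (drop (Suc i) x)))) (\<delta> p (x ! i) (c = 0)))"
    "length (filter (%r. \<not> good Or y r) (runs \<delta> p c (drop i x))) = 
      sum_list (map (%(p', b, m). length (filter (%r. \<not> good Or (y @ [b]) r) (runs \<delta> p' (nat (int c + m)) (drop (Suc i) x)))) (\<delta> p (x ! i) (c = 0)))"
    by (simp_all add: dr filter_concat length_concat comp_def case_prod_unfold fil[unfolded case_prod_unfold] good_Cons)
  define t where "t = l + Suc (Suc (Suc k))"
  have t: "Suc l + Suc (Suc (Suc k)) = Suc t" by (simp add: t_def)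
  note IH = IH[folded t_def]
  have ne: "step M Or (conf x p c i y) \<noteq> []" using \<delta>_ne[OF Suc.prems(1) a] by (simp add: st)
  show ?case
  proof (intro conjI)
    show "halts_within M Or (Suc l + Suc (Suc (Suc k))) (conf x p c i y)"
      unfolding t halts_within.simps st using IH(1) by auto
    show "acc_paths M Or (Suc l + Suc (Suc (Suc k))) (conf x p c i y) = length (filter (good Or y) (runs \<delta> p c (drop i x)))"
      unfolding len t acc_paths.simps if_not_P[OF ne]
      unfolding st map_map by (intro arg_cong[where f = sum_list] map_cong refl) (use IH(2) in \<open>auto simp del: acc_paths.simps\<close>)
    show "rej_paths M Or (Suc l + Suc (Suc (Suc k))) (conf x p c i y) = length (filter (%r. \<not> good Or y r) (runs \<delta> p c (drop i x)))"
      unfolding len t rej_paths.simps if_not_P[OF ne]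
      unfolding st map_map by (intro arg_cong[where f = sum_list] map_cong refl) (use IH(3) in \<open>auto simp del: rej_paths.simps\<close>)
  qed
qed

lemma onepass_counts:
  assumes x: "x \<in> lists {..<s}"
  shows "halts_within M Or (5 * (length x + 1)) (init_config M x)"
    "acc_paths M Or (5 * (length x + 1)) (init_config M x) = length (filter (good Or []) (runs \<delta> p0 0 x))"
    "rej_paths M Or (5 * (length x + 1)) (init_config M x) = length (filter (%r. \<not> good Or [] r) (runs \<delta> p0 0 x))"
proof -
  have z: "((%_. 0)(0 := 0)) = (%_. 0 :: nat)" by auto
  have st: "step M Or (init_config M x) = [conf x p0 0 0 []]"
    by (simp add: step_def init_config_def conf_def tr_def numeral_2_eq_2 ctape_def qtape_def fun_upd_idem z)
  \<comment> \<open>One step places the mark on the counter tape, \<open>length x\<close> steps read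
    the input, three steps save the flag, query and evaluate the answer; the rest is slack.\<close>
  have t: "5 * (length x + 1) = Suc (length x + Suc (Suc (Suc (4 * length x + 1))))" by simp
  note mp = main_phase[OF x p0, of 0 "length x" Or "4 * length x + 1" 0 "[]", simplified]
  show "halts_within M Or (5 * (length x + 1)) (init_config M x)"
    unfolding t halts_within.simps st using mp by simp
  show "acc_paths M Or (5 * (length x + 1)) (init_config M x) = length (filter (good Or []) (runs \<delta> p0 0 x))"
    unfolding t acc_paths.simps st using mp by simp
  show "rej_paths M Or (5 * (length x + 1)) (init_config M x) = length (filter (%r. \<not> good Or [] r) (runs \<delta> p0 0 x))"
    unfolding t rej_paths.simps st using mp by simp
qed

end

text \<open>Lets every later machine be given by transitions, an acceptance function and its list of
  outcomes; tapes and time bounds do not reappear in the direction from logic to machines.\<close>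

theorem onepass_lin_class:
  fixes \<delta> :: "'q => nat => bool => ('q \<times> nat \<times> int) list"
  assumes Q: "finite Q" "p0 \<in> Q"
    and \<delta>: "\<And>p a z r. p \<in> Q ==> a < s ==> r \<in> set (\<delta> p a z) ==>
              fst r \<in> Q \<and> fst (snd r) < S' \<and> snd (snd r) \<in> {-1, 0, 1}"
    and ne: "\<And>p a z. p \<in> Q ==> a < s ==> \<delta> p a z \<noteq> []"
    and L: "L \<subseteq> lists {..<s}" "(s', Or) \<in> Os"
    and eq: "\<And>x. x \<in> lists {..<s} ==> x \<in> L \<longleftrightarrow> mode_accepts md
       (length (filter (%(r, d, y). acc r (d = 0) (y \<in> Or)) (runs \<delta> p0 0 x)))
       (length (filter (%(r, d, y). \<not> acc r (d = 0) (y \<in> Or)) (runs \<delta> p0 0 x)))"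
  shows "(s, L) \<in> lin_class md Os"
proof -
  obtain g where "bij_betw g Q {..<card Q}"
    using ex_bij_betw_finite_nat[OF Q(1)] by (auto simp: atLeast0LessThan)
  then interpret onepass Q g p0 s S' \<delta> acc
    using assms by unfold_locales auto
  have "good Or [] = (%(r, d, y). acc r (d = 0) (y \<in> Or))"
    "(%r. \<not> good Or [] r) = (%(r, d, y). \<not> acc r (d = 0) (y \<in> Or))"
    by (auto simp: good_def)
  then have "\<forall>x \<in> lists {..<s}. halts_within M Or (5 * (length x + 1)) (init_config M x) \<and>
           (x \<in> L \<longleftrightarrow> mode_accepts md (acc_paths M Or (5 * (length x + 1)) (init_config M x))
                                     (rej_paths M Or (5 * (length x + 1)) (init_config M x)))"
    using onepass_counts eq by metis
  then show ?thesis unfolding lin_class_def mem_Collect_eq case_prod_conv using L wf_M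
    by (intro conjI exI[of _ M] exI[of _ Or] exI[of _ s'] exI[of _ 5]) auto
qed

subsection \<open>A monadic counting logic and its evaluation in the hierarchies\<close>

text \<open>The atoms are what one pass can decide: \<open>IFst\<close> scans for the first column
  on which its function commits itself, and \<open>IPl\<close> needs the counter.
  \<open>ICnt\<close> takes sums of counts over lists of formulas, so that a linear combination with
  fixed coefficients fits into a single quantifier.\<close>

datatype ifm =
    IFst nat "nat => nat set => bool option" bool
  | IPl nat nat nat
  | INeg ifm
  | ICnt mode "nat list" "ifm list" "ifm list"

fun first_dec :: "('a => bool option) => bool => 'a list => bool" where
  "first_dec D d [] = d"
| "first_dec D d (c # cs) = (case D c of Some b => b | None => first_dec D d cs)"

text \<open>A real-time counter automaton for \<open>x + y = z\<close> on marked positions: the counter goes up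
  on \<open>[0, x)\<close> and down on \<open>[y, z)\<close>; the flags record which marks have been passed and whether an
  error (\<open>z < y\<close> or a negative counter) has occurred.\<close>

definition plus_next :: "bool \<times> bool \<times> bool \<times> bool => bool => bool => bool => bool => (bool \<times> bool \<times> bool \<times> bool) \<times> int" where
  "plus_next st zero bx by bz = (case st of (fx, fy, fz, bad) =>
     let x = fx \<or> bx; y = fy \<or> by; z = fz \<or> bz; inc = (\<not> x); dec = (y \<and> \<not> z)
     in ((x, y, z, bad \<or> z \<and> \<not> y \<or> \<not> inc \<and> dec \<and> zero),
         if inc \<and> \<not> dec then 1 else if dec \<and> \<not> inc then -1 else 0))"

fun plus_run :: "bool \<times> bool \<times> bool \<times> bool => nat => (bool \<times> bool \<times> bool) list => bool" where
  "plus_run (fx, fy, fz, bad) c [] = (\<not> bad \<and> c = 0)"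
| "plus_run st c ((bx, by, bz) # cs) =
     (let r = plus_next st (c = 0) bx by bz in plus_run (fst r) (nat (int c + snd r)) cs)"

fun isat :: "nat list => (nat => nat set) => ifm => bool" where
  "isat w so (IFst v D d) =
     first_dec (%p. D (w ! p) {X. X < v \<and> p \<in> so X}) d [0..<length w]"
| "isat w so (IPl X Y Z) =
     plus_run (False, False, False, False) 0 (map (%p. (p \<in> so X, p \<in> so Y, p \<in> so Z)) [0..<length w])"
| "isat w so (INeg f) = (\<not> isat w so f)"
| "isat w so (ICnt md Xs fs gs) = mode_accepts md
     (sum_list (map (%f. card {As \<in> tuples (length w) (length Xs). isat w (upds so Xs As) f}) fs))
     (sum_list (map (%f. card {As \<in> tuples (length w) (length Xs). isat w (upds so Xs As) f}) gs))"

fun ibnd :: "nat => ifm => bool" where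
  "ibnd v (IFst v' D d) = (v' \<le> v)"
| "ibnd v (IPl X Y Z) = (X < v \<and> Y < v \<and> Z < v)"
| "ibnd v (INeg f) = ibnd v f"
| "ibnd v (ICnt md Xs fs gs) = (set Xs \<subseteq> {..<v} \<and> (\<forall>f\<in>set fs. ibnd v f) \<and> (\<forall>f\<in>set gs. ibnd v f))"

text \<open>A nonempty \<open>fs\<close> guarantees a choice for the machine. With majority, paths
  of \<open>fs\<close> vote for and paths of \<open>gs\<close> against the formula they evaluate;
  equal lengths make the constant contributions cancel.\<close>

fun iwf :: "mode set => ifm => bool" where
  "iwf Md (INeg f) = iwf Md f"
| "iwf Md (ICnt md Xs fs gs) = (md \<in> Md \<and> distinct Xs \<and> fs \<noteq> [] \<and> (md = PPm --> length fs = length gs) \<and>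
     (\<forall>f\<in>set fs. iwf Md f) \<and> (\<forall>f\<in>set gs. iwf Md f))"
| "iwf Md _ = True"

lemma ibnd_mono: "ibnd v f ==> v \<le> v' ==> ibnd v' f"
  by (induction f) auto

lemma ibnd_ex: "\<exists>v. ibnd v f"
proof (induction f)
  case (IPl X Y Z)
  show ?case by (intro exI[of _ "Suc (max X (max Y Z))"]) auto
next
  case (ICnt md Xs fs gs)
  then have "\<forall>f\<in>set fs \<union> set gs. \<exists>v. ibnd v f" by auto
  from bchoice[OF this] obtain h where h: "\<forall>f\<in>set fs \<union> set gs. ibnd (h f) f" by blast
  define v where "v = Max (insert 0 (h ` (set fs \<union> set gs) \<union> Suc ` set Xs))"
  have "h f \<le> v" if "f \<in> set fs \<union> set gs" for f using that by (auto simp: v_def intro!: Max_ge)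
  moreover have "Suc X \<le> v" if "X \<in> set Xs" for X using that by (auto simp: v_def intro!: Max_ge)
  ultimately show ?case using h by (intro exI[of _ v]) (auto simp: Suc_le_eq intro: ibnd_mono)
qed auto

lemma upds_Cons: "upds so (Y # Xs) (A # As) = upds (so(Y := A)) Xs As"
  by (simp add: upds_def)

lemma upds_notin: "X \<notin> set Xs ==> upds so Xs As X = so X"
  unfolding upds_def by (induction Xs As arbitrary: so rule: list_induct2') auto

lemma upds_nth:
  "length As = length Xs ==> distinct Xs ==> l < length Xs ==> upds so Xs As (Xs ! l) = As ! l"
proof (induction As Xs arbitrary: so l rule: list_induct2)
  case (Cons A As X Xs)
  show ?case
  proof (cases l)
    case 0
    have "upds (so(X := A)) Xs As X = A" using Cons.prems upds_notin[of X Xs] by simp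
    then show ?thesis using 0 by (simp add: upds_def)
  next
    case (Suc l')
    then show ?thesis using Cons by (simp add: upds_def)
  qed
qed simp

lemma upds_cong: "(X \<notin> set Xs ==> p \<in> so X \<longleftrightarrow> p \<in> so' X) ==> length As = length Xs ==>
    p \<in> upds so Xs As X \<longleftrightarrow> p \<in> upds so' Xs As X"
proof (induction Xs arbitrary: As so so')
  case (Cons Y Xs)
  then obtain A As' where "As = A # As'" by (cases As) auto
  moreover have "p \<in> upds (so(Y := A)) Xs As' X \<longleftrightarrow> p \<in> upds (so'(Y := A)) Xs As' X"
    using Cons.prems calculation by (intro Cons.IH) auto
  ultimately show ?case by (simp only: upds_Cons)
qed (simp add: upds_def)

lemma first_dec_cong: "\<forall>x\<in>set xs. D x = D' x ==> first_dec D d xs = first_dec D' d xs"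
  by (induction xs) (auto split: option.split)

lemma isat_cong:
  "ibnd v f ==> (\<forall>X<v. \<forall>p<length w. p \<in> so X \<longleftrightarrow> p \<in> so' X) ==> isat w so f \<longleftrightarrow> isat w so' f"
proof (induction f arbitrary: so so')
  case (IFst v' D d)
  then have "{X. X < v' \<and> p \<in> so X} = {X. X < v' \<and> p \<in> so' X}" if "p < length w" for p
    using that by auto
  then show ?case by (auto intro!: first_dec_cong)
next
  case (IPl X Y Z)
  have "map (%p. (p \<in> so X, p \<in> so Y, p \<in> so Z)) [0..<length w] = map (%p. (p \<in> so' X, p \<in> so' Y, p \<in> so' Z)) [0..<length w]"
    using IPl by auto
  then show ?case by (simp only: isat.simps)
next
  case (ICnt md Xs fs gs)
  have "{As \<in> tuples (length w) (length Xs). isat w (upds so Xs As) f} = {As \<in> tuples (length w) (length Xs). isat w (upds so' Xs As) f}"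
    if "f \<in> set fs \<union> set gs" for f
  proof (rule Collect_cong, rule conj_cong[OF refl])
    fix As assume "As \<in> tuples (length w) (length Xs)"
    then have ag: "\<forall>X<v. \<forall>p<length w. p \<in> upds so Xs As X \<longleftrightarrow> p \<in> upds so' Xs As X"
      using ICnt.prems(2) by (auto intro!: upds_cong simp: tuples_def)
    from that show "isat w (upds so Xs As) f \<longleftrightarrow> isat w (upds so' Xs As) f"
    proof
      assume "f \<in> set fs" then show ?thesis using ICnt.prems(1) ag by (intro ICnt.IH(1)) auto
    next
      assume "f \<in> set gs" then show ?thesis using ICnt.prems(1) ag by (intro ICnt.IH(2)) auto
    qed
  qed
  then show ?case by (simp cong: map_cong)
qed auto

lemma plus_run_bad: "\<not> plus_run (fx, fy, fz, True) c cs"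
proof (induction cs arbitrary: fx fy fz c)
  case (Cons b cs)
  then show ?case by (cases b) (simp add: plus_next_def Let_def)
qed simp

text \<open>Invariant after \<open>p\<close> letters without error: the counter plus the increments
  still due equals the decrements still due. Until \<open>x\<close> is passed every decrement is
  offset by an increment, so a decrement at zero shows that the decrements prevail for good.\<close>

lemma plus_run_iff:
  assumes "x < n" "y < n" "z < n"
  shows "p \<le> n ==> (z < p --> y < p) ==>
    plus_run (x < p, y < p, z < p, False) c (map (%p. (p = x, p = y, p = z)) [p..<n])
      \<longleftrightarrow> (y \<le> z \<or> z < p) \<and> c + (x - p) = z - max y p"
proof (induction "n - p" arbitrary: p c)
  case 0
  then show ?case using assms by auto
next
  case (Suc k)
  then have p: "p < n" by simp
  have s: "[p..<n] = p # [Suc p..<n]" using p by (rule upt_conv_Cons)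
  have le: "(u < p \<or> p = u) = (u < Suc p)" for u by auto
  let ?bad = "z < Suc p \<and> \<not> y < Suc p \<or> \<not> \<not> x < Suc p \<and> (y < Suc p \<and> \<not> z < Suc p) \<and> c = 0"
  let ?m = "if \<not> x < Suc p \<and> \<not> (y < Suc p \<and> \<not> z < Suc p) then 1 else if (y < Suc p \<and> \<not> z < Suc p) \<and> \<not> \<not> x < Suc p then -1 else 0 :: int"
  have eq: "plus_run (x < p, y < p, z < p, False) c (map (%p. (p = x, p = y, p = z)) [p..<n])
     = plus_run (x < Suc p, y < Suc p, z < Suc p, ?bad) (nat (int c + ?m)) (map (%p. (p = x, p = y, p = z)) [Suc p..<n])"
    by (simp only: s list.map plus_run.simps plus_next_def Let_def prod.case fst_conv snd_conv le simp_thms)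
  show ?case
  proof (cases ?bad)
    case True
    then have "?bad = True" by blast
    have "\<not> ((y \<le> z \<or> z < p) \<and> c + (x - p) = z - max y p)" using True Suc.prems by auto
    then show ?thesis unfolding eq[unfolded \<open>?bad = True\<close>] by (simp only: plus_run_bad)
  next
    case False
    then have "?bad = False" by blast
    then have "plus_run (x < p, y < p, z < p, False) c (map (%p. (p = x, p = y, p = z)) [p..<n]) \<longleftrightarrow>
        (y \<le> z \<or> z < Suc p) \<and> nat (int c + ?m) + (x - Suc p) = z - max y (Suc p)"
      unfolding eq[unfolded \<open>?bad = False\<close>]
      by (intro Suc.hyps(1)) (use Suc.hyps(2) p False in linarith)+
    also have "\<dots> \<longleftrightarrow> (y \<le> z \<or> z < p) \<and> c + (x - p) = z - max y p"
      using False Suc.prems by (auto simp: max_def split: if_splits)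
    finally show ?thesis .
  qed
qed

lemma isat_IPl:
  assumes "so X = {x}" "so Y = {y}" "so Z = {z}" "x < length w" "y < length w" "z < length w"
  shows "isat w so (IPl X Y Z) \<longleftrightarrow> x + y = z"
  using plus_run_iff[OF assms(4-6), of 0 0] assms(1-3) by auto

text \<open>Post-order, so that a formula comes after everything it asks about.\<close>

fun isubs :: "ifm => ifm list" where
  "isubs (INeg f) = isubs f @ [INeg f]"
| "isubs (ICnt md Xs fs gs) = concat (map isubs fs) @ concat (map isubs gs) @ [ICnt md Xs fs gs]"
| "isubs f = [f]"

fun kids :: "ifm => ifm set" where
  "kids (INeg f) = {f}"
| "kids (ICnt md Xs fs gs) = set fs \<union> set gs"
| "kids f = {}"

definition closed_list :: "ifm list => bool" where
  "closed_list l \<longleftrightarrow> (\<forall>i<length l. \<forall>g\<in>kids (l!i). \<exists>j<i. l!j = g)"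

lemma closed_list_append: "closed_list l ==> closed_list l' ==> closed_list (l @ l')"
  unfolding closed_list_def
proof (intro allI ballI impI)
  fix i g
  assume l: "\<forall>i<length l. \<forall>g\<in>kids (l ! i). \<exists>j<i. l ! j = g" and l': "\<forall>i<length l'. \<forall>g\<in>kids (l' ! i). \<exists>j<i. l' ! j = g"
    and i: "i < length (l @ l')" and g: "g \<in> kids ((l @ l') ! i)"
  show "\<exists>j<i. (l @ l') ! j = g"
  proof (cases "i < length l")
    case True
    then obtain j where "j < i" "l ! j = g" using l g by (auto simp: nth_append)
    then show ?thesis using True by (intro exI[of _ j]) (auto simp: nth_append)
  next
    case False
    then have "i - length l < length l'" using i by simp
    then obtain j where "j < i - length l" "l' ! j = g"
      using l'[rule_format, of "i - length l" g] g False by (auto simp: nth_append)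
    then show ?thesis using False by (intro exI[of _ "j + length l"]) (auto simp: nth_append)
  qed
qed

lemma closed_list_snoc: "closed_list l ==> kids f \<subseteq> set l ==> closed_list (l @ [f])"
  unfolding closed_list_def
proof (intro allI ballI impI)
  fix i g
  assume l: "\<forall>i<length l. \<forall>g\<in>kids (l ! i). \<exists>j<i. l ! j = g" and f: "kids f \<subseteq> set l"
    and i: "i < length (l @ [f])" and g: "g \<in> kids ((l @ [f]) ! i)"
  show "\<exists>j<i. (l @ [f]) ! j = g"
  proof (cases "i < length l")
    case True
    then obtain j where "j < i" "l ! j = g" using l g by (auto simp: nth_append)
    then show ?thesis using True by (intro exI[of _ j]) (auto simp: nth_append)
  next
    case False
    then have "i = length l" using i by simp
    then have "g \<in> set l" using g f by auto
    then show ?thesis using \<open>i = length l\<close> by (auto simp: in_set_conv_nth nth_append)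
  qed
qed

lemma closed_list_concat: "\<forall>l\<in>set ls. closed_list l ==> closed_list (concat ls)"
  by (induction ls) (auto intro: closed_list_append simp: closed_list_def[of "[]"])

lemma isubs_last: "isubs f \<noteq> [] \<and> last (isubs f) = f"
  by (cases f) auto

lemma self_in_isubs: "f \<in> set (isubs f)"
  using isubs_last last_in_set by metis

lemma closed_list_isubs: "closed_list (isubs f)"
proof (induction f)
  case (INeg f)
  then show ?case using self_in_isubs by (auto intro!: closed_list_snoc)
next
  case (ICnt md Xs fs gs)
  have "closed_list ((concat (map isubs fs) @ concat (map isubs gs)) @ [ICnt md Xs fs gs])"
    using ICnt self_in_isubs by (intro closed_list_snoc closed_list_append closed_list_concat) auto
  then show ?case by simp
qed (simp_all add: closed_list_def)

lemma isubs_iwf: "iwf Md f ==> g \<in> set (isubs f) ==> iwf Md g"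
proof (induction f)
  case (ICnt md Xs fs gs)
  then consider "g = ICnt md Xs fs gs" | h where "h \<in> set fs" "g \<in> set (isubs h)" | h where "h \<in> set gs" "g \<in> set (isubs h)"
    by auto
  then show ?case
  proof cases
    case 1
    then show ?thesis using ICnt.prems by simp
  next
    case (2 h)
    then show ?thesis using ICnt.prems(1) by (intro ICnt.IH(1)[of h]) simp_all
  next
    case (3 h)
    then show ?thesis using ICnt.prems(1) by (intro ICnt.IH(2)[of h]) simp_all
  qed
qed auto

lemma isubs_ibnd: "ibnd v f ==> g \<in> set (isubs f) ==> ibnd v g"
proof (induction f)
  case (ICnt md Xs fs gs)
  then consider "g = ICnt md Xs fs gs" | h where "h \<in> set fs" "g \<in> set (isubs h)" | h where "h \<in> set gs" "g \<in> set (isubs h)"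
    by auto
  then show ?case
  proof cases
    case 1
    then show ?thesis using ICnt.prems by simp
  next
    case (2 h)
    then show ?thesis using ICnt.prems(1) by (intro ICnt.IH(1)[of h]) simp_all
  next
    case (3 h)
    then show ?thesis using ICnt.prems(1) by (intro ICnt.IH(2)[of h]) simp_all
  qed
qed auto

fun choices :: "'a list => nat => 'a list list" where
  "choices Cs 0 = [[]]"
| "choices Cs (Suc n) = concat (map (%C. map ((#) C) (choices Cs n)) Cs)"

lemma set_choices: "set (choices Cs n) = {xs. length xs = n \<and> set xs \<subseteq> set Cs}"
  by (induction n) (auto simp: length_Suc_conv)

lemma distinct_choices: "distinct Cs ==> distinct (choices Cs n)"
proof (induction n)
  case (Suc n)
  have "distinct (concat (map (%C. map ((#) C) L) Ds))" if "distinct L" "distinct Ds" for L and Ds :: "'a list"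
    using that(2) that(1) by (induction Ds) (auto simp: distinct_map inj_on_def)
  then show ?case using Suc by simp
qed simp

text \<open>The transpose of a tuple of sets: a machine that passes once over its input has to guess
  an assignment column by column.\<close>

definition cols_of :: "nat => nat list => nat set list => nat set list" where
  "cols_of n Xs As = map (%p. {Xs ! l | l. l < length Xs \<and> p \<in> As ! l}) [0..<n]"

lemma bij_betw_cols_of:
  assumes "distinct Xs"
  shows "bij_betw (cols_of n Xs) (tuples n (length Xs)) {Cl. length Cl = n \<and> set Cl \<subseteq> Pow (set Xs)}"
proof (rule bij_betw_byWitness[where f' = "%Cl. map (%l. {p. p < n \<and> Xs ! l \<in> Cl ! p}) [0..<length Xs]"])
  have inj: "Xs ! l = Xs ! l' \<longleftrightarrow> l = l'" if "l < length Xs" "l' < length Xs" for l l'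
    using assms that by (simp add: nth_eq_iff_index_eq)
  show "\<forall>As\<in>tuples n (length Xs). map (%l. {p. p < n \<and> Xs ! l \<in> cols_of n Xs As ! p}) [0..<length Xs] = As"
  proof
    fix As assume A: "As \<in> tuples n (length Xs)"
    then have sub: "As ! l \<subseteq> {..<n}" if "l < length Xs" for l
    proof -
      have "As ! l \<in> set As" using that A by (auto simp: tuples_def)
      then show ?thesis using A by (auto simp: tuples_def)
    qed
    show "map (%l. {p. p < n \<and> Xs ! l \<in> cols_of n Xs As ! p}) [0..<length Xs] = As"
    proof (rule nth_equalityI)
      fix l assume "l < length (map (%l. {p. p < n \<and> Xs ! l \<in> cols_of n Xs As ! p}) [0..<length Xs])"
      then have l: "l < length Xs" by simp
      have "p < n \<and> Xs ! l \<in> cols_of n Xs As ! p \<longleftrightarrow> p \<in> As ! l" for p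
      proof
        assume "p \<in> As ! l"
        then have "p < n" using sub[OF l] by auto
        then show "p < n \<and> Xs ! l \<in> cols_of n Xs As ! p" using l \<open>p \<in> As ! l\<close> by (auto simp: cols_of_def)
      qed (use l in \<open>auto simp: cols_of_def inj\<close>)
      then show "map (%l. {p. p < n \<and> Xs ! l \<in> cols_of n Xs As ! p}) [0..<length Xs] ! l = As ! l"
        using l by simp
    qed (use A in \<open>simp add: tuples_def\<close>)
  qed
  show "\<forall>Cl\<in>{Cl. length Cl = n \<and> set Cl \<subseteq> Pow (set Xs)}.
      cols_of n Xs (map (%l. {p. p < n \<and> Xs ! l \<in> Cl ! p}) [0..<length Xs]) = Cl"
  proof
    fix Cl assume C: "Cl \<in> {Cl. length Cl = n \<and> set Cl \<subseteq> Pow (set Xs)}"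
    show "cols_of n Xs (map (%l. {p. p < n \<and> Xs ! l \<in> Cl ! p}) [0..<length Xs]) = Cl"
    proof (rule nth_equalityI)
      fix p assume "p < length (cols_of n Xs (map (%l. {p. p < n \<and> Xs ! l \<in> Cl ! p}) [0..<length Xs]))"
      then have p: "p < n" by (simp add: cols_of_def)
      then have "Cl ! p \<in> set Cl" using C by auto
      then have "Cl ! p \<subseteq> set Xs" using C by blast
      then have "{Xs ! l | l. l < length Xs \<and> Xs ! l \<in> Cl ! p} = Cl ! p"
        by (auto simp: in_set_conv_nth subset_iff)
      moreover have "cols_of n Xs (map (%l. {p. p < n \<and> Xs ! l \<in> Cl ! p}) [0..<length Xs]) ! p
         = {Xs ! l | l. l < length Xs \<and> Xs ! l \<in> Cl ! p}"
        using p by (auto simp: cols_of_def)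
      ultimately show "cols_of n Xs (map (%l. {p. p < n \<and> Xs ! l \<in> Cl ! p}) [0..<length Xs]) ! p = Cl ! p" by simp
    qed (use C in \<open>simp add: cols_of_def\<close>)
  qed
qed (auto simp: cols_of_def tuples_def)

lemma choices_count:
  assumes "distinct Xs"
  shows "length (filter P (choices (map set (subseqs Xs)) n)) = card {As \<in> tuples n (length Xs). P (cols_of n Xs As)}"
proof -
  let ?C = "choices (map set (subseqs Xs)) n"
  have d: "distinct ?C" using distinct_choices[OF distinct_set_subseqs[OF assms]] .
  have st: "set ?C = cols_of n Xs ` tuples n (length Xs)"
    using bij_betw_imp_surj_on[OF bij_betw_cols_of[OF assms, of n]] by (simp add: set_choices subseqs_powset)
  have "length (filter P ?C) = card {Cl \<in> set ?C. P Cl}"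
    using d by (metis distinct_card distinct_filter set_filter)
  also have "\<dots> = card {As \<in> tuples n (length Xs). P (cols_of n Xs As)}"
    unfolding st using bij_betw_imp_inj_on[OF bij_betw_cols_of[OF assms, of n]]
    by (subst image_filter[symmetric], intro card_image) (auto simp: inj_on_def)
  finally show ?thesis .
qed

fun atomic :: "ifm => bool" where
  "atomic (INeg f) = False" | "atomic (ICnt md Xs fs gs) = False" | "atomic _ = True"

text \<open>\<open>bstate\<close> evaluates an atom: not started, decided, or running formula number
  \<open>t\<close> with the flags of the addition automaton. \<open>xstate\<close> drives an
  expansion: not started, copying the input, or following the branch of one subformula with its
  expected answer.\<close>

type_synonym flags = "bool \<times> bool \<times> bool \<times> bool"
type_synonym bstate = "(bool + nat \<times> flags) option"
type_synonym xstate = "(nat \<times> bool) option option"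

text \<open>Words over \<open>{..<S}\<close> encode a word over \<open>{..<s}\<close> with an assignment to \<open>v\<close> set variables;
  each letter moreover carries the index of a formula of the list \<open>\<Phi>\<close>, of which only the first
  one counts.  The language of level \<open>j\<close> is correct for atoms and for the first \<open>j\<close> formulas of \<open>\<Phi>\<close>;
  the machine of the next level expands only the formula number \<open>j\<close> and otherwise passes its input
  on to the oracle.\<close>

locale ifm_chain =
  fixes Md :: "mode set" and md0 :: mode and \<Phi> :: "ifm list" and v s S :: nat
    and e :: "nat \<times> nat \<times> nat set => nat" and lev :: "nat => (nat \<times> lang) set"
  assumes e: "bij_betw e ({..<length \<Phi>} \<times> {..<s} \<times> Pow {..<v}) {..<S}"
    and clos: "closed_list \<Phi>" and iwf: "\<And>f. f \<in> set \<Phi> ==> iwf Md f" and ibnd: "\<And>f. f \<in> set \<Phi> ==> ibnd v f"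
    and md0: "md0 \<in> Md" and md: "\<And>md. md \<in> Md ==> mode_accepts md 1 0 \<and> \<not> mode_accepts md 0 1"
    and lev0: "(1, {}) \<in> lev 0" and lev: "\<And>p k md. p \<in> lev k ==> md \<in> Md ==> lin_class md {p} \<subseteq> lev (Suc k)"
begin

abbreviation "\<Gamma> \<equiv> {..<length \<Phi>} \<times> {..<s} \<times> Pow {..<v}"

definition "dc z = the_inv_into \<Gamma> e z"
definition "tg z = fst (dc z)"
definition "lt z = fst (snd (dc z))"
definition "bt z = snd (snd (dc z))"
definition "so z X = {i. i < length z \<and> X \<in> bt (z ! i)}"

definition U :: "nat => nat list set" where
  "U j = {z \<in> lists {..<S}. z \<noteq> [] \<and> (atomic (\<Phi> ! tg (hd z)) \<or> tg (hd z) < j) \<and>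
     isat (map lt z) (so z) (\<Phi> ! tg (hd z))}"

lemma dec_in: "z < S ==> tg z < length \<Phi> \<and> lt z < s \<and> bt z \<subseteq> {..<v}"
proof -
  assume "z < S"
  then have "dc z \<in> \<Gamma>" using e unfolding dc_def bij_betw_def by (intro the_inv_into_into) auto
  then show ?thesis by (auto simp: tg_def lt_def bt_def)
qed

lemma enc: "x \<in> \<Gamma> ==> dc (e x) = x \<and> e x < S"
  using e by (auto simp: bij_betw_def dc_def intro: the_inv_into_f_f)

fun bnext :: "nat => flags => nat => bool => bstate \<times> int" where
  "bnext t l z zero = (case \<Phi> ! t of
     IFst v' D d => ((case D (lt z) {X. X < v' \<and> X \<in> bt z} of Some b => Some (Inl b) | None => Some (Inr (t, l))), 0)
   | IPl X Y Z => (let r = plus_next l zero (X \<in> bt z) (Y \<in> bt z) (Z \<in> bt z) in (Some (Inr (t, fst r)), snd r))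
   | _ => (Some (Inr (t, l)), 0))"

fun bstep :: "bstate => nat => bool => (bstate \<times> nat \<times> int) list" where
  "bstep None z zero = [let r = bnext (tg z) (False, False, False, False) z zero in (fst r, 0, snd r)]"
| "bstep (Some (Inl b)) z zero = [(Some (Inl b), 0, 0)]"
| "bstep (Some (Inr (t, l))) z zero = [let r = bnext t l z zero in (fst r, 0, snd r)]"

fun bacc :: "bstate => bool => bool => bool" where
  "bacc None zero an = False"
| "bacc (Some (Inl b)) zero an = b"
| "bacc (Some (Inr (t, l))) zero an = (case \<Phi> ! t of IFst v' D d => d | IPl X Y Z => \<not> snd (snd (snd l)) \<and> zero | _ => False)"

definition bsem :: "nat => flags => nat => nat list => bool" where
  "bsem t l c x = (case \<Phi> ! t of
     IFst v' D d => first_dec (%z. D (lt z) {X. X < v' \<and> X \<in> bt z}) d x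
   | IPl X Y Z => plus_run l c (map (%z. (X \<in> bt z, Y \<in> bt z, Z \<in> bt z)) x)
   | _ => False)"

lemma bacc_lift: "map (%(r, d, y). bacc r (d = 0) (y \<in> Or)) (map (%(r, d, y). (r, d, b # y)) rs)
     = map (%(r, d, y). bacc r (d = 0) (y \<in> {y. b # y \<in> Or})) rs"
  by (simp add: case_prod_unfold comp_def)

lemma bruns_decided:
  "map (%(r, d, y). bacc r (d = 0) (y \<in> Or)) (runs bstep (Some (Inl b)) c x) = [b]"
proof (induction x arbitrary: Or)
  case (Cons a x)
  then show ?case using Cons.IH[of "{y. 0 # y \<in> Or}"] by (simp add: bacc_lift del: mem_Collect_eq map_map)
qed simp

lemma bruns:
  "map (%(r, d, y). bacc r (d = 0) (y \<in> Or)) (runs bstep (Some (Inr (t, l))) c x) = [bsem t l c x]"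
proof (induction x arbitrary: Or l c)
  case Nil
  then show ?case by (cases l) (simp add: bsem_def split: ifm.split)
next
  case (Cons z x)
  note lift = bacc_lift
  show ?case
  proof (cases "\<Phi> ! t")
    case (IFst v' D d)
    then show ?thesis using Cons.IH[of "{y. 0 # y \<in> Or}" l c] bruns_decided[of "{y. 0 # y \<in> Or}"]
      by (simp add: bsem_def lift del: mem_Collect_eq map_map split: option.split)
  next
    case (IPl X Y Z)
    obtain f1 f2 f3 f4 where l: "l = (f1, f2, f3, f4)" by (cases l)
    define r where "r = plus_next l (c = 0) (X \<in> bt z) (Y \<in> bt z) (Z \<in> bt z)"
    show ?thesis using Cons.IH[of "{y. 0 # y \<in> Or}" "fst r" "nat (int c + snd r)"] IPl
      by (simp add: bsem_def lift Let_def r_def l del: mem_Collect_eq map_map)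
  next
    case INeg
    then show ?thesis using Cons.IH[of "{y. 0 # y \<in> Or}" l c]
      by (simp add: bsem_def lift del: mem_Collect_eq map_map)
  next
    case ICnt
    then show ?thesis using Cons.IH[of "{y. 0 # y \<in> Or}" l c]
      by (simp add: bsem_def lift del: mem_Collect_eq map_map)
  qed
qed

lemma first_dec_map: "first_dec D d (map f xs) = first_dec (%x. D (f x)) d xs"
  by (induction xs) (auto split: option.split)

lemma bsem_isat:
  assumes "atomic (\<Phi> ! t)"
  shows "bsem t (False, False, False, False) 0 z \<longleftrightarrow> isat (map lt z) (so z) (\<Phi> ! t)"
proof -
  have z: "z = map ((!) z) [0..<length z]" by (simp add: map_nth)
  show ?thesis
  proof (cases "\<Phi> ! t")
    case (IFst v' D d)
    have "first_dec (%z. D (lt z) {X. X < v' \<and> X \<in> bt z}) d z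
       = first_dec (%p. D (lt (z ! p)) {X. X < v' \<and> X \<in> bt (z ! p)}) d [0..<length z]"
      by (subst z, simp only: first_dec_map)
    then show ?thesis using IFst by (auto simp: bsem_def so_def intro!: first_dec_cong)
  next
    case (IPl X Y Z)
    have "map (%z. (X \<in> bt z, Y \<in> bt z, Z \<in> bt z)) z = map (%p. (p \<in> so z X, p \<in> so z Y, p \<in> so z Z)) [0..<length z]"
      by (subst z, simp only: map_map) (simp add: so_def)
    then show ?thesis using IPl by (simp add: bsem_def)
  qed (use assms in auto)
qed

lemma filter_as_map: "length (filter P xs) = length (filter id (map P xs))"
  by (simp add: filter_map comp_def)

lemma base_level: "(S, U 0) \<in> lev 1"
proof -
  let ?Q = "insert None (Some ` (range Inl \<union> Inr ` ({..<length \<Phi>} \<times> UNIV))) :: bstate set"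
  have "(S, U 0) \<in> lin_class md0 {(1, {})}"
  proof (rule onepass_lin_class[of ?Q None S bstep 1 _ 1 "{}" _ _ bacc])
    fix p z b r assume p: "p \<in> ?Q" and z: "z < S" and r: "r \<in> set (bstep p z b)"
    have "snd (plus_next l b x y w) \<in> {-1, 0, 1}" for l x y w
      by (auto simp: plus_next_def Let_def split: prod.split)
    then have bn: "fst (bnext t l z b) \<in> ?Q \<and> snd (bnext t l z b) \<in> {-1, 0, 1}" if "t < length \<Phi>" for t l
      using that by (auto simp: Let_def split: ifm.split option.split)
    consider "p = None" | b' where "p = Some (Inl b')" | t l where "p = Some (Inr (t, l))" "t < length \<Phi>"
      using p by auto
    then show "fst r \<in> ?Q \<and> fst (snd r) < 1 \<and> snd (snd r) \<in> {-1, 0, 1}"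
    proof cases
      case 1
      then show ?thesis using r bn[of "tg z" "(False, False, False, False)"] dec_in[OF z] by (simp add: Let_def del: bnext.simps)
    next
      case (2 b')
      then show ?thesis using r by simp
    next
      case (3 t l)
      then show ?thesis using r bn[of t l] by (simp add: Let_def del: bnext.simps)
    qed
  next
    fix p z b assume "p \<in> ?Q" then show "bstep p z b \<noteq> []" by (cases "(p, z, b)" rule: bstep.cases) auto
  next
    fix z assume z: "z \<in> lists {..<S}"
    have m: "map (%(r, d, y). bacc r (d = 0) (y \<in> {})) (runs bstep None 0 z) = [z \<in> U 0]"
    proof (cases z)
      case Nil
      then show ?thesis by (simp add: U_def)
    next
      case (Cons a x)
      have "runs bstep None 0 z = runs bstep (Some (Inr (tg a, (False, False, False, False)))) 0 z"
        unfolding Cons by simp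
      then have "map (%(r, d, y). bacc r (d = 0) (y \<in> {})) (runs bstep None 0 z) = [bsem (tg a) (False, False, False, False) 0 z]"
        by (simp only: bruns)
      moreover have "bsem (tg a) (False, False, False, False) 0 z \<longleftrightarrow> z \<in> U 0"
      proof (cases "atomic (\<Phi> ! tg a)")
        case True
        then show ?thesis using bsem_isat[OF True] z Cons by (simp add: U_def)
      next
        case False
        then show ?thesis using Cons by (cases "\<Phi> ! tg a") (auto simp: U_def bsem_def)
      qed
      ultimately show ?thesis by simp
    qed
    have n: "map (%(r, d, y). \<not> bacc r (d = 0) (y \<in> {})) (runs bstep None 0 z) = [z \<notin> U 0]"
      using arg_cong[OF m, of "map Not"] by (simp add: case_prod_unfold comp_def)
    show "z \<in> U 0 \<longleftrightarrow> mode_accepts md0 (length (filter (%(r, d, y). bacc r (d = 0) (y \<in> {})) (runs bstep None 0 z)))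
       (length (filter (%(r, d, y). \<not> bacc r (d = 0) (y \<in> {})) (runs bstep None 0 z)))"
      unfolding filter_as_map[of _ "runs bstep None 0 z"] m n using md[OF md0] by simp
  qed (auto simp: U_def)
  then show ?thesis using lev[OF lev0 md0] by auto
qed

end

context ifm_chain
begin

definition XV :: "nat => nat list" where
  "XV j = (case \<Phi> ! j of ICnt md Xs fs gs => Xs | _ => [])"

definition ix :: "nat => ifm => nat" where
  "ix j g = (SOME i. i < j \<and> \<Phi> ! i = g)"

text \<open>The branches of the machine: the index of the formula to be evaluated, and the answer of
  the oracle on which the branch accepts.\<close>

definition G :: "nat => (nat \<times> bool) list" where
  "G j = (case \<Phi> ! j of INeg g => [(ix j g, False)]
     | ICnt md Xs fs gs => map (%f. (ix j f, True)) fs @ (if md = PPm then map (%f. (ix j f, False)) gs else [])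
     | _ => [])"

definition Cs :: "nat => nat set list" where
  "Cs j = map set (subseqs (XV j))"

text \<open>The columns of the quantified variables are overwritten and the index is replaced by
  \<open>t\<close>, so the query encodes the same input with the guessed assignment and a smaller
  formula.\<close>

definition out :: "nat => nat => nat => nat set => nat" where
  "out j t z C = e (t, lt z, (bt z - set (XV j)) \<union> C)"

fun xstep :: "nat => xstate => nat => bool => (xstate \<times> nat \<times> int) list" where
  "xstep j None z zero = (if tg z = j \<and> \<not> atomic (\<Phi> ! j)
     then concat (map (%(t, sg). map (%C. (Some (Some (t, sg)), out j t z C, 0)) (Cs j)) (G j))
     else [(Some None, z, 0)])"
| "xstep j (Some None) z zero = [(Some None, z, 0)]"
| "xstep j (Some (Some (t, sg))) z zero = map (%C. (Some (Some (t, sg)), out j t z C, 0)) (Cs j)"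

fun xacc :: "xstate => bool => bool => bool" where
  "xacc None zero an = False"
| "xacc (Some None) zero an = an"
| "xacc (Some (Some (t, sg))) zero an = (an = sg)"

lemma xruns_copy: "runs (xstep j) (Some None) 0 x = [(Some None, 0, x)]"
  by (induction x) auto

lemma xruns_exp:
  "runs (xstep j) (Some (Some (t, sg))) 0 x
     = map (%Cl. (Some (Some (t, sg)), 0, map2 (out j t) x Cl)) (choices (Cs j) (length x))"
  by (induction x) (simp_all add: map_concat comp_def)

lemma xruns_start:
  assumes "tg z = j" "\<not> atomic (\<Phi> ! j)"
  shows "runs (xstep j) None 0 (z # x)
     = concat (map (%(t, sg). map (%Cl. (Some (Some (t, sg)), 0, map2 (out j t) (z # x) Cl)) (choices (Cs j) (length (z # x)))) (G j))"
proof -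
  have "concat (map f (concat (map (%(t, sg). map (%C. (h t sg, k t C, 0)) Ds) ts)))
     = concat (map (%(t, sg). concat (map f (map (%C. (h t sg, k t C, 0)) Ds))) ts)"
    for f :: "_ => 'x list" and h k Ds and ts :: "(nat \<times> bool) list"
    by (induction ts) auto
  then have "runs (xstep j) None 0 (z # x) = concat (map (%(t, sg). runs (xstep j) (Some (Some (t, sg))) 0 (z # x)) (G j))"
    using assms by (simp only: runs.simps xstep.simps simp_thms if_True)
  then show ?thesis by (simp only: xruns_exp)
qed

lemma nth_props: "j < length \<Phi> ==> iwf Md (\<Phi> ! j) \<and> ibnd v (\<Phi> ! j)"
  using iwf ibnd by simp

lemma XV_props: assumes "j < length \<Phi>" shows "distinct (XV j)" "set (XV j) \<subseteq> {..<v}"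
  using nth_props[OF assms] by (cases "\<Phi> ! j"; auto simp: XV_def)+

lemma ix_props: "j < length \<Phi> ==> g \<in> kids (\<Phi> ! j) ==> ix j g < j \<and> \<Phi> ! ix j g = g"
  unfolding ix_def by (rule someI_ex) (use clos in \<open>auto simp: closed_list_def\<close>)

lemma G_less: "j < length \<Phi> ==> (t, sg) \<in> set (G j) ==> t < j"
  using ix_props[of j] by (auto simp: G_def split: ifm.splits if_splits)

lemma G_ne: "j < length \<Phi> ==> \<not> atomic (\<Phi> ! j) ==> G j \<noteq> []"
  using nth_props[of j] by (cases "\<Phi> ! j") (auto simp: G_def)

lemma Cs_props: "Cs j \<noteq> []" "C \<in> set (Cs j) ==> C \<subseteq> set (XV j)"
  using subseqs_powset[of "XV j"] by (auto simp: Cs_def)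

text \<open>Reading the query back gives the original letters and, below \<open>v\<close>, the
  updated assignment; its index \<open>t < j\<close> lies in the range where \<open>U j\<close> is
  correct.\<close>

lemma out_word:
  assumes z: "z \<in> lists {..<S}" "z \<noteq> []" and j: "j < length \<Phi>" and t: "t < j"
    and As: "As \<in> tuples (length z) (length (XV j))"
  shows "map2 (out j t) z (cols_of (length z) (XV j) As) \<in> U j
     \<longleftrightarrow> isat (map lt z) (upds (so z) (XV j) As) (\<Phi> ! t)"
proof -
  let ?C = "cols_of (length z) (XV j) As"
  let ?y = "map2 (out j t) z ?C"
  have len: "length ?C = length z" "length ?y = length z" by (simp_all add: cols_of_def)
  have C: "?C ! i \<subseteq> set (XV j)" if "i < length z" for i using that by (auto simp: cols_of_def)
  have d: "dc (?y ! i) = (t, lt (z ! i), (bt (z ! i) - set (XV j)) \<union> ?C ! i) \<and> ?y ! i < S" if i: "i < length z" for i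
  proof -
    have zi: "z ! i < S" using z(1) i by (auto simp: in_lists_conv_set)
    have "(t, lt (z ! i), (bt (z ! i) - set (XV j)) \<union> ?C ! i) \<in> \<Gamma>"
      using dec_in[OF zi] C[OF i] XV_props[OF j] t j by auto
    from enc[OF this] show ?thesis using i len by (simp add: out_def)
  qed
  have y0: "hd ?y = ?y ! 0" using z(2) len by (intro hd_conv_nth) (metis length_0_conv)
  have "?y \<in> lists {..<S}" using d len by (auto simp: in_lists_conv_set in_set_conv_nth simp del: length_map)
  moreover have "?y \<noteq> []" using z(2) len by (metis length_0_conv)
  moreover have "tg (hd ?y) = t" unfolding y0 using d[of 0] z(2) by (simp add: tg_def)
  moreover have "map lt ?y = map lt z"
  proof (rule nth_equalityI)
    fix i assume "i < length (map lt ?y)"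
    then have i: "i < length z" using len by (simp only: length_map)
    then show "map lt ?y ! i = map lt z ! i" using d[OF i] len by (simp only: nth_map lt_def fst_conv snd_conv)
  qed (use len in \<open>simp only: length_map\<close>)
  moreover have "isat (map lt z) (so ?y) (\<Phi> ! t) \<longleftrightarrow> isat (map lt z) (upds (so z) (XV j) As) (\<Phi> ! t)"
  proof (rule isat_cong)
    show "ibnd v (\<Phi> ! t)" using nth_props t j by simp
    show "\<forall>X<v. \<forall>p<length (map lt z). p \<in> so ?y X \<longleftrightarrow> p \<in> upds (so z) (XV j) As X"
    proof (intro allI impI)
      fix X p assume "p < length (map lt z)"
      then have p: "p < length z" by simp
      have y: "p \<in> so ?y X \<longleftrightarrow> X \<in> bt (z ! p) \<and> X \<notin> set (XV j) \<or> X \<in> ?C ! p"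
        using d[OF p] p len by (simp only: so_def bt_def mem_Collect_eq fst_conv snd_conv) auto
      show "p \<in> so ?y X \<longleftrightarrow> p \<in> upds (so z) (XV j) As X"
      proof (cases "X \<in> set (XV j)")
        case True
        then obtain l where l: "l < length (XV j)" "X = XV j ! l" by (auto simp: in_set_conv_nth)
        have "upds (so z) (XV j) As X = As ! l"
          unfolding l(2) using As l(1) XV_props[OF j] by (intro upds_nth) (auto simp: tuples_def)
        moreover have "X \<in> ?C ! p \<longleftrightarrow> p \<in> As ! l"
          using p l XV_props(1)[OF j] by (auto simp: cols_of_def nth_eq_iff_index_eq)
        ultimately show ?thesis using y True by simp
      next
        case False
        then have "X \<notin> ?C ! p" using C[OF p] by blast
        then show ?thesis using y False p by (simp add: upds_notin so_def)
      qed
    qed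
  qed
  ultimately show ?thesis using t by (simp add: U_def)
qed

definition cnt :: "nat => nat list => ifm => bool => nat" where
  "cnt j z f b = card {As \<in> tuples (length z) (length (XV j)). isat (map lt z) (upds (so z) (XV j) As) f = b}"

lemma exp_counts:
  assumes z: "z # x \<in> lists {..<S}" and j: "j < length \<Phi>" "tg z = j" "\<not> atomic (\<Phi> ! j)"
  shows "length (filter (%(r, d, y). xacc r (d = 0) (y \<in> U j)) (runs (xstep j) None 0 (z # x)))
      = sum_list (map (%(t, sg). cnt j (z # x) (\<Phi> ! t) sg) (G j))"
    "length (filter (%(r, d, y). \<not> xacc r (d = 0) (y \<in> U j)) (runs (xstep j) None 0 (z # x)))
      = sum_list (map (%(t, sg). cnt j (z # x) (\<Phi> ! t) (\<not> sg)) (G j))"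
proof -
  have *: "length (filter (%Cl. (map2 (out j t) (z # x) Cl \<in> U j) = b) (choices (Cs j) (length (z # x)))) = cnt j (z # x) (\<Phi> ! t) b"
    if "(t, sg) \<in> set (G j)" for t sg b
    unfolding Cs_def choices_count[OF XV_props(1)[OF j(1)]] cnt_def
    using out_word[OF z _ j(1) G_less[OF j(1) that]]
    by (intro arg_cong[where f = card] Collect_cong conj_cong refl) (simp del: list.map zip_Cons_Cons)
  have 1: "length (filter P (concat (map (%(t, sg). map (h t sg) D) g))) = sum_list (map (%(t, sg). length (filter (%C. P (h t sg C)) D)) g)"
    for P h and D :: "'x list" and g :: "(nat \<times> bool) list"
    by (induction g) (auto simp: filter_map comp_def)
  show "length (filter (%(r, d, y). xacc r (d = 0) (y \<in> U j)) (runs (xstep j) None 0 (z # x)))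
      = sum_list (map (%(t, sg). cnt j (z # x) (\<Phi> ! t) sg) (G j))"
    unfolding xruns_start[OF j(2,3)] 1
    by (intro arg_cong[where f = sum_list] map_cong refl) (use * in \<open>auto simp del: list.map zip_Cons_Cons choices.simps list.size\<close>)
  show "length (filter (%(r, d, y). \<not> xacc r (d = 0) (y \<in> U j)) (runs (xstep j) None 0 (z # x)))
      = sum_list (map (%(t, sg). cnt j (z # x) (\<Phi> ! t) (\<not> sg)) (G j))"
    unfolding xruns_start[OF j(2,3)] 1
  proof (intro arg_cong[where f = sum_list] map_cong refl)
    fix r assume r: "r \<in> set (G j)"
    obtain t sg where ts: "r = (t, sg)" by (cases r)
    show "(case r of (t, sg) => length (filter (%C. case (Some (Some (t, sg)), 0::nat, map2 (out j t) (z # x) C) of (r, d, y) => \<not> xacc r (d = 0) (y \<in> U j)) (choices (Cs j) (length (z # x)))))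
       = (case r of (t, sg) => cnt j (z # x) (\<Phi> ! t) (\<not> sg))"
      using *[of t sg "\<not> sg"] r unfolding ts prod.case xacc.simps by (simp del: list.map zip_Cons_Cons choices.simps list.size)
  qed
qed

definition mdj :: "nat => mode" where
  "mdj j = (case \<Phi> ! j of ICnt md Xs fs gs => md | _ => md0)"

lemma mdj_Md: "j < length \<Phi> ==> mdj j \<in> Md"
  using nth_props[of j] md0 by (auto simp: mdj_def split: ifm.split)

lemma exp_accepts:
  assumes j: "j < length \<Phi>" "\<not> atomic (\<Phi> ! j)"
  shows "mode_accepts (mdj j) (sum_list (map (%(t, sg). cnt j z (\<Phi> ! t) sg) (G j)))
      (sum_list (map (%(t, sg). cnt j z (\<Phi> ! t) (\<not> sg)) (G j)))
    \<longleftrightarrow> isat (map lt z) (so z) (\<Phi> ! j)"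
proof (cases "\<Phi> ! j")
  case (INeg g)
  \<comment> \<open>A negation is a count over no variables: one empty tuple, with the expected
    answer reversed.\<close>
  have "tuples n 0 = {[]}" for n by (auto simp: tuples_def)
  then have "cnt j z g b = (if isat (map lt z) (so z) g = b then 1 else 0)" for b
    using INeg by (auto simp: cnt_def XV_def upds_def)
  then show ?thesis using INeg md[OF md0] ix_props[OF j(1), of g] by (simp add: G_def mdj_def)
next
  case (ICnt m Xs fs gs)
  have ix: "f \<in> set fs \<union> set gs ==> \<Phi> ! ix j f = f" for f using ix_props[OF j(1), of f] ICnt by simp
  have mj: "mdj j = m" by (simp add: mdj_def ICnt)
  have s: "sum_list (map (%(t, sg). cnt j z (\<Phi> ! t) sg) (map (%f. (ix j f, b)) fs)) = sum_list (map (%f. cnt j z f b) fs)"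
    "sum_list (map (%(t, sg). cnt j z (\<Phi> ! t) (\<not> sg)) (map (%f. (ix j f, b)) fs)) = sum_list (map (%f. cnt j z f (\<not> b)) fs)"
    "sum_list (map (%(t, sg). cnt j z (\<Phi> ! t) sg) (map (%f. (ix j f, b)) gs)) = sum_list (map (%f. cnt j z f b) gs)"
    "sum_list (map (%(t, sg). cnt j z (\<Phi> ! t) (\<not> sg)) (map (%f. (ix j f, b)) gs)) = sum_list (map (%f. cnt j z f (\<not> b)) gs)" for b
    unfolding map_map by (auto intro!: arg_cong[where f = sum_list] map_cong simp: ix)
  have sem: "isat (map lt z) (so z) (\<Phi> ! j) \<longleftrightarrow> mode_accepts m (sum_list (map (%f. cnt j z f True) fs)) (sum_list (map (%f. cnt j z f True) gs))"
    unfolding ICnt by (simp add: cnt_def XV_def ICnt)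
  show ?thesis
  proof (cases "m = PPm")
    case False
    then show ?thesis unfolding sem mj using s(1)[of True] by (cases m) (simp_all add: G_def ICnt)
  next
    case True
    \<comment> \<open>Every branch has \<open>?T\<close> paths. With equally many branches on both
      sides, accepting minus rejecting paths is twice the difference of the two sums.\<close>
    let ?T = "card (tuples (length z) (length (XV j)))"
    have T: "cnt j z f True + cnt j z f False = ?T" for f
    proof -
      have "{As \<in> tuples (length z) (length (XV j)). isat (map lt z) (upds (so z) (XV j) As) f = True}
        \<union> {As \<in> tuples (length z) (length (XV j)). isat (map lt z) (upds (so z) (XV j) As) f = False} = tuples (length z) (length (XV j))" by auto
      then show ?thesis unfolding cnt_def using finite_tuples
        by (subst card_Un_disjoint[symmetric]) auto
    qed
    have Tl: "sum_list (map (%f. cnt j z f True) hs) + sum_list (map (%f. cnt j z f False) hs) = length hs * ?T" for hs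
    proof (induction hs)
      case (Cons h hs)
      then show ?case using T[of h] by simp
    qed simp
    have "length fs = length gs" using nth_props[OF j(1)] ICnt True by simp
    then show ?thesis unfolding sem mj using Tl[of fs] Tl[of gs] s True by (simp add: G_def ICnt) linarith
  qed
qed (use j in auto)

lemma step_level:
  assumes j: "j < length \<Phi>" and k: "(S, U j) \<in> lev k"
  shows "(S, U (Suc j)) \<in> lev (Suc k)"
proof -
  let ?Q = "insert None (insert (Some None) ((%r. Some (Some r)) ` ({..<j} \<times> UNIV))) :: xstate set"
  have out_less: "out j t z C < S" if "z < S" "t < j" "C \<in> set (Cs j)" for t z C
    using enc[of "(t, lt z, (bt z - set (XV j)) \<union> C)"] dec_in[OF that(1)] that j XV_props[OF j] Cs_props(2)[OF that(3)]
    by (auto simp: out_def)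
  have "(S, U (Suc j)) \<in> lin_class (mdj j) {(S, U j)}"
  proof (rule onepass_lin_class[of ?Q None S "xstep j" S _ S "U j" _ _ xacc])
    fix p z b r assume p: "p \<in> ?Q" and z: "z < S" and r: "r \<in> set (xstep j p z b)"
    consider "p = None" | "p = Some None" | t sg where "p = Some (Some (t, sg))" "t < j" using p by auto
    then show "fst r \<in> ?Q \<and> fst (snd r) < S \<and> snd (snd r) \<in> {-1, 0, 1}"
    proof cases
      case 1
      then show ?thesis using r z G_less[OF j] out_less[OF z] by (auto split: if_splits)
    next
      case 2
      then show ?thesis using r z by auto
    next
      case 3
      then show ?thesis using r z out_less[OF z] by auto
    qed
  next
    fix p z b assume p: "p \<in> ?Q"
    consider "p = None" | "p = Some None" | t sg where "p = Some (Some (t, sg))" using p by auto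
    then show "xstep j p z b \<noteq> []"
    proof cases
      case 1
      show ?thesis
      proof (cases "tg z = j \<and> \<not> atomic (\<Phi> ! j)")
        case True
        obtain t sg gs where "G j = (t, sg) # gs" using G_ne[OF j] True by (cases "G j") auto
        moreover obtain C cs where "Cs j = C # cs" using Cs_props(1)[of j] by (cases "Cs j") auto
        ultimately show ?thesis using True 1 by simp
      qed (use 1 in auto)
    qed (use Cs_props(1)[of j] in auto)
  next
    fix z assume z: "z \<in> lists {..<S}"
    show "z \<in> U (Suc j) \<longleftrightarrow> mode_accepts (mdj j) (length (filter (%(r, d, y). xacc r (d = 0) (y \<in> U j)) (runs (xstep j) None 0 z)))
       (length (filter (%(r, d, y). \<not> xacc r (d = 0) (y \<in> U j)) (runs (xstep j) None 0 z)))"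
    proof (cases z)
      case Nil
      then show ?thesis using md[OF mdj_Md[OF j]] by (simp add: U_def)
    next
      case (Cons a x)
      show ?thesis
      proof (cases "tg a = j \<and> \<not> atomic (\<Phi> ! j)")
        case True
        then show ?thesis unfolding Cons
          exp_counts[OF z[unfolded Cons] j True[THEN conjunct1] True[THEN conjunct2]] exp_accepts[OF j True[THEN conjunct2]]
          using z True Cons by (simp add: U_def)
      next
        case False
        have "runs (xstep j) None 0 z = [(Some None, 0, z)]" using False Cons by (auto simp: xruns_copy)
        moreover have "z \<in> U (Suc j) \<longleftrightarrow> z \<in> U j" using False Cons by (auto simp: U_def less_Suc_eq)
        ultimately show ?thesis using md[OF mdj_Md[OF j]] by simp
      qed
    qed
  qed (use k in \<open>auto simp: U_def\<close>)
  then show ?thesis using lev[OF k mdj_Md[OF j]] by blast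
qed

lemma all_levels: "j \<le> length \<Phi> ==> (S, U j) \<in> lev (Suc j)"
  by (induction j) (use base_level step_level in auto)

text \<open>One further deterministic level relabels the input: each letter receives the index
  \<open>t\<close> and the empty column, and the answer of the oracle is passed on.\<close>

lemma top_level:
  assumes "t < length \<Phi>"
  shows "(s, {w \<in> lists {..<s}. w \<noteq> [] \<and> isat w (%_. {}) (\<Phi> ! t)}) \<in> lev (Suc (Suc (length \<Phi>)))"
proof -
  let ?U = "U (length \<Phi>)"
  define h where "h a = e (t, a, {})" for a
  have h: "dc (h a) = (t, a, {}) \<and> h a < S" if "a < s" for a
    using enc[of "(t, a, {})"] assms that by (auto simp: h_def)
  let ?d = "%(_::unit) a (_::bool). [((), h a, 0::int)]"
  have runs: "runs ?d () 0 w = [((), 0, map h w)]" for w by (induction w) auto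
  have "(s, {w \<in> lists {..<s}. w \<noteq> [] \<and> isat w (%_. {}) (\<Phi> ! t)}) \<in> lin_class md0 {(S, ?U)}"
  proof (rule onepass_lin_class[of "{()}" "()" s ?d S _ S ?U _ _ "%_ _ an. an"])
    fix w assume w: "w \<in> lists {..<s}"
    have d: "dc (h (w ! i)) = (t, w ! i, {})" if "i < length w" for i using w that h by (auto simp: in_lists_conv_set)
    have "w \<noteq> [] ==> map h w \<in> ?U \<longleftrightarrow> isat w (%_. {}) (\<Phi> ! t)"
    proof -
      assume ne: "w \<noteq> []"
      have "map lt (map h w) = w" using d by (intro nth_equalityI) (auto simp: lt_def)
      moreover have "so (map h w) = (%_. {})" using d by (auto simp: so_def bt_def fun_eq_iff)
      moreover have "tg (hd (map h w)) = t" using ne d[of 0] by (simp add: hd_map hd_conv_nth tg_def)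
      moreover have "map h w \<in> lists {..<S}" using w h by auto
      ultimately show ?thesis using ne assms by (simp add: U_def del: map_map)
    qed
    moreover have "[] \<notin> ?U" by (simp add: U_def)
    ultimately show "w \<in> {w \<in> lists {..<s}. w \<noteq> [] \<and> isat w (%_. {}) (\<Phi> ! t)} \<longleftrightarrow>
       mode_accepts md0 (length (filter (%(r, d, y). y \<in> ?U) (runs ?d () 0 w)))
         (length (filter (%(r, d, y). y \<notin> ?U) (runs ?d () 0 w)))"
      unfolding runs using md[OF md0] w by (cases "w = []") auto
  qed (use h in auto)
  then show ?thesis using lev[OF all_levels[of "length \<Phi>"] md0] by auto
qed

end

theorem ifm_definable_in_level:
  assumes f: "iwf Md f" and md0: "md0 \<in> Md"
    and md: "\<And>md. md \<in> Md ==> mode_accepts md 1 0 \<and> \<not> mode_accepts md 0 1"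
    and lev0: "(1, {}) \<in> lev 0" and lev: "\<And>p k md. p \<in> lev k ==> md \<in> Md ==> lin_class md {p} \<subseteq> lev (Suc k)"
  shows "\<exists>k. (s, {w \<in> lists {..<s}. w \<noteq> [] \<and> isat w (%_. {}) f}) \<in> lev (Suc k)"
proof -
  obtain v where v: "ibnd v f" using ibnd_ex by blast
  let ?\<Gamma> = "{..<length (isubs f)} \<times> {..<s} \<times> Pow {..<v}"
  obtain e where "bij_betw e ?\<Gamma> {..<card ?\<Gamma>}"
    using ex_bij_betw_finite_nat[of ?\<Gamma>] by (auto simp: atLeast0LessThan)
  then interpret ifm_chain Md md0 "isubs f" v s "card ?\<Gamma>" e lev
    using assms v by unfold_locales (auto intro: closed_list_isubs isubs_iwf isubs_ibnd)
  obtain t where "t < length (isubs f)" "isubs f ! t = f" using self_in_isubs by (metis in_set_conv_nth)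
  then show ?thesis using top_level[of t] by (intro exI[of _ "Suc (length (isubs f))"]) simp
qed

subsection \<open>Translation of formulas into the monadic counting logic\<close>

definition in_range :: "nat list => (nat => nat set) => bool" where
  "in_range w so \<longleftrightarrow> w \<noteq> [] \<and> (\<forall>X. so X \<subseteq> {..<length w})"

lemma in_range_upd: "in_range w so ==> A \<subseteq> {..<length w} ==> in_range w (so(X := A))"
  by (auto simp: in_range_def)

lemma in_range_upds: "in_range w so ==> As \<in> tuples (length w) k ==> in_range w (upds so Xs As)"
proof (induction Xs As arbitrary: so k rule: list_induct2')
  case (4 X Xs A As)
  then have "As \<in> tuples (length w) (k - 1)" "A \<subseteq> {..<length w}" by (auto simp: tuples_def)
  then show ?case using 4 in_range_upd unfolding upds_Cons by blast
qed (auto simp: upds_def)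

lemma tuples_0: "tuples n 0 = {[]}"
  by (auto simp: tuples_def)

lemma tuples_Suc: "tuples n (Suc k) = (%(A, As). A # As) ` (Pow {..<n} \<times> tuples n k)"
proof (rule set_eqI)
  show "L \<in> tuples n (Suc k) \<longleftrightarrow> L \<in> (%(A, As). A # As) ` (Pow {..<n} \<times> tuples n k)" for L
    by (cases L) (simp_all add: tuples_def image_iff conj_ac)
qed

lemma upds_Nil: "upds so [] As = so" "upds so Xs [] = so"
  by (simp_all add: upds_def)

locale counting_modes =
  fixes Md :: "mode set"
  assumes ex_mode: "NPm \<in> Md \<or> PPm \<in> Md"
begin

text \<open>Relations are handled semantically: closure properties of \<open>rec\<close> replace a
  translation function on formulas, and agreement is asked only where all sets stay inside the
  universe.\<close>

definition rec :: "(nat list => (nat => nat set) => bool) => bool" where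
  "rec R \<longleftrightarrow> (\<exists>f. iwf Md f \<and> (\<forall>w so. in_range w so --> isat w so f = R w so))"

lemma recI: "iwf Md f ==> (\<And>w so. in_range w so ==> isat w so f = R w so) ==> rec R"
  unfolding rec_def by blast

lemma rec_cong: "rec R ==> (\<And>w so. in_range w so ==> R w so = R' w so) ==> rec R'"
  unfolding rec_def by metis

lemma rec_neg: "rec R ==> rec (%w so. \<not> R w so)"
  unfolding rec_def by (metis isat.simps(3) iwf.simps(1))

lemma rec_bot: "rec (%_ _. False)"
proof (rule recI[of "IFst 0 (%_ _. None) False"])
  have "\<not> first_dec (%_. None) False xs" for xs :: "'x list" by (induction xs) auto
  then show "isat w so (IFst 0 (%_ _. None) False) = False" for w so by simp
qed simp

definition count_sum :: "nat list => (nat => nat set) => nat list => (nat list => (nat => nat set) => bool) list => nat" where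
  "count_sum w so Xs Rs = sum_list (map (%R. card {As \<in> tuples (length w) (length Xs). R w (upds so Xs As)}) Rs)"

lemma count_sum_simps:
  "count_sum w so Xs [] = 0"
  "count_sum w so Xs (R # Rs) = card {As \<in> tuples (length w) (length Xs). R w (upds so Xs As)} + count_sum w so Xs Rs"
  "count_sum w so Xs (Rs @ Rs') = count_sum w so Xs Rs + count_sum w so Xs Rs'"
  "count_sum w so Xs (replicate m R) = m * card {As \<in> tuples (length w) (length Xs). R w (upds so Xs As)}"
  by (simp_all add: count_sum_def sum_list_replicate)

lemma rec_list: 
  assumes "\<forall>R\<in>set Rs. rec R"
  shows "\<exists>fs. length fs = length Rs \<and> (\<forall>f\<in>set fs. iwf Md f) \<and>
    (\<forall>w so Xs. in_range w so --> count_sum w so Xs Rs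
       = sum_list (map (%f. card {As \<in> tuples (length w) (length Xs). isat w (upds so Xs As) f}) fs))"
  using assms
proof (induction Rs)
  case (Cons R Rs)
  then obtain fs where fs: "length fs = length Rs" "\<forall>f\<in>set fs. iwf Md f"
    "\<forall>w so Xs. in_range w so --> count_sum w so Xs Rs
       = sum_list (map (%f. card {As \<in> tuples (length w) (length Xs). isat w (upds so Xs As) f}) fs)" by auto
  obtain f where f: "iwf Md f" "\<And>w so. in_range w so ==> isat w so f = R w so"
    using Cons.prems by (auto simp: rec_def)
  have "{As \<in> tuples (length w) (length Xs). R w (upds so Xs As)} = {As \<in> tuples (length w) (length Xs). isat w (upds so Xs As) f}"
    if "in_range w so" for w so Xs using f(2)[OF in_range_upds[OF that]] by auto
  then show ?case using f(1) fs by (intro exI[of _ "f # fs"]) (simp add: count_sum_simps)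
qed (simp add: count_sum_simps)

lemma rec_count:
  assumes "md \<in> Md" "distinct Xs" "Rs \<noteq> []" "md = PPm ==> length Rs = length Ss" "\<forall>R\<in>set Rs. rec R" "\<forall>R\<in>set Ss. rec R"
  shows "rec (%w so. mode_accepts md (count_sum w so Xs Rs) (count_sum w so Xs Ss))"
proof -
  obtain fs where fs: "length fs = length Rs" "\<forall>f\<in>set fs. iwf Md f"
    "\<forall>w so Xs. in_range w so --> count_sum w so Xs Rs
       = sum_list (map (%f. card {As \<in> tuples (length w) (length Xs). isat w (upds so Xs As) f}) fs)" 
    using rec_list[OF assms(5)] by blast
  obtain gs where gs: "length gs = length Ss" "\<forall>f\<in>set gs. iwf Md f"
    "\<forall>w so Xs. in_range w so --> count_sum w so Xs Ss
       = sum_list (map (%f. card {As \<in> tuples (length w) (length Xs). isat w (upds so Xs As) f}) gs)" 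
    using rec_list[OF assms(6)] by blast
  show ?thesis
  proof (rule recI[of "ICnt md Xs fs gs"])
    have "fs \<noteq> []" using assms(3) fs(1) by auto
    moreover have "md = PPm ==> length fs = length gs" using assms(4) fs(1) gs(1) by simp
    ultimately show "iwf Md (ICnt md Xs fs gs)" using assms(1,2) fs(2) gs(2) by simp
    show "isat w so (ICnt md Xs fs gs) = mode_accepts md (count_sum w so Xs Rs) (count_sum w so Xs Ss)"
      if "in_range w so" for w so using fs(3) gs(3) that by simp
  qed
qed

text \<open>Padding with unsatisfiable relations allows both modes to express that a count is positive,
  and the comparison of sums with different numbers of summands.\<close>

lemma rec_pos:
  assumes "distinct Xs" "\<forall>R\<in>set Rs. rec R"
  shows "rec (%w so. count_sum w so Xs Rs > 0)"
proof -
  let ?b = "%(_::nat list) (_::nat => nat set). False"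
  have z: "count_sum w so Xs (replicate m ?b) = 0" for w so m by (simp add: count_sum_simps)
  from ex_mode show ?thesis
  proof
    assume "NPm \<in> Md"
    from rec_count[OF this assms(1), of "?b # Rs" "[]"] show ?thesis
      using assms rec_bot by (simp add: count_sum_simps)
  next
    assume "PPm \<in> Md"
    from rec_count[OF this assms(1), of "?b # Rs" "replicate (Suc (length Rs)) ?b"] show ?thesis
      using assms rec_bot by (simp add: count_sum_simps z del: replicate.simps)
  qed
qed

lemma rec_less:
  assumes "PPm \<in> Md" "distinct Xs" "\<forall>R\<in>set Rs. rec R" "\<forall>R\<in>set Ss. rec R"
  shows "rec (%w so. count_sum w so Xs Ss < count_sum w so Xs Rs)"
proof -
  let ?b = "%(_::nat list) (_::nat => nat set). False"
  have "rec (%w so. mode_accepts PPm (count_sum w so Xs (?b # Rs @ replicate (length Ss) ?b)) (count_sum w so Xs (?b # Ss @ replicate (length Rs) ?b)))"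
    using assms rec_bot by (intro rec_count) auto
  then show ?thesis by (simp add: count_sum_simps)
qed

text \<open>Over no variables there is exactly one tuple, so the summands are truth values and a
  positive sum is a disjunction. This works for majority as well, where no Boolean closure of the
  oracles is at hand.\<close>

lemma rec_disj: assumes "rec R" "rec S" shows "rec (%w so. R w so \<or> S w so)"
proof -
  have "rec (%w so. count_sum w so [] [R, S] > 0)" using assms by (intro rec_pos) auto
  then show ?thesis by (rule rec_cong) (auto simp: count_sum_simps tuples_0 upds_Nil Collect_conv_if)
qed

lemma rec_exs:
  assumes "distinct Xs" "rec R"
  shows "rec (%w so. \<exists>As\<in>tuples (length w) (length Xs). R w (upds so Xs As))"
proof -
  have "rec (%w so. count_sum w so Xs [R] > 0)" using assms by (intro rec_pos) auto
  then show ?thesis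
    by (rule rec_cong) (auto simp: count_sum_simps card_gt_0_iff finite_tuples)
qed

lemma rec_top: "rec (%_ _. True)" using rec_neg[OF rec_bot] by simp

lemma rec_conj: "rec R ==> rec S ==> rec (%w so. R w so \<and> S w so)"
  using rec_neg[OF rec_disj[OF rec_neg rec_neg]] by simp

lemma rec_imp: "rec R ==> rec S ==> rec (%w so. R w so --> S w so)"
  using rec_disj[OF rec_neg] by simp

lemma rec_ball: "finite I ==> (\<And>i. i \<in> I ==> rec (R i)) ==> rec (%w so. \<forall>i\<in>I. R i w so)"
  by (induction I rule: finite_induct) (auto intro: rec_conj rec_top)

lemma rec_bex: "finite I ==> (\<And>i. i \<in> I ==> rec (R i)) ==> rec (%w so. \<exists>i\<in>I. R i w so)"
  by (induction I rule: finite_induct) (auto intro: rec_disj rec_bot)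

lemma rec_ex: assumes "rec R" shows "rec (%w so. \<exists>A\<subseteq>{..<length w}. R w (so(X := A)))"
proof (rule rec_cong[OF rec_exs[of "[X]" R]])
  show "(\<exists>As\<in>tuples (length w) (length [X]). R w (upds so [X] As)) = (\<exists>A\<subseteq>{..<length w}. R w (so(X := A)))" for w so
    by (auto simp: tuples_Suc tuples_0 upds_Cons upds_Nil)
qed (use assms in auto)

lemma rec_all: assumes "rec R" shows "rec (%w so. \<forall>A\<subseteq>{..<length w}. R w (so(X := A)))"
  using rec_neg[OF rec_ex[OF rec_neg[OF assms], of X]] by simp

lemma rec_fst: "rec (%w so. first_dec (%p. D (w ! p) {X. X < v \<and> p \<in> so X}) d [0..<length w])"
  by (rule recI[of "IFst v D d"]) auto

end

lemma first_dec_all: "\<forall>x\<in>set xs. D x = None \<or> D x = Some False ==> first_dec D True xs \<longleftrightarrow> (\<forall>x\<in>set xs. D x = None)"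
  by (induction xs) (auto split: option.split)

lemma first_dec_upt:
  assumes "p < n" "D p = Some b" "\<forall>q<p. D q = None"
  shows "first_dec D d [0..<n] = b"
proof -
  have s: "[0..<n] = [0..<p] @ p # [Suc p..<n]"
    using assms(1) upt_add_eq_append[of 0 p "n - p"] by (simp add: upt_conv_Cons)
  have "\<forall>x\<in>set xs. D x = None ==> first_dec D d (xs @ ys) = first_dec D d ys" for xs ys :: "nat list"
    by (induction xs) auto
  then show ?thesis unfolding s using assms by simp
qed

context counting_modes
begin

lemma rec_local:
  assumes "\<And>a f. P a f = P a (%X. X < v \<and> f X)"
  shows "rec (%w so. \<forall>p<length w. P (w ! p) (%X. p \<in> so X))"
proof (rule rec_cong[OF rec_fst[of "%a B. if P a (%X. X \<in> B) then None else Some False" v True]])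
  fix w and so :: "nat => nat set"
  have eq: "P (w ! p) (%X. X \<in> {X. X < v \<and> p \<in> so X}) = P (w ! p) (%X. p \<in> so X)" for p
    using assms[of "w ! p" "%X. p \<in> so X"] by simp
  show "first_dec (%p. if P (w ! p) (%X. X \<in> {X. X < v \<and> p \<in> so X}) then None else Some False) True [0..<length w]
     = (\<forall>p<length w. P (w ! p) (%X. p \<in> so X))"
    unfolding eq by (subst first_dec_all) auto
qed

lemma rec_eq: "rec (%w so. so X = so Y)"
  by (rule rec_cong[OF rec_local[of "%a f. f X = f Y" "Suc (max X Y)"]]) (auto simp: in_range_def less_Suc_eq_le)

lemma rec_subset: "rec (%w so. so X \<subseteq> so Y)"
  by (rule rec_cong[OF rec_local[of "%a f. f X --> f Y" "Suc (max X Y)"]]) (auto simp: in_range_def less_Suc_eq_le)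

lemma rec_empty: "rec (%w so. so X = {})"
  by (rule rec_cong[OF rec_local[of "%a f. \<not> f X" "Suc X"]]) (auto simp: in_range_def)

lemma rec_letter: "rec (%w so. \<forall>p\<in>so X. p < length w \<and> w ! p = c)"
  by (rule rec_cong[OF rec_local[of "%a f. f X --> a = c" "Suc X"]]) (auto simp: in_range_def)

definition singleton :: "nat set => bool" where "singleton A \<longleftrightarrow> (\<exists>a. A = {a})"

text \<open>An \<open>IFst\<close> scan keeps no memory and cannot notice a second element. A
  singleton is therefore expressed as a minimal nonempty set.\<close>

lemma rec_sing: "rec (%w so. singleton (so X))"
proof -
  have "rec (%w so. \<not> so X = {} \<and> (\<forall>A\<subseteq>{..<length w}.
     (so(Suc X := A)) (Suc X) \<subseteq> (so(Suc X := A)) X --> (so(Suc X := A)) (Suc X) = {} \<or> (so(Suc X := A)) (Suc X) = (so(Suc X := A)) X))"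
    by (intro rec_conj rec_neg rec_empty rec_all rec_imp rec_disj rec_subset rec_eq)
  then show ?thesis
  proof (rule rec_cong)
    fix w and so :: "nat => nat set" assume "in_range w so"
    then have r: "so X \<subseteq> {..<length w}" by (simp add: in_range_def)
    show "(\<not> so X = {} \<and> (\<forall>A\<subseteq>{..<length w}. (so(Suc X := A)) (Suc X) \<subseteq> (so(Suc X := A)) X -->
      (so(Suc X := A)) (Suc X) = {} \<or> (so(Suc X := A)) (Suc X) = (so(Suc X := A)) X)) = singleton (so X)" (is "?l = _")
    proof
      assume l: ?l
      then obtain a where a: "a \<in> so X" by blast
      then have "{a} \<subseteq> {..<length w} \<and> {a} \<subseteq> so X" using r by blast
      then have "{a} = so X" using l by auto
      then show "singleton (so X)" by (auto simp: singleton_def)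
    qed (auto simp: singleton_def)
  qed
qed

text \<open>The first position lying in either singleton decides, negatively if it lies in
  both.\<close>

lemma rec_lt:
  "\<exists>R. rec R \<and> (\<forall>(w::nat list) so x y. so X = {x} --> so Y = {y} --> x < length w --> y < length w --> (R w so \<longleftrightarrow> x < y))"
proof (intro exI conjI allI impI)
  let ?D = "%(a::nat) B. if X \<in> B \<or> Y \<in> B then Some (Y \<notin> B) else None"
  let ?R = "%w so. first_dec (%p. ?D (w ! p) {Z. Z < Suc (max X Y) \<and> p \<in> so Z}) False [0..<length w]"
  show "rec ?R" by (rule rec_fst)
  fix w :: "nat list" and so :: "nat => nat set" and x y
  assume so: "so X = {x}" "so Y = {y}" and l: "x < length w" "y < length w"
  show "?R w so \<longleftrightarrow> x < y"
    using so l by (subst first_dec_upt[where p = "min x y" and b = "x < y"]) (auto simp: min_def)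
qed

lemma rec_plus:
  "\<exists>R. rec R \<and> (\<forall>(w::nat list) so x y z. so X = {x} --> so Y = {y} --> so Z = {z} --> x < length w --> y < length w --> z < length w -->
     (R w so \<longleftrightarrow> x + y = z))"
  by (intro exI[of _ "%w so. isat w so (IPl X Y Z)"] conjI allI impI isat_IPl)
     (auto intro: recI[of "IPl X Y Z"])

lemma rec_zero: "rec (%w so. so X = {0})"
proof (rule rec_cong[OF rec_conj[OF rec_sing[of X] rec_fst[of "%a B. Some (X \<in> B)" "Suc X" False]]])
  fix w and so :: "nat => nat set" assume "in_range w so"
  then have "0 < length w" by (simp add: in_range_def)
  then show "(singleton (so X) \<and> first_dec (%p. Some (X \<in> {Xa. Xa < Suc X \<and> p \<in> so Xa})) False [0..<length w]) = (so X = {0})"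
    by (subst first_dec_upt[where p = 0]) (auto simp: singleton_def)
qed

lemma rec_max: "rec (%w so. so X = {length w - 1})"
proof -
  obtain R where R: "rec R" "\<And>w so x y. so X = {x} ==> so (Suc X) = {y} ==> x < length w ==> y < length w ==> (R w so \<longleftrightarrow> x < y)"
    using rec_lt[of X "Suc X"] by blast
  have "rec (%w so. singleton (so X) \<and> (\<forall>A\<subseteq>{..<length w}. singleton ((so(Suc X := A)) (Suc X)) --> \<not> R w (so(Suc X := A))))"
    by (intro rec_conj rec_sing rec_all rec_imp rec_neg R(1))
  then show ?thesis
  proof (rule rec_cong)
    fix w and so :: "nat => nat set" assume r: "in_range w so"
    have "(\<forall>A\<subseteq>{..<length w}. singleton ((so(Suc X := A)) (Suc X)) --> \<not> R w (so(Suc X := A))) \<longleftrightarrow> x = length w - 1"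
      if x: "so X = {x}" for x
    proof -
      have xl: "x < length w" using x r unfolding in_range_def by (metis insert_subset lessThan_iff)
      have "R w (so(Suc X := {y})) \<longleftrightarrow> x < y" if "y < length w" for y using R(2)[of "so(Suc X := {y})" x y w] x xl that by simp
      then have "(\<forall>A\<subseteq>{..<length w}. singleton ((so(Suc X := A)) (Suc X)) --> \<not> R w (so(Suc X := A))) \<longleftrightarrow> (\<forall>y<length w. \<not> x < y)"
        by (auto simp: singleton_def)
      also have "\<dots> \<longleftrightarrow> x = length w - 1" using xl by (metis Suc_pred' diff_less less_Suc_eq_le linorder_not_less not_less_eq zero_less_one gr_implies_not0 neq0_conv le_antisym less_or_eq_imp_le)
      finally show ?thesis .
    qed
    then show "(singleton (so X) \<and> (\<forall>A\<subseteq>{..<length w}. singleton ((so(Suc X := A)) (Suc X)) --> \<not> R w (so(Suc X := A))))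
       = (so X = {length w - 1})" by (auto simp: singleton_def)
  qed
qed

end

section \<open>Numbers as ranks of set tuples\<close>

lemma rank_image:
  fixes T :: "'a set"
  assumes fin: "finite T" and irr: "\<And>A. A \<in> T ==> \<not> lt A A"
    and tr: "\<And>A B C. A \<in> T ==> B \<in> T ==> C \<in> T ==> lt A B ==> lt B C ==> lt A C"
    and tot: "\<And>A B. A \<in> T ==> B \<in> T ==> A \<noteq> B ==> lt A B \<or> lt B A"
  shows "(%B. card {A \<in> T. lt A B}) ` T = {..<card T}"
proof (rule card_subset_eq)
  let ?r = "%B. card {A \<in> T. lt A B}"
  have less: "?r A < ?r B" if "A \<in> T" "B \<in> T" "lt A B" for A B
  proof (rule psubset_card_mono)
    show "{C \<in> T. lt C A} \<subset> {C \<in> T. lt C B}" using that tr irr by blast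
  qed (use fin in simp)
  have "inj_on ?r T"
  proof (rule inj_onI, rule ccontr)
    fix A B assume AB: "A \<in> T" "B \<in> T" "?r A = ?r B" "A \<noteq> B"
    then have "lt A B \<or> lt B A" using tot by simp
    then show False using less[OF AB(1,2)] less[OF AB(2,1)] AB(3) by linarith
  qed
  then show "card (?r ` T) = card {..<card T}" by (simp add: card_image)
  show "?r ` T \<subseteq> {..<card T}"
  proof
    fix x assume "x \<in> ?r ` T"
    then obtain B where B: "B \<in> T" "x = ?r B" by blast
    have "{A \<in> T. lt A B} \<subset> T" using B(1) irr by blast
    then show "x \<in> {..<card T}" using B(2) fin psubset_card_mono by blast
  qed
qed simp

definition llt :: "nat list => nat list => bool" where
  "llt xs ys = first_dec (%(x, y). if x = y then None else Some (x < y)) False (zip xs ys)"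

lemma llt_irrefl: "\<not> llt xs xs"
  by (induction xs) (auto simp: llt_def)

lemma llt_trans: "length xs = length ys ==> length ys = length zs ==> llt xs ys ==> llt ys zs ==> llt xs zs"
  by (induction xs ys zs rule: list_induct3) (auto simp: llt_def split: if_splits)

lemma llt_total: "length xs = length ys ==> xs \<noteq> ys ==> llt xs ys \<or> llt ys xs"
  by (induction xs ys rule: list_induct2) (auto simp: llt_def)

text \<open>An injective number for a column. Comparing these numbers at the first position where
  they differ is a strict total order on tuples that an \<open>IFst\<close> scan decides.\<close>

definition code :: "nat set list => nat => nat" where
  "code As p = list_encode (map (%A. of_bool (p \<in> A)) As)"

definition key :: "nat => nat set list => nat list" where
  "key n As = map (code As) [0..<n]"

lemma key_inj: "inj_on (key n) (tuples n k)"
proof (rule inj_onI)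
  fix As Bs assume A: "As \<in> tuples n k" and B: "Bs \<in> tuples n k" and eq: "key n As = key n Bs"
  show "As = Bs"
  proof (rule nth_equalityI)
    show "length As = length Bs" using A B by (simp add: tuples_def)
    fix l assume l: "l < length As"
    have "As ! l \<in> set As" "Bs ! l \<in> set Bs" using l A B by (auto simp: tuples_def)
    then have sub: "As ! l \<subseteq> {..<n}" "Bs ! l \<subseteq> {..<n}" using A B by (auto simp: tuples_def)
    have "p \<in> As ! l \<longleftrightarrow> p \<in> Bs ! l" if "p < n" for p
    proof -
      have "code As p = code Bs p" using eq that by (auto simp: key_def)
      then have "map (%A. of_bool (p \<in> A) :: nat) As = map (%A. of_bool (p \<in> A)) Bs"
        unfolding code_def by (simp add: list_encode_eq)
      then have "(of_bool (p \<in> As ! l) :: nat) = of_bool (p \<in> Bs ! l)"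
        using l A B by (metis (mono_tags, lifting) nth_map map_eq_imp_length_eq)
      then show ?thesis by (simp only: of_bool_eq_iff)
    qed
    then show "As ! l = Bs ! l" using sub by blast
  qed
qed

definition rank :: "nat => nat => nat set list => nat" where
  "rank n k Bs = card {As \<in> tuples n k. llt (key n As) (key n Bs)}"

lemma rank_surj: "j < card (tuples n k) ==> \<exists>Bs\<in>tuples n k. rank n k Bs = j"
proof -
  assume j: "j < card (tuples n k)"
  have "(%B. card {A \<in> tuples n k. llt (key n A) (key n B)}) ` tuples n k = {..<card (tuples n k)}"
  proof (rule rank_image[OF finite_tuples])
    fix A B C assume "A \<in> tuples n k" "B \<in> tuples n k" "C \<in> tuples n k"
      "llt (key n A) (key n B)" "llt (key n B) (key n C)"
    then show "llt (key n A) (key n C)" using llt_trans[of "key n A" "key n B" "key n C"] by (simp add: key_def)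
  next
    fix A B assume "A \<in> tuples n k" "B \<in> tuples n k" "A \<noteq> B"
    then show "llt (key n A) (key n B) \<or> llt (key n B) (key n A)"
      using llt_total[of "key n A" "key n B"] key_inj[of n k] by (auto simp: inj_on_def) (auto simp: key_def)
  qed (simp add: llt_irrefl)
  then show ?thesis using j unfolding rank_def by (metis (no_types, lifting) imageE lessThan_iff)
qed

lemma card_Diff_ge: "finite A ==> (\<exists>b\<in>A. m \<le> card (A - {b})) \<longleftrightarrow> Suc m \<le> card A"
  by (metis Suc_le_mono card.remove card_eq_0_iff ex_in_conv not_less_eq_eq zero_le card_Suc_Diff1 bot_nat_0.extremum_uniqueI nat.distinct(1))

lemma mod_add_right_cancel: "(a + c) mod p = (b + c) mod p \<longleftrightarrow> a mod p = b mod (p::nat)"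
proof -
  have "int (a + c) mod int p = int (b + c) mod int p \<longleftrightarrow> int a mod int p = int b mod int p"
    by (simp add: mod_eq_dvd_iff)
  then show ?thesis by (metis of_nat_eq_iff zmod_int)
qed

lemma collect_cong_eq:
  assumes "\<forall>x\<in>T. P x \<longleftrightarrow> P' x" "\<forall>x\<in>T. Q x \<longleftrightarrow> x = b" "b \<in> T"
  shows "(\<exists>x\<in>T. P x \<and> Q x) \<longleftrightarrow> b \<in> {x \<in> T. P' x}" "{x \<in> T. P x \<and> \<not> Q x} = {x \<in> T. P' x} - {b}"
  using assms by auto

lemma map_upds: "distinct Xs ==> length As = length Xs ==> map (upds so Xs As) Xs = As"
  by (intro nth_equalityI) (auto simp: upds_nth)

context counting_modes
begin

definition kap :: "nat list => (nat list => (nat => nat set) => bool) => nat list => (nat => nat set) => nat" where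
  "kap Xs R w so = card {As \<in> tuples (length w) (length Xs). R w (upds so Xs As)}"

lemma rec_fresh:
  assumes "rec R"
  shows "\<exists>v. \<forall>w so so'. in_range w so --> in_range w so' --> (\<forall>X<v. so X = so' X) --> R w so = R w so'"
proof -
  obtain f where f: "\<And>w so. in_range w so ==> isat w so f = R w so" using assms by (auto simp: rec_def)
  obtain v where v: "ibnd v f" using ibnd_ex by blast
  have "R w so = R w so'" if "in_range w so" "in_range w so'" "\<forall>X<v. so X = so' X" for w so so'
    using isat_cong[OF v, of w so so'] f that by simp
  then show ?thesis by blast
qed

text \<open>A unit: it holds for a single tuple, and copies of it as summands add constants to
  counts.\<close>

definition one :: "nat list => nat list => (nat => nat set) => bool" where
  "one Xs w so \<longleftrightarrow> (\<forall>X\<in>set Xs. so X = {})"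

lemma rec_one: "rec (one Xs)"
  unfolding one_def using rec_ball[of "set Xs" "%X w so. so X = {}"] rec_empty by simp

lemma card_one: "distinct Xs ==> card {As \<in> tuples n (length Xs). one Xs w (upds so Xs As)} = 1"
proof -
  assume d: "distinct Xs"
  have "{As \<in> tuples n (length Xs). one Xs w (upds so Xs As)} = {replicate (length Xs) {}}"
  proof (intro set_eqI iffI)
    fix As assume "As \<in> {As \<in> tuples n (length Xs). one Xs w (upds so Xs As)}"
    then have l: "length As = length Xs" and o: "\<forall>X\<in>set Xs. upds so Xs As X = {}" by (auto simp: tuples_def one_def)
    have "\<forall>i<length Xs. As ! i = {}"
    proof (intro allI impI)
      fix i assume "i < length Xs"
      then show "As ! i = {}" using o upds_nth[OF l d, of i so] nth_mem[of i Xs] by auto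
    qed
    then show "As \<in> {replicate (length Xs) {}}" using l by (auto intro: nth_equalityI)
  next
    fix As :: "nat set list" assume "As \<in> {replicate (length Xs) {}}"
    then show "As \<in> {As \<in> tuples n (length Xs). one Xs w (upds so Xs As)}"
      using upds_nth[of As Xs] d by (auto simp: tuples_def one_def in_set_conv_nth)
  qed
  then show ?thesis by simp
qed

text \<open>The mode only reports whether a count is divisible by \<open>p\<close>; adding
  \<open>p - m\<close> units shifts the residue \<open>m\<close> to 0.\<close>

lemma rec_mod:
  assumes "ModPm p \<in> Md" "distinct Xs" "rec R" "m < p"
  shows "rec (%w so. kap Xs R w so mod p = m)"
proof -
  have "rec (%w so. \<not> mode_accepts (ModPm p) (count_sum w so Xs (R # replicate (p - m) (one Xs))) (count_sum w so Xs []))"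
    using assms rec_one by (intro rec_neg rec_count) auto
  then show ?thesis
  proof (rule rec_cong)
    fix w and so :: "nat => nat set"
    have "(c + (p - m)) mod p = 0 \<longleftrightarrow> c mod p = m" for c
    proof -
      have "(c + (p - m)) mod p = (c mod p + (p - m)) mod p" by (simp add: mod_simps)
      moreover have "c mod p < p" using assms(4) by simp
      moreover have "(c mod p + (p - m)) mod p = c mod p - m" if "m \<le> c mod p"
      proof -
        have "c mod p + (p - m) = (c mod p - m) + p" using that assms(4) by simp
        then have "(c mod p + (p - m)) mod p = (c mod p - m) mod p" by (simp only: mod_add_self2)
        also have "\<dots> = c mod p - m" using \<open>c mod p < p\<close> by (intro mod_less) linarith
        finally show ?thesis .
      qed
      moreover have "(c mod p + (p - m)) mod p = c mod p + (p - m)" if "c mod p < m"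
        using that assms(4) by (intro mod_less) linarith
      ultimately show ?thesis using assms(4) by (cases "m \<le> c mod p") auto
    qed
    then show "(\<not> mode_accepts (ModPm p) (count_sum w so Xs (R # replicate (p - m) (one Xs))) (count_sum w so Xs [])) = (kap Xs R w so mod p = m)"
      using card_one[OF assms(2)] by (simp add: count_sum_simps kap_def)
  qed
qed

text \<open>A threshold is reached by removing one witness at a time: a satisfying tuple is stored
  in fresh variables and excluded from the remaining count. No comparison of counts is needed, so
  this also works with modular modes.\<close>

lemma rec_ge:
  assumes d: "distinct Xs"
  shows "rec R ==> rec (%w so. m \<le> kap Xs R w so)"
proof (induction m arbitrary: R)
  case 0
  show ?case using rec_top by simp
next
  case (Suc m)
  obtain v0 where v0: "\<And>w so so'. in_range w so ==> in_range w so' ==> (\<forall>X<v0. so X = so' X) ==> R w so = R w so'"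
    using rec_fresh[OF Suc.prems] by blast
  \<comment> \<open>Beyond the variables on which \<open>R\<close> depends and beyond
    \<open>Xs\<close>, so storing the witness disturbs neither.\<close>
  define v where "v = v0 + Suc (Max (insert 0 (set Xs)))"
  have vX: "X < v" if "X \<in> set Xs" for X using that by (auto simp: v_def less_Suc_eq_le intro!: trans_le_add2 le_SucI)
  let ?k = "length Xs"
  let ?Ys = "[v..<v + ?k]"
  let ?E = "%(w::nat list) so. \<forall>l\<in>{..<?k}. so (Xs ! l) = so (?Ys ! l)"
  have E: "rec ?E" using rec_ball[of "{..<?k}" "%l w so. so (Xs ! l) = so (?Ys ! l)"] rec_eq by simp
  let ?R' = "%w so. R w so \<and> \<not> ?E w so"
  let ?S = "%w so. (\<exists>As\<in>tuples (length w) ?k. (%w so. R w so \<and> ?E w so) w (upds so Xs As)) \<and> m \<le> kap Xs ?R' w so"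
  have "rec ?S" using d Suc E by (intro rec_conj rec_exs Suc.IH rec_neg)
  then have "rec (%w so. \<exists>Bs\<in>tuples (length w) (length ?Ys). ?S w (upds so ?Ys Bs))" by (intro rec_exs) auto
  then show ?case
  proof (rule rec_cong)
    fix w and so :: "nat => nat set" assume rg: "in_range w so"
    let ?n = "length w"
    let ?T = "{As \<in> tuples ?n ?k. R w (upds so Xs As)}"
    have "?S w (upds so ?Ys Bs) \<longleftrightarrow> Bs \<in> ?T \<and> m \<le> card (?T - {Bs})" if B: "Bs \<in> tuples ?n ?k" for Bs
    proof -
      let ?so = "upds so ?Ys Bs"
      have lB: "length Bs = length ?Ys" using B by (simp add: tuples_def)
      have rg2: "in_range w ?so" using in_range_upds[OF rg B] .
      have RR: "R w (upds ?so Xs As) = R w (upds so Xs As)" if "As \<in> tuples ?n ?k" for As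
      proof (rule v0[OF in_range_upds[OF rg2 that] in_range_upds[OF rg that]], intro allI impI)
        fix X assume "X < v0"
        then have "X \<notin> set ?Ys" by (auto simp: v_def)
        then have "p \<in> upds ?so Xs As X \<longleftrightarrow> p \<in> upds so Xs As X" for p
          using that by (intro upds_cong) (auto simp: upds_notin tuples_def)
        then show "upds ?so Xs As X = upds so Xs As X" by blast
      qed
      have EE: "?E w (upds ?so Xs As) \<longleftrightarrow> As = Bs" if "As \<in> tuples ?n ?k" for As
      proof -
        have lA: "length As = ?k" using that by (simp add: tuples_def)
        have e: "upds ?so Xs As (Xs ! l) = As ! l" "upds ?so Xs As (?Ys ! l) = Bs ! l" if "l < ?k" for l
        proof -
          show "upds ?so Xs As (Xs ! l) = As ! l" using lA d that by (intro upds_nth) auto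
          have "?Ys ! l \<notin> set Xs" using vX that by fastforce
          then have "upds ?so Xs As (?Ys ! l) = ?so (?Ys ! l)" by (rule upds_notin)
          also have "\<dots> = Bs ! l" using lB that by (intro upds_nth) auto
          finally show "upds ?so Xs As (?Ys ! l) = Bs ! l" .
        qed
        have "?E w (upds ?so Xs As) \<longleftrightarrow> (\<forall>l\<in>{..<?k}. As ! l = Bs ! l)"
          by (intro ball_cong refl) (simp only: e lessThan_iff)
        also have "\<dots> \<longleftrightarrow> As = Bs"
        proof
          assume "\<forall>l\<in>{..<?k}. As ! l = Bs ! l"
          then show "As = Bs" using lA lB by (intro nth_equalityI) simp_all
        qed simp
        finally show ?thesis .
      qed
      have gen: "(\<exists>As\<in>tuples ?n ?k. P As \<and> Q As) \<longleftrightarrow> Bs \<in> {As \<in> tuples ?n ?k. P' As}"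
        "{As \<in> tuples ?n ?k. P As \<and> \<not> Q As} = {As \<in> tuples ?n ?k. P' As} - {Bs}"
        if "\<And>As. As \<in> tuples ?n ?k ==> P As = P' As" "\<And>As. As \<in> tuples ?n ?k ==> Q As \<longleftrightarrow> As = Bs" for P P' Q
        using collect_cong_eq[of "tuples ?n ?k" P P' Q Bs] that B by blast+
      note gen(1)[OF RR EE] 
      moreover note gen(2)[OF RR EE]
      ultimately show ?thesis by (simp only: kap_def)
    qed
    moreover have "(\<exists>Bs\<in>tuples ?n ?k. P Bs) \<longleftrightarrow> (\<exists>Bs\<in>?T. m \<le> card (?T - {Bs}))"
      if "\<And>Bs. Bs \<in> tuples ?n ?k ==> P Bs \<longleftrightarrow> Bs \<in> ?T \<and> m \<le> card (?T - {Bs})" for P using that by blast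
    moreover have "length ?Ys = ?k" by simp
    ultimately have "(\<exists>Bs\<in>tuples ?n (length ?Ys). ?S w (upds so ?Ys Bs)) \<longleftrightarrow> (\<exists>Bs\<in>?T. m \<le> card (?T - {Bs}))" by presburger
    also have "\<dots> \<longleftrightarrow> Suc m \<le> kap Xs R w so"
      unfolding kap_def using finite_tuples by (intro card_Diff_ge) simp
    finally show "(\<exists>Bs\<in>tuples ?n (length ?Ys). ?S w (upds so ?Ys Bs)) = (Suc m \<le> kap Xs R w so)" .
  qed
qed

text \<open>The tested expression is the least element of the class of the count under
  \<open>count_sim N p\<close>; each case is a threshold test combined with a second threshold or
  with a residue.\<close>

lemma rec_count_class:
  assumes p: "ModPm p \<in> Md" "1 < p" and d: "distinct Xs" and R: "rec R"
  shows "rec (%w so. (if kap Xs R w so < N then kap Xs R w so else N + (kap Xs R w so - N) mod p) = k)"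
proof (cases "k < N")
  case True
  have "rec (%w so. k \<le> kap Xs R w so \<and> \<not> Suc k \<le> kap Xs R w so)"
    using d R by (intro rec_conj rec_neg rec_ge)
  then show ?thesis by (rule rec_cong) (use True in auto)
next
  case False
  show ?thesis
  proof (cases "k < N + p")
    case True
    have "rec (%w so. N \<le> kap Xs R w so \<and> kap Xs R w so mod p = k mod p)"
      using d R p by (intro rec_conj rec_ge rec_mod) auto
    then show ?thesis
    proof (rule rec_cong)
      fix w and so :: "nat => nat set"
      let ?c = "kap Xs R w so"
      have "N + (?c - N) mod p = k \<longleftrightarrow> ?c mod p = k mod p" if "N \<le> ?c"
      proof -
        have "N + (?c - N) mod p = k \<longleftrightarrow> (?c - N) mod p = (k - N) mod p" using False True by auto
        also have "\<dots> \<longleftrightarrow> ((?c - N) + N) mod p = ((k - N) + N) mod p"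
          by (rule mod_add_right_cancel[symmetric])
        finally show ?thesis using that False by simp
      qed
      then show "(N \<le> ?c \<and> ?c mod p = k mod p) = ((if ?c < N then ?c else N + (?c - N) mod p) = k)"
        using False by auto
    qed
  next
    case False
    have "\<not> (if c < N then c else N + (c - N) mod p) = k" for c
      using False p(2) mod_less_divisor[of p "c - N"] by (auto simp del: mod_less_divisor)
    then show ?thesis using rec_bot by simp
  qed
qed

end

lemma first_dec_map_fun: "first_dec D d (map f xs) = first_dec (%x. D (f x)) d xs"
  by (induction xs) (auto split: option.split)

context counting_modes
begin

lemma rec_fresh_finite:
  assumes "finite I" "\<And>i. i \<in> I ==> rec (R i)"
  shows "\<exists>v. \<forall>i\<in>I. \<forall>w so so'. in_range w so --> in_range w so' --> (\<forall>X<v. so X = so' X) --> R i w so = R i w so'"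
  using assms
proof (induction I rule: finite_induct)
  case (insert i I)
  then obtain v where v: "\<forall>i\<in>I. \<forall>w so so'. in_range w so --> in_range w so' --> (\<forall>X<v. so X = so' X) --> R i w so = R i w so'" by blast
  obtain v' where v': "\<forall>w so so'. in_range w so --> in_range w so' --> (\<forall>X<v'. so X = so' X) --> R i w so = R i w so'"
    using rec_fresh insert.prems by blast
  show ?case
  proof (intro exI[of _ "max v v'"] ballI allI impI)
    fix j w so so' assume j: "j \<in> insert i I" "in_range w so" "in_range w so'" "\<forall>X<max v v'. so X = so' X"
    then show "R j w so = R j w so'"
      using v'[rule_format, of w so so'] v[rule_format, of j w so so'] by (cases "j = i") simp_all
  qed
qed simp

definition lless :: "nat list => nat list => nat list => (nat => nat set) => bool" where
  "lless Us Vs w so \<longleftrightarrow> llt (key (length w) (map so Us)) (key (length w) (map so Vs))"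

lemma rec_lless: "rec (lless Us Vs)"
proof -
  define v where "v = Suc (Max (insert 0 (set Us \<union> set Vs)))"
  have v: "X < v" if "X \<in> set Us \<union> set Vs" for X using that by (auto simp: v_def less_Suc_eq_le)
  let ?c = "%B Us. list_encode (map (%U. of_bool (U \<in> B)) Us)"
  let ?D = "%(a::nat) B. if ?c B Us = ?c B Vs then None else Some (?c B Us < ?c B Vs)"
  have "rec (%w so. first_dec (%p. ?D (w ! p) {X. X < v \<and> p \<in> so X}) False [0..<length w])" by (rule rec_fst)
  then show ?thesis
  proof (rule rec_cong)
    fix w :: "nat list" and so :: "nat => nat set"
    have c: "?c {X. X < v \<and> p \<in> so X} Us = code (map so Us) p" "?c {X. X < v \<and> p \<in> so X} Vs = code (map so Vs) p" for p
      using v unfolding code_def map_map comp_def by (intro arg_cong[where f = list_encode] map_cong refl; simp)+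
    have "zip (key (length w) (map so Us)) (key (length w) (map so Vs)) = map (%p. (code (map so Us) p, code (map so Vs) p)) [0..<length w]"
      unfolding key_def by (intro nth_equalityI) auto
    then show "first_dec (%p. ?D (w ! p) {X. X < v \<and> p \<in> so X}) False [0..<length w] = lless Us Vs w so"
      unfolding c lless_def llt_def by (simp add: first_dec_map_fun)
  qed
qed

lemma count_sum_concat: "count_sum w so Xs (concat Rss) = sum_list (map (count_sum w so Xs) Rss)"
  by (induction Rss) (auto simp: count_sum_simps)

text \<open>Every period is nonzero at some letter, so its coefficient is at most a count of tuples
  of length \<open>length Xs\<close>. It is thus below the number of tuples that are one longer and
  is the rank of a guessed tuple. A coefficient times a constant is that many copies of the count of
  tuples below the guess, and equality of two sums is the failure of both strict
  comparisons.\<close>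

lemma rec_linear:
  fixes s :: nat
  assumes PP: "PPm \<in> Md" and d: "distinct Xs" and R: "\<And>a. a < s ==> rec (R a)"
    and ps: "\<And>p. p \<in> set ps ==> \<exists>a<s. p a \<noteq> (0::nat)"
  shows "rec (%w so. \<exists>ns. length ns = length ps \<and> (\<forall>a<s. kap Xs (R a) w so = b a + (\<Sum>i<length ps. ns!i * (ps!i) a)))"
proof -
  obtain v0 where v00: "\<forall>a\<in>{..<s}. \<forall>w so so'. in_range w so --> in_range w so' --> (\<forall>X<v0. so X = so' X) --> R a w so = R a w so'"
    using rec_fresh_finite[OF finite_lessThan, of s R] R by auto
  have v0: "R a w so = R a w so'" if "a < s" "in_range w so" "in_range w so'" "\<forall>X<v0. so X = so' X" for a w so so'
    by (rule v00[rule_format]) (use that in auto)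
  define v where "v = v0 + Suc (Max (insert 0 (set Xs)))"
  have vX: "X < v" if "X \<in> set Xs" for X using that by (auto simp: v_def less_Suc_eq_le intro!: trans_le_add2 le_SucI)
  define k where "k = length Xs"
  define r where "r = length ps"
  \<comment> \<open>Both sides must count tuples of the same length. On the side of \<open>R\<close>
    the extra set \<open>v\<close> is pinned to the empty set, which leaves the count
    unchanged.\<close>
  define Xs2 where "Xs2 = Xs @ [v]"
  define Ys where "Ys = [Suc v..<Suc v + r * Suc k]"
  define Y where "Y i = map (%l. Suc v + (i * Suc k + l)) [0..<Suc k]" for i
  have d2: "distinct Xs2" using d vX by (auto simp: Xs2_def)
  have l2: "length Xs2 = Suc k" by (simp add: Xs2_def k_def)
  define Le where "Le a = [%w so. R a w so \<and> so v = {}]" for a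
  define Ri where "Ri a = replicate (b a) (one Xs2) @ concat (map (%i. replicate ((ps!i) a) (lless Xs2 (Y i))) [0..<r])" for a
  let ?E = "%w so. \<forall>a\<in>{..<s}. \<not> count_sum w so Xs2 (Le a) < count_sum w so Xs2 (Ri a) \<and> \<not> count_sum w so Xs2 (Ri a) < count_sum w so Xs2 (Le a)"
  have Le_rec: "\<forall>S\<in>set (Le a). rec S" if "a < s" for a
    using R[OF that] by (auto simp: Le_def intro!: rec_conj rec_empty)
  have Ri_rec: "\<forall>S\<in>set (Ri a). rec S" for a
    using rec_one rec_lless by (auto simp: Ri_def split: if_splits)
  have "rec ?E"
  proof (rule rec_ball[OF finite_lessThan])
    fix a assume "a \<in> {..<s}"
    then have a: "a < s" by simp
    show "rec (%w so. \<not> count_sum w so Xs2 (Le a) < count_sum w so Xs2 (Ri a) \<and> \<not> count_sum w so Xs2 (Ri a) < count_sum w so Xs2 (Le a))"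
      by (rule rec_conj[OF rec_neg[OF rec_less[OF PP d2 Ri_rec Le_rec[OF a]]] rec_neg[OF rec_less[OF PP d2 Le_rec[OF a] Ri_rec]]])
  qed
  then have "rec (%w so. \<exists>Bs\<in>tuples (length w) (length Ys). ?E w (upds so Ys Bs))" by (intro rec_exs) (auto simp: Ys_def)
  then show ?thesis
  proof (rule rec_cong)
    fix w and so :: "nat => nat set" assume rg: "in_range w so"
    let ?n = "length w"
    have n0: "?n > 0" using rg by (simp add: in_range_def)
    have lY: "length Ys = r * Suc k" by (simp add: Ys_def del: upt_Suc mult_Suc_right)
    have Le: "count_sum w (upds so Ys Bs) Xs2 (Le a) = kap Xs (R a) w so" if B: "Bs \<in> tuples ?n (length Ys)" and a: "a < s" for Bs a
    proof -
      let ?so = "upds so Ys Bs"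
      have rg2: "in_range w ?so" by (rule in_range_upds[OF rg B])
      have eq: "upds ?so Xs2 (As @ [C]) = (upds ?so Xs As)(v := C)" if "length As = length Xs" for As C
        using that by (simp add: Xs2_def upds_def)
      have RR: "R a w ((upds ?so Xs As)(v := {})) = R a w (upds so Xs As)" if "As \<in> tuples ?n k" for As
      proof (rule v0[OF a])
        show "in_range w ((upds ?so Xs As)(v := {}))" "in_range w (upds so Xs As)"
          using that rg rg2 by (auto intro!: in_range_upd in_range_upds)
        show "\<forall>X<v0. ((upds ?so Xs As)(v := {})) X = upds so Xs As X"
        proof (intro allI impI)
          fix X assume "X < v0"
          then have X: "X \<notin> set Ys" "X \<noteq> v" by (auto simp: v_def Ys_def)
          then have "p \<in> upds ?so Xs As X \<longleftrightarrow> p \<in> upds so Xs As X" for p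
            using that by (intro upds_cong) (auto simp: upds_notin tuples_def k_def)
          then show "((upds ?so Xs As)(v := {})) X = upds so Xs As X" using X by auto
        qed
      qed
      have "{As \<in> tuples ?n (Suc k). R a w (upds ?so Xs2 As) \<and> (upds ?so Xs2 As) v = {}}
         = (%As. As @ [{}]) ` {As \<in> tuples ?n k. R a w (upds so Xs As)}" (is "?l = ?r")
      proof (intro set_eqI iffI)
        fix As assume "As \<in> ?l"
        then have As: "As \<in> tuples ?n (Suc k)" "R a w (upds ?so Xs2 As)" "(upds ?so Xs2 As) v = {}" by auto
        then obtain As' C where c: "As = As' @ [C]" "length As' = k"
          by (auto simp: tuples_def length_Suc_conv_rev)
        then have "As' \<in> tuples ?n k" using As(1) by (auto simp: tuples_def)
        moreover have "C = {}" using As(3) c eq[of As' C] by (simp add: k_def)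
        ultimately show "As \<in> ?r" using As(2) c eq[of As' "{}"] RR[of As'] by (auto simp: k_def)
      next
        fix As assume "As \<in> ?r"
        then obtain As' where "As' \<in> tuples ?n k" "R a w (upds so Xs As')" "As = As' @ [{}]" by auto
        then show "As \<in> ?l" using eq[of As' "{}"] RR[of As'] by (auto simp: tuples_def k_def)
      qed
      then show ?thesis by (simp add: Le_def count_sum_simps l2 kap_def k_def card_image inj_on_def)
    qed
    have Ri: "count_sum w (upds so Ys Bs) Xs2 (Ri a) = b a + (\<Sum>i<r. rank ?n (Suc k) (map (upds so Ys Bs) (Y i)) * (ps!i) a)" for Bs a
    proof -
      let ?so = "upds so Ys Bs"
      have "card {As \<in> tuples ?n (length Xs2). lless Xs2 (Y i) w (upds ?so Xs2 As)} = rank ?n (Suc k) (map ?so (Y i))" if "i < r" for i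
      proof -
        have "X \<notin> set Xs2" if "X \<in> set (Y i)" for X using that vX by (fastforce simp: Y_def Xs2_def)
        then have m: "map (upds ?so Xs2 As) (Y i) = map ?so (Y i)" for As by (simp add: upds_notin)
        then have "lless Xs2 (Y i) w (upds ?so Xs2 As) \<longleftrightarrow> llt (key ?n As) (key ?n (map ?so (Y i)))" if "As \<in> tuples ?n (length Xs2)" for As
        proof -
          have "map (upds ?so Xs2 As) Xs2 = As" using that by (intro map_upds d2) (simp add: tuples_def)
          then show ?thesis by (simp only: lless_def m)
        qed
        then show ?thesis unfolding rank_def l2[symmetric] by (intro arg_cong[where f = card] Collect_cong conj_cong refl)
      qed
      then show ?thesis using card_one[OF d2, of ?n w ?so]
        by (simp add: Ri_def count_sum_simps count_sum_concat comp_def interv_sum_list_conv_sum_set_nat atLeast0LessThan mult.commute)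
    qed
    have key: "(\<exists>Bs\<in>tuples ?n (length Ys). ?E w (upds so Ys Bs)) \<longleftrightarrow>
      (\<exists>Bs\<in>tuples ?n (length Ys). \<forall>a<s. kap Xs (R a) w so = b a + (\<Sum>i<r. rank ?n (Suc k) (map (upds so Ys Bs) (Y i)) * (ps!i) a))"
      using Le Ri by (intro bex_cong refl) (auto simp: not_less intro: order_antisym)
    show "(\<exists>Bs\<in>tuples ?n (length Ys). ?E w (upds so Ys Bs)) = (\<exists>ns. length ns = length ps \<and> (\<forall>a<s. kap Xs (R a) w so = b a + (\<Sum>i<length ps. ns!i * (ps!i) a)))"
      unfolding key
    proof
      assume "\<exists>Bs\<in>tuples ?n (length Ys). \<forall>a<s. kap Xs (R a) w so = b a + (\<Sum>i<r. rank ?n (Suc k) (map (upds so Ys Bs) (Y i)) * (ps!i) a)"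
      then obtain Bs where "\<forall>a<s. kap Xs (R a) w so = b a + (\<Sum>i<r. rank ?n (Suc k) (map (upds so Ys Bs) (Y i)) * (ps!i) a)" by blast
      then show "\<exists>ns. length ns = length ps \<and> (\<forall>a<s. kap Xs (R a) w so = b a + (\<Sum>i<length ps. ns!i * (ps!i) a))"
        by (intro exI[of _ "map (%i. rank ?n (Suc k) (map (upds so Ys Bs) (Y i))) [0..<r]"]) (simp add: r_def)
    next
      assume "\<exists>ns. length ns = length ps \<and> (\<forall>a<s. kap Xs (R a) w so = b a + (\<Sum>i<length ps. ns!i * (ps!i) a))"
      then obtain ns where ns: "length ns = r" "\<And>a. a < s ==> kap Xs (R a) w so = b a + (\<Sum>i<r. ns!i * (ps!i) a)" by (auto simp: r_def)
      have "\<exists>B\<in>tuples ?n (Suc k). rank ?n (Suc k) B = ns ! i" if i: "i < r" for i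
      proof -
        obtain a where a: "a < s" "(ps!i) a \<noteq> 0" using ps[of "ps ! i"] i by (auto simp: r_def)
        have "ns ! i \<le> ns!i * (ps!i) a" using a(2) by simp
        also have "\<dots> \<le> (\<Sum>i<r. ns!i * (ps!i) a)" using i by (intro member_le_sum) auto
        also have "\<dots> \<le> kap Xs (R a) w so" using ns(2)[OF a(1)] by simp
        also have "\<dots> \<le> card (tuples ?n k)" unfolding kap_def k_def by (intro card_mono finite_tuples) auto
        also have "\<dots> < card (tuples ?n (Suc k))" using n0 by (simp add: card_tuples)
        finally show ?thesis by (rule rank_surj)
      qed
      then obtain B where B: "\<And>i. i < r ==> B i \<in> tuples ?n (Suc k) \<and> rank ?n (Suc k) (B i) = ns ! i" by metis
      define Bs where "Bs = map (%t. B (t div Suc k) ! (t mod Suc k)) [0..<r * Suc k]"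
      have BsT: "Bs \<in> tuples ?n (length Ys)"
      proof -
        have "B (t div Suc k) ! (t mod Suc k) \<in> Pow {..<?n}" if "t < r * Suc k" for t
        proof -
          have "t div Suc k < r" using that by (simp add: less_mult_imp_div_less)
          then have "set (B (t div Suc k)) \<subseteq> Pow {..<?n}" "length (B (t div Suc k)) = Suc k" using B by (auto simp: tuples_def)
          moreover have "t mod Suc k < Suc k" by simp
          ultimately show ?thesis by (metis nth_mem subsetD)
        qed
        then have "set Bs \<subseteq> Pow {..<?n}" unfolding Bs_def set_map by (intro image_subsetI) (simp del: mult_Suc_right)
        then show ?thesis unfolding tuples_def lY by (simp add: Bs_def)
      qed
      have "map (upds so Ys Bs) (Y i) = B i" if i: "i < r" for i
      proof (rule nth_equalityI)
        show "length (map (upds so Ys Bs) (Y i)) = length (B i)" using B[OF i] by (simp add: Y_def tuples_def)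
        fix l assume "l < length (map (upds so Ys Bs) (Y i))"
        then have l: "l < Suc k" by (simp add: Y_def)
        have "i * Suc k + l < Suc i * Suc k" using l by simp
        also have "\<dots> \<le> r * Suc k" using i by (intro mult_le_mono1) simp
        finally have t: "i * Suc k + l < r * Suc k" .
        have "map (upds so Ys Bs) (Y i) ! l = upds so Ys Bs (Ys ! (i * Suc k + l))"
          using l t by (simp add: Y_def Ys_def del: mult_Suc_right upt_Suc)
        also have "\<dots> = Bs ! (i * Suc k + l)"
          using t lY BsT by (intro upds_nth) (auto simp: Ys_def tuples_def)
        also have "\<dots> = B i ! l" using t l by (simp add: Bs_def del: mult_Suc_right)
        finally show "map (upds so Ys Bs) (Y i) ! l = B i ! l" .
      qed
      then show "\<exists>Bs\<in>tuples ?n (length Ys). \<forall>a<s. kap Xs (R a) w so = b a + (\<Sum>i<r. rank ?n (Suc k) (map (upds so Ys Bs) (Y i)) * (ps!i) a)"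
        using BsT B ns(2) by (intro bexI[of _ Bs]) auto
    qed
  qed
qed

text \<open>One family of sets for both sorts: indices 0 modulo 3 hold set variables, 1 modulo 3
  hold element variables as singletons, and 2 modulo 3 are scratch slots for the values of
  terms.\<close>

definition comb :: "(nat => nat) => (nat => nat set) => nat => nat set" where
  "comb fo so v = (if v mod 3 = 0 then so (v div 3) else if v mod 3 = 1 then {fo (v div 3)} else {})"

fun tset :: "nat list => (nat => nat set) => trm => nat set" where
  "tset w so (V i) = so (3 * i + 1)"
| "tset w so TMin = {0}"
| "tset w so TMax = {length w - 1}"

definition ok_env :: "nat list => (nat => nat) => (nat => nat set) => bool" where
  "ok_env w fo so \<longleftrightarrow> in_range w so \<and> (\<forall>i. fo i < length w)"

definition trl :: "fm => bool" where
  "trl f \<longleftrightarrow> (\<exists>R. rec R \<and> (\<forall>w fo so. ok_env w fo so --> R w (comb fo so) = sat w fo so f))"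

lemma comb_simps [simp]: "comb fo so (3 * X) = so X" "comb fo so (Suc (3 * i)) = {fo i}"
  "comb fo so 2 = {}" "comb fo so 5 = {}" "comb fo so 8 = {}"
proof -
  have "Suc (3 * i) div 3 = i" "Suc (3 * i) mod 3 = 1" by presburger+
  then show "comb fo so (Suc (3 * i)) = {fo i}" by (simp add: comb_def)
qed (auto simp: comb_def)

lemma comb_upd: "comb (fo(i := a)) so = (comb fo so)(3 * i + 1 := {a})" "comb fo (so(X := A)) = (comb fo so)(3 * X := A)"
proof -
  have 1: "(3 * i + 1) div 3 = i" "(3 * i + 1) mod 3 = 1" by presburger+
  have 2: "v \<noteq> 3 * i + 1 ==> v mod 3 = 1 ==> v div 3 \<noteq> i" for v by presburger
  show "comb (fo(i := a)) so = (comb fo so)(3 * i + 1 := {a})"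
  proof
    fix v show "comb (fo(i := a)) so v = ((comb fo so)(3 * i + 1 := {a})) v"
      using 1 2[of v] by (cases "v = 3 * i + 1") (auto simp: comb_def)
  qed
  have 3: "v \<noteq> 3 * X ==> v mod 3 = 0 ==> v div 3 \<noteq> X" for v by presburger
  show "comb fo (so(X := A)) = (comb fo so)(3 * X := A)"
  proof
    fix v show "comb fo (so(X := A)) v = ((comb fo so)(3 * X := A)) v"
      using 3[of v] by (cases "v = 3 * X") (auto simp: comb_def)
  qed
qed

lemma comb_in_range: "ok_env w fo so ==> in_range w (comb fo so)"
  by (auto simp: ok_env_def in_range_def comb_def split: if_splits)

lemma tset_upd [simp]: "a mod 3 = 2 ==> tset w (so(a := A)) t = tset w so t"
  by (cases t) auto

lemma tset_comb: "ok_env w fo so ==> tset w (comb fo so) t = {eval_trm w fo t} \<and> eval_trm w fo t < length w"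
  by (cases t) (auto simp: ok_env_def in_range_def)

text \<open>Substitution of a term for a scratch variable: the value is quantified existentially and
  is determined by the term.\<close>

lemma slot: 
  assumes R: "rec R" and a: "a mod 3 = 2"
  shows "rec (%w so. R w (so(a := tset w so t)))"
proof -
  have "rec (%w so. so a = tset w so t)" by (cases t) (auto intro: rec_eq rec_zero rec_max[unfolded One_nat_def])
  then have "rec (%w so. \<exists>A\<subseteq>{..<length w}. (%w so. so a = tset w so t \<and> R w so) w (so(a := A)))"
    using R by (intro rec_ex rec_conj)
  then show ?thesis
  proof (rule rec_cong)
    fix w and so :: "nat => nat set" assume "in_range w so"
    then have "tset w so t \<subseteq> {..<length w}" by (cases t) (auto simp: in_range_def)
    then show "(\<exists>A\<subseteq>{..<length w}. (so(a := A)) a = tset w (so(a := A)) t \<and> R w (so(a := A))) = R w (so(a := tset w so t))"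
      using a by auto
  qed
qed

lemma trl_atom1:
  assumes "rec R0" "\<And>w fo so. ok_env w fo so ==> R0 w ((comb fo so)(2 := {eval_trm w fo t})) = sat w fo so f"
  shows "trl f"
  unfolding trl_def
  by (rule exI[of _ "%w so. R0 w (so(2 := tset w so t))"]) (use slot[OF assms(1), of 2] assms(2) tset_comb in auto)

lemma trl_atom3:
  assumes "rec R0" "\<And>w fo so. ok_env w fo so ==>
     R0 w ((comb fo so)(2 := {eval_trm w fo t1}, 5 := {eval_trm w fo t2}, 8 := {eval_trm w fo t3})) = sat w fo so f"
  shows "trl f"
proof -
  let ?R1 = "%w so. R0 w (so(8 := tset w so t3))"
  let ?R2 = "%w so. ?R1 w (so(5 := tset w so t2))"
  let ?R3 = "%w so. ?R2 w (so(2 := tset w so t1))"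
  have "rec ?R1" using assms(1) by (intro slot) auto
  then have "rec ?R2" by (intro slot[of ?R1]) auto
  then have "rec ?R3" by (intro slot[of ?R2]) auto
  then show ?thesis unfolding trl_def
    by (intro exI[of _ ?R3]) (use assms(2) tset_comb in auto)
qed

lemma trl_neg: "trl f ==> trl (Neg f)"
  unfolding trl_def using rec_neg by (metis (no_types, lifting) sat.simps(7))

lemma trl_conj: "trl f ==> trl g ==> trl (Conj f g)"
proof -
  assume "trl f" "trl g"
  then obtain R S where "rec R" "rec S" "\<forall>w fo so. ok_env w fo so --> R w (comb fo so) = sat w fo so f"
    "\<forall>w fo so. ok_env w fo so --> S w (comb fo so) = sat w fo so g" by (auto simp: trl_def)
  then show "trl (Conj f g)" unfolding trl_def by (intro exI[of _ "%w so. R w so \<and> S w so"]) (auto intro: rec_conj)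
qed

lemma trl_cong: "trl f ==> (\<And>w fo so. ok_env w fo so ==> sat w fo so f = sat w fo so g) ==> trl g"
  unfolding trl_def by metis

lemma trl_disj: "trl f ==> trl g ==> trl (Disj f g)"
  by (rule trl_cong[OF trl_neg[OF trl_conj[OF trl_neg trl_neg]]]) auto

lemma trl_exS: "trl f ==> trl (ExS X f)"
proof -
  assume "trl f"
  then obtain R where R: "rec R" "\<And>w fo so. ok_env w fo so ==> R w (comb fo so) = sat w fo so f" by (auto simp: trl_def)
  have "(\<exists>A\<subseteq>{..<length w}. R w ((comb fo so)(3 * X := A))) = sat w fo so (ExS X f)" if ok: "ok_env w fo so" for w fo so
  proof -
    have "R w ((comb fo so)(3 * X := A)) = sat w fo (so(X := A)) f" if "A \<subseteq> {..<length w}" for A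
      using R(2)[of w fo "so(X := A)"] ok that in_range_upd by (auto simp: comb_upd ok_env_def)
    then show ?thesis by auto
  qed
  then show ?thesis unfolding trl_def
    by (intro exI[of _ "%w so. \<exists>A\<subseteq>{..<length w}. R w (so(3 * X := A))"]) (use rec_ex[OF R(1)] in auto)
qed

lemma trl_ex: "trl f ==> trl (Ex i f)"
proof -
  assume "trl f"
  then obtain R where R: "rec R" "\<And>w fo so. ok_env w fo so ==> R w (comb fo so) = sat w fo so f" by (auto simp: trl_def)
  let ?R = "%w so. singleton (so (3 * i + 1)) \<and> R w so"
  have "rec (%w so. \<exists>A\<subseteq>{..<length w}. ?R w (so(3 * i + 1 := A)))" by (intro rec_ex rec_conj rec_sing R(1))
  moreover have "(\<exists>A\<subseteq>{..<length w}. ?R w ((comb fo so)(3 * i + 1 := A))) = sat w fo so (Ex i f)" if ok: "ok_env w fo so" for w fo so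
  proof -
    have "R w ((comb fo so)(3 * i + 1 := {a})) = sat w (fo(i := a)) so f" if "a < length w" for a
      using R(2)[of w "fo(i := a)" so] ok that by (auto simp: comb_upd ok_env_def)
    then show ?thesis by (auto simp: singleton_def)
  qed
  ultimately show ?thesis unfolding trl_def by blast
qed

lemma trl_all: "trl f ==> trl (All i f)" "trl f ==> trl (AllS X f)"
  by (rule trl_cong[OF trl_neg[OF trl_ex[OF trl_neg]]]; auto) (rule trl_cong[OF trl_neg[OF trl_exS[OF trl_neg]]]; auto)

lemma trl_atoms: "trl (Eq a b)" "trl (Lt a b)" "trl (Pr c a)" "trl (Mem X a)" "trl (Plus a b c')"
proof -
  show "trl (Eq a b)" by (rule trl_atom3[OF rec_eq[of 2 5], of a b a]) auto
  obtain R where "rec R" "\<And>(w::nat list) so x y. so 2 = {x} ==> so 5 = {y} ==> x < length w ==> y < length w ==> (R w so \<longleftrightarrow> x < y)"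
    using rec_lt[of 2 5] by blast
  then show "trl (Lt a b)" by (intro trl_atom3[of R a b a]) (simp_all add: tset_comb)
  show "trl (Pr c a)"
    by (rule trl_atom1[OF rec_letter[of 2 c], of a]) auto
  show "trl (Mem X a)"
  proof (rule trl_atom1[OF rec_subset[of 2 "3 * X"], of a])
    have "3 * X \<noteq> 2" by presburger
    then show "(((comb fo so)(2 := {eval_trm w fo a})) 2 \<subseteq> ((comb fo so)(2 := {eval_trm w fo a})) (3 * X)) = sat w fo so (Mem X a)" for w fo so
      by simp
  qed
  obtain R where "rec R" "\<And>(w::nat list) so x y z. so 2 = {x} ==> so 5 = {y} ==> so 8 = {z} ==> x < length w ==> y < length w ==> z < length w
     ==> (R w so \<longleftrightarrow> x + y = z)" using rec_plus[of 2 5 8] by blast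
  then show "trl (Plus a b c')" by (intro trl_atom3[of R a b c']) (simp_all add: tset_comb)
qed

definition lam :: "(nat list => (nat => nat set) => bool) list => nat => nat list => (nat => nat set) => bool" where
  "lam Rs a w so \<longleftrightarrow> length (takeWhile Not (map (%R. R w so) Rs)) = a"

lemma rec_lam: "\<forall>R\<in>set Rs. rec R ==> rec (lam Rs a)"
proof (induction Rs arbitrary: a)
  case Nil
  then show ?case using rec_top rec_bot by (cases "a = 0") (simp_all add: lam_def[abs_def])
next
  case (Cons R Rs)
  show ?case
  proof (cases a)
    case 0
    have "lam (R # Rs) 0 = R" by (intro ext) (simp add: lam_def)
    then show ?thesis using Cons.prems 0 by simp
  next
    case (Suc a')
    have "lam (R # Rs) (Suc a') = (%w so. \<not> R w so \<and> lam Rs a' w so)" by (intro ext) (simp add: lam_def)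
    then show ?thesis using Cons Suc by (auto intro!: rec_conj rec_neg)
  qed
qed

lemma trl_list: "\<forall>g\<in>set fs. trl g ==> \<exists>Rs. (\<forall>R\<in>set Rs. rec R) \<and>
    (\<forall>w fo so. ok_env w fo so --> map (%R. R w (comb fo so)) Rs = map (%g. sat w fo so g) fs)"
proof (induction fs)
  case (Cons f fs)
  then obtain R Rs where "rec R" "\<forall>w fo so. ok_env w fo so --> R w (comb fo so) = sat w fo so f"
    "\<forall>R\<in>set Rs. rec R" "\<forall>w fo so. ok_env w fo so --> map (%R. R w (comb fo so)) Rs = map (%g. sat w fo so g) fs"
    by (auto simp: trl_def)
  then show ?case by (intro exI[of _ "R # Rs"]) auto
next
  case Nil
  show ?case by (intro exI[of _ "[]"]) simp
qed

lemma comb_upds: "length As = length Xs ==> upds (comb fo so) (map ((*) 3) Xs) As = comb fo (upds so Xs As)"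
  by (induction As Xs arbitrary: so rule: list_induct2) (auto simp: upds_Nil upds_Cons simp flip: comb_upd)

text \<open>Leaves to \<open>main\<close> only the question which vectors of letter counts belong to
  \<open>L\<close>; the conditions for the letters reach it as arbitrary relations
  \<open>R a\<close>.\<close>

lemma trl_QStar:
  assumes fs: "\<forall>g\<in>set fs. trl g" "length fs = s - 1" "1 \<le> s" and L: "symmetric_lang L" and Xs: "distinct Xs"
    and main: "\<And>R. (\<And>a. rec (R a)) ==> \<exists>S. rec S \<and> (\<forall>w so u. in_range w so --> u \<in> lists {..<s} -->
       (\<forall>a. count (mset u) a = kap (map ((*) 3) Xs) (R a) w so) --> (u \<in> L \<longleftrightarrow> S w so))"
  shows "trl (QStar s L Xs fs)"
proof -
  obtain Rs where Rs: "\<forall>R\<in>set Rs. rec R" "\<And>w fo so. ok_env w fo so ==> map (%R. R w (comb fo so)) Rs = map (%g. sat w fo so g) fs"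
    using trl_list[OF fs(1)] by blast
  obtain S where S: "rec S" "\<And>w so u. in_range w so ==> u \<in> lists {..<s} ==>
       (\<forall>a. count (mset u) a = kap (map ((*) 3) Xs) (lam Rs a) w so) ==> (u \<in> L \<longleftrightarrow> S w so)"
    using main[of "lam Rs"] rec_lam[OF Rs(1)] by blast
  have "S w (comb fo so) = sat w fo so (QStar s L Xs fs)" if ok: "ok_env w fo so" for w fo so
  proof -
    obtain u where u: "u \<in> lists {..<s}" "sat w fo so (QStar s L Xs fs) \<longleftrightarrow> u \<in> L"
      "\<And>a. count (mset u) a = card {As \<in> tuples (length w) (length Xs). letter w fo fs (upds so Xs As) = a}"
      using sat_QStar_counts[OF L fs(2,3), of w fo so Xs] by blast
    have "kap (map ((*) 3) Xs) (lam Rs a) w (comb fo so) = count (mset u) a" for a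
    proof -
      have "lam Rs a w (upds (comb fo so) (map ((*) 3) Xs) As) \<longleftrightarrow> letter w fo fs (upds so Xs As) = a"
        if As: "As \<in> tuples (length w) (length Xs)" for As
      proof -
        have "ok_env w fo (upds so Xs As)" using ok As in_range_upds by (auto simp: ok_env_def)
        moreover have "length As = length Xs" using As by (simp add: tuples_def)
        ultimately show ?thesis using Rs(2)[of w fo "upds so Xs As"] by (simp add: lam_def letter_def comb_upds)
      qed
      then show ?thesis unfolding u(3) kap_def length_map by (intro arg_cong[where f = card] Collect_cong conj_cong refl)
    qed
    then show ?thesis using S(2)[OF comb_in_range[OF ok] u(1)] u(2) by simp
  qed
  then show ?thesis unfolding trl_def using S(1) by blast
qed

end

text \<open>The fragment that any counting modes can translate. The product is later defined inside
  it and is thereby translated as well.\<close>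

fun basic :: "fm => bool" where
  "basic (Times _ _ _) = False"
| "basic (QStar _ _ _ _) = False"
| "basic (Neg f) = basic f"
| "basic (Conj f g) = (basic f \<and> basic g)"
| "basic (Disj f g) = (basic f \<and> basic g)"
| "basic (Ex _ f) = basic f"
| "basic (All _ f) = basic f"
| "basic (ExS _ f) = basic f"
| "basic (AllS _ f) = basic f"
| "basic _ = True"

lemma lin_class_mono: "Os \<subseteq> Os' ==> lin_class md Os \<subseteq> lin_class md Os'"
  unfolding lin_class_def by blast

context counting_modes
begin

lemma trl_basic: "basic f ==> trl f"
  by (induction f) (auto intro: trl_atoms trl_neg trl_conj trl_disj trl_ex trl_exS trl_all)

lemma trl_in_logic:
  assumes times: "\<And>a b c. ar ==> trl (Times a b c)"
    and q: "\<And>s L Xs fs. al s L ==> 1 \<le> s ==> length fs = s - 1 ==> distinct Xs ==> \<forall>g\<in>set fs. trl g ==> trl (QStar s L Xs fs)"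
  shows "in_logic ar al f ==> trl f"
proof (induction f)
  case (QStar s L Xs fs)
  then show ?case by (intro q) (auto simp: list_all_iff)
qed (auto intro: trl_atoms trl_neg trl_conj trl_disj trl_ex trl_exS trl_all times)

text \<open>\<open>isat\<close> starts with empty sets, whereas \<open>comb\<close> assigns the
  singleton of 0 to every element variable. The finitely many of them that matter are quantified and
  forced to be that singleton.\<close>

lemma trl_isat:
  assumes "trl f"
  shows "\<exists>g. iwf Md g \<and> (\<forall>w. w \<noteq> [] --> isat w (%_. {}) g = sat w (%_. 0) (%_. {}) f)"
proof -
  obtain R where R: "rec R" "\<And>w fo so. ok_env w fo so ==> R w (comb fo so) = sat w fo so f" using assms by (auto simp: trl_def)
  obtain v where v: "\<And>w so so'. in_range w so ==> in_range w so' ==> (\<forall>X<v. so X = so' X) ==> R w so = R w so'"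
    using rec_fresh[OF R(1)] by blast
  define Xs where "Xs = map (%i. 3 * i + 1) [0..<v]"
  have d: "distinct Xs" by (simp add: Xs_def distinct_map inj_on_def)
  let ?P = "%w so. (\<forall>X\<in>set Xs. so X = {0}) \<and> R w so"
  have "rec ?P" using rec_ball[of "set Xs" "%X w so. so X = {0}"] rec_zero R(1) by (intro rec_conj) auto
  then have "rec (%w so. \<exists>As\<in>tuples (length w) (length Xs). ?P w (upds so Xs As))" by (intro rec_exs d)
  then obtain g where g: "iwf Md g" "\<And>w so. in_range w so ==> isat w so g = (\<exists>As\<in>tuples (length w) (length Xs). ?P w (upds so Xs As))"
    unfolding rec_def by blast
  have "isat w (%_. {}) g = sat w (%_. 0) (%_. {}) f" if w: "w \<noteq> []" for w
  proof -
    let ?c = "comb (%_. 0) (%_. {})"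
    have ok: "ok_env w (%_. 0) (%_. {})" and rg: "in_range w (%_. {})" using w by (auto simp: ok_env_def in_range_def)
    have eq: "R w (upds (%_. {}) Xs As) = R w ?c" if "As \<in> tuples (length w) (length Xs)" "\<forall>X\<in>set Xs. upds (%_. {}) Xs As X = {0}" for As
    proof (rule v[OF in_range_upds[OF rg that(1)] comb_in_range[OF ok]], intro allI impI)
      fix X assume X: "X < v"
      show "upds (%_. {}) Xs As X = ?c X"
      proof (cases "X mod 3 = 1")
        case True
        then have "X = 3 * (X div 3) + 1" "X div 3 < v" using X by presburger+
        then have "X \<in> set Xs" unfolding Xs_def set_map by (intro image_eqI[of _ _ "X div 3"]) auto
        then show ?thesis using that(2) True by (simp add: comb_def)
      next
        case False
        have "(3 * i + 1) mod 3 = 1" for i :: nat by presburger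
        then have "X \<notin> set Xs" using False by (auto simp: Xs_def)
        then show ?thesis using False by (simp add: upds_notin comb_def)
      qed
    qed
    let ?As = "replicate (length Xs) {0::nat}"
    have As: "?As \<in> tuples (length w) (length Xs)" using w by (auto simp: tuples_def)
    have "\<forall>X\<in>set Xs. upds (%_. {}) Xs ?As X = {0}" using upds_nth[of ?As Xs] d by (auto simp: in_set_conv_nth)
    then have "isat w (%_. {}) g = R w ?c" unfolding g(2)[OF rg] using eq As by blast
    then show ?thesis using R(2)[OF ok] by simp
  qed
  then show ?thesis using g(1) by blast
qed

text \<open>Membership depends only on the vector of classes of the letter counts, of which there
  are finitely many; the formula is a disjunction over the vectors of words in
  \<open>L\<close>.\<close>

lemma trl_QStar_REG:
  assumes md: "\<And>p. 1 < p ==> ModPm p \<in> Md" and L: "REG_sym s L"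
    and fs: "\<forall>g\<in>set fs. trl g" "length fs = s - 1" "1 \<le> s" "distinct Xs"
  shows "trl (QStar s L Xs fs)"
proof (rule trl_QStar[OF fs(1-3) _ fs(4)])
  show "symmetric_lang L" using L by (simp add: REG_sym_def)
  fix R :: "nat => nat list => (nat => nat set) => bool" assume R: "\<And>a. rec (R a)"
  obtain N p where p: "1 < p" and sim: "\<And>v w. v \<in> lists {..<s} ==> w \<in> lists {..<s} ==>
    (\<forall>a<s. count_sim N p (count (mset v) a) (count (mset w) a)) ==> (v \<in> L \<longleftrightarrow> w \<in> L)"
    using REG_sym_count_sim[OF L] by blast
  define cl where "cl c = (if c < N then c else N + (c - N) mod p)" for c
  have cl_sim: "count_sim N p c d" if "cl c = cl d" for c d
  proof (cases "c < N \<or> d < N")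
    case True
    then show ?thesis using that by (auto simp: cl_def count_sim_def split: if_splits)
  next
    case False
    then have "(c - N) mod p = (d - N) mod p" using that by (simp add: cl_def)
    then have "((c - N) + N) mod p = ((d - N) + N) mod p" by (simp only: mod_add_right_cancel)
    then show ?thesis using False by (simp add: count_sim_def)
  qed
  have cl_less: "cl c < N + p" for c using p by (auto simp: cl_def)
  define P where "P = (%v. map (%a. cl (count (mset v) a)) [0..<s]) ` L"
  have "P \<subseteq> {xs. set xs \<subseteq> {..<N + p} \<and> length xs = s}" using cl_less by (auto simp: P_def)
  then have finP: "finite P" by (rule finite_subset) (simp add: finite_lists_length_eq)
  let ?Xs = "map ((*) 3) Xs"
  let ?S = "%w so. \<exists>r\<in>P. \<forall>a\<in>{..<s}. cl (kap ?Xs (R a) w so) = r ! a"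
  have d: "distinct ?Xs" using fs(4) by (simp add: distinct_map inj_on_def)
  have "rec ?S" unfolding cl_def
    using rec_count_class[OF md[OF p] p d R] by (intro rec_bex[OF finP] rec_ball finite_lessThan) simp
  moreover have "u \<in> L \<longleftrightarrow> ?S w so" if u: "u \<in> lists {..<s}" "\<forall>a. count (mset u) a = kap ?Xs (R a) w so" for w so u
  proof
    assume "u \<in> L"
    then show "?S w so" unfolding P_def using u(2) by (intro bexI[OF _ imageI[of u]]) auto
  next
    assume "?S w so"
    then obtain v where v: "v \<in> L" "\<forall>a<s. cl (kap ?Xs (R a) w so) = cl (count (mset v) a)" by (auto simp: P_def)
    have "v \<in> lists {..<s}" using v(1) L by (auto simp: REG_sym_def regular_lang_def)
    then show "u \<in> L" using sim[OF u(1), of v] v u(2) cl_sim by simp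
  qed
  ultimately show "\<exists>S. rec S \<and> (\<forall>w so u. in_range w so --> u \<in> lists {..<s} -->
       (\<forall>a. count (mset u) a = kap ?Xs (R a) w so) --> (u \<in> L \<longleftrightarrow> S w so))" by blast
qed

text \<open>Symmetry makes membership a property of the Parikh vector, which has to lie in one of
  finitely many linear sets; each of these is handled by \<open>rec_linear\<close>.\<close>

lemma trl_QStar_CFL:
  assumes md: "PPm \<in> Md" and L: "CFL_sym s L"
    and fs: "\<forall>g\<in>set fs. trl g" "length fs = s - 1" "1 \<le> s" "distinct Xs"
  shows "trl (QStar s L Xs fs)"
proof (rule trl_QStar[OF fs(1-3) _ fs(4)])
  show sym: "symmetric_lang L" using L by (simp add: CFL_sym_def)
  fix R :: "nat => nat list => (nat => nat set) => bool" assume R: "\<And>a. rec (R a)"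
  have "context_free_lang s L" using L by (simp add: CFL_sym_def)
  from parikh[OF this] obtain F where F: "finite F"
    "\<forall>(b, ps)\<in>F. (\<forall>a\<ge>s. b a = 0) \<and> (\<forall>p\<in>set ps. (\<exists>a<s. p a \<noteq> 0) \<and> (\<forall>a\<ge>s. p a = 0))"
    "\<forall>w\<in>lists {..<s}. (\<exists>v\<in>L. mset v = mset w) \<longleftrightarrow> (\<exists>(b, ps)\<in>F. count (mset w) \<in> linear_set b ps)" by blast
  let ?Xs = "map ((*) 3) Xs"
  have d: "distinct ?Xs" using fs(4) by (simp add: distinct_map inj_on_def)
  let ?T = "%r w so. \<exists>ns. length ns = length (snd r) \<and> (\<forall>a<s. kap ?Xs (R a) w so = fst r a + (\<Sum>i<length (snd r). ns!i * (snd r!i) a))"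
  let ?S = "%w so. \<exists>r\<in>F. ?T r w so"
  have "rec (?T r)" if "r \<in> F" for r
    using F(2) that by (intro rec_linear[OF md d R]) fastforce
  then have "rec ?S" by (intro rec_bex[OF F(1)])
  moreover have "u \<in> L \<longleftrightarrow> ?S w so" if u: "u \<in> lists {..<s}" "\<forall>a. count (mset u) a = kap ?Xs (R a) w so" for w so u
  proof -
    have "u \<in> L \<longleftrightarrow> (\<exists>v\<in>L. mset v = mset u)" using sym unfolding symmetric_lang_def by metis
    also have "\<dots> \<longleftrightarrow> (\<exists>r\<in>F. count (mset u) \<in> linear_set (fst r) (snd r))"
      using F(3) u(1) by (auto simp: case_prod_unfold)
    also have "\<dots> \<longleftrightarrow> ?S w so"
    proof (intro bex_cong refl)
      fix r assume r: "r \<in> F"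
      have z: "fst r a = 0" "(\<Sum>i<length (snd r). ns!i * (snd r!i) a) = 0" if "a \<ge> s" for a and ns :: "nat list"
        using F(2) r that by (auto simp: case_prod_unfold)
      have c0: "count (mset u) a = 0" if "a \<ge> s" for a using u(1) that by (auto simp: count_eq_zero_iff)
      have "(\<forall>a. count (mset u) a = fst r a + (\<Sum>i<length (snd r). ns!i * (snd r!i) a)) \<longleftrightarrow>
         (\<forall>a<s. kap ?Xs (R a) w so = fst r a + (\<Sum>i<length (snd r). ns!i * (snd r!i) a))" for ns
        unfolding u(2)[rule_format, symmetric] using z c0 by (metis add_0 not_less)
      then show "(count (mset u) \<in> linear_set (fst r) (snd r)) = ?T r w so" unfolding linear_set_def by simp
    qed
    finally show ?thesis .
  qed
  ultimately show "\<exists>S. rec S \<and> (\<forall>w so u. in_range w so --> u \<in> lists {..<s} -->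
       (\<forall>a. count (mset u) a = kap ?Xs (R a) w so) --> (u \<in> L \<longleftrightarrow> S w so))" by blast
qed

end

lemma definable_in_hierarchy:
  assumes "counting_modes Md" and f: "counting_modes.trl Md f"
    and L: "L = {w \<in> lists {..<s}. w \<noteq> [] \<and> sat w (%_. 0) (%_. {}) f}"
    and md0: "em \<in> Md" and md: "\<And>md. md \<in> Md ==> mode_accepts md 1 0 \<and> \<not> mode_accepts md 0 1"
    and lev0: "(1, {}) \<in> lev 0" and lev: "\<And>p k md. p \<in> lev k ==> md \<in> Md ==> lin_class md {p} \<subseteq> lev (Suc k)"
  shows "\<exists>k. (s, L) \<in> lev (Suc k)"
proof -
  interpret counting_modes Md by fact
  obtain g where g: "iwf Md g" "\<And>w. w \<noteq> [] ==> isat w (%_. {}) g = sat w (%_. 0) (%_. {}) f"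
    using trl_isat[OF f] by blast
  have L': "L = {w \<in> lists {..<s}. w \<noteq> [] \<and> isat w (%_. {}) g}" using g(2) L by auto
  show ?thesis unfolding L'
    by (rule ifm_definable_in_level[where lev = lev]; fact g(1) md0 md lev0 lev)
qed

lemma counting_modes_PP: "counting_modes {PPm}"
  by unfold_locales simp

lemma counting_modes_MOD: "counting_modes (insert NPm (ModPm ` {q. 1 < q}))"
  by unfold_locales simp

theorem definable_CFL_in_CH:
  assumes "definable False CFL_sym s L"
  shows "(s, L) \<in> LIN_CH"
proof -
  interpret counting_modes "{PPm}" by (rule counting_modes_PP)
  obtain f where f: "in_logic False CFL_sym f" "L = {w \<in> lists {..<s}. w \<noteq> [] \<and> sat w (%_. 0) (%_. {}) f}"
    using assms by (auto simp: definable_def)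
  have "trl f" using f(1) by (rule trl_in_logic[rotated 2]) (auto intro: trl_QStar_CFL)
  then have "\<exists>k. (s, L) \<in> CH_level (Suc k)"
  proof (rule definable_in_hierarchy[OF counting_modes_PP _ f(2), where em = PPm])
    fix p k md assume "p \<in> CH_level k" "md \<in> {PPm}"
    then show "lin_class md {p} \<subseteq> CH_level (Suc k)" using lin_class_mono[of "{p}" "CH_level k" PPm] by simp
  qed auto
  then show ?thesis by (auto simp: LIN_CH_def)
qed

text \<open>The product is no atom of the counting logic. Its translation is a hypothesis here
  because it rests on definable iteration, which is developed below.\<close>

theorem definable_REG_in_MODPH:
  assumes "definable True REG_sym s L"
    and times: "\<And>a b c. counting_modes.trl (insert NPm (ModPm ` {q. 1 < q})) (Times a b c)"
  shows "(s, L) \<in> LIN_MODPH"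
proof -
  interpret counting_modes "insert NPm (ModPm ` {q. 1 < q})" by (rule counting_modes_MOD)
  obtain f where f: "in_logic True REG_sym f" "L = {w \<in> lists {..<s}. w \<noteq> [] \<and> sat w (%_. 0) (%_. {}) f}"
    using assms(1) by (auto simp: definable_def)
  have "trl f" using f(1)
  proof (rule trl_in_logic[rotated 2])
    show "trl (Times a b c)" for a b c by (rule times)
    show "trl (QStar s L Xs fs)" if "REG_sym s L" "1 \<le> s" "length fs = s - 1" "distinct Xs" "\<forall>g\<in>set fs. trl g" for s L Xs fs
      using that by (intro trl_QStar_REG) auto
  qed
  then have "\<exists>k. (s, L) \<in> MODPH_level (Suc k)"
  proof (rule definable_in_hierarchy[OF counting_modes_MOD _ f(2), where em = NPm])
    fix p k md assume p: "p \<in> MODPH_level k" and md: "md \<in> insert NPm (ModPm ` {q. 1 < q})"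
    have "lin_class md {p} \<subseteq> lin_class md (bool_closure (MODPH_level k))"
      using p by (intro lin_class_mono) (auto intro: bc_base)
    then show "lin_class md {p} \<subseteq> MODPH_level (Suc k)" using md by auto
  qed auto
  then show ?thesis by (auto simp: LIN_MODPH_def)
qed

subsection \<open>Definability over an enlarged universe\<close>

text \<open>A relation \<open>R\<close> on contexts is definable from number-valued terms \<open>Ts\<close> and set-valued terms
  \<open>Bs\<close> over the universe \<open>{0..<K * n}\<close>.  Elements are represented by a block number, fixed
  by \<open>\<beta>\<close> outside of the formula, and an offset \<open>< n\<close>; a set is represented by its \<open>K\<close> blocks.\<close>

definition fenv :: "nat => ('c => nat) list => 'c => nat => nat" where
  "fenv n Ts c = (%i. if i < length Ts then (Ts ! i) c mod n else 0)"

text \<open>A set variable is the code of a pair: the index of a set term and the number of one of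
  its blocks.\<close>

definition senv :: "nat => ('c => nat set) list => 'c => nat => nat set" where
  "senv n Bs c = (%v. if fst (prod_decode v) < length Bs
     then {i. i < n \<and> snd (prod_decode v) * n + i \<in> (Bs ! fst (prod_decode v)) c} else {})"

definition gd :: "nat => ('c => nat list) => ('c => nat) list => ('c => nat set) list => 'c => bool" where
  "gd K W Ts Bs c \<longleftrightarrow> W c \<noteq> [] \<and> (\<forall>t\<in>set Ts. t c < K * length (W c)) \<and> (\<forall>B\<in>set Bs. B c \<subseteq> {..<K * length (W c)})"

text \<open>A common interface to the logics in which iterations and machines are described.
  Addition is demanded semantically because one of these logics has only the order built in.\<close>

locale flogic =
  fixes G :: "fm => bool" and Md :: "mode set"
  assumes G_atoms: "G (Eq a b)" "G (Lt a b)" "G (Pr l a)" "G (Mem X a)"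
    and G_bool: "G f ==> G (Neg f)" "G f ==> G g ==> G (Conj f g)" "G f ==> G g ==> G (Disj f g)"
    and G_ex: "G f ==> G (Ex i f)"
    and G_plus: "\<exists>f. G f \<and> fv_fo f \<subseteq> {i, j, k} \<and>
       (\<forall>w fo so. fo i < length w --> fo j < length w --> fo k < length w --> sat w fo so f = (fo i + fo j = fo k))"
    and G_cnt: "md \<in> Md ==> G f ==> G g ==> distinct Xs ==> Xs \<noteq> [] ==>
       \<exists>h. G h \<and> fv_fo h \<subseteq> fv_fo f \<union> fv_fo g \<and>
       (\<forall>w fo so. w \<noteq> [] --> sat w fo so h = mode_accepts md
          (card {As \<in> tuples (length w) (length Xs). sat w fo (upds so Xs As) f})
          (card {As \<in> tuples (length w) (length Xs). sat w fo (upds so Xs As) g}))"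
    and NPm: "NPm \<in> Md"
begin

text \<open>\<open>I\<close> is a promise: the formula has to be right only for contexts satisfying
  it. The formula may depend on the block numbers \<beta>, but on nothing else of the
  context.\<close>

definition Dfor :: "nat => ('c => nat list) => ('c => bool) => ('c => nat) list => ('c => nat set) list => ('c => bool) => nat list => fm => bool" where
  "Dfor K W I Ts Bs R \<beta> f \<longleftrightarrow> G f \<and> fv_fo f \<subseteq> {..<length Ts} \<and>
     (\<forall>c. I c --> gd K W Ts Bs c --> (\<forall>i<length Ts. (Ts ! i) c div length (W c) = \<beta> ! i) -->
        sat (W c) (fenv (length (W c)) Ts c) (senv (length (W c)) Bs c) f = R c)"

definition D :: "nat => ('c => nat list) => ('c => bool) => ('c => nat) list => ('c => nat set) list => ('c => bool) => bool" where
  "D K W I Ts Bs R \<longleftrightarrow> (\<forall>\<beta>. length \<beta> = length Ts --> set \<beta> \<subseteq> {..<K} --> (\<exists>f. Dfor K W I Ts Bs R \<beta> f))"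

lemma DI: "(\<And>\<beta>. length \<beta> = length Ts ==> set \<beta> \<subseteq> {..<K} ==> \<exists>f. Dfor K W I Ts Bs R \<beta> f) ==> D K W I Ts Bs R"
  unfolding D_def by blast

lemma DE: "D K W I Ts Bs R ==> length \<beta> = length Ts ==> set \<beta> \<subseteq> {..<K} ==> (\<And>f. Dfor K W I Ts Bs R \<beta> f ==> P) ==> P"
  unfolding D_def by blast

lemma D_cong:
  assumes "D K W I Ts Bs R" "\<And>c. I' c ==> gd K W Ts Bs c ==> I c \<and> R c = R' c"
  shows "D K W I' Ts Bs R'"
proof (rule DI)
  fix \<beta> assume b: "length \<beta> = length Ts" "set \<beta> \<subseteq> {..<K}"
  obtain f where "Dfor K W I Ts Bs R \<beta> f" using DE[OF assms(1) b] .
  then have "Dfor K W I' Ts Bs R' \<beta> f" using assms(2) unfolding Dfor_def by metis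
  then show "\<exists>f. Dfor K W I' Ts Bs R' \<beta> f" ..
qed

lemma D_eq_cong: "D K W I Ts Bs R ==> (\<And>c. I c ==> gd K W Ts Bs c ==> R c = R' c) ==> D K W I Ts Bs R'"
  by (erule D_cong) blast

lemma D_K: assumes "D K' W I Ts Bs R" "K \<le> K'" shows "D K W I Ts Bs R"
proof (rule DI)
  fix \<beta> assume b: "length \<beta> = length Ts" "set \<beta> \<subseteq> {..<K}"
  then have "set \<beta> \<subseteq> {..<K'}" using assms(2) by auto
  with assms(1) b(1) obtain f where f: "Dfor K' W I Ts Bs R \<beta> f" by (rule DE)
  have "gd K' W Ts Bs c" if "gd K W Ts Bs c" for c
  proof -
    have "K * length (W c) \<le> K' * length (W c)" using assms(2) by simp
    then show ?thesis using that unfolding gd_def by (metis lessThan_subset_iff order_less_le_trans subset_trans)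
  qed
  then have "Dfor K W I Ts Bs R \<beta> f" using f unfolding Dfor_def by blast
  then show "\<exists>f. Dfor K W I Ts Bs R \<beta> f" ..
qed

lemma D_neg: assumes "D K W I Ts Bs R" shows "D K W I Ts Bs (%c. \<not> R c)"
proof (rule DI)
  fix \<beta> assume b: "length \<beta> = length Ts" "set \<beta> \<subseteq> {..<K}"
  obtain f where "Dfor K W I Ts Bs R \<beta> f" using DE[OF assms(1) b] .
  then have "Dfor K W I Ts Bs (%c. \<not> R c) \<beta> (Neg f)" unfolding Dfor_def by (auto intro: G_bool)
  then show "\<exists>f. Dfor K W I Ts Bs (%c. \<not> R c) \<beta> f" ..
qed

text \<open>The second conjunct may rely on the first. In this way a guessed object, such as a
  square or a partition, is checked once and then serves as a promise.\<close>

lemma D_conj: assumes "D K W I Ts Bs R" "D K W (%c. I c \<and> R c) Ts Bs S" shows "D K W I Ts Bs (%c. R c \<and> S c)"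
proof (rule DI)
  fix \<beta> assume b: "length \<beta> = length Ts" "set \<beta> \<subseteq> {..<K}"
  obtain f where f: "Dfor K W I Ts Bs R \<beta> f" using DE[OF assms(1) b] .
  obtain g where g: "Dfor K W (%c. I c \<and> R c) Ts Bs S \<beta> g" using DE[OF assms(2) b] .
  from f g have "Dfor K W I Ts Bs (%c. R c \<and> S c) \<beta> (Conj f g)" unfolding Dfor_def by (auto intro: G_bool)
  then show "\<exists>f. Dfor K W I Ts Bs (%c. R c \<and> S c) \<beta> f" ..
qed

lemma D_inv: "D K W I Ts Bs R ==> D K W (%c. I c \<and> J c) Ts Bs R"
  by (erule D_cong) blast

lemma D_disj: "D K W I Ts Bs R ==> D K W I Ts Bs S ==> D K W I Ts Bs (%c. R c \<or> S c)"
  using D_neg[OF D_conj[OF D_neg D_inv[OF D_neg]]] by simp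

lemma D_imp: "D K W I Ts Bs R ==> D K W (%c. I c \<and> R c) Ts Bs S ==> D K W I Ts Bs (%c. R c --> S c)"
proof -
  assume "D K W I Ts Bs R" "D K W (%c. I c \<and> R c) Ts Bs S"
  from D_neg[OF D_conj[OF this(1) D_neg[OF this(2)]]] show ?thesis by simp
qed

lemma D_iff: "D K W I Ts Bs R ==> D K W I Ts Bs S ==> D K W I Ts Bs (%c. R c \<longleftrightarrow> S c)"
  by (rule D_eq_cong[OF D_conj[OF D_imp[OF _ D_inv] D_inv[OF D_imp[OF _ D_inv]]], of _ _ _ _ _ R S S R]) blast+

lemma D_const: "D K W I Ts Bs (%_. b)"
proof (rule DI)
  fix \<beta>
  have "Dfor K W I Ts Bs (%_. b) \<beta> (if b then Eq TMin TMin else Neg (Eq TMin TMin))"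
    unfolding Dfor_def by (auto intro: G_bool G_atoms)
  then show "\<exists>f. Dfor K W I Ts Bs (%_. b) \<beta> f" ..
qed

lemma D_ball: "finite A ==> (\<And>a. a \<in> A ==> D K W I Ts Bs (R a)) ==> D K W I Ts Bs (%c. \<forall>a\<in>A. R a c)"
  by (induction A rule: finite_induct) (auto intro: D_conj D_inv D_const)

lemma D_bex: "finite A ==> (\<And>a. a \<in> A ==> D K W I Ts Bs (R a)) ==> D K W I Ts Bs (%c. \<exists>a\<in>A. R a c)"
  by (induction A rule: finite_induct) (auto intro: D_disj D_const)

lemma D_atom:
  assumes "\<And>\<beta>. length \<beta> = length Ts ==> set \<beta> \<subseteq> {..<K} ==> \<exists>f. G f \<and> fv_fo f \<subseteq> {..<length Ts} \<and>
     (\<forall>c fo so n. n = length (W c) --> n > 0 --> gd K W Ts Bs c --> fo = fenv n Ts c --> so = senv n Bs c -->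
       (\<forall>i<length Ts. (Ts ! i) c = \<beta> ! i * n + fo i \<and> fo i < n) --> sat (W c) fo so f = R c)"
  shows "D K W I Ts Bs R"
proof (rule DI)
  fix \<beta> assume b: "length \<beta> = length Ts" "set \<beta> \<subseteq> {..<K}"
  from assms[OF b] obtain f where f: "G f" "fv_fo f \<subseteq> {..<length Ts}"
    "\<And>c fo so n. n = length (W c) ==> n > 0 ==> gd K W Ts Bs c ==> fo = fenv n Ts c ==> so = senv n Bs c ==>
       (\<forall>i<length Ts. (Ts ! i) c = \<beta> ! i * n + fo i \<and> fo i < n) ==> sat (W c) fo so f = R c" by blast
  have "sat (W c) (fenv (length (W c)) Ts c) (senv (length (W c)) Bs c) f = R c"
    if c: "gd K W Ts Bs c" "\<forall>i<length Ts. (Ts ! i) c div length (W c) = \<beta> ! i" for c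
  proof (rule f(3))
    show n0: "0 < length (W c)" using c(1) by (simp add: gd_def)
    show "\<forall>i<length Ts. (Ts ! i) c = \<beta> ! i * length (W c) + fenv (length (W c)) Ts c i \<and> fenv (length (W c)) Ts c i < length (W c)"
      using n0 c(2) by (auto simp: fenv_def) (metis div_mult_mod_eq)
  qed (use c in auto)
  then have "Dfor K W I Ts Bs R \<beta> f" using f(1,2) unfolding Dfor_def by blast
  then show "\<exists>f. Dfor K W I Ts Bs R \<beta> f" ..
qed

lemma block_less: "i < n ==> j < n ==> a * n + i < b * n + j \<longleftrightarrow> a < b \<or> a = b \<and> i < (j::nat)"
proof -
  assume ij: "i < n" "j < n"
  have "a * n + i < b * n + j" if "a < b" "i < n" for a b i j :: nat
  proof -
    have "a * n + i < Suc a * n" using that by simp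
    also have "\<dots> \<le> b * n" using that by (intro mult_le_mono1) simp
    finally show ?thesis by simp
  qed
  from this[of a b i j] this[of b a j i] ij show ?thesis by (cases a b rule: linorder_cases) auto
qed

lemma block_eq: "i < n ==> j < n ==> a * n + i = b * n + j \<longleftrightarrow> a = b \<and> i = (j::nat)"
  using block_less[of i n j a b] block_less[of j n i b a] by (cases a b rule: linorder_cases) auto

lemma D_less: assumes "t \<in> set Ts" "u \<in> set Ts" shows "D K W I Ts Bs (%c. t c < u c)"
proof (rule D_atom)
  fix \<beta> :: "nat list"
  obtain i j where ij: "i < length Ts" "Ts ! i = t" "j < length Ts" "Ts ! j = u" using assms by (auto simp: in_set_conv_nth)
  show "\<exists>f. G f \<and> fv_fo f \<subseteq> {..<length Ts} \<and>
     (\<forall>c fo so n. n = length (W c) --> n > 0 --> gd K W Ts Bs c --> fo = fenv n Ts c --> so = senv n Bs c -->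
       (\<forall>i<length Ts. (Ts ! i) c = \<beta> ! i * n + fo i \<and> fo i < n) --> sat (W c) fo so f = (t c < u c))"
    using ij block_less
    by (intro exI[of _ "if \<beta>!i < \<beta>!j then Eq TMin TMin else if \<beta>!i = \<beta>!j then Lt (V i) (V j) else Neg (Eq TMin TMin)"])
       (auto intro: G_atoms G_bool)
qed

lemma D_eq: assumes "t \<in> set Ts" "u \<in> set Ts" shows "D K W I Ts Bs (%c. t c = u c)"
  by (rule D_eq_cong[OF D_conj[OF D_neg[OF D_less[OF assms]] D_inv[OF D_neg[OF D_less[OF assms(2,1)]]]]]) auto

lemma D_less_const: assumes "t \<in> set Ts" shows "D K W I Ts Bs (%c. t c < k * length (W c))"
proof (rule D_atom)
  fix \<beta> :: "nat list"
  obtain i where i: "i < length Ts" "Ts ! i = t" using assms by (auto simp: in_set_conv_nth)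
  show "\<exists>f. G f \<and> fv_fo f \<subseteq> {..<length Ts} \<and>
     (\<forall>c fo so n. n = length (W c) --> n > 0 --> gd K W Ts Bs c --> fo = fenv n Ts c --> so = senv n Bs c -->
       (\<forall>i<length Ts. (Ts ! i) c = \<beta> ! i * n + fo i \<and> fo i < n) --> sat (W c) fo so f = (t c < k * length (W c)))"
    using i block_less[of _ _ 0 _ k]
    by (intro exI[of _ "if \<beta>!i < k then Eq TMin TMin else Neg (Eq TMin TMin)"]) (auto intro: G_atoms G_bool)
qed

lemma D_zero: assumes "t \<in> set Ts" shows "D K W I Ts Bs (%c. t c = 0)"
proof (rule D_atom)
  fix \<beta> :: "nat list"
  obtain i where i: "i < length Ts" "Ts ! i = t" using assms by (auto simp: in_set_conv_nth)
  show "\<exists>f. G f \<and> fv_fo f \<subseteq> {..<length Ts} \<and>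
     (\<forall>c fo so n. n = length (W c) --> n > 0 --> gd K W Ts Bs c --> fo = fenv n Ts c --> so = senv n Bs c -->
       (\<forall>i<length Ts. (Ts ! i) c = \<beta> ! i * n + fo i \<and> fo i < n) --> sat (W c) fo so f = (t c = 0))"
    using i by (intro exI[of _ "if \<beta>!i = 0 then Eq (V i) TMin else Neg (Eq TMin TMin)"]) (auto intro: G_atoms G_bool)
qed

lemma D_letter: assumes "t \<in> set Ts" shows "D K W I Ts Bs (%c. t c < length (W c) \<and> W c ! t c = a)"
proof (rule D_atom)
  fix \<beta> :: "nat list"
  obtain i where i: "i < length Ts" "Ts ! i = t" using assms by (auto simp: in_set_conv_nth)
  show "\<exists>f. G f \<and> fv_fo f \<subseteq> {..<length Ts} \<and>
     (\<forall>c fo so n. n = length (W c) --> n > 0 --> gd K W Ts Bs c --> fo = fenv n Ts c --> so = senv n Bs c -->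
       (\<forall>i<length Ts. (Ts ! i) c = \<beta> ! i * n + fo i \<and> fo i < n) --> sat (W c) fo so f = (t c < length (W c) \<and> W c ! t c = a))"
  proof -
    have "0 < b ==> \<not> b * n + x < n" for b n x :: nat by (cases b) auto
    then show ?thesis using i
      by (intro exI[of _ "if \<beta>!i = 0 then Pr a (V i) else Neg (Eq TMin TMin)"]) (auto intro: G_atoms G_bool)
  qed
qed

lemma D_mem: assumes "t \<in> set Ts" "B \<in> set Bs" shows "D K W I Ts Bs (%c. t c \<in> B c)"
proof (rule D_atom)
  fix \<beta> :: "nat list"
  obtain i j where ij: "i < length Ts" "Ts ! i = t" "j < length Bs" "Bs ! j = B" using assms by (auto simp: in_set_conv_nth)
  show "\<exists>f. G f \<and> fv_fo f \<subseteq> {..<length Ts} \<and>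
     (\<forall>c fo so n. n = length (W c) --> n > 0 --> gd K W Ts Bs c --> fo = fenv n Ts c --> so = senv n Bs c -->
       (\<forall>i<length Ts. (Ts ! i) c = \<beta> ! i * n + fo i \<and> fo i < n) --> sat (W c) fo so f = (t c \<in> B c))"
    using ij by (intro exI[of _ "Mem (prod_encode (j, \<beta>!i)) (V i)"]) (auto intro: G_atoms simp: senv_def)
qed

text \<open>Adding offsets may carry into the next block. The carry case reads
  \<open>fo i + fo j = fo k + n\<close>; as \<open>n\<close> is no element, it is expressed by the
  difference \<open>d\<close> of \<open>fo i\<close> and \<open>fo k\<close> and its predecessor
  \<open>e\<close>, for which \<open>fo j + e\<close> is the maximum \<open>n - 1\<close>.\<close>

lemma D_plus: assumes "t \<in> set Ts" "u \<in> set Ts" "v \<in> set Ts" shows "D K W I Ts Bs (%c. t c + u c = v c)"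
proof (rule D_atom)
  fix \<beta> :: "nat list"
  obtain i j k where ij: "i < length Ts" "Ts ! i = t" "j < length Ts" "Ts ! j = u" "k < length Ts" "Ts ! k = v"
    using assms by (auto simp: in_set_conv_nth)
  define l where "l = length Ts"
  have P: "\<exists>f. G f \<and> fv_fo f \<subseteq> {i, j, k} \<and>
       (\<forall>w fo so. fo i < length w --> fo j < length w --> fo k < length w --> sat w fo so f = (fo i + fo j = fo k))" for i j k
    by (rule G_plus)
  obtain p0 where p0: "G p0" "fv_fo p0 \<subseteq> {i, j, k}" "\<And>w fo so. fo i < length w ==> fo j < length w ==> fo k < length w ==> sat w fo so p0 = (fo i + fo j = fo k)"
    using P[of i j k] by blast
  obtain p1 where p1: "G p1" "fv_fo p1 \<subseteq> {k, l, i}" "\<And>w fo so. fo k < length w ==> fo l < length w ==> fo i < length w ==> sat w fo so p1 = (fo k + fo l = fo i)"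
    using P[of k l i] by blast
  obtain p2 where p2: "G p2" "fv_fo p2 \<subseteq> {j, Suc l, l + 2}" "\<And>w fo so. fo j < length w ==> fo (Suc l) < length w ==> fo (l + 2) < length w ==> sat w fo so p2 = (fo j + fo (Suc l) = fo (l + 2))"
    using P[of j "Suc l" "l + 2"] by blast
  let ?s = "Conj (Lt (V (Suc l)) (V l)) (Neg (Ex (l + 3) (Conj (Lt (V (Suc l)) (V (l + 3))) (Lt (V (l + 3)) (V l)))))"
  let ?q = "Ex l (Conj p1 (Ex (Suc l) (Conj ?s (Ex (l + 2) (Conj (Eq (V (l + 2)) TMax) p2)))))"
  have ne: "i \<noteq> l" "j \<noteq> l" "k \<noteq> l" "i < l" "j < l" "k < l" using ij by (auto simp: l_def)
  have s: "sat w fo so ?s = (fo l = Suc (fo (Suc l)))" if "fo l < length w" for w fo so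
    using that by auto
  have q: "sat w fo so ?q = (fo i + fo j = fo k + length w)" if f: "fo i < length w" "fo j < length w" "fo k < length w" for w fo so
  proof -
    have e1: "sat w (fo(l := d)) so p1 = (fo k + d = fo i)" if "d < length w" for d
      by (subst p1(3)) (use f ne that in auto)
    have e2: "sat w (fo(l := d, Suc l := e, l + 2 := m)) so p2 = (fo j + e = m)" if "e < length w" "m < length w" for d e m
      by (subst p2(3)) (use f ne that in auto)
    have e3: "sat w (fo(l := d, Suc l := e)) so ?s = (d = Suc e)" if "d < length w" for d e
      by (subst s) (use that in auto)
    have "sat w fo so ?q = (\<exists>d<length w. sat w (fo(l := d)) so p1 \<and> (\<exists>e<length w. sat w (fo(l := d, Suc l := e)) so ?s \<and>
        (\<exists>m<length w. m = length w - 1 \<and> sat w (fo(l := d, Suc l := e, l + 2 := m)) so p2)))"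
      by (simp only: sat.simps(1,8,10) eval_trm.simps fun_upd_same)
    also have "\<dots> = (\<exists>d<length w. fo k + d = fo i \<and> (\<exists>e<length w. d = Suc e \<and> (\<exists>m<length w. m = length w - 1 \<and> fo j + e = m)))"
      by (simp only: e1 e2 e3 cong: conj_cong)
    also have "\<dots> = (fo i + fo j = fo k + length w)"
    proof
      assume h: "fo i + fo j = fo k + length w"
      then have "fo k < fo i" using f by linarith
      then show "\<exists>d<length w. fo k + d = fo i \<and> (\<exists>e<length w. d = Suc e \<and> (\<exists>m<length w. m = length w - 1 \<and> fo j + e = m))"
        using h f by (intro exI[of _ "fo i - fo k"] conjI exI[of _ "fo i - fo k - 1"] exI[of _ "length w - 1"]) linarith+
    qed auto
    finally show ?thesis .
  qed
  have Gq: "G ?q" "fv_fo ?q \<subseteq> {..<l}" using p1 p2 ne by (auto intro!: G_bool G_ex G_atoms)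
  have N: "fv_fo (Neg (Eq TMin TMin)) = {}" "\<not> sat w fo so (Neg (Eq TMin TMin))" for w fo so by simp_all
  let ?f = "if \<beta>!i + \<beta>!j = \<beta>!k then p0 else if Suc (\<beta>!i + \<beta>!j) = \<beta>!k then ?q else Neg (Eq TMin TMin)"
  show "\<exists>f. G f \<and> fv_fo f \<subseteq> {..<length Ts} \<and>
     (\<forall>c fo so n. n = length (W c) --> n > 0 --> gd K W Ts Bs c --> fo = fenv n Ts c --> so = senv n Bs c -->
       (\<forall>i<length Ts. (Ts ! i) c = \<beta> ! i * n + fo i \<and> fo i < n) --> sat (W c) fo so f = (t c + u c = v c))"
  proof (intro exI[of _ ?f] conjI allI impI)
    show "G ?f" using p0(1) Gq(1) by (auto intro: G_bool G_atoms)
    show "fv_fo ?f \<subseteq> {..<length Ts}" using p0(2) Gq(2) ij by (auto simp: l_def N simp del: fv_fo.simps)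
    fix c fo and so :: "nat => nat set" and n
    assume n: "n = length (W c)" "n > 0" and a: "\<forall>i<length Ts. (Ts ! i) c = \<beta> ! i * n + fo i \<and> fo i < n"
    have e: "t c = \<beta>!i * n + fo i" "u c = \<beta>!j * n + fo j" "v c = \<beta>!k * n + fo k" and l: "fo i < n" "fo j < n" "fo k < n"
      using a ij by auto
    have "t c + u c = v c \<longleftrightarrow> (\<beta>!i + \<beta>!j) * n + (fo i + fo j) = \<beta>!k * n + fo k"
      unfolding e by (simp add: algebra_simps)
    also have "\<dots> \<longleftrightarrow> (if \<beta>!i + \<beta>!j = \<beta>!k then fo i + fo j = fo k else Suc (\<beta>!i + \<beta>!j) = \<beta>!k \<and> fo i + fo j = fo k + n)"
    proof (cases "fo i + fo j < n")
      case True
      then show ?thesis using block_eq[of "fo i + fo j" n "fo k" "\<beta>!i + \<beta>!j" "\<beta>!k"] l by auto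
    next
      case False
      define z where "z = fo i + fo j - n"
      have z: "fo i + fo j = z + n" "z < n" using l False by (auto simp: z_def)
      have "(\<beta>!i + \<beta>!j) * n + (fo i + fo j) = Suc (\<beta>!i + \<beta>!j) * n + z" using z by (simp add: algebra_simps)
      then show ?thesis using block_eq[of z n "fo k" "Suc (\<beta>!i + \<beta>!j)" "\<beta>!k"] l z by auto
    qed
    finally have tuv: "t c + u c = v c \<longleftrightarrow> (if \<beta>!i + \<beta>!j = \<beta>!k then fo i + fo j = fo k else Suc (\<beta>!i + \<beta>!j) = \<beta>!k \<and> fo i + fo j = fo k + n)" .
    show "sat (W c) fo so ?f = (t c + u c = v c)"
      unfolding tuv using p0(3)[of fo "W c" so] q[of fo "W c" so] l n
      by (cases "\<beta>!i + \<beta>!j = \<beta>!k"; cases "Suc (\<beta>!i + \<beta>!j) = \<beta>!k") (simp_all add: N(2) del: sat.simps)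
  qed
qed

end

definition liftT :: "('c => 'b) list => ('c \<times> 'd => 'b) list" where
  "liftT Ts = map (%t p. t (fst p)) Ts"

lemma in_liftT: "t \<in> set Ts ==> (%p. t (fst p)) \<in> set (liftT Ts)"
  by (auto simp: liftT_def)

lemma in_liftT_append: "t \<in> set Ts ==> (%p. t (fst p)) \<in> set (liftT Ts @ us)"
  by (auto simp: liftT_def)

lemma in_append_snd: "snd \<in> set (us @ [snd])"
  by simp

lemmas in_liftT_snoc = in_liftT_append in_append_snd

lemma length_liftT [simp]: "length (liftT Ts) = length Ts"
  by (simp add: liftT_def)

context flogic
begin

lemma fold_Disj:
  assumes "\<forall>f\<in>set fs. G f \<and> fv_fo f \<subseteq> A"
  shows "\<exists>h. G h \<and> fv_fo h \<subseteq> A \<and> (\<forall>w fo so. sat w fo so h = (\<exists>f\<in>set fs. sat w fo so f))"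
  using assms
proof (induction fs)
  case Nil
  show ?case by (intro exI[of _ "Neg (Eq TMin TMin)"]) (auto intro: G_bool G_atoms)
next
  case (Cons f fs)
  then obtain h where h: "G h \<and> fv_fo h \<subseteq> A \<and> (\<forall>w fo so. sat w fo so h = (\<exists>f\<in>set fs. sat w fo so f))" by auto
  then show ?case using Cons.prems by (intro exI[of _ "Disj f h"]) (auto intro: G_bool)
qed

text \<open>A quantifier over \<open>K * n\<close> values is a disjunction over the block of the
  value, with one element quantifier for its offset.\<close>

lemma D_ex:
  assumes "D K (%p. W (fst p)) (%p. I (fst p)) (liftT Ts @ [snd]) (liftT Bs) (%p. P (fst p) (snd p))"
  shows "D K W I Ts Bs (%c. \<exists>x<K * length (W c). P c x)"
proof (rule DI)
  fix \<beta> assume b: "length \<beta> = length Ts" "set \<beta> \<subseteq> {..<K}"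
  let ?l = "length Ts"
  let ?T = "liftT Ts @ [snd] :: ('a \<times> nat => nat) list"
  have "\<forall>k\<in>{..<K}. \<exists>f. Dfor K (%p. W (fst p)) (%p. I (fst p)) ?T (liftT Bs) (%p. P (fst p) (snd p)) (\<beta> @ [k]) f"
  proof
    fix k assume "k \<in> {..<K}"
    then have "length (\<beta> @ [k]) = length ?T" "set (\<beta> @ [k]) \<subseteq> {..<K}" using b by auto
    then show "\<exists>f. Dfor K (%p. W (fst p)) (%p. I (fst p)) ?T (liftT Bs) (%p. P (fst p) (snd p)) (\<beta> @ [k]) f"
      using assms unfolding D_def by blast
  qed
  from bchoice[OF this] obtain f where f: "\<And>k. k < K ==> Dfor K (%p. W (fst p)) (%p. I (fst p)) ?T (liftT Bs) (%p. P (fst p) (snd p)) (\<beta> @ [k]) (f k)" by auto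
  have fG: "G (f k)" "fv_fo (f k) \<subseteq> {..<Suc ?l}" if "k < K" for k
    using f[OF that] by (auto simp: Dfor_def)
  have "\<exists>h. G h \<and> fv_fo h \<subseteq> {..<?l} \<and>
      (\<forall>w fo so. sat w fo so h = (\<exists>g\<in>set (map (%k. Ex ?l (f k)) [0..<K]). sat w fo so g))"
  proof (rule fold_Disj, rule ballI)
    fix g assume "g \<in> set (map (%k. Ex ?l (f k)) [0..<K])"
    then obtain k where "k < K" "g = Ex ?l (f k)" by auto
    then show "G g \<and> fv_fo g \<subseteq> {..<?l}"
      using fG[of k] by (auto intro: G_ex simp: less_Suc_eq subset_iff)
  qed
  then obtain h where h: "G h" "fv_fo h \<subseteq> {..<?l}"
      "\<And>w fo so. sat w fo so h = (\<exists>k<K. \<exists>a<length w. sat w (fo(?l := a)) so (f k))" by (auto simp: Bex_def)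
  have "sat (W c) (fenv (length (W c)) Ts c) (senv (length (W c)) Bs c) h = (\<exists>x<K * length (W c). P c x)"
    if c: "I c" "gd K W Ts Bs c" "\<forall>i<?l. (Ts ! i) c div length (W c) = \<beta> ! i" for c
  proof -
    let ?n = "length (W c)"
    have n0: "?n > 0" using c(2) by (simp add: gd_def)
    have key: "sat (W c) ((fenv ?n Ts c)(?l := a)) (senv ?n Bs c) (f k) = P c (k * ?n + a)" if "k < K" "a < ?n" for k a
    proof -
      let ?p = "(c, k * ?n + a)"
      have lt: "k * ?n + a < K * ?n"
      proof -
        have "k * ?n + a < Suc k * ?n" using that by simp
        also have "\<dots> \<le> K * ?n" using that by (intro mult_le_mono1) simp
        finally show ?thesis .
      qed
      have "gd K (%p. W (fst p)) ?T (liftT Bs) ?p" using c(2) lt by (auto simp: gd_def liftT_def)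
      moreover have "(k * ?n + a) div ?n = k" using n0 that by simp
      then have "\<forall>i<length ?T. (?T ! i) ?p div length (W (fst ?p)) = (\<beta> @ [k]) ! i"
        using c(3) b(1) that by (auto simp: nth_append liftT_def less_Suc_eq)
      moreover have "fenv ?n ?T ?p = (fenv ?n Ts c)(?l := a)"
        using that by (auto simp: fenv_def nth_append liftT_def fun_eq_iff)
      moreover have "senv ?n (liftT Bs) ?p = senv ?n Bs c"
        by (auto simp: senv_def liftT_def fun_eq_iff)
      ultimately show ?thesis using f[OF that(1)] c(1) unfolding Dfor_def by (metis fst_conv snd_conv)
    qed
    have "(\<exists>k<K. \<exists>a<?n. P c (k * ?n + a)) = (\<exists>x<K * ?n. P c x)"
    proof
      assume "\<exists>k<K. \<exists>a<?n. P c (k * ?n + a)"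
      then obtain k a where ka: "k < K" "a < ?n" "P c (k * ?n + a)" by blast
      have "k * ?n + a < Suc k * ?n" using ka by simp
      also have "\<dots> \<le> K * ?n" using ka by (intro mult_le_mono1) simp
      finally show "\<exists>x<K * ?n. P c x" using ka(3) by blast
    next
      assume "\<exists>x<K * ?n. P c x"
      then obtain x where x: "x < K * ?n" "P c x" by blast
      have "x div ?n < K" using x(1) by (simp add: less_mult_imp_div_less)
      moreover have "x mod ?n < ?n" using n0 by simp
      moreover have "P c (x div ?n * ?n + x mod ?n)" using x(2) by simp
      ultimately show "\<exists>k<K. \<exists>a<?n. P c (k * ?n + a)" by blast
    qed
    then show ?thesis unfolding h(3) using key by (metis (no_types, lifting))
  qed
  then have "Dfor K W I Ts Bs (%c. \<exists>x<K * length (W c). P c x) \<beta> h" using h(1,2) unfolding Dfor_def by blast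
  then show "\<exists>f. Dfor K W I Ts Bs (%c. \<exists>x<K * length (W c). P c x) \<beta> f" ..
qed

lemma D_all:
  assumes "D K (%p. W (fst p)) (%p. I (fst p)) (liftT Ts @ [snd]) (liftT Bs) (%p. P (fst p) (snd p))"
  shows "D K W I Ts Bs (%c. \<forall>x<K * length (W c). P c x)"
  using D_neg[OF D_ex[of K W I Ts Bs "%c x. \<not> P c x", OF D_neg[OF assms]]] by simp

definition setp :: "nat => ('c \<times> (nat => nat set) => nat set) list" where
  "setp m = map (%j p. snd p j) [0..<m]"

lemma setp_simps [simp]: "length (setp m) = m" "j < m ==> setp m ! j = (%p. snd p j)"
  by (simp_all add: setp_def)

lemma in_setp: "j < m ==> (%p. snd p j) \<in> set (xs @ setp m)"
  by (auto simp: setp_def)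

definition split_sets :: "nat => nat => nat => nat set list => nat set list" where
  "split_sets K n m As = map (%t. {i. i < n \<and> (t mod K) * n + i \<in> As ! (t div K)}) [0..<m * K]"

lemma bij_betw_split_sets:
  assumes n: "n > 0" and K: "K > 0"
  shows "bij_betw (split_sets K n m) (tuples (K * n) m) (tuples n (m * K))"
proof -
  have maps: "split_sets K n m ` tuples (K * n) m \<subseteq> tuples n (m * K)" by (auto simp: split_sets_def tuples_def)
  have inj: "inj_on (split_sets K n m) (tuples (K * n) m)"
  proof (rule inj_onI)
    fix As Bs assume A: "As \<in> tuples (K * n) m" and B: "Bs \<in> tuples (K * n) m" and eq: "split_sets K n m As = split_sets K n m Bs"
    show "As = Bs"
    proof (rule nth_equalityI)
      show "length As = length Bs" using A B by (simp add: tuples_def)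
      fix j assume "j < length As"
      then have j: "j < m" using A by (simp add: tuples_def)
      have "As ! j \<in> set As" "Bs ! j \<in> set Bs" using j A B by (auto simp: tuples_def)
      then have sub: "As ! j \<subseteq> {..<K * n}" "Bs ! j \<subseteq> {..<K * n}" using A B by (auto simp: tuples_def)
      have "x \<in> As ! j \<longleftrightarrow> x \<in> Bs ! j" if x: "x < K * n" for x
      proof -
        have xd: "x div n < K" using x by (simp add: less_mult_imp_div_less)
        have t: "j * K + x div n < m * K"
        proof -
          have "j * K + x div n < Suc j * K" using xd by simp
          also have "\<dots> \<le> m * K" using j by (intro mult_le_mono1) simp
          finally show ?thesis .
        qed
        have "(j * K + x div n) mod K = x div n" "(j * K + x div n) div K = j" using xd K by auto
        then have "{i. i < n \<and> x div n * n + i \<in> As ! j} = {i. i < n \<and> x div n * n + i \<in> Bs ! j}"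
          using arg_cong[OF eq, of "%l. l ! (j * K + x div n)"] t by (simp add: split_sets_def)
        then have "x mod n \<in> {i. i < n \<and> x div n * n + i \<in> As ! j} \<longleftrightarrow> x mod n \<in> {i. i < n \<and> x div n * n + i \<in> Bs ! j}" by simp
        then show ?thesis using n by simp
      qed
      then show "As ! j = Bs ! j" using sub by blast
    qed
  qed
  have "card (split_sets K n m ` tuples (K * n) m) = card (tuples n (m * K))"
    unfolding card_image[OF inj] by (simp add: card_tuples ac_simps)
  then have "split_sets K n m ` tuples (K * n) m = tuples n (m * K)"
    using maps finite_tuples by (intro card_subset_eq) auto
  then show ?thesis using inj by (simp add: bij_betw_def)
qed

text \<open>Cutting every set into its \<open>K\<close> blocks is a bijection from
  \<open>m\<close>-tuples over the large universe to tuples of length \<open>m * K\<close> over the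
  small one. Counts are thus preserved exactly, as majority and residues require.\<close>

lemma D_cnt:
  assumes md: "md \<in> Md" and m: "m > 0" and K: "K > 0"
    and P: "D K (%p. W (fst p)) (%p. I (fst p)) (liftT Ts) (liftT Bs @ setp m) (%p. P (fst p) (map (snd p) [0..<m]))"
    and Q: "D K (%p. W (fst p)) (%p. I (fst p)) (liftT Ts) (liftT Bs @ setp m) (%p. Q (fst p) (map (snd p) [0..<m]))"
  shows "D K W I Ts Bs (%c. mode_accepts md (card {As \<in> tuples (K * length (W c)) m. P c As}) (card {As \<in> tuples (K * length (W c)) m. Q c As}))"
proof (rule DI)
  fix \<beta> assume b: "length \<beta> = length Ts" "set \<beta> \<subseteq> {..<K}"
  let ?W = "%p. W (fst p)" and ?I = "%p. I (fst p)"
  let ?T = "liftT Ts :: ('a \<times> (nat => nat set) => nat) list" and ?B = "liftT Bs @ setp m"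
  have b': "length \<beta> = length ?T" using b(1) by simp
  obtain f where f: "Dfor K ?W ?I ?T ?B (%p. P (fst p) (map (snd p) [0..<m])) \<beta> f" using DE[OF P b' b(2)] .
  obtain g where g: "Dfor K ?W ?I ?T ?B (%p. Q (fst p) (map (snd p) [0..<m])) \<beta> g" using DE[OF Q b' b(2)] .
  let ?l = "length Bs"
  define Xs where "Xs = map (%t. prod_encode (?l + t div K, t mod K)) [0..<m * K]"
  have lX: "length Xs = m * K" by (simp add: Xs_def)
  have dX: "distinct Xs" unfolding Xs_def distinct_map
  proof
    show "inj_on (%t. prod_encode (?l + t div K, t mod K)) (set [0..<m * K])"
      by (rule inj_onI) (metis add_left_cancel div_mult_mod_eq prod.inject prod_encode_eq)
  qed simp
  have neX: "Xs \<noteq> []" using m K by (simp add: Xs_def)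
  obtain h where h: "G h" "fv_fo h \<subseteq> fv_fo f \<union> fv_fo g"
    "\<And>w fo so. w \<noteq> [] ==> sat w fo so h = mode_accepts md
          (card {As \<in> tuples (length w) (length Xs). sat w fo (upds so Xs As) f})
          (card {As \<in> tuples (length w) (length Xs). sat w fo (upds so Xs As) g})"
    using G_cnt[OF md _ _ dX neX, of f g] f g by (auto simp: Dfor_def)
  have cnt: "card {As \<in> tuples n (length Xs). sat (W c) (fenv n Ts c) (upds (senv n Bs c) Xs As) f'} = card {As \<in> tuples (K * n) m. P' c As}"
    if c: "I c" "gd K W Ts Bs c" "\<forall>i<length Ts. (Ts ! i) c div length (W c) = \<beta> ! i"
      and f': "Dfor K ?W ?I ?T ?B (%p. P' (fst p) (map (snd p) [0..<m])) \<beta> f'" and n: "n = length (W c)" for c P' f' n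
  proof -
    have n0: "n > 0" using c(2) n by (simp add: gd_def)
    have key: "sat (W c) (fenv n Ts c) (upds (senv n Bs c) Xs (split_sets K n m As)) f' = P' c As" if As: "As \<in> tuples (K * n) m" for As
    proof -
      let ?p = "(c, %j. As ! j)"
      have lA: "length As = m" using As by (simp add: tuples_def)
      have sub: "As ! j \<subseteq> {..<K * n}" if "j < m" for j
      proof -
        have "As ! j \<in> set As" using that lA by simp
        then show ?thesis using As by (auto simp: tuples_def)
      qed
      have "map (snd ?p) [0..<m] = As" using lA map_nth[of As] by simp
      moreover have "gd K ?W ?T ?B ?p"
      proof -
        have "\<forall>B\<in>set (setp m). B ?p \<subseteq> {..<K * n}" unfolding setp_def using sub by simp
        moreover have "\<forall>B\<in>set (liftT Bs). B ?p \<subseteq> {..<K * n}" using c(2) n by (simp add: gd_def liftT_def)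
        ultimately show ?thesis using c(2) n by (simp add: gd_def liftT_def ball_Un)
      qed
      moreover have "\<forall>i<length ?T. (?T ! i) ?p div length (W (fst ?p)) = \<beta> ! i" using c(3) by (simp add: liftT_def)
      moreover have "fenv n ?T ?p = fenv n Ts c" by (auto simp: fenv_def liftT_def fun_eq_iff)
      moreover have "senv n ?B ?p = upds (senv n Bs c) Xs (split_sets K n m As)"
      proof
        fix v
        obtain j k where v: "prod_decode v = (j, k)" by (cases "prod_decode v")
        then have ve: "v = prod_encode (j, k)" by (metis prod_decode_inverse)
        have Xmem: "v \<in> set Xs \<longleftrightarrow> ?l \<le> j \<and> j < ?l + m \<and> k < K"
        proof
          assume "v \<in> set Xs"
          then obtain t where "t < m * K" "j = ?l + t div K" "k = t mod K" by (auto simp: Xs_def ve)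
          then show "?l \<le> j \<and> j < ?l + m \<and> k < K" using K by (simp add: less_mult_imp_div_less)
        next
          assume a: "?l \<le> j \<and> j < ?l + m \<and> k < K"
          have "(j - ?l) * K + k < Suc (j - ?l) * K" using a by simp
          also have "\<dots> \<le> m * K" by (intro mult_le_mono1) (use a in linarith)
          finally show "v \<in> set Xs" unfolding Xs_def set_map ve using a
            by (intro image_eqI[of _ _ "(j - ?l) * K + k"]) auto
        qed
        show "senv n ?B ?p v = upds (senv n Bs c) Xs (split_sets K n m As) v"
        proof (cases "v \<in> set Xs")
          case True
          then have a: "?l \<le> j" "j < ?l + m" "k < K" using Xmem by auto
          define t where "t = (j - ?l) * K + k"
          have "t < Suc (j - ?l) * K" using a by (simp add: t_def)
          also have "\<dots> \<le> m * K" by (intro mult_le_mono1) (use a in linarith)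
          finally have t: "t < m * K" .
          have td: "t div K = j - ?l" "t mod K = k" using a by (auto simp: t_def)
          have "v = Xs ! t" using t td a by (simp add: Xs_def ve)
          then have "upds (senv n Bs c) Xs (split_sets K n m As) v = split_sets K n m As ! t"
            using t lX dX by (simp add: upds_nth split_sets_def)
          also have "\<dots> = {i. i < n \<and> k * n + i \<in> As ! (j - ?l)}" using t td by (simp add: split_sets_def)
          also have "\<dots> = senv n ?B ?p v" using a by (simp add: senv_def v nth_append)
          finally show ?thesis by simp
        next
          case False
          then have u: "upds (senv n Bs c) Xs (split_sets K n m As) v = senv n Bs c v" by (rule upds_notin)
          show ?thesis
          proof (cases "j < ?l")
            case True
            then show ?thesis unfolding u by (simp add: senv_def v nth_append liftT_def)
          next
            case jl: False
            have "{i. i < n \<and> k * n + i \<in> As ! (j - ?l)} = {}" if "j < ?l + m"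
            proof -
              have "K \<le> k" using False Xmem jl that by auto
              then have ge: "K * n \<le> k * n + i" for i by (simp add: trans_le_add1)
              have "j - ?l < m" using that jl by linarith
              note sb = sub[OF this]
              have "k * n + i \<notin> As ! (j - ?l)" for i
              proof
                assume "k * n + i \<in> As ! (j - ?l)"
                then have "k * n + i < K * n" using sb by auto
                then show False using ge[of i] by linarith
              qed
              then show ?thesis by simp
            qed
            then show ?thesis unfolding u using jl by (simp add: senv_def v nth_append)
          qed
        qed
      qed
      ultimately show ?thesis using f' c(1) n unfolding Dfor_def by (metis fst_conv)
    qed
    have "card {As \<in> tuples (K * n) m. P' c As} = card {As \<in> tuples n (length Xs). sat (W c) (fenv n Ts c) (upds (senv n Bs c) Xs As) f'}"
    proof (rule bij_betw_same_card[OF bij_betw_subset[OF bij_betw_split_sets[OF n0 K, of m]]])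
      have "split_sets K n m ` {As \<in> tuples (K * n) m. P' c As}
         = split_sets K n m ` {As \<in> tuples (K * n) m. sat (W c) (fenv n Ts c) (upds (senv n Bs c) Xs (split_sets K n m As)) f'}"
        using key by (intro arg_cong[where f = "image (split_sets K n m)"]) auto
      also have "\<dots> = {As \<in> tuples n (m * K). sat (W c) (fenv n Ts c) (upds (senv n Bs c) Xs As) f'}"
        using bij_betw_imp_surj_on[OF bij_betw_split_sets[OF n0 K, of m]]
          image_filter[of "split_sets K n m" "tuples (K * n) m" "%As. sat (W c) (fenv n Ts c) (upds (senv n Bs c) Xs As) f'"] by simp
      finally show "split_sets K n m ` {As \<in> tuples (K * n) m. P' c As} = {As \<in> tuples n (length Xs). sat (W c) (fenv n Ts c) (upds (senv n Bs c) Xs As) f'}"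
        by (simp add: lX)
    qed auto
    then show ?thesis by simp
  qed
  have "sat (W c) (fenv (length (W c)) Ts c) (senv (length (W c)) Bs c) h
      = mode_accepts md (card {As \<in> tuples (K * length (W c)) m. P c As}) (card {As \<in> tuples (K * length (W c)) m. Q c As})"
    if c: "I c" "gd K W Ts Bs c" "\<forall>i<length Ts. (Ts ! i) c div length (W c) = \<beta> ! i" for c
  proof -
    have "W c \<noteq> []" using c(2) by (simp add: gd_def)
    show ?thesis unfolding h(3)[OF \<open>W c \<noteq> []\<close>] cnt[OF c f refl] cnt[OF c g refl] ..
  qed
  moreover have "fv_fo h \<subseteq> {..<length Ts}" using h(2) f g by (auto simp: Dfor_def)
  ultimately have "Dfor K W I Ts Bs (%c. mode_accepts md (card {As \<in> tuples (K * length (W c)) m. P c As})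
      (card {As \<in> tuples (K * length (W c)) m. Q c As})) \<beta> h"
    using h(1) unfolding Dfor_def by blast
  then show "\<exists>h. Dfor K W I Ts Bs (%c. mode_accepts md (card {As \<in> tuples (K * length (W c)) m. P c As})
      (card {As \<in> tuples (K * length (W c)) m. Q c As})) \<beta> h" ..
qed

lemma D_exs:
  assumes "m > 0" "K > 0"
    and P: "D K (%p. W (fst p)) (%p. I (fst p)) (liftT Ts) (liftT Bs @ setp m) (%p. P (fst p) (map (snd p) [0..<m]))"
  shows "D K W I Ts Bs (%c. \<exists>As\<in>tuples (K * length (W c)) m. P c As)"
proof (rule D_eq_cong[OF D_cnt[OF NPm assms(1,2) P P]])
  show "mode_accepts NPm (card {As \<in> tuples (K * length (W c)) m. P c As}) (card {As \<in> tuples (K * length (W c)) m. P c As})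
    = (\<exists>As\<in>tuples (K * length (W c)) m. P c As)" for c
    using finite_tuples[of "K * length (W c)" m] by (auto simp: card_gt_0_iff)
qed

text \<open>Definability for tuples of values pulls back along the map from a context to the values
  of its terms, so one statement about canonical contexts serves all context types.\<close>

lemma D_transfer:
  fixes Ts :: "('c => nat) list" and R0 :: "nat list \<times> nat list \<times> nat set list => bool"
  assumes "D K fst J (map (%i c. (fst (snd c)) ! i) [0..<length Ts]) (map (%j c. (snd (snd c)) ! j) [0..<length Bs]) R0"
  shows "D K W (%c. J (W c, map (%t. t c) Ts, map (%B. B c) Bs)) Ts Bs (%c. R0 (W c, map (%t. t c) Ts, map (%B. B c) Bs))"
proof (rule DI)
  fix \<beta> assume b: "length \<beta> = length Ts" "set \<beta> \<subseteq> {..<K}"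
  let ?T = "map (%i c. (fst (snd c)) ! i) [0..<length Ts] :: (nat list \<times> nat list \<times> nat set list => nat) list"
  let ?B = "map (%j c. (snd (snd c)) ! j) [0..<length Bs] :: (nat list \<times> nat list \<times> nat set list => nat set) list"
  have "length \<beta> = length ?T" using b(1) by simp
  then obtain f where f: "Dfor K fst J ?T ?B R0 \<beta> f" using DE[OF assms _ b(2)] by blast
  have "sat (W c) (fenv (length (W c)) Ts c) (senv (length (W c)) Bs c) f = R0 (W c, map (%t. t c) Ts, map (%B. B c) Bs)"
    if c: "gd K W Ts Bs c" "\<forall>i<length Ts. (Ts ! i) c div length (W c) = \<beta> ! i"
      and J: "J (W c, map (%t. t c) Ts, map (%B. B c) Bs)" for c
  proof -
    let ?p = "(W c, map (%t. t c) Ts, map (%B. B c) Bs)"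
    have "gd K fst ?T ?B ?p" using c(1) by (auto simp: gd_def)
    moreover have "\<forall>i<length ?T. (?T ! i) ?p div length (fst ?p) = \<beta> ! i" using c(2) by simp
    moreover have "fenv (length (W c)) ?T ?p = fenv (length (W c)) Ts c" by (auto simp: fenv_def fun_eq_iff)
    moreover have "senv (length (W c)) ?B ?p = senv (length (W c)) Bs c" by (auto simp: senv_def fun_eq_iff)
    ultimately show ?thesis using f J unfolding Dfor_def by (metis fst_conv)
  qed
  then have "Dfor K W (%c. J (W c, map (%t. t c) Ts, map (%B. B c) Bs)) Ts Bs (%c. R0 (W c, map (%t. t c) Ts, map (%B. B c) Bs)) \<beta> f" using f unfolding Dfor_def by auto
  then show "\<exists>f. Dfor K W (%c. J (W c, map (%t. t c) Ts, map (%B. B c) Bs)) Ts Bs (%c. R0 (W c, map (%t. t c) Ts, map (%B. B c) Bs)) \<beta> f" ..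
qed

end

context flogic
begin

lemma D_and: "D K W I Ts Bs R ==> D K W I Ts Bs S ==> D K W I Ts Bs (%c. R c \<and> S c)"
  by (rule D_conj[OF _ D_inv])

lemma D_impl: "D K W I Ts Bs R ==> D K W I Ts Bs S ==> D K W I Ts Bs (%c. R c --> S c)"
  by (rule D_imp[OF _ D_inv])

lemmas D_mems = in_liftT_snoc in_liftT in_setp
lemmas D_intros0 = D_ex D_all D_and D_disj D_neg D_impl D_iff D_plus D_zero D_less_const D_mem D_less D_eq

lemma D_Suc: 
  assumes "t \<in> set Ts" "u \<in> set Ts"
  shows "D K W I Ts Bs (%c. Suc (t c) = u c)"
proof (rule D_eq_cong)
  show "D K W I Ts Bs (%c. t c < u c \<and> \<not> (\<exists>x<K * length (W c). t c < x \<and> x < u c))"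
    by (intro D_intros0 D_mems assms)
  fix c assume "gd K W Ts Bs c"
  then have "u c < K * length (W c)" using assms by (auto simp: gd_def)
  then show "(t c < u c \<and> \<not> (\<exists>x<K * length (W c). t c < x \<and> x < u c)) = (Suc (t c) = u c)"
    by auto
qed

text \<open>The order matters: the later rules also match goals meant for the earlier ones.\<close>

lemmas D_intros = D_ex D_all D_and D_disj D_neg D_impl D_iff D_Suc D_plus D_zero D_less_const D_mem D_less D_eq

section \<open>Squares, rows and iteration of definable functions\<close>

lemma mult_set_iff:
  assumes b: "(b::nat) > 0" and Q: "Q \<le> N" and M: "M \<subseteq> {..<N}"
  shows "(\<forall>x<N. x \<in> M \<longleftrightarrow> x < Q \<and> (x = 0 \<or> (\<exists>y<N. y \<in> M \<and> y + b = x))) \<longleftrightarrow> M = {x. x < Q \<and> b dvd x}"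
proof
  assume l: "\<forall>x<N. x \<in> M \<longleftrightarrow> x < Q \<and> (x = 0 \<or> (\<exists>y<N. y \<in> M \<and> y + b = x))"
  have "x \<in> M \<longleftrightarrow> x < Q \<and> b dvd x" if "x < N" for x
    using that
  proof (induction x rule: less_induct)
    case (less x)
    show ?case
    proof (cases "x < b")
      case True
      then have "b dvd x \<longleftrightarrow> x = 0" using b by (auto dest: dvd_imp_le)
      moreover have "\<not> (\<exists>y<N. y \<in> M \<and> y + b = x)" using True by auto
      ultimately show ?thesis using l[rule_format, OF less.prems] by blast
    next
      case False
      then obtain y where y: "x = y + b" by (metis add.commute le_Suc_ex not_less)
      then have "y \<in> M \<longleftrightarrow> y < Q \<and> b dvd y" using less b by simp
      moreover have "x \<in> M \<longleftrightarrow> x < Q \<and> y \<in> M" using l less.prems y b by auto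
      ultimately show ?thesis using y by auto
    qed
  qed
  then show "M = {x. x < Q \<and> b dvd x}" using M Q by auto
next
  assume M: "M = {x. x < Q \<and> b dvd x}"
  show "\<forall>x<N. x \<in> M \<longleftrightarrow> x < Q \<and> (x = 0 \<or> (\<exists>y<N. y \<in> M \<and> y + b = x))"
  proof (intro allI impI iffI)
    fix x assume x: "x < N" "x \<in> M"
    then have "x = 0 \<or> b \<le> x" "x < Q" "b dvd x" using M by (auto dest: dvd_imp_le)
    then show "x < Q \<and> (x = 0 \<or> (\<exists>y<N. y \<in> M \<and> y + b = x))"
      using x M by (auto intro!: exI[of _ "x - b"] simp: dvd_minus_self)
  qed (use M b in auto)
qed

lemma D_mult_set:
  assumes "b \<in> set Ts" "Q \<in> set Ts" "M \<in> set Bs" and b: "\<And>c. I c ==> 0 < b c"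
  shows "D K W I Ts Bs (%c. M c = {x. x < Q c \<and> b c dvd x})"
proof (rule D_eq_cong)
  show "D K W I Ts Bs (%c. \<forall>x<K * length (W c). x \<in> M c \<longleftrightarrow> x < Q c \<and> (x = 0 \<or> (\<exists>y<K * length (W c). y \<in> M c \<and> y + b c = x)))"
    by (intro D_intros D_mems assms)
  fix c assume "I c" "gd K W Ts Bs c"
  then show "(\<forall>x<K * length (W c). x \<in> M c \<longleftrightarrow> x < Q c \<and> (x = 0 \<or> (\<exists>y<K * length (W c). y \<in> M c \<and> y + b c = x))) = (M c = {x. x < Q c \<and> b c dvd x})"
    using assms by (intro mult_set_iff) (auto simp: gd_def)
qed

definition sq_base :: "nat => nat => nat => nat set => nat set => bool" where
  "sq_base b b1 Q M E \<longleftrightarrow> 0 < b \<and> b1 = Suc b \<and> Q = b * b \<and> M = {x. x < Q \<and> b dvd x} \<and> E = {x. x < Q \<and> Suc b dvd x}"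

text \<open>For a positive multiple \<open>x = b * k\<close>, the number \<open>x + k\<close> is a
  multiple of \<open>Suc b\<close>, so \<open>Suc b\<close> divides \<open>x - 1\<close> iff it
  divides \<open>k + 1\<close>. The least such \<open>k\<close> is \<open>b\<close>.\<close>

lemma square_iff:
  assumes b: "(b::nat) > 0"
  shows "Q = b * b \<longleftrightarrow> 0 < Q \<and> b dvd Q \<and> Suc b dvd Q - 1 \<and> (\<forall>x. 0 < x --> x < Q --> b dvd x --> \<not> Suc b dvd x - 1)"
proof -
  have sq: "0 < b * b" "Suc b dvd b * b - 1"
  proof -
    show "0 < b * b" using b by simp
    have "b * b - 1 = Suc b * (b - 1)" using b by (cases b) auto
    then show "Suc b dvd b * b - 1" by (metis dvd_triv_left)
  qed
  have min: "\<not> Suc b dvd x - 1" if x: "0 < x" "x < b * b" "b dvd x" for x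
  proof
    assume d: "Suc b dvd x - 1"
    obtain k where k: "x = b * k" using x(3) by blast
    then have k0: "0 < k" "k < b" using x(1,2) by auto
    have "(x - 1) + (k + 1) = Suc b * k" using k x(1) by simp
    then have "Suc b dvd (x - 1) + (k + 1)" by (metis dvd_triv_left)
    then have "Suc b dvd k + 1" using d by (simp only: dvd_add_right_iff)
    then show False using k0 by (auto dest!: dvd_imp_le)
  qed
  show ?thesis
  proof
    assume "Q = b * b" then show "0 < Q \<and> b dvd Q \<and> Suc b dvd Q - 1 \<and> (\<forall>x. 0 < x --> x < Q --> b dvd x --> \<not> Suc b dvd x - 1)"
      using sq min by auto
  next
    assume r: "0 < Q \<and> b dvd Q \<and> Suc b dvd Q - 1 \<and> (\<forall>x. 0 < x --> x < Q --> b dvd x --> \<not> Suc b dvd x - 1)"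
    then have "\<not> b * b < Q" using sq by auto
    moreover have "\<not> Q < b * b" using min r by blast
    ultimately show "Q = b * b" by simp
  qed
qed

lemma D_sq_base:
  assumes "b \<in> set Ts" "b1 \<in> set Ts" "Q \<in> set Ts" "M \<in> set Bs" "E \<in> set Bs"
  shows "D K W I Ts Bs (%c. sq_base (b c) (b1 c) (Q c) (M c) (E c))"
proof (rule D_eq_cong)
  let ?A = "%c. \<not> b c = 0 \<and> Suc (b c) = b1 c"
  let ?B = "%c. M c = {x. x < Q c \<and> b c dvd x} \<and> E c = {x. x < Q c \<and> b1 c dvd x}"
  let ?C = "%c. (\<exists>y<K * length (W c). y \<in> M c \<and> y + b c = Q c) \<and> (\<exists>z<K * length (W c). z \<in> E c \<and> Suc z = Q c) \<and>
     (\<forall>x<K * length (W c). x \<in> M c --> \<not> (\<exists>z<K * length (W c). z \<in> E c \<and> Suc z = x))"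
  show "D K W I Ts Bs (%c. ?A c \<and> ?B c \<and> ?C c)"
  proof (rule D_conj)
    show "D K W I Ts Bs ?A" by (intro D_intros D_mems assms)
    show "D K W (%c. I c \<and> ?A c) Ts Bs (%c. ?B c \<and> ?C c)"
      by (intro D_and D_mult_set D_intros D_mems assms) auto
  qed
  fix c assume gd: "gd K W Ts Bs c"
  let ?N = "K * length (W c)"
  have lt: "Q c < ?N" "b c < ?N" using gd assms by (auto simp: gd_def)
  show "(?A c \<and> ?B c \<and> ?C c) = sq_base (b c) (b1 c) (Q c) (M c) (E c)"
  proof (cases "?A c \<and> ?B c")
    case True
    then have b0: "0 < b c" by simp
    have M: "M c = {x. x < Q c \<and> b c dvd x}" and E: "E c = {x. x < Q c \<and> Suc (b c) dvd x}" using True by auto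
    have 1: "(\<exists>y<?N. y \<in> M c \<and> y + b c = Q c) \<longleftrightarrow> 0 < Q c \<and> b c dvd Q c"
    proof
      assume "0 < Q c \<and> b c dvd Q c"
      then have "b c \<le> Q c" "b c dvd Q c" by (auto dest: dvd_imp_le)
      then show "\<exists>y<?N. y \<in> M c \<and> y + b c = Q c" using lt b0 unfolding M
        by (intro exI[of _ "Q c - b c"]) (auto simp: dvd_minus_self)
    next
      assume "\<exists>y<?N. y \<in> M c \<and> y + b c = Q c"
      then obtain y where "b c dvd y" "Q c = y + b c" using M by force
      then show "0 < Q c \<and> b c dvd Q c" using b0 by simp
    qed
    have 2: "(\<exists>z<?N. z \<in> E c \<and> Suc z = x) \<longleftrightarrow> 0 < x \<and> Suc (b c) dvd x - 1" if "x \<le> Q c" for x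
    proof
      assume "0 < x \<and> Suc (b c) dvd x - 1"
      then show "\<exists>z<?N. z \<in> E c \<and> Suc z = x" using that lt unfolding E by (intro exI[of _ "x - 1"]) auto
    qed (auto simp: E)
    have 3: "(\<forall>x<?N. x \<in> M c --> \<not> (\<exists>z<?N. z \<in> E c \<and> Suc z = x)) \<longleftrightarrow> (\<forall>x. 0 < x --> x < Q c --> b c dvd x --> \<not> Suc (b c) dvd x - 1)"
    proof (intro iffI allI impI)
      fix x assume l: "\<forall>x<?N. x \<in> M c --> \<not> (\<exists>z<?N. z \<in> E c \<and> Suc z = x)" and x: "0 < x" "x < Q c" "b c dvd x"
      then have "x < ?N" "x \<in> M c" using lt M by auto
      then have "\<not> (\<exists>z<?N. z \<in> E c \<and> Suc z = x)" using l by blast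
      then show "\<not> Suc (b c) dvd x - 1" using 2[of x] x by simp
    next
      fix x assume r: "\<forall>x. 0 < x --> x < Q c --> b c dvd x --> \<not> Suc (b c) dvd x - 1" and x: "x < ?N" "x \<in> M c"
      then have "x < Q c" "b c dvd x" using M by auto
      then show "\<not> (\<exists>z<?N. z \<in> E c \<and> Suc z = x)" using 2[of x] r by auto
    qed
    have R: "sq_base (b c) (b1 c) (Q c) (M c) (E c) = (Q c = b c * b c)"
    proof -
      have "b1 c = Suc (b c)" using True by simp
      then show ?thesis unfolding sq_base_def using b0 M E by blast
    qed
    have "?C c = (0 < Q c \<and> b c dvd Q c \<and> Suc (b c) dvd Q c - 1 \<and> (\<forall>x. 0 < x --> x < Q c --> b c dvd x --> \<not> Suc (b c) dvd x - 1))"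
      unfolding 1 2[OF order_refl] 3 by blast
    then show ?thesis using True unfolding R square_iff[OF b0, symmetric] by blast
  next
    case False
    have "?A c \<and> ?B c" if sq: "sq_base (b c) (b1 c) (Q c) (M c) (E c)"
    proof -
      have "b1 c = Suc (b c)" "0 < b c" "M c = {x. x < Q c \<and> b c dvd x}" "E c = {x. x < Q c \<and> Suc (b c) dvd x}"
        using sq unfolding sq_base_def by blast+
      then show ?thesis by simp
    qed
    then show ?thesis using False by blast
  qed
qed

text \<open>Writing \<open>x = k * b\<close> and \<open>x + s = k' * Suc b\<close> gives
  \<open>k * b + s = k' * b + k'\<close>; since \<open>s\<close> and \<open>k'\<close> are below
  \<open>b\<close>, uniqueness of digits in base \<open>b\<close> yields
  \<open>k = k' = s\<close>.\<close>

lemma sq_base_mul: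
  assumes V: "sq_base b b1 Q M E"
  shows "s < b \<and> x = s * b \<longleftrightarrow> s < b \<and> x \<in> M \<and> x + s \<in> E"
proof
  assume a: "s < b \<and> x = s * b"
  then have lt: "s * b + s < b * b"
  proof -
    have "s * b + s < Suc s * b" using a by simp
    also have "\<dots> \<le> b * b" using a by (intro mult_le_mono1) simp
    finally show ?thesis .
  qed
  have "s * b + s = Suc b * s" by simp
  then have "Suc b dvd s * b + s" by (metis dvd_triv_left)
  then show "s < b \<and> x \<in> M \<and> x + s \<in> E" using a V lt unfolding sq_base_def by auto
next
  assume a: "s < b \<and> x \<in> M \<and> x + s \<in> E"
  then obtain k k' where k: "x = b * k" "x + s = Suc b * k'" "x + s < b * b" using V by (auto simp: sq_base_def elim!: dvdE)
  have "k' < b"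
  proof (rule ccontr)
    assume "\<not> k' < b"
    then have "Suc b * b \<le> Suc b * k'" by (intro mult_le_mono2) simp
    then show False using k by simp
  qed
  then have "k * b + s = k' * b + k'" using k by (simp add: mult.commute)
  then have "k = k' \<and> s = k'" using block_eq[of s b k' k k'] a \<open>k' < b\<close> by blast
  then show "s < b \<and> x = s * b" using a k by (simp add: mult.commute)
qed

lemma D_mul:
  assumes "b \<in> set Ts" "s \<in> set Ts" "x \<in> set Ts" "M \<in> set Bs" "E \<in> set Bs"
    and V: "\<And>c. I c ==> sq_base (b c) (b1 c) (Q c) (M c) (E c)"
  shows "D K W I Ts Bs (%c. s c < b c \<and> x c = s c * b c)"
proof (rule D_eq_cong)
  show "D K W I Ts Bs (%c. s c < b c \<and> x c \<in> M c \<and> (\<exists>y<K * length (W c). x c + s c = y \<and> y \<in> E c))"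
    by (intro D_intros D_mems assms)
  fix c assume c: "I c" "gd K W Ts Bs c"
  have "E c \<subseteq> {..<K * length (W c)}" using c(2) assms(5) by (simp add: gd_def)
  then show "(s c < b c \<and> x c \<in> M c \<and> (\<exists>y<K * length (W c). x c + s c = y \<and> y \<in> E c)) = (s c < b c \<and> x c = s c * b c)"
    unfolding sq_base_mul[OF V[OF c(1)]] by auto
qed

end

text \<open>Entry \<open>s\<close> of a row owns the segment from \<open>s * b\<close> on; its high
  digit is marked there in \<open>G1\<close> and its low digit in \<open>G2\<close>.\<close>

definition rowi :: "nat => nat set => nat set => nat => nat => bool" where
  "rowi b G1 G2 s p \<longleftrightarrow> (\<exists>hi<b. \<exists>lo<b. s * b + hi \<in> G1 \<and> s * b + lo \<in> G2 \<and> p = hi * b + lo)"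

context flogic
begin

lemma rowi_encode:
  assumes "0 < b" "\<And>s. s < b ==> g s < b * b"
  shows "\<exists>G1 G2. G1 \<subseteq> {..<b * b} \<and> G2 \<subseteq> {..<b * b} \<and> (\<forall>s<b. \<forall>p. rowi b G1 G2 s p \<longleftrightarrow> p = g s)"
proof -
  define G1 where "G1 = (%s. s * b + g s div b) ` {..<b}"
  define G2 where "G2 = (%s. s * b + g s mod b) ` {..<b}"
  have lt: "g s div b < b" "g s mod b < b" if "s < b" for s
    using assms that by (simp_all add: less_mult_imp_div_less)
  have sub: "s * b + x < b * b" if "s < b" "x < b" for s x
  proof -
    have "s * b + x < Suc s * b" using that by simp
    also have "\<dots> \<le> b * b" using that by (intro mult_le_mono1) simp
    finally show ?thesis .
  qed
  have m: "s * b + hi \<in> G1 \<longleftrightarrow> hi = g s div b" "s * b + hi \<in> G2 \<longleftrightarrow> hi = g s mod b" if "s < b" "hi < b" for s hi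
    unfolding G1_def G2_def image_iff using that lt block_eq[OF that(2) lt(1), of _ s] block_eq[OF that(2) lt(2), of _ s] by auto
  have "rowi b G1 G2 s p \<longleftrightarrow> p = g s" if "s < b" for s p
  proof
    assume "rowi b G1 G2 s p"
    then obtain hi lo where "hi < b" "lo < b" "s * b + hi \<in> G1" "s * b + lo \<in> G2" "p = hi * b + lo" by (auto simp: rowi_def)
    then show "p = g s" using m[OF that] by simp
  next
    assume "p = g s"
    then show "rowi b G1 G2 s p" unfolding rowi_def using lt[OF that] m[OF that]
      by (intro exI[of _ "g s div b"] exI[of _ "g s mod b"] conjI) auto
  qed
  moreover have "G1 \<subseteq> {..<b * b}" "G2 \<subseteq> {..<b * b}" using sub lt by (auto simp: G1_def G2_def)
  ultimately show ?thesis by blast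
qed

lemma D_row:
  assumes mem: "b \<in> set Ts" "s \<in> set Ts" "p \<in> set Ts" "M \<in> set Bs" "E \<in> set Bs" "G1 \<in> set Bs" "G2 \<in> set Bs"
    and V: "\<And>c. I c ==> sq_base (b c) (b1 c) (Q c) (M c) (E c)"
    and Q: "Q \<in> set Ts" and s: "\<And>c. I c ==> s c < b c"
  shows "D K W I Ts Bs (%c. rowi (b c) (G1 c) (G2 c) (s c) (p c))"
proof (rule D_eq_cong)
  let ?P = "%c hi lo x H u v. lo < b c \<and> (s c < b c \<and> x = s c * b c) \<and> (hi < b c \<and> H = hi * b c) \<and> x + hi = u \<and> u \<in> G1 c \<and> x + lo = v \<and> v \<in> G2 c \<and> H + lo = p c"
  show "D K W I Ts Bs (%c. \<exists>hi<K * length (W c). \<exists>lo<K * length (W c). \<exists>x<K * length (W c). \<exists>H<K * length (W c). \<exists>u<K * length (W c). \<exists>v<K * length (W c). ?P c hi lo x H u v)"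
    apply (rule D_ex)+
    apply (rule D_and, (intro D_intros D_mems mem)[1])
    apply (rule D_and, rule D_mul[rotated 5], rule V, assumption, ((intro D_mems mem)[1])+)
    apply (rule D_and, rule D_mul[rotated 5], rule V, assumption, ((intro D_mems mem)[1])+)
    apply (intro D_intros D_mems mem)
    done
  fix c assume c: "I c" "gd K W Ts Bs c"
  let ?N = "K * length (W c)"
  have N: "b c * b c < ?N" using c(2) Q V[OF c(1)] by (auto simp: gd_def sq_base_def)
  have sb: "s c < b c" using s c(1) by simp
  have lt: "r * b c + x < ?N" if "r < b c" "x < b c" for r x
  proof -
    have "r * b c + x < Suc r * b c" using that by simp
    also have "\<dots> \<le> b c * b c" using that by (intro mult_le_mono1) simp
    finally show ?thesis using N by simp
  qed
  have b0: "0 < b c" using sb by simp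
  show "(\<exists>hi<?N. \<exists>lo<?N. \<exists>x<?N. \<exists>H<?N. \<exists>u<?N. \<exists>v<?N. ?P c hi lo x H u v) = rowi (b c) (G1 c) (G2 c) (s c) (p c)"
  proof
    assume "rowi (b c) (G1 c) (G2 c) (s c) (p c)"
    then obtain hi lo where h: "hi < b c" "lo < b c" "s c * b c + hi \<in> G1 c" "s c * b c + lo \<in> G2 c" "p c = hi * b c + lo" by (auto simp: rowi_def)
    have l: "hi < ?N" "lo < ?N" "s c * b c < ?N" "hi * b c < ?N"
      using lt[of 0 hi] lt[of 0 lo] lt[OF sb b0] lt[OF h(1) b0] h(1,2) b0 by simp_all
    show "\<exists>hi<?N. \<exists>lo<?N. \<exists>x<?N. \<exists>H<?N. \<exists>u<?N. \<exists>v<?N. ?P c hi lo x H u v"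
      by (rule exI[of _ hi], rule conjI[OF l(1)], rule exI[of _ lo], rule conjI[OF l(2)], rule exI[of _ "s c * b c"], rule conjI[OF l(3)],
          rule exI[of _ "hi * b c"], rule conjI[OF l(4)], rule exI[of _ "s c * b c + hi"], rule conjI[OF lt[OF sb h(1)]],
          rule exI[of _ "s c * b c + lo"], rule conjI[OF lt[OF sb h(2)]]) (use h sb in simp)
  next
    assume "\<exists>hi<?N. \<exists>lo<?N. \<exists>x<?N. \<exists>H<?N. \<exists>u<?N. \<exists>v<?N. ?P c hi lo x H u v"
    then obtain hi lo x H u v where P: "?P c hi lo x H u v"
      by (elim exE conjE) (rule that, intro conjI, assumption+)
    then have "hi < b c" "lo < b c" "s c * b c + hi \<in> G1 c" "s c * b c + lo \<in> G2 c" "p c = hi * b c + lo" by auto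
    then show "rowi (b c) (G1 c) (G2 c) (s c) (p c)" unfolding rowi_def by blast
  qed
qed

text \<open>Two guessed sets are checked to hold the sequence: the entry at 0 is the start value,
  and neighbouring entries are related by the step. In \<open>SD\<close> the layers around the
  context are, from the inside out, the guessed sets, \<open>s\<close>, \<open>s'\<close>,
  \<open>p'\<close> and \<open>p\<close>.\<close>

lemma D_seq:
  fixes S :: "'c => nat => nat => nat => bool"
  assumes mem: "b \<in> set Ts" "Q \<in> set Ts" "a \<in> set Ts" "s \<in> set Ts" "q \<in> set Ts" "M \<in> set Bs" "E \<in> set Bs"
    and K: "K > 0"
    and V: "\<And>c. I c ==> sq_base (b c) (b1 c) (Q c) (M c) (E c)"
    and s: "\<And>c. I c ==> s c < b c" and g: "\<And>c s. I c ==> s < b c ==> g c s < Q c" and g0: "\<And>c. I c ==> g c 0 = a c"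
    and step: "\<And>c s p'. I c ==> Suc s < b c ==> S c s (g c s) p' \<longleftrightarrow> p' = g c (Suc s)"
    and SD: "D K (%r. W (fst (fst (fst (fst (fst r)))))) (%r. I (fst (fst (fst (fst (fst r))))) \<and> Suc (snd (fst (fst (fst r)))) = snd (fst (fst r)) \<and> snd (fst (fst r)) < b (fst (fst (fst (fst (fst r))))))
      (liftT (liftT (liftT (liftT (liftT Ts) @ [snd]) @ [snd]) @ [snd]) @ [snd]) (liftT (liftT (liftT (liftT (liftT Bs @ setp 2)))))
      (%r. S (fst (fst (fst (fst (fst r))))) (snd (fst (fst (fst r)))) (snd r) (snd (fst r)))"
  shows "D K W I Ts Bs (%c. q c = g c (s c))"
proof (rule D_eq_cong)
  let ?P = "%c As. (\<exists>z<K * length (W c). z = 0 \<and> (\<forall>p<K * length (W c). rowi (b c) (As!0) (As!1) z p \<longleftrightarrow> p = a c)) \<and>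
     (\<forall>s<K * length (W c). \<forall>s'<K * length (W c). Suc s = s' \<and> s' < b c -->
        (\<forall>p'<K * length (W c). rowi (b c) (As!0) (As!1) s' p' \<longleftrightarrow> (\<exists>p<K * length (W c). rowi (b c) (As!0) (As!1) s p \<and> S c s p p'))) \<and>
     rowi (b c) (As!0) (As!1) (s c) (q c)"
  have m: "map f [0..<2] ! 0 = f 0" "map f [0..<2] ! 1 = f 1" for f :: "nat => nat set" by simp_all
  have b0: "0 < b c" if "I c" for c using V[OF that] by (simp add: sq_base_def)
  have two: "0 < (2::nat)" "1 < (2::nat)" by simp_all
  show "D K W I Ts Bs (%c. \<exists>As\<in>tuples (K * length (W c)) 2. ?P c As)"
    apply (rule D_exs[OF two(1) K])
    apply (unfold m)
    apply (rule D_and)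
     apply (rule D_ex, rule D_conj, (intro D_intros D_mems mem)[1])
     apply (rule D_all, rule D_iff)
      apply (rule D_row[rotated 7], rule V, blast, (intro D_mems mem)[1], simp add: b0, ((intro D_mems mem two)[1])+)
     apply (intro D_intros D_mems mem)
    apply (rule D_and)
     apply (rule D_all, rule D_all, rule D_imp, (intro D_intros D_mems mem)[1])
     apply (rule D_all, rule D_iff)
      apply (rule D_row[rotated 7], rule V, blast, (intro D_mems mem)[1], blast, ((intro D_mems mem two)[1])+)
     apply (rule D_ex, rule D_and)
      apply (rule D_row[rotated 7], rule V, blast, (intro D_mems mem)[1], linarith, ((intro D_mems mem two)[1])+)
     apply (rule D_cong[OF SD], blast)
    apply (rule D_row[rotated 7], rule V, blast, (intro D_mems mem)[1], rule s, blast, ((intro D_mems mem two)[1])+)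
    done
  fix c assume c: "I c" "gd K W Ts Bs c"
  let ?N = "K * length (W c)"
  have QN: "Q c < ?N" "q c < ?N" using c(2) mem by (auto simp: gd_def)
  have b: "0 < b c" "Q c = b c * b c" using V[OF c(1)] by (auto simp: sq_base_def)
  have N0: "0 < ?N" by (rule le_less_trans[OF le0 QN(1)])
  have gN: "g c s < ?N" if "s < b c" for s using g[OF c(1) that] QN by simp
  have bN: "b c \<le> Q c" using b by simp
  show "(\<exists>As\<in>tuples ?N 2. ?P c As) = (q c = g c (s c))"
  proof
    assume "\<exists>As\<in>tuples ?N 2. ?P c As"
    then obtain As where P: "?P c As" by blast
    note P1 = P[THEN conjunct1] and P2 = P[THEN conjunct2, THEN conjunct1] and P3 = P[THEN conjunct2, THEN conjunct2]
    have "\<forall>p<?N. rowi (b c) (As!0) (As!1) s p \<longleftrightarrow> p = g c s" if "s < b c" for s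
      using that
    proof (induction s)
      case 0
      then show ?case using P1 g0[OF c(1)] by simp
    next
      case (Suc s)
      have IH: "\<forall>p<?N. rowi (b c) (As!0) (As!1) s p \<longleftrightarrow> p = g c s" using Suc by simp
      have "s < ?N" "Suc s < ?N" using Suc.prems bN QN by auto
      then have "\<forall>p'<?N. rowi (b c) (As!0) (As!1) (Suc s) p' \<longleftrightarrow> (\<exists>p<?N. rowi (b c) (As!0) (As!1) s p \<and> S c s p p')"
        using P2 Suc.prems by blast
      then show ?case using IH step[OF c(1) Suc.prems] gN[of s] Suc.prems by auto
    qed
    from this[OF s[OF c(1)]] show "q c = g c (s c)" using P3 QN(2) by simp
  next
    assume q: "q c = g c (s c)"
    obtain G1 G2 where G: "G1 \<subseteq> {..<b c * b c}" "G2 \<subseteq> {..<b c * b c}" "\<And>s p. s < b c ==> rowi (b c) G1 G2 s p \<longleftrightarrow> p = g c s"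
      using rowi_encode[OF b(1), of "g c"] g[OF c(1)] b(2) by auto
    have sub: "{..<b c * b c} \<subseteq> {..<?N}" using b(2) QN(1) by simp
    have "G1 \<subseteq> {..<?N}" "G2 \<subseteq> {..<?N}" by (rule subset_trans[OF G(1) sub], rule subset_trans[OF G(2) sub])
    then have "[G1, G2] \<in> tuples ?N 2" unfolding tuples_def by simp
    moreover have "?P c [G1, G2]"
    proof (intro conjI)
      show "\<exists>z<?N. z = 0 \<and> (\<forall>p<?N. rowi (b c) ([G1, G2]!0) ([G1, G2]!1) z p \<longleftrightarrow> p = a c)"
        using N0 G(3)[OF b(1)] g0[OF c(1)] by simp
      show "rowi (b c) ([G1, G2]!0) ([G1, G2]!1) (s c) (q c)" using G(3)[OF s[OF c(1)]] q by simp
      show "\<forall>s<?N. \<forall>s'<?N. Suc s = s' \<and> s' < b c -->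
        (\<forall>p'<?N. rowi (b c) ([G1, G2]!0) ([G1, G2]!1) s' p' \<longleftrightarrow> (\<exists>p<?N. rowi (b c) ([G1, G2]!0) ([G1, G2]!1) s p \<and> S c s p p'))"
        using G(3) step[OF c(1)] gN by auto
    qed
    ultimately show "\<exists>As\<in>tuples ?N 2. ?P c As" by blast
  qed
qed

end

type_synonym canon = "nat list \<times> nat list \<times> nat set list"

text \<open>\<open>E\<close> selects the parameters of a relation among the terms and sets of a
  context; fixing their numbers gives relations an arity.\<close>

definition Env :: "('c => nat list) => ('c => nat) list => ('c => nat set) list => nat => nat => ('c => canon) => bool" where
  "Env W Ts Bs a b E \<longleftrightarrow> (\<exists>ts bs. length ts = a \<and> set ts \<subseteq> set Ts \<and> length bs = b \<and> set bs \<subseteq> set Bs \<and>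
     (\<forall>c. E c = (W c, map (%t. t c) ts, map (%B. B c) bs)))"

lemma EnvI: "length ts = a ==> set ts \<subseteq> set Ts ==> length bs = b ==> set bs \<subseteq> set Bs ==>
   Env W Ts Bs a b (%c. (W c, map (%t. t c) ts, map (%B. B c) bs))"
  unfolding Env_def by blast

lemma Env_fst: "Env W Ts Bs a b E ==> fst (E c) = W c"
  by (auto simp: Env_def)

lemma Env_lift4: "Env W Ts Bs a b E ==> Env (%p. W (fst p)) (liftT Ts @ us) (liftT Bs @ vs) a b (%p. E (fst p))"
proof -
  assume "Env W Ts Bs a b E"
  then obtain ts bs where e: "length ts = a" "set ts \<subseteq> set Ts" "length bs = b" "set bs \<subseteq> set Bs"
     "\<And>c. E c = (W c, map (%t. t c) ts, map (%B. B c) bs)" by (auto simp: Env_def)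
  show ?thesis unfolding Env_def
    by (rule exI[of _ "liftT ts"], rule exI[of _ "liftT bs"]) (use e in \<open>auto simp: liftT_def\<close>)
qed

lemmas Env_lift = Env_lift4 Env_lift4[where us = "[]", simplified] Env_lift4[where vs = "[]", simplified]
  Env_lift4[where us = "[]" and vs = "[]", simplified]

type_synonym 'c ctx5 = "((((('c \<times> (nat => nat set)) \<times> nat) \<times> nat) \<times> nat) \<times> nat)"

context flogic
begin

text \<open>As one cannot quantify over context types, definability for all contexts is expressed with
  the context type \<open>canon\<close>, whose contexts are the tuples of the values of all terms and sets.\<close>

definition RelD :: "nat => nat => nat => nat => (canon => bool) => (canon => nat list => bool) => bool" where
  "RelD K a b k J R \<longleftrightarrow> (\<forall>Ts Bs (E :: canon => canon) ys. Env fst Ts Bs a b E --> length ys = k --> set ys \<subseteq> set Ts -->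
     D K fst (%c. J (E c)) Ts Bs (%c. R (E c) (map (%t. t c) ys)))"

lemma RelD_use:
  fixes W :: "'c => nat list"
  assumes R: "RelD K a b k J R" and E: "Env W Ts Bs a b E" and ys: "length ys = k" "set ys \<subseteq> set Ts"
    and J: "\<And>c. I c ==> J (E c)"
  shows "D K W I Ts Bs (%c. R (E c) (map (%t. t c) ys))"
proof -
  obtain ts bs where e: "length ts = a" "set ts \<subseteq> set Ts" "length bs = b" "set bs \<subseteq> set Bs"
     "\<And>c. E c = (W c, map (%t. t c) ts, map (%B. B c) bs)" using E by (auto simp: Env_def)
  have idx: "\<exists>is. length is = length xs \<and> set is \<subseteq> {..<length Xs} \<and> xs = map ((!) Xs) is" if "set xs \<subseteq> set Xs" for xs Xs :: "'x list"
    using that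
  proof (induction xs)
    case (Cons x xs)
    then obtain "is" where "length is = length xs" "set is \<subseteq> {..<length Xs}" "xs = map ((!) Xs) is" by auto
    moreover obtain i where "i < length Xs" "Xs ! i = x" using Cons.prems by (auto simp: in_set_conv_nth)
    ultimately show ?case by (intro exI[of _ "i # is"]) auto
  qed simp
  obtain it where it: "length it = a" "set it \<subseteq> {..<length Ts}" "ts = map ((!) Ts) it" using idx[OF e(2)] e(1) by auto
  obtain ib where ib: "length ib = b" "set ib \<subseteq> {..<length Bs}" "bs = map ((!) Bs) ib" using idx[OF e(4)] e(3) by auto
  obtain iy where iy: "length iy = k" "set iy \<subseteq> {..<length Ts}" "ys = map ((!) Ts) iy" using idx[OF ys(2)] ys(1) by auto
  let ?T = "map (%i c. (fst (snd c)) ! i) [0..<length Ts] :: (canon => nat) list"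
  let ?B = "map (%j c. (snd (snd c)) ! j) [0..<length Bs] :: (canon => nat set) list"
  let ?E = "%c :: canon. (fst c, map (%t. t c) (map (%i c. (fst (snd c)) ! i) it), map (%t. t c) (map (%i c. (snd (snd c)) ! i) ib))"
  have "Env fst ?T ?B a b ?E" using it ib by (intro EnvI) auto
  then have "D K fst (%c. J (?E c)) ?T ?B (%c. R (?E c) (map (%t. t c) (map (%i c. (fst (snd c)) ! i) iy)))"
    using R iy unfolding RelD_def by (elim allE[of _ ?T] allE[of _ ?B] allE[of _ ?E] allE[of _ "map (%i c. (fst (snd c)) ! i) iy"]) auto
  from D_transfer[OF this, of W] show ?thesis
  proof (rule D_cong)
    fix c assume "I c"
    let ?c = "(W c, map (%t. t c) Ts, map (%B. B c) Bs)"
    have m: "map (%i. map (%t. t c) Xs ! i) is = map (%t. t c) (map ((!) Xs) is)" if "set is \<subseteq> {..<length Xs}" for Xs :: "('c => 'x) list" and "is"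
      using that by (auto simp: subset_iff)
    have "?E ?c = E c" using e(5) it ib m[OF it(2)] m[OF ib(2)] by (simp add: comp_def)
    moreover have "map (%t. t ?c) (map (%i c. (fst (snd c)) ! i) iy) = map (%t. t c) ys" using m[OF iy(2)] iy(3) by (simp add: comp_def)
    ultimately show "J (?E ?c) \<and> R (?E ?c) (map (%t. t ?c) (map (%i c. (fst (snd c)) ! i) iy)) = R (E c) (map (%t. t c) ys)"
      using J[OF \<open>I c\<close>] by simp
  qed
qed

end

text \<open>The step \<open>F\<close> may depend on time. Values stay below \<open>K0 * n\<close>,
  and the universe is four times as large in order to hold a square above that bound.\<close>

locale iteration = flogic G Md for G Md +
  fixes K K0 a bb :: nat and J :: "canon => bool" and F :: "canon => nat => nat => nat" and h :: "canon => nat => nat"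
  assumes S: "RelD K a bb 3 J (%e ys. ys!2 = F e (ys!0) (ys!1))" and K0: "0 < K0" "4 * K0 \<le> K"
    and bound: "\<And>e t p. J e ==> fst e \<noteq> [] ==> F e t p < K0 * length (fst e)"
    and h0: "\<And>e. h e 0 = 0" and hS: "\<And>e t. h e (Suc t) = F e t (h e t)"
begin

lemma S_use:
  assumes "Env W Ts Bs a bb E" "t \<in> set Ts" "p \<in> set Ts" "q \<in> set Ts" "\<And>c. I c ==> J (E c)"
  shows "D K W I Ts Bs (%c. q c = F (E c) (t c) (p c))"
  using RelD_use[OF S assms(1), of "[t, p, q]" I] assms(2-5) by simp

definition it :: "canon => nat => nat => nat => nat" where
  "it e x p s = rec_nat p (%s v. F e (x + s) v) s"

lemma it_simps [simp]: "it e x p 0 = p" "it e x p (Suc s) = F e (x + s) (it e x p s)"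
  by (simp_all add: it_def)

lemma h_it: "h e (x + s) = it e x (h e x) s"
  by (induction s) (simp_all add: hS)

lemma it_less: "J e ==> fst e \<noteq> [] ==> p < K0 * length (fst e) ==> it e x p s < K0 * length (fst e)"
  by (cases s) (simp_all add: bound)

lemma h_less: "J e ==> fst e \<noteq> [] ==> h e t < K0 * length (fst e)"
  using K0 by (cases t) (simp_all add: bound h0 hS)

text \<open>The time inside a row is \<open>x + s\<close>. As \<open>x\<close> starts a row, this
  stays below the square \<open>Q\<close> and is therefore an element to which \<open>F\<close> can
  be applied.\<close>

lemma D_inner:
  fixes W :: "'c => nat list"
  assumes E: "Env W Ts Bs a bb E"
    and mem: "b \<in> set Ts" "Q \<in> set Ts" "x \<in> set Ts" "p \<in> set Ts" "s \<in> set Ts" "q \<in> set Ts" "M \<in> set Bs" "Es \<in> set Bs"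
    and V: "\<And>c. I c ==> sq_base (b c) (b1 c) (Q c) (M c) (Es c)" and J: "\<And>c. I c ==> J (E c) \<and> W c \<noteq> []"
    and x: "\<And>c. I c ==> \<exists>r<b c. x c = r * b c" and p: "\<And>c. I c ==> p c < K0 * length (W c) \<and> K0 * length (W c) \<le> Q c"
    and s: "\<And>c. I c ==> s c < b c"
  shows "D K W I Ts Bs (%c. q c = it (E c) (x c) (p c) (s c))"
proof (rule D_seq[where b = b and Q = Q and a = p and M = M and E = Es and ?b1.0 = b1 and g = "%c s. it (E c) (x c) (p c) s" and S = "%c s p p'. p' = F (E c) (x c + s) p"])
  show "0 < K" using K0 by simp
  show "it (E c) (x c) (p c) s < Q c" if "I c" "s < b c" for c s
    using it_less[of "E c" "p c" "x c" s] J[OF that(1)] p[OF that(1)] Env_fst[OF E, of c] by simp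
  show "D K (%r. W (fst (fst (fst (fst (fst r)))))) (%r. I (fst (fst (fst (fst (fst r))))) \<and> Suc (snd (fst (fst (fst r)))) = snd (fst (fst r)) \<and> snd (fst (fst r)) < b (fst (fst (fst (fst (fst r))))))
      (liftT (liftT (liftT (liftT (liftT Ts) @ [snd]) @ [snd]) @ [snd]) @ [snd]) (liftT (liftT (liftT (liftT (liftT Bs @ setp 2)))))
      (%r. snd (fst r) = F (E (fst (fst (fst (fst (fst r)))))) (x (fst (fst (fst (fst (fst r))))) + snd (fst (fst (fst r)))) (snd r))"
  proof (rule D_eq_cong)
    show "D K (%r. W (fst (fst (fst (fst (fst r)))))) (%r. I (fst (fst (fst (fst (fst r))))) \<and> Suc (snd (fst (fst (fst r)))) = snd (fst (fst r)) \<and> snd (fst (fst r)) < b (fst (fst (fst (fst (fst r))))))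
      (liftT (liftT (liftT (liftT (liftT Ts) @ [snd]) @ [snd]) @ [snd]) @ [snd]) (liftT (liftT (liftT (liftT (liftT Bs @ setp 2)))))
      (%r. \<exists>t<K * length (W (fst (fst (fst (fst (fst r)))))). x (fst (fst (fst (fst (fst r))))) + snd (fst (fst (fst r))) = t \<and> snd (fst r) = F (E (fst (fst (fst (fst (fst r)))))) t (snd r))"
      apply (rule D_ex, rule D_and)
       apply (intro D_intros D_mems mem)
      apply (rule S_use)
          apply (rule Env_lift)+
          apply (rule E)
         apply (intro D_mems mem)
        apply (intro D_mems mem)
       apply (intro D_mems mem)
      apply (use J in blast)
      done
    fix r :: "'c ctx5"
    obtain c A s s' p' pp where r: "r = (((((c, A), s), s'), p'), pp)" by (metis prod.collapse)
    let ?TT = "liftT (liftT (liftT (liftT (liftT Ts) @ [snd]) @ [snd]) @ [snd]) @ [snd]"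
    assume I: "I (fst (fst (fst (fst (fst r))))) \<and> Suc (snd (fst (fst (fst r)))) = snd (fst (fst r)) \<and> snd (fst (fst r)) < b (fst (fst (fst (fst (fst r)))))"
      and gd: "gd K (%r. W (fst (fst (fst (fst (fst r)))))) ?TT (liftT (liftT (liftT (liftT (liftT Bs @ setp 2))))) r"
    have "(%r. Q (fst (fst (fst (fst (fst r)))))) \<in> set ?TT" by (intro D_mems mem)
    moreover have "\<forall>t\<in>set ?TT. t r < K * length (W c)" using gd unfolding gd_def r by simp
    ultimately have "Q c < K * length (W c)" unfolding r by (metis fst_conv)
    moreover have "x c + s < Q c"
    proof -
      obtain k where k: "k < b c" "x c = k * b c" using x I r by auto
      have "x c + s < Suc k * b c" using k I r by auto
      also have "\<dots> \<le> b c * b c" using k by (intro mult_le_mono1) simp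
      also have "\<dots> = Q c" using V[of c] I r by (auto simp: sq_base_def)
      finally show ?thesis .
    qed
    ultimately show "(\<exists>t<K * length (W (fst (fst (fst (fst (fst r)))))). x (fst (fst (fst (fst (fst r))))) + snd (fst (fst (fst r))) = t \<and> snd (fst r) = F (E (fst (fst (fst (fst (fst r)))))) t (snd r))
       = (snd (fst r) = F (E (fst (fst (fst (fst (fst r)))))) (x (fst (fst (fst (fst (fst r))))) + snd (fst (fst (fst r)))) (snd r))"
      unfolding r by auto
  qed
qed (use mem V s in auto)

text \<open>The values at the starts of rows form a sequence of length \<open>b\<close> again. Its
  step crosses a whole row: \<open>b - 1\<close> steps come from \<open>D_inner\<close>, whose index
  must be below \<open>b\<close>, and the last one is a direct application of
  \<open>F\<close>.\<close>

lemma D_outer: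
  fixes W :: "'c => nat list"
  assumes E: "Env W Ts Bs a bb E"
    and mem: "b \<in> set Ts" "Q \<in> set Ts" "r \<in> set Ts" "q \<in> set Ts" "z \<in> set Ts" "M \<in> set Bs" "Es \<in> set Bs"
    and V: "\<And>c. I c ==> sq_base (b c) (b1 c) (Q c) (M c) (Es c)" and J: "\<And>c. I c ==> J (E c) \<and> W c \<noteq> []"
    and Q: "\<And>c. I c ==> K0 * length (W c) \<le> Q c" and r: "\<And>c. I c ==> r c < b c" and z: "\<And>c. I c ==> z c = 0"
  shows "D K W I Ts Bs (%c. q c = h (E c) (r c * b c))"
proof (rule D_seq[where b = b and Q = Q and a = z and M = M and E = Es and ?b1.0 = b1 and g = "%c s. h (E c) (s * b c)" and
    S = "%c s p p'. p < K0 * length (W c) \<and> p' = F (E c) (s * b c + (b c - 1)) (it (E c) (s * b c) p (b c - 1))"])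
  show "0 < K" using K0 by simp
  show "h (E c) (s * b c) < Q c" if "I c" "s < b c" for c s
    using h_less[of "E c" "s * b c"] J[OF that(1)] Q[OF that(1)] Env_fst[OF E, of c] by simp
  show "h (E c) (0 * b c) = z c" if "I c" for c using z[OF that] h0 by simp
  show "h (E c) (s * b c) < K0 * length (W c) \<and> p' = F (E c) (s * b c + (b c - 1)) (it (E c) (s * b c) (h (E c) (s * b c)) (b c - 1))
      \<longleftrightarrow> p' = h (E c) (Suc s * b c)" if "I c" "Suc s < b c" for c s p'
  proof -
    have "Suc s * b c = Suc (s * b c + (b c - 1))" using that(2) by simp
    then have "h (E c) (Suc s * b c) = F (E c) (s * b c + (b c - 1)) (it (E c) (s * b c) (h (E c) (s * b c)) (b c - 1))"
      by (simp only: hS h_it)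
    then show ?thesis using h_less[of "E c" "s * b c"] J[OF that(1)] Env_fst[OF E, of c] by simp
  qed
  let ?WW = "%r :: 'c ctx5. W (fst (fst (fst (fst (fst r)))))"
  let ?II = "%r :: 'c ctx5. I (fst (fst (fst (fst (fst r))))) \<and> Suc (snd (fst (fst (fst r)))) = snd (fst (fst r)) \<and> snd (fst (fst r)) < b (fst (fst (fst (fst (fst r)))))"
  let ?TT = "liftT (liftT (liftT (liftT (liftT Ts) @ [snd]) @ [snd]) @ [snd]) @ [snd]"
  let ?BB = "liftT (liftT (liftT (liftT (liftT Bs @ setp 2))))"
  let ?b = "%r :: 'c ctx5. b (fst (fst (fst (fst (fst r)))))" and ?E = "%r :: 'c ctx5. E (fst (fst (fst (fst (fst r)))))"
  let ?s = "%r :: 'c ctx5. snd (fst (fst (fst r)))" and ?p = "%r :: 'c ctx5. snd r" and ?p' = "%r :: 'c ctx5. snd (fst r)"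
  show "D K ?WW ?II ?TT ?BB
      (%r. ?p r < K0 * length (?WW r) \<and> ?p' r = F (?E r) (?s r * ?b r + (?b r - 1)) (it (?E r) (?s r * ?b r) (?p r) (?b r - 1)))"
  proof (rule D_eq_cong)
    show "D K ?WW ?II ?TT ?BB (%r. ?p r < K0 * length (?WW r) \<and> (\<exists>x<K * length (?WW r). (?s r < ?b r \<and> x = ?s r * ?b r) \<and>
       (\<exists>m<K * length (?WW r). Suc m = ?b r \<and> (\<exists>p1<K * length (?WW r). p1 = it (?E r) x (?p r) m \<and>
         (\<exists>t<K * length (?WW r). x + m = t \<and> ?p' r = F (?E r) t p1)))))"
      apply (rule D_conj, (intro D_intros D_mems mem)[1])
      apply (rule D_ex, rule D_conj)
       apply (rule D_mul[rotated 5], rule V, blast, ((intro D_mems mem)[1])+)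
      apply (rule D_ex, rule D_conj, (intro D_intros D_mems mem)[1])
      apply (rule D_ex, rule D_and)
       apply (rule D_inner[rotated 9], rule V, blast, use J in blast, blast, use Q in blast)
         apply (elim conjE, linarith)
        apply ((rule Env_lift)+, rule E)
       apply ((intro D_mems mem)[1])+
      apply (rule D_ex, rule D_and, (intro D_intros D_mems mem)[1])
      apply (rule S_use)
          apply ((rule Env_lift)+, rule E)
         apply ((intro D_mems mem)[1])+
      apply (use J in blast)
      done
    fix r0 :: "'c ctx5"
    obtain c A s s' p' pp where r0: "r0 = (((((c, A), s), s'), p'), pp)" by (metis prod.collapse)
    assume I: "?II r0" and gd: "gd K ?WW ?TT ?BB r0"
    let ?N = "K * length (W c)"
    have Ic: "I c" and sb: "Suc s < b c" using I by (auto simp: r0)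
    have "(%r. Q (fst (fst (fst (fst (fst r)))))) \<in> set ?TT" by (intro D_mems mem)
    moreover have "\<forall>t\<in>set ?TT. t r0 < ?N" using gd unfolding gd_def r0 by simp
    ultimately have QN: "Q c < ?N" unfolding r0 by (metis fst_conv)
    have Qb: "Q c = b c * b c" "0 < b c" using V[OF Ic] by (auto simp: sq_base_def)
    have lt: "s * b c + m < ?N" if "m < b c" for m
    proof -
      have "s * b c + m < Suc s * b c" using that by simp
      also have "\<dots> \<le> b c * b c" using sb by (intro mult_le_mono1) simp
      finally show ?thesis using Qb QN by simp
    qed
    have itl: "it (E c) x pp m < ?N" if "pp < K0 * length (W c)" for x m
      using it_less[of "E c" pp x m] J[OF Ic] Q[OF Ic] QN Env_fst[OF E, of c] that by simp
    have bN: "b c - 1 < ?N" "s * b c < ?N" "s * b c + (b c - 1) < ?N" using lt[of 0] lt[of "b c - 1"] Qb(2) by simp_all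
    have sm: "Suc m = b c \<longleftrightarrow> m = b c - 1" for m using Qb(2) by auto
    have ex: "(\<exists>x<n. x = (v::nat) \<and> P x) \<longleftrightarrow> v < n \<and> P v" for n v P by blast
    have ex': "(\<exists>x<n. v = (x::nat) \<and> P x) \<longleftrightarrow> v < n \<and> P v" for n v P by blast
    have "s < b c" using sb by simp
    have "(pp < K0 * length (W c) \<and> (\<exists>x<?N. (s < b c \<and> x = s * b c) \<and> (\<exists>m<?N. Suc m = b c \<and> (\<exists>p1<?N. p1 = it (E c) x pp m \<and> (\<exists>t<?N. x + m = t \<and> p' = F (E c) t p1)))))
       = (pp < K0 * length (W c) \<and> p' = F (E c) (s * b c + (b c - 1)) (it (E c) (s * b c) pp (b c - 1)))"
      unfolding sm ex ex' using bN itl \<open>s < b c\<close> by auto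
    then show "(?p r0 < K0 * length (?WW r0) \<and> (\<exists>x<K * length (?WW r0). (?s r0 < ?b r0 \<and> x = ?s r0 * ?b r0) \<and>
       (\<exists>m<K * length (?WW r0). Suc m = ?b r0 \<and> (\<exists>p1<K * length (?WW r0). p1 = it (?E r0) x (?p r0) m \<and>
         (\<exists>t<K * length (?WW r0). x + m = t \<and> ?p' r0 = F (?E r0) t p1)))))
      = (?p r0 < K0 * length (?WW r0) \<and> ?p' r0 = F (?E r0) (?s r0 * ?b r0 + (?b r0 - 1)) (it (?E r0) (?s r0 * ?b r0) (?p r0) (?b r0 - 1)))"
      unfolding r0 fst_conv snd_conv .
  qed
qed (use mem V r in auto)

text \<open>With \<open>M = K0 * n\<close>, the least \<open>b\<close> such that
  \<open>M \<le> b * b\<close> satisfies \<open>b \<le> M\<close> and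
  \<open>b * b < M + 2 * b\<close>, hence \<open>b * b < 4 * M\<close>. This is the origin of the
  factor 4 in the locale.\<close>

lemma sq_ex:
  assumes n: "0 < (n::nat)"
  shows "\<exists>b. 0 < b \<and> K0 * n \<le> b * b \<and> b * b < K * n \<and> Suc b < K * n"
proof -
  let ?M = "K0 * n"
  have M: "0 < ?M" using n K0 by simp
  define b where "b = (LEAST b. ?M \<le> b * b)"
  have "?M \<le> ?M * ?M" using M by simp
  then have b1: "?M \<le> b * b" and b2: "b \<le> ?M" unfolding b_def by (rule LeastI, rule Least_le)
  have b0: "0 < b" using b1 M by (cases b) auto
  then have "\<not> ?M \<le> (b - 1) * (b - 1)" unfolding b_def by (intro not_less_Least) simp
  moreover have "b * b = (b - 1) * (b - 1) + 2 * (b - 1) + 1" using b0 by (cases b) (auto simp: algebra_simps)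
  ultimately have "b * b < ?M + 2 * b" using b0 by linarith
  then have "b * b < 4 * ?M" "Suc b < 4 * ?M" using b2 M by linarith+
  moreover have "4 * ?M \<le> K * n" using K0(2) by (metis mult.assoc mult_le_mono1)
  ultimately show ?thesis using b0 b1 by (meson order_less_le_trans)
qed

text \<open>Time is split as \<open>t = r * b + s\<close>: the outer sequence gives the value at the
  start of row \<open>r\<close>, and the inner one continues from there for \<open>s\<close>
  steps.\<close>

theorem RelD_iter: "RelD K a bb 2 J (%e ys. ys!0 < K0 * length (fst e) \<and> ys!1 = h e (ys!0))"
  unfolding RelD_def
proof (intro allI impI)
  fix Ts :: "(canon => nat) list" and Bs and E :: "canon => canon" and ys
  assume E: "Env fst Ts Bs a bb E" and ys: "length ys = 2" "set ys \<subseteq> set Ts"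
  obtain t q where tq: "ys = [t, q]" using ys(1) by (auto simp: numeral_2_eq_2 length_Suc_conv)
  have mem: "t \<in> set Ts" "q \<in> set Ts" using ys tq by auto
  let ?N = "%c::canon. K * length (fst c)"
  let ?I = "%c. J (E c) \<and> fst c \<noteq> []"
  have m: "map f [0..<2] ! 0 = f 0" "map f [0..<2] ! 1 = f 1" for f :: "nat => nat set" by simp_all
  have two: "0 < (2::nat)" "1 < (2::nat)" and Kp: "0 < K" using K0 by simp_all
  let ?H = "%c b x r s. x + s = t c \<and> (\<exists>z<?N c. z = 0 \<and> (\<exists>p<?N c. p = h (E c) (r * b) \<and> (p < K0 * length (fst c) \<and> q c = it (E c) x p s)))"
  let ?P = "%c. t c < K0 * length (fst c) \<and> (\<exists>b<?N c. \<exists>b1<?N c. \<exists>Q<?N c. \<exists>As\<in>tuples (?N c) 2. sq_base b b1 Q (As!0) (As!1) \<and>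
     (\<not> Q < K0 * length (fst c) \<and> (\<exists>r<?N c. \<exists>x<?N c. \<exists>s<?N c. (r < b \<and> x = r * b) \<and> (s < b \<and> ?H c b x r s))))"
  have E': "fst (E c) = fst c" for c using Env_fst[OF E] .
  have "D K fst ?I Ts Bs ?P"
    apply (rule D_conj, (intro D_intros D_mems mem)[1])
    apply (rule D_ex, rule D_ex, rule D_ex, rule D_exs[OF two(1) Kp])
    apply (unfold m)
    apply (rule D_conj, rule D_sq_base; (intro D_mems two)?)
    apply (rule D_conj, (intro D_intros D_mems mem)[1])
    apply (rule D_ex, rule D_ex, rule D_ex)
    apply (rule D_conj, rule D_mul[rotated 5], blast, ((intro D_mems mem two)[1])+)
    apply (rule D_conj, (intro D_intros D_mems mem)[1])
    apply (rule D_conj, (intro D_intros D_mems mem)[1])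
    apply (rule D_ex, rule D_conj, (intro D_intros D_mems mem)[1])
    apply (rule D_ex, rule D_conj)
     apply (rule D_outer[rotated 8], blast, blast)
          apply (elim conjE, linarith)
         apply blast
        apply (erule conjunct2)
       apply ((rule Env_lift)+, rule E)
      apply ((intro D_mems mem two)[1])+
    apply (rule D_conj, (intro D_intros D_mems mem)[1])
    apply (rule D_inner[rotated 9], blast, blast, blast)
         apply (elim conjE, rule conjI, assumption, linarith)
        apply blast
       apply ((rule Env_lift)+, rule E)
      apply ((intro D_mems mem two)[1])+
    done
  then show "D K fst (%c. J (E c)) Ts Bs (%c. map (%t. t c) ys ! 0 < K0 * length (fst (E c)) \<and> map (%t. t c) ys ! 1 = h (E c) (map (%t. t c) ys ! 0))"
  proof (rule D_cong)
    fix c assume J: "J (E c)" and gd: "gd K fst Ts Bs c"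
    then have I: "?I c" by (simp add: gd_def)
    define n where "n = length (fst c)"
    have n0: "0 < n" using I by (simp add: n_def)
    have K0N: "K0 * n \<le> K * n" using K0 by (intro mult_le_mono1) simp
    have hl: "h (E c) y < K0 * n" for y using h_less[of "E c" y] I by (simp add: E' n_def)
    have "?P c \<longleftrightarrow> t c < K0 * n \<and> q c = h (E c) (t c)"
    proof
      assume P: "?P c"
      then obtain b r x s p where "x = r * b" "x + s = t c" "p = h (E c) (r * b)" "q c = it (E c) x p s" by blast
      then have "q c = h (E c) (t c)" using h_it[of "E c" x s] by simp
      then show "t c < K0 * n \<and> q c = h (E c) (t c)" using P by (simp add: n_def)
    next
      assume R: "t c < K0 * n \<and> q c = h (E c) (t c)"
      obtain b where b: "0 < b" "K0 * n \<le> b * b" "b * b < K * n" "Suc b < K * n" using sq_ex[OF n0] by blast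
      let ?M = "{x. x < b * b \<and> b dvd x}" and ?Es = "{x. x < b * b \<and> Suc b dvd x}"
      have tup: "[?M, ?Es] \<in> tuples (K * n) 2" using b by (auto simp: tuples_def)
      have sq: "sq_base b (Suc b) (b * b) ([?M, ?Es]!0) ([?M, ?Es]!1)" using b by (simp add: sq_base_def)
      define r s where "r = t c div b" and "s = t c mod b"
      have tb: "t c < b * b" using R b by simp
      have rs: "r < b" "s < b" "r * b + s = t c" using tb b by (simp_all add: r_def s_def less_mult_imp_div_less)
      have lt: "b < K * n" "r < K * n" "s < K * n" "r * b < K * n" "0 < K * n" using b rs R K0N by linarith+
      have lp: "h (E c) (r * b) < K * n" using hl[of "r * b"] K0N by linarith
      have q: "q c = it (E c) (r * b) (h (E c) (r * b)) s" using R rs(3) h_it[of "E c" "r * b" s] by simp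
      have H: "?H c b (r * b) r s"
        using rs(3) lt lp hl[of "r * b"] q unfolding n_def by blast
      have nl: "\<not> b * b < K0 * n" using b by simp
      show "?P c" unfolding n_def[symmetric]
        by (intro conjI exI[of _ b] exI[of _ "Suc b"] exI[of _ "b * b"] bexI[OF _ tup] exI[of _ r] exI[of _ "r * b"] exI[of _ s]
             lt b(3,4) sq nl rs(1,2) refl conjunct1[OF R] H[unfolded n_def[symmetric], THEN conjunct1] H[unfolded n_def[symmetric], THEN conjunct2])
    qed
    then show "?I c \<and> ?P c = (map (%t. t c) ys ! 0 < K0 * length (fst (E c)) \<and> map (%t. t c) ys ! 1 = h (E c) (map (%t. t c) ys ! 0))"
      using I unfolding tq E' n_def by simp
  qed
qed

end

section \<open>Closed formulas and the definition of the product\<close>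

lemma assign_upd_cong:
  "so X = so' X \<or> X \<in> set Xs ==> assign_upd so Xs n i X = assign_upd so' Xs n i X"
proof -
  have A: "g X = g' X \<or> X \<in> snd ` set ys ==> fold (%(l, X) g. g(X := F l)) ys g X = fold (%(l, X) g. g(X := F l)) ys g' X"
    for ys :: "(nat \<times> nat) list" and F :: "nat => nat set" and g g' :: "nat => nat set"
  proof (induction ys arbitrary: g g')
    case (Cons y ys)
    obtain l Z where y: "y = (l, Z)" by (cases y)
    show ?case using Cons.IH[of "g(Z := F l)" "g'(Z := F l)"] Cons.prems by (cases "X = Z") (auto simp: y)
  qed simp
  have "snd ` set (enumerate 0 Xs) = set Xs" by (metis list.set_map map_snd_enumerate)
  then show "so X = so' X \<or> X \<in> set Xs ==> ?thesis" unfolding assign_upd_def by (intro A) simp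
qed

lemma sat_cong:
  "\<forall>i\<in>fv_fo f. fo i = fo' i ==> \<forall>X\<in>fv_so f. so X = so' X ==> sat w fo so f = sat w fo' so' f"
proof (induction f arbitrary: fo fo' so so')
  case (QStar s L Xs fs)
  have "sat w fo (assign_upd so Xs (length w) i) g = sat w fo' (assign_upd so' Xs (length w) i) g" if "g \<in> set fs" for g i
    using QStar.prems that by (intro QStar.IH[OF that] ballI) (auto intro!: assign_upd_cong)
  then have "map (%g. sat w fo (assign_upd so Xs (length w) i) g) fs = map (%g. sat w fo' (assign_upd so' Xs (length w) i) g) fs" for i by simp
  then show ?case by (simp only: sat.simps)
next
  case (Eq a b)
  have "\<forall>i\<in>fv_trm t. fo i = fo' i ==> eval_trm w fo t = eval_trm w fo' t" for t by (cases t) auto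
  from this[of a] this[of b] Eq show ?case by simp
next
  case (Lt a b)
  have "\<forall>i\<in>fv_trm t. fo i = fo' i ==> eval_trm w fo t = eval_trm w fo' t" for t by (cases t) auto
  from this[of a] this[of b] Lt show ?case by simp
next
  case (Pr c a)
  have "\<forall>i\<in>fv_trm t. fo i = fo' i ==> eval_trm w fo t = eval_trm w fo' t" for t by (cases t) auto
  from this[of a] Pr show ?case by simp
next
  case (Mem c a)
  have "\<forall>i\<in>fv_trm t. fo i = fo' i ==> eval_trm w fo t = eval_trm w fo' t" for t by (cases t) auto
  from this[of a] Mem show ?case by simp
next
  case (Plus a b c)
  have "\<forall>i\<in>fv_trm t. fo i = fo' i ==> eval_trm w fo t = eval_trm w fo' t" for t by (cases t) auto
  from this[of a] this[of b] this[of c] Plus show ?case by simp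
next
  case (Times a b c)
  have "\<forall>i\<in>fv_trm t. fo i = fo' i ==> eval_trm w fo t = eval_trm w fo' t" for t by (cases t) auto
  from this[of a] this[of b] this[of c] Times show ?case by simp
next
  case (Neg f)
  then show ?case by (metis sat.simps(7) fv_fo.simps(7) fv_so.simps(2))
next
  case (Conj f g)
  from Conj.IH(1)[of fo fo' so so'] Conj.IH(2)[of fo fo' so so'] Conj.prems show ?case by simp
next
  case (Disj f g)
  from Disj.IH(1)[of fo fo' so so'] Disj.IH(2)[of fo fo' so so'] Disj.prems show ?case by simp
next
  case (Ex i f)
  have "sat w (fo(i := a)) so f = sat w (fo'(i := a)) so' f" for a using Ex.prems by (intro Ex.IH) auto
  then show ?case by simp
next
  case (All i f)
  have "sat w (fo(i := a)) so f = sat w (fo'(i := a)) so' f" for a using All.prems by (intro All.IH) auto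
  then show ?case by simp
next
  case (ExS X f)
  have "sat w fo (so(X := A)) f = sat w fo' (so'(X := A)) f" for A using ExS.prems by (intro ExS.IH) auto
  then show ?case by simp
next
  case (AllS X f)
  have "sat w fo (so(X := A)) f = sat w fo' (so'(X := A)) f" for A using AllS.prems by (intro AllS.IH) auto
  then show ?case by simp
qed

lemma finite_fv_so: "finite (fv_so f)"
  by (induction f) auto

text \<open>Free set variables are closed off by forcing them to be empty.\<close>

definition cls :: "nat list => fm => fm" where
  "cls Xs f = foldr (%X g. ExS X (Conj (Neg (Ex 0 (Mem X (V 0)))) g)) Xs f"

lemma cls_simps [simp]: "in_logic ar al (cls Xs f) = in_logic ar al f" "basic (cls Xs f) = basic f"
  "fv_fo (cls Xs f) = fv_fo f" "fv_so (cls Xs f) = fv_so f - set Xs"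
  by (induction Xs) (auto simp: cls_def)

lemma sat_cls: "(\<And>X. so X \<subseteq> {..<length w}) ==> sat w fo so (cls Xs f) = sat w fo (%X. if X \<in> set Xs then {} else so X) f"
proof (induction Xs arbitrary: so)
  case (Cons X Xs)
  have e: "A \<subseteq> {..<length w} ==> (\<forall>a<length w. a \<notin> A) = (A = {})" for A by auto
  have "sat w fo so (cls (X # Xs) f) = sat w fo (so(X := {})) (cls Xs f)"
    by (auto simp: cls_def e)
  also have "\<dots> = sat w fo (%Y. if Y \<in> set Xs then {} else (so(X := {})) Y) f" by (rule Cons.IH) (use Cons.prems in auto)
  also have "(%Y. if Y \<in> set Xs then {} else (so(X := {})) Y) = (%Y. if Y \<in> set (X # Xs) then {} else so Y)" by (auto simp: fun_eq_iff)
  finally show ?case .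
qed (simp add: cls_def)

lemma ex_closed: 
  "\<exists>g. (\<forall>ar al. in_logic ar al g = in_logic ar al f) \<and> basic g = basic f \<and> fv_fo g = fv_fo f \<and> fv_so g = {} \<and>
     (\<forall>w fo so. sat w fo so g = sat w fo (%_. {}) f)"
proof -
  obtain Xs where Xs: "set Xs = fv_so f" using finite_list[OF finite_fv_so] by blast
  have "sat w fo so (cls Xs f) = sat w fo (%_. {}) f" for w fo so
  proof -
    have "sat w fo so (cls Xs f) = sat w fo (%_. {}) (cls Xs f)" by (rule sat_cong) (auto simp: Xs)
    then show ?thesis by (subst (asm) (2) sat_cls) auto
  qed
  then show ?thesis by (intro exI[of _ "cls Xs f"]) (simp add: Xs)
qed

lemma sat_nested_ExS:
  "sat w fo so (foldr ExS Xs f) \<longleftrightarrow> (\<exists>As\<in>tuples (length w) (length Xs). sat w fo (upds so Xs As) f)"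
proof (induction Xs arbitrary: so)
  case (Cons X Xs)
  have "(\<exists>As\<in>tuples (length w) (length (X # Xs)). sat w fo (upds so (X # Xs) As) f)
      = (\<exists>A\<subseteq>{..<length w}. \<exists>As\<in>tuples (length w) (length Xs). sat w fo (upds (so(X := A)) Xs As) f)"
    unfolding length_Cons tuples_Suc by (auto simp: upds_def)
  then show ?case by (simp only: foldr.simps comp_apply sat.simps Cons.IH)
qed (simp add: tuples_0 upds_Nil)

lemma nested_ExS:
  assumes "w \<noteq> []"
  shows "sat w fo so (foldr ExS Xs f) = mode_accepts NPm
     (card {As \<in> tuples (length w) (length Xs). sat w fo (upds so Xs As) f}) r"
  unfolding sat_nested_ExS using finite_tuples[of "length w" "length Xs"] by (auto simp: card_gt_0_iff)

lemma foldr_ExS [simp]: "fv_fo (foldr ExS Xs f) = fv_fo f" "basic (foldr ExS Xs f) = basic f" "in_logic ar al (foldr ExS Xs f) = in_logic ar al f"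
  by (induction Xs) auto

interpretation bas: flogic basic "{NPm}"
proof
  show "\<exists>f. basic f \<and> fv_fo f \<subseteq> {i, j, k} \<and>
       (\<forall>w fo so. fo i < length w --> fo j < length w --> fo k < length w --> sat w fo so f = (fo i + fo j = fo k))" for i j k
    by (intro exI[of _ "Plus (V i) (V j) (V k)"]) auto
  show "\<exists>h. basic h \<and> fv_fo h \<subseteq> fv_fo f \<union> fv_fo g \<and>
       (\<forall>w fo so. w \<noteq> [] --> sat w fo so h = mode_accepts md
          (card {As \<in> tuples (length w) (length Xs). sat w fo (upds so Xs As) f})
          (card {As \<in> tuples (length w) (length Xs). sat w fo (upds so Xs As) g}))"
    if "md \<in> {NPm}" "basic f" for md f g and Xs :: "nat list"
    using that by (intro exI[of _ "foldr ExS Xs f"]) (auto simp: nested_ExS simp del: mode_accepts.simps)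
qed auto

text \<open>Addition saturated at \<open>n\<close>, so that all iterates stay below
  \<open>2 * n\<close>; hence the constants 2 and 8 of the interpretation below. A product below
  \<open>n\<close> is not affected by the saturation.\<close>

definition addc :: "canon => nat => nat => nat" where
  "addc e t p = (if p + hd (fst (snd e)) < length (fst e) then p + hd (fst (snd e)) else length (fst e))"

definition mulc :: "canon => nat => nat" where
  "mulc e t = min (t * hd (fst (snd e))) (length (fst e))"

interpretation mul: iteration basic "{NPm}" 8 2 1 0 "%_. True" addc mulc
proof
  show "bas.RelD 8 1 0 3 (%_. True) (%e ys. ys ! 2 = addc e (ys ! 0) (ys ! 1))"
    unfolding bas.RelD_def
  proof (intro allI impI)
    fix Ts :: "(canon => nat) list" and Bs and E :: "canon => canon" and ys
    assume E: "Env fst Ts Bs 1 0 E" and ys: "length ys = 3" "set ys \<subseteq> set Ts"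
    obtain t p q where tq: "ys = [t, p, q]" using ys(1) by (auto simp: numeral_3_eq_3 length_Suc_conv)
    have mem: "p \<in> set Ts" "q \<in> set Ts" using ys tq by auto
    obtain y where y: "y \<in> set Ts" "\<And>c. E c = (fst c, [y c], [])" using E unfolding Env_def by (auto simp: length_Suc_conv)
    have "bas.D 8 fst (%_. True) Ts Bs (%c. (q c < 1 * length (fst c) \<and> p c + y c = q c) \<or>
       (\<not> q c < 1 * length (fst c) \<and> (\<forall>x<8 * length (fst c). x < q c --> x < 1 * length (fst c)) \<and>
          \<not> (\<exists>v<8 * length (fst c). p c + y c = v \<and> v < 1 * length (fst c))))"
      by (intro bas.D_intros bas.D_mems mem y)
    then show "bas.D 8 fst (%c. True) Ts Bs (%c. map (%t. t c) ys ! 2 = addc (E c) (map (%t. t c) ys ! 0) (map (%t. t c) ys ! 1))"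
    proof (rule bas.D_eq_cong)
      fix c assume gd: "gd 8 fst Ts Bs c"
      let ?n = "length (fst c)"
      have n: "0 < ?n" "q c < 8 * ?n" using gd mem by (auto simp: gd_def)
      have 1: "(\<exists>v<8 * ?n. p c + y c = v \<and> v < 1 * ?n) = (p c + y c < ?n)" by auto
      have 2: "(\<not> q c < 1 * ?n \<and> (\<forall>x<8 * ?n. x < q c --> x < 1 * ?n)) = (q c = ?n)"
      proof (cases "?n < q c")
        case True
        then have "\<not> (\<forall>x<8 * ?n. x < q c --> x < 1 * ?n)" using n(1) by (intro notI) (drule spec[of _ ?n], simp)
        then show ?thesis using True by auto
      qed auto
      show "((q c < 1 * ?n \<and> p c + y c = q c) \<or> (\<not> q c < 1 * ?n \<and> (\<forall>x<8 * ?n. x < q c --> x < 1 * ?n) \<and>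
          \<not> (\<exists>v<8 * ?n. p c + y c = v \<and> v < 1 * ?n))) = (map (%t. t c) ys ! 2 = addc (E c) (map (%t. t c) ys ! 0) (map (%t. t c) ys ! 1))"
        unfolding 1 conj_assoc[symmetric] 2 tq by (auto simp: addc_def y(2))
    qed
  qed
  show "mulc e (Suc t) = addc e t (mulc e t)" for e t by (auto simp: mulc_def addc_def)
qed (auto simp: addc_def mulc_def)

text \<open>Saturated addition of \<open>fo j\<close> is iterated \<open>fo i\<close> times. Passing
  to universe factor 1 and to block vector 0 brings the relation back to the original
  elements.\<close>

lemma ex_times:
  "\<exists>f. basic f \<and> (\<forall>w fo so. (\<forall>i. fo i < length w) --> sat w fo so f = (fo i * fo j = fo k))"
proof -
  define N where "N = Suc (max i (max j k))"
  define Ts where "Ts = map (%l (c :: nat list \<times> (nat => nat)). snd c l) [0..<N]"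
  have lT: "length Ts = N" "Ts ! l = (%c. snd c l)" if "l < N" for l using that by (simp_all add: Ts_def)
  have mem: "(%c. snd c l) \<in> set Ts" if "l < N" for l using that by (auto simp: Ts_def)
  have ijk: "i < N" "j < N" "k < N" by (auto simp: N_def)
  let ?E = "%c :: nat list \<times> (nat => nat). (fst c, map (%t. t c) [%c. snd c j], map (%B. B c) ([] :: (nat list \<times> (nat => nat) => nat set) list))"
  have "Env fst Ts [] 1 0 ?E" by (intro EnvI) (use mem ijk in auto)
  then have "bas.D 8 fst (%_. True) Ts [] (%c. map (%t. t c) [%c. snd c i, %c. snd c k] ! 0 < 2 * length (fst (?E c)) \<and>
      map (%t. t c) [%c. snd c i, %c. snd c k] ! 1 = mulc (?E c) (map (%t. t c) [%c. snd c i, %c. snd c k] ! 0))"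
    by (intro bas.RelD_use[OF mul.RelD_iter]) (use mem ijk in auto)
  then have "bas.D 1 fst (%_. True) Ts [] (%c. map (%t. t c) [%c. snd c i, %c. snd c k] ! 0 < 2 * length (fst (?E c)) \<and>
      map (%t. t c) [%c. snd c i, %c. snd c k] ! 1 = mulc (?E c) (map (%t. t c) [%c. snd c i, %c. snd c k] ! 0))"
    by (rule bas.D_K) simp
  then have D: "bas.D 1 fst (%_. True) Ts [] (%c. snd c i * snd c j = snd c k)"
  proof (rule bas.D_eq_cong)
    fix c assume "gd 1 fst Ts [] c"
    then have "snd c i < length (fst c)" "snd c j < length (fst c)" "snd c k < length (fst c)" using mem ijk by (auto simp: gd_def)
    then show "(map (%t. t c) [%c. snd c i, %c. snd c k] ! 0 < 2 * length (fst (?E c)) \<and>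
      map (%t. t c) [%c. snd c i, %c. snd c k] ! 1 = mulc (?E c) (map (%t. t c) [%c. snd c i, %c. snd c k] ! 0)) = (snd c i * snd c j = snd c k)"
      by (auto simp: mulc_def min_def)
  qed
  obtain f where f: "bas.Dfor 1 fst (%_. True) Ts [] (%c. snd c i * snd c j = snd c k) (replicate N 0) f"
    by (rule bas.DE[OF D, of "replicate N 0"]) (auto simp: Ts_def)
  obtain g where g: "basic g = basic f" "fv_fo g = fv_fo f" "\<And>w fo so. sat w fo so g = sat w fo (%_. {}) f" using ex_closed[of f] by blast
  have "sat w fo so g = (fo i * fo j = fo k)" if fo: "\<forall>i. fo i < length w" for w fo so
  proof -
    let ?c = "(w, fo)"
    have w: "w \<noteq> []" using fo[rule_format, of 0] by auto
    have "gd 1 fst Ts [] ?c" using w fo by (auto simp: gd_def Ts_def)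
    moreover have "\<forall>l<length Ts. (Ts ! l) ?c div length (fst ?c) = replicate N 0 ! l" using fo by (auto simp: Ts_def)
    ultimately have "sat (fst ?c) (fenv (length (fst ?c)) Ts ?c) (senv (length (fst ?c)) [] ?c) f = (snd ?c i * snd ?c j = snd ?c k)"
      using f unfolding bas.Dfor_def by blast
    moreover have "senv (length w) [] ?c = (%_. {})" by (simp add: senv_def)
    moreover have "sat w (fenv (length w) Ts ?c) (%_. {}) f = sat w fo (%_. {}) f"
      using f fo by (intro sat_cong) (auto simp: bas.Dfor_def fenv_def Ts_def subset_iff)
    ultimately show ?thesis by (simp add: g(3))
  qed
  moreover have "basic g" using f g(1) by (simp add: bas.Dfor_def)
  ultimately show ?thesis by blast
qed

lemma (in counting_modes) trl_times: "trl (Times a b c)"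
proof -
  obtain m where m: "\<forall>i\<in>fv_trm a \<union> fv_trm b \<union> fv_trm c. i < m"
    by (rule that[of "Suc (Max (fv_trm a \<union> fv_trm b \<union> fv_trm c))"]) (cases a; cases b; cases c; auto simp: less_Suc_eq_le)
  define m1 m2 where "m1 = m + 1" and "m2 = m + 2"
  have ne: "m < m1" "m < m2" "m1 \<noteq> m2" "m \<noteq> m1" "m \<noteq> m2" by (auto simp: m1_def m2_def)
  obtain f where f: "basic f" "\<And>w fo so. \<forall>i. fo i < length w ==> sat w fo so f = (fo m * fo m1 = fo m2)" using ex_times[of m m1 m2] by blast
  let ?g = "Ex m (Ex m1 (Ex m2 (Conj (Conj (Eq (V m) a) (Eq (V m1) b)) (Conj (Eq (V m2) c) f))))"
  have "basic ?g" using f(1) by simp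
  from trl_basic[OF this] show ?thesis
  proof (rule trl_cong)
    fix w fo so assume ok: "ok_env w fo so"
    have ev: "eval_trm w (fo(m := x, m1 := y, m2 := z)) t = eval_trm w fo t" if "\<forall>i\<in>fv_trm t. i < m" for t x y z
      using that ne by (cases t) auto
    have eva: "eval_trm w (fo(m := x, m1 := y, m2 := z)) a = eval_trm w fo a"
      "eval_trm w (fo(m := x, m1 := y, m2 := z)) b = eval_trm w fo b"
      "eval_trm w (fo(m := x, m1 := y, m2 := z)) c = eval_trm w fo c" for x y z by (rule ev; use m in blast)+
    have lt: "eval_trm w fo t < length w" for t using ok tset_comb by blast
    have ff: "sat w (fo(m := x, m1 := y, m2 := z)) so f = (x * y = z)" if "x < length w" "y < length w" "z < length w" for x y z
      using f(2)[of "fo(m := x, m1 := y, m2 := z)" w so] ok that ne by (auto simp: ok_env_def)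
    have "sat w fo so ?g = (\<exists>x<length w. \<exists>y<length w. \<exists>z<length w. (x = eval_trm w fo a \<and> y = eval_trm w fo b) \<and> z = eval_trm w fo c \<and> x * y = z)"
      using ne by (simp add: eva ff lt)
    then show "sat w fo so ?g = sat w fo so (Times a b c)" using lt by auto
  qed
qed

subsection \<open>Computation paths as words of events\<close>

text \<open>An event \<open>(q, ys, j)\<close> is a step in state \<open>q\<close> scanning \<open>ys\<close> with choice \<open>j\<close>.  Halted configurations are
  repeated; in the query state the choice is the negated oracle answer.\<close>

type_synonym event = "nat \<times> nat list \<times> nat"

locale machine =
  fixes M :: tm and Or :: lang
  assumes wf: "wf_tm M"
begin

abbreviation "k \<equiv> ntapes M"

definition nx :: "event => nat \<times> nat list \<times> int list" where
  "nx = (%(q, ys, j). if q = q_acc M then (q, ys, replicate k 0)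
     else if q = q_qry M then (if j = 0 then q_yes M else q_no M, ys, replicate k 0)
     else if delta M q ys = [] then (q, ys, replicate k 0) else delta M q ys ! j)"

definition nch :: "nat => nat list => nat" where
  "nch q ys = (if q = q_acc M then 1 else if q = q_qry M then 2 else if delta M q ys = [] then 1 else length (delta M q ys))"

definition reset :: "event => nat => bool" where
  "reset ev i \<longleftrightarrow> fst ev = q_qry M \<and> Suc i = k"

definition ap :: "event => config => config" where
  "ap ev c = (fst (nx ev), map (%i. if reset ev i then (%_. 0, 0) else
     ((fst (snd c ! i))(snd (snd c ! i) := fst (snd (nx ev)) ! i), nat (int (snd (snd c ! i)) + snd (snd (nx ev)) ! i))) [0..<k])"

definition reads :: "config => nat list" where
  "reads c = map (%(f, h). f h) (snd c)"

text \<open>The guessed answer is checked against the oracle here, so of the two events of a query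
  only one is allowed.\<close>

definition ok :: "config => event => bool" where
  "ok c = (%(q, ys, j). fst c = q \<and> reads c = ys \<and> j < nch q ys \<and>
     (q = q_qry M --> (j = 0 \<longleftrightarrow> query_word (fst (last (snd c))) \<in> Or)))"

definition wfc :: "config => bool" where
  "wfc c \<longleftrightarrow> fst c < nstates M \<and> length (snd c) = k \<and> (\<forall>i<k. \<forall>x. fst (snd c ! i) x < nsyms M)"

lemma wf': "2 \<le> k" "q_acc M \<noteq> q_qry M" "1 \<le> nsyms M" "q_init M < nstates M" "q_yes M < nstates M" "q_no M < nstates M"
  using wf by (auto simp: wf_tm_def)

lemma reads_wfc: "wfc c ==> length (reads c) = k \<and> set (reads c) \<subseteq> {..<nsyms M}"
  by (auto simp: reads_def wfc_def set_conv_nth split_beta)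

lemma wf_delta: 
  assumes "q < nstates M" "length ys = k" "set ys \<subseteq> {..<nsyms M}" "(q', ws, ms) \<in> set (delta M q ys)"
  shows "q' < nstates M \<and> length ws = k \<and> set ws \<subseteq> {..<nsyms M} \<and> length ms = k \<and> set ms \<subseteq> {-1, 0, 1}"
  using wf assms unfolding wf_tm_def by blast

definition Evs :: "event set" where
  "Evs = {(q, ys, j). q < nstates M \<and> length ys = k \<and> set ys \<subseteq> {..<nsyms M} \<and> j < nch q ys}"

lemma nx_wf: assumes "(q, ys, j) \<in> Evs" 
  shows "fst (nx (q, ys, j)) < nstates M" "length (fst (snd (nx (q, ys, j)))) = k" "set (fst (snd (nx (q, ys, j)))) \<subseteq> {..<nsyms M}"
    "length (snd (snd (nx (q, ys, j)))) = k" "set (snd (snd (nx (q, ys, j)))) \<subseteq> {-1, 0, 1}"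
proof -
  have e: "q < nstates M" "length ys = k" "set ys \<subseteq> {..<nsyms M}" "j < nch q ys" using assms by (auto simp: Evs_def)
  have "fst (nx (q, ys, j)) < nstates M \<and> length (fst (snd (nx (q, ys, j)))) = k \<and> set (fst (snd (nx (q, ys, j)))) \<subseteq> {..<nsyms M} \<and>
    length (snd (snd (nx (q, ys, j)))) = k \<and> set (snd (snd (nx (q, ys, j)))) \<subseteq> {-1, 0, 1}"
  proof (cases "q = q_acc M \<or> q = q_qry M \<or> delta M q ys = []")
    case True
    then show ?thesis using e wf' by (auto simp: nx_def)
  next
    case False
    then have j: "j < length (delta M q ys)" using e(4) by (auto simp: nch_def)
    obtain q' ws ms where d: "delta M q ys ! j = (q', ws, ms)" by (metis prod.collapse)
    then have "(q', ws, ms) \<in> set (delta M q ys)" using j by (metis nth_mem)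
    then show ?thesis using wf_delta[OF e(1-3)] False d by (auto simp: nx_def)
  qed
  then show "fst (nx (q, ys, j)) < nstates M" "length (fst (snd (nx (q, ys, j)))) = k" "set (fst (snd (nx (q, ys, j)))) \<subseteq> {..<nsyms M}"
    "length (snd (snd (nx (q, ys, j)))) = k" "set (snd (snd (nx (q, ys, j)))) \<subseteq> {-1, 0, 1}" by auto
qed

lemma ok_Evs: "wfc c ==> ok c ev ==> ev \<in> Evs"
  using reads_wfc[of c] by (auto simp: ok_def Evs_def wfc_def)

lemma finite_Evs: "finite Evs"
proof -
  have "Evs = (SIGMA q:{..<nstates M}. SIGMA ys:{ys. set ys \<subseteq> {..<nsyms M} \<and> length ys = k}. {..<nch q ys})"
    by (auto simp: Evs_def)
  then show ?thesis by (auto intro!: finite_SigmaI finite_lists_length_eq)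
qed

lemma ap_wfc: assumes "wfc c" "ev \<in> Evs" shows "wfc (ap ev c)"
proof -
  obtain q ys j where ev: "ev = (q, ys, j)" by (cases ev)
  note n = nx_wf[OF assms(2)[unfolded ev]]
  have "fst (snd (nx ev)) ! i < nsyms M" if "i < k" for i
    using n(2,3) that by (metis ev lessThan_iff nth_mem subsetD)
  then show ?thesis using assms(1) n(1) wf' by (auto simp: wfc_def ap_def ev)
qed

text \<open>Events match the entries of \<open>step\<close> with multiplicity: two choices leading
  to the same configuration remain different events, and the sum over an arbitrary \<open>g\<close>
  expresses this without naming a bijection. A halted configuration allows one event, which leaves
  it unchanged.\<close>

lemma step_ok:
  assumes c: "wfc c"
  shows "step M Or c = [] ==> {ev. ok c ev} = {(fst c, reads c, 0)} \<and> ap (fst c, reads c, 0) c = c"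
    and "step M Or c \<noteq> [] ==> sum_list (map g (step M Or c)) = (\<Sum>ev\<in>{ev. ok c ev}. g (ap ev c))"
proof -
  obtain q tps where ce: "c = (q, tps)" by (cases c)
  have sc: "fst c = q" "snd c = tps" by (simp_all add: ce)
  have l: "length tps = k" using c by (simp add: wfc_def ce)
  have rd: "reads c ! i = (fst (tps ! i)) (snd (tps ! i))" if "i < k" for i using that l by (simp add: reads_def ce split_beta)
  have lr: "length (reads c) = k" using l by (simp add: reads_def ce)
  have idle: "map (%i. ((fst (tps ! i))(snd (tps ! i) := reads c ! i), nat (int (snd (tps ! i)) + replicate k 0 ! i))) [0..<k] = tps"
    by (rule nth_equalityI) (auto simp: l rd)
  show "step M Or c = [] ==> {ev. ok c ev} = {(fst c, reads c, 0)} \<and> ap (fst c, reads c, 0) c = c"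
  proof -
    assume "step M Or c = []"
    then have h: "q = q_acc M \<or> q \<noteq> q_qry M \<and> delta M q (reads c) = []" by (auto simp: step_def ce Let_def reads_def split: if_splits)
    then have nq: "q \<noteq> q_qry M" using wf' by auto
    have nc: "nch q (reads c) = 1" using h nq by (auto simp: nch_def)
    have nxe: "nx (q, reads c, 0) = (q, reads c, replicate k 0)" using h nq by (auto simp: nx_def)
    have "ap (q, reads c, 0) c = c" unfolding ap_def nxe using nq idle by (simp add: reset_def ce)
    then show ?thesis using nc nq by (auto simp: ok_def ce)
  qed
  assume ne: "step M Or c \<noteq> []"
  then have na: "q \<noteq> q_acc M" by (auto simp: step_def ce Let_def)
  show "sum_list (map g (step M Or c)) = (\<Sum>ev\<in>{ev. ok c ev}. g (ap ev c))"
  proof (cases "q = q_qry M")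
    case True
    define j where "j = (if query_word (fst (last tps)) \<in> Or then 0 else 1 :: nat)"
    have o: "{ev. ok c ev} = {(q, reads c, j)}" using True na by (auto simp: ok_def ce nch_def j_def)
    have nxe: "nx (q, reads c, j) = (if query_word (fst (last tps)) \<in> Or then q_yes M else q_no M, reads c, replicate k 0)"
      using True na by (simp add: nx_def j_def)
    have "map (%i. if reset (q, reads c, j) i then (%_. 0, 0) else
     ((fst (tps ! i))(snd (tps ! i) := reads c ! i), nat (int (snd (tps ! i)) + replicate k 0 ! i))) [0..<k] = butlast tps @ [(%_. 0, 0)]"
      by (rule nth_equalityI) (use wf' in \<open>auto simp: l rd reset_def True nth_append nth_butlast\<close>)
    then have "ap (q, reads c, j) c = (if query_word (fst (last tps)) \<in> Or then q_yes M else q_no M, butlast tps @ [(%_. 0, 0)])"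
      unfolding ap_def nxe sc fst_conv snd_conv by simp
    then have "step M Or c = [ap (q, reads c, j) c]" using True na by (simp add: step_def sc Let_def)
    then show ?thesis unfolding o by simp
  next
    case False
    let ?d = "delta M q (reads c)"
    have st: "step M Or c = map (%(q', ws, ms). (q', map (%((f, h), (a, m)). (f(h := a), nat (int h + m))) (zip tps (zip ws ms)))) ?d"
      using na False by (simp add: step_def ce Let_def reads_def)
    then have d: "?d \<noteq> []" using ne by auto
    have nc: "nch q (reads c) = length ?d" using na False d by (simp add: nch_def)
    have o: "{ev. ok c ev} = (%j. (q, reads c, j)) ` {..<length ?d}" using nc False by (auto simp: ok_def ce)
    have "step M Or c = map (%j. ap (q, reads c, j) c) [0..<length ?d]"
    proof (rule nth_equalityI)
      fix j assume "j < length (step M Or c)"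
      then have j: "j < length ?d" by (simp add: st)
      obtain q' ws ms where dj: "?d ! j = (q', ws, ms)" by (metis prod.collapse)
      have "(q, reads c, j) \<in> Evs" using j nc reads_wfc[OF c] c by (auto simp: Evs_def wfc_def ce)
      note n = nx_wf[OF this]
      have nxe: "nx (q, reads c, j) = (q', ws, ms)" using na False d dj by (simp add: nx_def)
      have lw: "length ws = k" "length ms = k" using n nxe by auto
      have "map (%((f, h), (a, m)). (f(h := a), nat (int h + m))) (zip tps (zip ws ms))
        = map (%i. ((fst (tps ! i))(snd (tps ! i) := ws ! i), nat (int (snd (tps ! i)) + ms ! i))) [0..<k]"
        by (rule nth_equalityI) (auto simp: l lw split_beta)
      then have "step M Or c ! j = (q', map (%i. ((fst (tps ! i))(snd (tps ! i) := ws ! i), nat (int (snd (tps ! i)) + ms ! i))) [0..<k])"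
        unfolding st using j dj by simp
      moreover have "ap (q, reads c, j) c = (q', map (%i. ((fst (tps ! i))(snd (tps ! i) := ws ! i), nat (int (snd (tps ! i)) + ms ! i))) [0..<k])"
        using False by (simp add: ap_def nxe sc reset_def)
      ultimately show "step M Or c ! j = map (%j. ap (q, reads c, j) c) [0..<length ?d] ! j" using j by simp
    qed (simp add: st)
    then have "sum_list (map g (step M Or c)) = (\<Sum>j<length ?d. g (ap (q, reads c, j) c))"
      by (simp add: comp_def interv_sum_list_conv_sum_set_nat atLeast0LessThan)
    also have "\<dots> = (\<Sum>ev\<in>{ev. ok c ev}. g (ap ev c))" unfolding o by (subst sum.reindex) (auto simp: inj_on_def)
    finally show ?thesis .
  qed
qed

fun valid :: "config => event list => bool" where
  "valid c [] = True"
| "valid c (ev # es) \<longleftrightarrow> ok c ev \<and> valid (ap ev c) es"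

definition paths :: "(nat => bool) => nat => config => event list set" where
  "paths A T c = {es. length es = T \<and> valid c es \<and> A (fst (fold ap es c))}"

lemma paths_0: "paths A 0 c = (if A (fst c) then {[]} else {})"
  by (auto simp: paths_def)

lemma paths_Suc: "paths A (Suc T) c = (\<Union>ev\<in>{ev. ok c ev}. (#) ev ` paths A T (ap ev c))"
  by (auto simp: paths_def length_Suc_conv)

lemma finite_ok: "wfc c ==> finite {ev. ok c ev}"
proof -
  assume "wfc c"
  then have "{ev. ok c ev} \<subseteq> Evs" using ok_Evs[of c] by (intro subsetI) simp
  then show ?thesis using finite_Evs by (rule finite_subset)
qed

lemma finite_paths: "wfc c ==> finite (paths A T c)"
proof (induction T arbitrary: c)
  case (Suc T)
  then show ?case unfolding paths_Suc using finite_ok ap_wfc ok_Evs by (intro finite_UN_I finite_imageI) auto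
qed (simp add: paths_0)

lemma card_paths_Suc: "wfc c ==> card (paths A (Suc T) c) = (\<Sum>ev\<in>{ev. ok c ev}. card (paths A T (ap ev c)))"
proof -
  assume c: "wfc c"
  have "card (paths A (Suc T) c) = (\<Sum>ev\<in>{ev. ok c ev}. card ((#) ev ` paths A T (ap ev c)))"
    unfolding paths_Suc by (rule card_UN_disjoint) (use c finite_ok finite_paths ap_wfc ok_Evs in auto)
  then show ?thesis by (simp add: card_image)
qed

text \<open>A halted configuration idles in exactly one way, so prolonging all paths to a common
  length \<open>T\<close> changes no count.\<close>

lemma card_paths:
  assumes "halts_within M Or t c" "t \<le> T" "wfc c"
  shows "acc_paths M Or t c = card (paths (%q. q = q_acc M) T c) \<and> rej_paths M Or t c = card (paths (%q. q \<noteq> q_acc M) T c)"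
  using assms
proof (induction T arbitrary: t c)
  case 0
  then show ?case by (simp add: paths_0)
next
  case (Suc T)
  show ?case
  proof (cases "step M Or c = []")
    case True
    note s = step_ok(1)[OF Suc.prems(3) True]
    have e: "acc_paths M Or t c = acc_paths M Or 0 c" "rej_paths M Or t c = rej_paths M Or 0 c" using True by (cases t; simp)+
    have "halts_within M Or 0 c" using True by simp
    from Suc.IH[OF this _ Suc.prems(3)] show ?thesis
      unfolding card_paths_Suc[OF Suc.prems(3)] e s[THEN conjunct1] by (simp add: s)
  next
    case False
    then obtain t' where t: "t = Suc t'" using Suc.prems(1) by (cases t) auto
    have "acc_paths M Or t' c' = card (paths (%q. q = q_acc M) T c') \<and> rej_paths M Or t' c' = card (paths (%q. q \<noteq> q_acc M) T c')"
      if "ok c ev" "c' = ap ev c" for c' ev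
    proof (rule Suc.IH)
      show "wfc c'" using that ap_wfc[OF Suc.prems(3) ok_Evs[OF Suc.prems(3)]] by simp
      have "c' \<in> set (step M Or c)"
      proof (rule ccontr)
        assume n: "c' \<notin> set (step M Or c)"
        have "sum_list (map (%d. if d = c' then 1 else 0 :: nat) (step M Or c)) = 0" using n by (subst sum_list_eq_0_iff) auto
        then have "(\<Sum>ev\<in>{ev. ok c ev}. if ap ev c = c' then 1 else 0 :: nat) = 0"
          by (simp only: step_ok(2)[OF Suc.prems(3) False])
        then have "\<forall>ev\<in>{ev. ok c ev}. (if ap ev c = c' then 1 else 0 :: nat) = 0"
          by (simp only: sum_eq_0_iff[OF finite_ok[OF Suc.prems(3)]])
        from bspec[OF this, of ev] show False using that by simp
      qed
      then show "halts_within M Or t' c'" using Suc.prems(1) False t by auto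
    qed (use Suc.prems t in simp)
    then have "(\<Sum>ev\<in>{ev. ok c ev}. card (paths (%q. q = q_acc M) T (ap ev c))) = (\<Sum>ev\<in>{ev. ok c ev}. acc_paths M Or t' (ap ev c))"
      "(\<Sum>ev\<in>{ev. ok c ev}. card (paths (%q. q \<noteq> q_acc M) T (ap ev c))) = (\<Sum>ev\<in>{ev. ok c ev}. rej_paths M Or t' (ap ev c))"
      by (auto intro!: sum.cong)
    then show ?thesis unfolding card_paths_Suc[OF Suc.prems(3)] using False
      by (simp only: t acc_paths.simps rej_paths.simps if_False step_ok(2)[OF Suc.prems(3) False])
  qed
qed

lemma init_wfc: "s < nsyms M ==> x \<in> lists {..<s} ==> wfc (init_config M x)"
proof -
  assume s: "s < nsyms M" and x: "x \<in> lists {..<s}"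
  have "x ! i < s" if "i < length x" for i using x that nth_mem by (auto simp: in_lists_conv_set)
  then have "x ! i + 1 < nsyms M" if "i < length x" for i using s that by (metis Suc_eq_plus1 Suc_lessI less_trans_Suc less_irrefl order_less_trans)
  then show ?thesis using wf' by (auto simp: wfc_def init_config_def nth_Cons')
qed

lemma valid_iff: "valid c es \<longleftrightarrow> (\<forall>t<length es. ok (fold ap (take t es) c) (es ! t))"
  by (induction es arbitrary: c) (auto simp: All_less_Suc2)

end

text \<open>A word is represented by the sets of positions of its letters; it ends at the first position
  that belongs to no set.\<close>

definition dec :: "nat => nat set list => nat list" where
  "dec T Bs = map (%t. LEAST a. t \<in> Bs ! a) [0..<T]"

definition wd :: "nat set list => nat list" where
  "wd Bs = dec (LEAST x. \<forall>B\<in>set Bs. x \<notin> B) Bs"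

definition lsets :: "nat => nat list => nat set list" where
  "lsets s w = map (%a. {t. t < length w \<and> w ! t = a}) [0..<s]"

definition part :: "nat => nat set list => bool" where
  "part T Bs \<longleftrightarrow> (\<forall>t<T. \<exists>a<length Bs. t \<in> Bs ! a \<and> (\<forall>b<length Bs. t \<in> Bs ! b --> b = a)) \<and> (\<forall>B\<in>set Bs. B \<subseteq> {..<T})"

lemma length_dec [simp]: "length (dec T Bs) = T"
  by (simp add: dec_def)

lemma dec_nth: "part T Bs ==> t < T ==> a < length Bs ==> dec T Bs ! t = a \<longleftrightarrow> t \<in> Bs ! a"
  and dec_lists: "part T Bs ==> dec T Bs \<in> lists {..<length Bs}"
proof -
  have L: "(LEAST a. t \<in> Bs ! a) < length Bs \<and> t \<in> Bs ! (LEAST a. t \<in> Bs ! a)" if "part T Bs" "t < T" for t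
  proof -
    obtain a where a: "a < length Bs" "t \<in> Bs ! a" using \<open>part T Bs\<close> \<open>t < T\<close> unfolding part_def by blast
    have "(LEAST a. t \<in> Bs ! a) \<le> a" using a(2) by (rule Least_le)
    then show ?thesis using a LeastI[of "%a. t \<in> Bs ! a", OF a(2)] by simp
  qed
  show "part T Bs ==> t < T ==> a < length Bs ==> dec T Bs ! t = a \<longleftrightarrow> t \<in> Bs ! a"
  proof -
    assume p: "part T Bs" and t: "t < T" and a: "a < length Bs"
    obtain b where b: "\<forall>c<length Bs. t \<in> Bs ! c --> c = b" using p t unfolding part_def by blast
    have "dec T Bs ! t = (LEAST a. t \<in> Bs ! a)" using t by (simp add: dec_def)
    then show ?thesis using L[OF p t] a b by auto
  qed
  show "part T Bs ==> dec T Bs \<in> lists {..<length Bs}" using L by (auto simp: dec_def)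
qed

lemma length_lsets [simp]: "length (lsets s w) = s"
  by (simp add: lsets_def)

lemma part_lsets: "w \<in> lists {..<s} ==> part (length w) (lsets s w)"
  by (auto simp: part_def lsets_def in_lists_conv_set)

lemma lsets_dec: "part T Bs ==> lsets (length Bs) (dec T Bs) = Bs"
proof (rule nth_equalityI)
  fix a assume p: "part T Bs" and "a < length (lsets (length Bs) (dec T Bs))"
  then have a: "a < length Bs" by simp
  then have "Bs ! a \<subseteq> {..<T}" using p nth_mem unfolding part_def by blast
  then show "lsets (length Bs) (dec T Bs) ! a = Bs ! a" using dec_nth[OF p _ a] a by (auto simp: lsets_def)
qed simp

lemma dec_lsets: "w \<in> lists {..<s} ==> dec (length w) (lsets s w) = w"
proof (rule nth_equalityI)
  fix t assume w: "w \<in> lists {..<s}" and "t < length (dec (length w) (lsets s w))"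
  then have t: "t < length w" by simp
  then have "w ! t < s" using w nth_mem by (auto simp: in_lists_conv_set)
  then show "dec (length w) (lsets s w) ! t = w ! t" using dec_nth[OF part_lsets[OF w] t, of "w ! t"] t by (simp add: lsets_def)
qed simp

lemma wd_lsets: assumes "w \<in> lists {..<s}" shows "wd (lsets s w) = w"
proof -
  have "(LEAST x. \<forall>B\<in>set (lsets s w). x \<notin> B) = length w"
  proof (rule Least_equality)
    show "\<forall>B\<in>set (lsets s w). length w \<notin> B" by (auto simp: lsets_def)
    fix y assume y: "\<forall>B\<in>set (lsets s w). y \<notin> B"
    show "length w \<le> y"
    proof (rule ccontr)
      assume "\<not> length w \<le> y"
      then have "y < length w" by simp
      moreover from this have "w ! y < s" using assms nth_mem by (auto simp: in_lists_conv_set)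
      ultimately show False using y by (auto simp: lsets_def)
    qed
  qed
  then show ?thesis using dec_lsets[OF assms] by (simp add: wd_def)
qed

text \<open>Length and letters of the decoded word, in the first-order form in which they are later
  defined.\<close>

lemma wd_props:
  assumes sub: "\<forall>B\<in>set Bs. B \<subseteq> {..<N}"
  shows "length (wd Bs) \<le> N" "x < length (wd Bs) \<longleftrightarrow> (\<forall>y\<le>x. \<exists>a<length Bs. y \<in> Bs ! a)"
    "x < length (wd Bs) ==> wd Bs ! x = a \<longleftrightarrow> a < length Bs \<and> x \<in> Bs ! a \<and> (\<forall>b<a. x \<notin> Bs ! b)"
    "wd Bs \<in> lists {..<length Bs}"
proof -
  define l where "l = (LEAST x. \<forall>B\<in>set Bs. x \<notin> B)"
  have N: "\<forall>B\<in>set Bs. N \<notin> B" using sub by auto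
  have l1: "\<forall>B\<in>set Bs. l \<notin> B" unfolding l_def by (rule LeastI[of "%x. \<forall>B\<in>set Bs. x \<notin> B", OF N])
  have l2: "\<exists>a<length Bs. y \<in> Bs ! a" if "y < l" for y
    using not_less_Least[OF that[unfolded l_def]] by (auto simp: in_set_conv_nth)
  have len: "length (wd Bs) = l" by (simp add: wd_def l_def)
  show "length (wd Bs) \<le> N" unfolding len l_def by (rule Least_le) (rule N)
  show "x < length (wd Bs) \<longleftrightarrow> (\<forall>y\<le>x. \<exists>a<length Bs. y \<in> Bs ! a)"
    unfolding len
  proof
    assume "x < l"
    then show "\<forall>y\<le>x. \<exists>a<length Bs. y \<in> Bs ! a" using l2 by simp
  next
    assume a: "\<forall>y\<le>x. \<exists>a<length Bs. y \<in> Bs ! a"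
    show "x < l"
    proof (rule ccontr)
      assume "\<not> x < l"
      then obtain a where "a < length Bs" "l \<in> Bs ! a" using a[rule_format, of l] by auto
      then show False using l1 nth_mem by blast
    qed
  qed
  have L: "(LEAST a. x \<in> Bs ! a) = a \<longleftrightarrow> a < length Bs \<and> x \<in> Bs ! a \<and> (\<forall>b<a. x \<notin> Bs ! b)" if "x < l" for x a
  proof -
    obtain b where b: "b < length Bs" "x \<in> Bs ! b" using l2[OF \<open>x < l\<close>] by blast
    show ?thesis
    proof
      assume a: "(LEAST a. x \<in> Bs ! a) = a"
      then have "x \<in> Bs ! a" "a \<le> b" using LeastI[of "%a. x \<in> Bs ! a", OF b(2)] Least_le[of "%a. x \<in> Bs ! a", OF b(2)] by auto
      moreover have "\<forall>b<a. x \<notin> Bs ! b" using a not_less_Least[of _ "%a. x \<in> Bs ! a"] by blast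
      ultimately show "a < length Bs \<and> x \<in> Bs ! a \<and> (\<forall>b<a. x \<notin> Bs ! b)" using b by simp
    next
      assume a: "a < length Bs \<and> x \<in> Bs ! a \<and> (\<forall>b<a. x \<notin> Bs ! b)"
      show "(LEAST a. x \<in> Bs ! a) = a"
      proof (rule Least_equality)
        show "x \<in> Bs ! a" using a by simp
        fix c assume "x \<in> Bs ! c"
        then show "a \<le> c" using a by (metis not_le)
      qed
    qed
  qed
  have nth: "wd Bs ! x = (LEAST a. x \<in> Bs ! a)" if "x < l" for x using that by (simp add: wd_def dec_def l_def)
  show "x < length (wd Bs) ==> wd Bs ! x = a \<longleftrightarrow> a < length Bs \<and> x \<in> Bs ! a \<and> (\<forall>b<a. x \<notin> Bs ! b)"
    unfolding len using nth L by simp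
  have "wd Bs ! x < length Bs" if "x < l" for x unfolding nth[OF that]
    by (rule L[OF that, THEN iffD1, OF refl, THEN conjunct1])
  then show "wd Bs \<in> lists {..<length Bs}" by (auto simp: in_lists_conv_set in_set_conv_nth len)
qed

text \<open>Tape contents over time would need a set of pairs of numbers, which unary sets cannot
  hold. A cell is instead read off from the last earlier step that touched it.\<close>

lemma last_change:
  assumes "\<And>u. u < t ==> f (Suc u) = (if P u then g u else f u)"
  shows "f t = a \<longleftrightarrow> (\<exists>u<t. P u \<and> g u = a \<and> (\<forall>v. u < v \<and> v < t --> \<not> P v)) \<or> (\<forall>u<t. \<not> P u) \<and> f 0 = a"
  using assms
proof (induction t)
  case (Suc t)
  have IH: "f t = a \<longleftrightarrow> (\<exists>u<t. P u \<and> g u = a \<and> (\<forall>v. u < v \<and> v < t --> \<not> P v)) \<or> (\<forall>u<t. \<not> P u) \<and> f 0 = a"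
    using Suc by simp
  have st: "f (Suc t) = (if P t then g t else f t)" using Suc.prems by simp
  show ?case
  proof (cases "P t")
    case True
    have "(\<exists>u<Suc t. P u \<and> g u = a \<and> (\<forall>v. u < v \<and> v < Suc t --> \<not> P v)) \<longleftrightarrow> g t = a"
    proof
      assume "\<exists>u<Suc t. P u \<and> g u = a \<and> (\<forall>v. u < v \<and> v < Suc t --> \<not> P v)"
      then obtain u where "u < Suc t" "g u = a" "\<forall>v. u < v \<and> v < Suc t --> \<not> P v" by blast
      then show "g t = a" using True by (metis less_Suc_eq)
    qed (use True in auto)
    then show ?thesis using st True by auto
  next
    case False
    then show ?thesis unfolding st using IH by (auto simp: less_Suc_eq)
  qed
qed simp

context machine
begin

definition evl :: "event list" where
  "evl = (SOME l. set l = Evs \<and> distinct l)"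

lemma evl: "set evl = Evs" "distinct evl" "0 < length evl"
proof -
  have "set evl = Evs \<and> distinct evl" unfolding evl_def by (rule someI_ex) (rule finite_distinct_list[OF finite_Evs])
  then show s: "set evl = Evs" and "distinct evl" by auto
  have "(q_acc M, replicate k 0, 0) \<in> Evs" using wf wf' by (auto simp: Evs_def nch_def wf_tm_def)
  then show "0 < length evl" using s by (metis length_pos_if_in_set)
qed

definition evs :: "nat => nat set list => event list" where
  "evs T As = map ((!) evl) (dec T As)"

lemma length_evs [simp]: "length (evs T As) = T"
  by (simp add: evs_def)

lemma evs_nth: assumes "part T As" "length As = length evl" "t < T"
  shows "evs T As ! t \<in> Evs" "PP (evs T As ! t) \<longleftrightarrow> (\<exists>a\<in>{a. a < length evl \<and> PP (evl ! a)}. t \<in> As ! a)"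
proof -
  have "dec T As ! t \<in> set (dec T As)" using assms(3) by simp
  then have "dec T As ! t < length evl" using dec_lists[OF assms(1)] assms(2) by auto
  then show "evs T As ! t \<in> Evs" "PP (evs T As ! t) \<longleftrightarrow> (\<exists>a\<in>{a. a < length evl \<and> PP (evl ! a)}. t \<in> As ! a)"
    using evl(1) dec_nth[OF assms(1,3)] assms(2,3) by (auto simp: evs_def)
qed

lemma valid_Evs: "wfc c ==> valid c es ==> set es \<subseteq> Evs"
proof (induction es arbitrary: c)
  case (Cons ev es)
  have ev: "ev \<in> Evs" using ok_Evs[OF Cons.prems(1)] Cons.prems(2) by simp
  then show ?case using Cons.IH[OF ap_wfc[OF Cons.prems(1) ev]] Cons.prems(2) by simp
qed simp

text \<open>Requiring a partition of exactly the first \<open>T\<close> positions makes the tuple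
  unique for each word of events, so the count of paths is not inflated.\<close>

lemma card_paths_sets:
  assumes c: "wfc c" and T: "T \<le> N"
  shows "card (paths A T c) = card {As \<in> tuples N (length evl). part T As \<and> valid c (evs T As) \<and> A (fst (fold ap (evs T As) c))}"
proof (rule sym, rule bij_betw_same_card[of "evs T"], rule bij_betw_imageI)
  let ?S = "{As \<in> tuples N (length evl). part T As \<and> valid c (evs T As) \<and> A (fst (fold ap (evs T As) c))}"
  show "inj_on (evs T) ?S"
  proof (rule inj_onI)
    fix As Bs assume a: "As \<in> ?S" "Bs \<in> ?S" and eq: "evs T As = evs T Bs"
    have l: "length As = length evl" "length Bs = length evl" using a by (auto simp: tuples_def)
    have "dec T As = dec T Bs"
    proof (rule map_inj_on)
      show "map ((!) evl) (dec T As) = map ((!) evl) (dec T Bs)" using eq by (simp add: evs_def)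
      show "inj_on ((!) evl) (set (dec T As) \<union> set (dec T Bs))"
        using dec_lists[of T As] dec_lists[of T Bs] a l evl(2) by (intro inj_on_nth) auto
    qed
    moreover have "lsets (length evl) (dec T As) = As" "lsets (length evl) (dec T Bs) = Bs"
      using lsets_dec[of T As] lsets_dec[of T Bs] a l by simp_all
    ultimately show "As = Bs" by metis
  qed
  show "evs T ` ?S = paths A T c"
  proof (intro subset_antisym subsetI)
    fix es assume es: "es \<in> paths A T c"
    then have le: "length es = T" and v: "valid c es" by (auto simp: paths_def)
    have "\<forall>ev\<in>set es. \<exists>a<length evl. evl ! a = ev" using valid_Evs[OF c v] unfolding evl(1)[symmetric] by (metis in_set_conv_nth subsetD)
    then obtain f where f: "\<And>ev. ev \<in> set es ==> f ev < length evl \<and> evl ! f ev = ev" by metis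
    let ?w = "map f es"
    have w: "?w \<in> lists {..<length evl}" using f by auto
    have e: "evs T (lsets (length evl) ?w) = es" using dec_lsets[OF w] f by (simp add: evs_def le map_idI)
    moreover have "lsets (length evl) ?w \<in> ?S"
    proof -
      have "lsets (length evl) ?w \<in> tuples N (length evl)" using T le by (auto simp: tuples_def lsets_def)
      then show ?thesis using part_lsets[OF w] es e le by (auto simp: paths_def)
    qed
    ultimately show "es \<in> evs T ` ?S" by (metis (no_types, lifting) image_eqI)
  qed (auto simp: paths_def)
qed

definition Cf :: "nat list => event list => nat => config" where
  "Cf w es t = fold ap (take t es) (init_config M w)"

definition head :: "nat list => event list => nat => nat => nat" where
  "head w es i t = snd (snd (Cf w es t) ! i)"

definition cont :: "nat list => event list => nat => nat => nat => nat" where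
  "cont w es i t = fst (snd (Cf w es t) ! i)"

abbreviation "mv ev i \<equiv> snd (snd (nx ev)) ! i"
abbreviation "wr ev i \<equiv> fst (snd (nx ev)) ! i"

lemma Cf_0: "fst (Cf w es 0) = q_init M" "length (snd (Cf w es 0)) = k" "i < k ==> head w es i 0 = 0"
  "i < k ==> cont w es i 0 x = (if i = 0 \<and> x < length w then w ! x + 1 else 0)"
  using wf' by (auto simp: Cf_def head_def cont_def init_config_def nth_Cons')

lemma Cf_Suc: "t < length es ==> Cf w es (Suc t) = ap (es ! t) (Cf w es t)"
  by (simp add: Cf_def take_Suc_conv_app_nth)

lemma Cf_Suc':
  assumes "t < length es"
  shows "fst (Cf w es (Suc t)) = fst (nx (es ! t))"
    "i < k ==> head w es i (Suc t) = (if reset (es ! t) i then 0 else nat (int (head w es i t) + mv (es ! t) i))"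
    "i < k ==> cont w es i (Suc t) x = (if reset (es ! t) i \<or> x = head w es i t then if reset (es ! t) i then 0 else wr (es ! t) i else cont w es i t x)"
  using Cf_Suc[OF assms, of w] by (auto simp: ap_def head_def cont_def)

lemma length_Cf: "length (snd (Cf w es t)) = k"
proof -
  have "length (snd (fold ap es c)) = k" if "length (snd c) = k" for c es using that by (induction es arbitrary: c) (auto simp: ap_def)
  then show ?thesis using Cf_0(2)[of w es] by (simp add: Cf_def)
qed

lemma cont_iff:
  assumes "t \<le> length es" "i < k"
  shows "cont w es i t x = b \<longleftrightarrow>
    (\<exists>u<t. (reset (es ! u) i \<or> x = head w es i u) \<and> (if reset (es ! u) i then 0 else wr (es ! u) i) = b \<and>
       (\<forall>v. u < v \<and> v < t --> \<not> (reset (es ! v) i \<or> x = head w es i v))) \<or>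
    (\<forall>u<t. \<not> (reset (es ! u) i \<or> x = head w es i u)) \<and> cont w es i 0 x = b"
  by (rule last_change) (use assms Cf_Suc'(3) in auto)

lemma mv_le: "ev \<in> Evs ==> i < k ==> mv ev i \<in> {-1, 0, 1}"
proof -
  assume e: "ev \<in> Evs" and i: "i < k"
  obtain q ys j where ev: "ev = (q, ys, j)" by (cases ev)
  show "mv ev i \<in> {-1, 0, 1}" using nx_wf(4,5)[of q ys j] e i unfolding ev by (metis nth_mem subsetD)
qed

lemma head_le: "set es \<subseteq> Evs ==> t \<le> length es ==> i < k ==> head w es i t \<le> t"
proof (induction t)
  case (Suc t)
  have "es ! t \<in> Evs" using Suc.prems by auto
  then show ?case using Suc mv_le[of "es ! t" i] Cf_Suc'(2)[of t es i w] by auto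
qed (simp add: Cf_0)

text \<open>A head moves at most one cell per step, so the cells from \<open>t\<close> on have not
  been written before time \<open>t\<close>. This bounds the query word by the running time.\<close>

lemma cont_blank: "set es \<subseteq> Evs ==> t \<le> length es ==> i < k ==> i \<noteq> 0 ==> t \<le> x ==> cont w es i t x = 0"
proof (induction t)
  case (Suc t)
  then show ?case using Cf_Suc'(3)[of t es i w x] head_le[of es t i w] by auto
qed (simp add: Cf_0)

lemma cont_less: 
  assumes "set es \<subseteq> Evs" "wfc (init_config M w)" "i < k" shows "cont w es i t x < nsyms M"
proof -
  have "wfc (fold ap es c)" if "set es \<subseteq> Evs" "wfc c" for es c using that ap_wfc by (induction es arbitrary: c) auto
  then have "wfc (Cf w es t)" using assms set_take_subset[of t es] unfolding Cf_def by blast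
  then show ?thesis using assms(3) by (simp add: wfc_def cont_def)
qed

text \<open>Validity becomes a conjunction of conditions on each time \<open>t\<close>: the state
  handed over by the preceding event, the scanned symbols, and the answer of the oracle.
  Configurations survive only through head positions and cell contents.\<close>

lemma valid_Cf:
  assumes "set es \<subseteq> Evs"
  shows "valid (init_config M w) es \<longleftrightarrow> (\<forall>t<length es.
     (t = 0 \<and> fst (es ! t) = q_init M \<or> (\<exists>u. Suc u = t \<and> fst (es ! t) = fst (nx (es ! u)))) \<and>
     (\<forall>i<k. fst (snd (es ! t)) ! i = cont w es i t (head w es i t)) \<and>
     (fst (es ! t) = q_qry M --> (snd (snd (es ! t)) = 0 \<longleftrightarrow> query_word (cont w es (k - 1) t) \<in> Or)))"
proof -
  have "ok (Cf w es t) (es ! t) \<longleftrightarrow> (t = 0 \<and> fst (es ! t) = q_init M \<or> (\<exists>u. Suc u = t \<and> fst (es ! t) = fst (nx (es ! u)))) \<and>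
     (\<forall>i<k. fst (snd (es ! t)) ! i = cont w es i t (head w es i t)) \<and>
     (fst (es ! t) = q_qry M --> (snd (snd (es ! t)) = 0 \<longleftrightarrow> query_word (cont w es (k - 1) t) \<in> Or))" if t: "t < length es" for t
  proof -
    obtain q ys j where ev: "es ! t = (q, ys, j)" by (cases "es ! t")
    have "es ! t \<in> Evs" using assms t by auto
    then have ys: "length ys = k" and j: "j < nch q ys" by (auto simp: ev Evs_def)
    have 1: "fst (Cf w es t) = q \<longleftrightarrow> t = 0 \<and> q = q_init M \<or> (\<exists>u. Suc u = t \<and> q = fst (nx (es ! u)))"
      using t Cf_Suc'(1)[of _ es w] by (cases t) (auto simp: Cf_0)
    have 2: "reads (Cf w es t) = ys \<longleftrightarrow> (\<forall>i<k. ys ! i = cont w es i t (head w es i t))"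
      using ys length_Cf[of w es t] by (auto simp: reads_def list_eq_iff_nth_eq split_beta cont_def head_def)
    have ne: "snd (Cf w es t) \<noteq> []" using length_Cf[of w es t] wf' by auto
    have 3: "fst (last (snd (Cf w es t))) = cont w es (k - 1) t" by (simp add: last_conv_nth[OF ne] length_Cf cont_def)
    show ?thesis unfolding ok_def ev using 1 2 3 j by auto
  qed
  then show ?thesis unfolding valid_iff Cf_def[symmetric] by blast
qed

end

text \<open>All factors \<open>K\<close> are demanded because a query written in linear time may be
  longer than the universe.\<close>

definition defD :: "(fm => bool) => nat => lang => bool" where
  "defD G s L \<longleftrightarrow> L \<subseteq> lists {..<s} \<and> (\<forall>K. flogic.RelD G K 0 s 0 (%_. True) (%e _. wd (snd (snd e)) \<in> L))"

section \<open>Defining the computations of one machine\<close>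

locale tx = flogic G Md + machine M Or for G Md M Or +
  fixes s s' K cc :: nat
  assumes s: "s < nsyms M" and def_Or: "defD G s' Or"
begin

text \<open>Inputs have length at most \<open>K * n\<close>, so \<open>cc * (length x + 1)\<close>
  is at most \<open>K1 * n\<close>; the summand in \<open>cc + 1\<close> keeps this bound positive.
  Times and heads up to \<open>K1 * n\<close> lie below \<open>(K1 + 1) * n\<close>, and iteration
  asks for a universe four times as large.\<close>

definition "K1 = (cc + 1) * (K + 1)"
definition "KK = 4 * (K1 + 1)"
abbreviation "ne \<equiv> length evl"
definition TT :: "canon => nat" where "TT e = K1 * length (fst e)"
text \<open>The sets of a context are the \<open>ne\<close> position sets of the events, followed by
  the \<open>s\<close> sets of the input letters.\<close>

definition AS :: "canon => nat set list" where "AS e = take ne (snd (snd e))"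
definition inp :: "canon => nat list" where "inp e = wd (drop ne (snd (snd e)))"
definition es :: "canon => event list" where "es e = evs (TT e) (AS e)"
definition Jc :: "canon => bool" where
  "Jc e \<longleftrightarrow> length (snd (snd e)) = ne + s \<and> part (TT e) (AS e) \<and> (\<forall>B\<in>set (drop ne (snd (snd e))). B \<subseteq> {..<K * length (fst e)}) \<and> fst e \<noteq> []"

definition "R0 Q = RelD KK 0 (ne + s) 0 Jc (%e ys. Q e)"
definition "R1 Q = RelD KK 0 (ne + s) 1 Jc (%e ys. Q e (ys ! 0))"
definition "R2 Q = RelD KK 0 (ne + s) 2 Jc (%e ys. Q e (ys ! 0) (ys ! 1))"

lemma R0I:
  assumes D: "\<And>Ts Bs E. Env fst Ts Bs 0 (ne + s) E ==> D KK fst (%c::canon. Jc (E c)) Ts Bs (%c. P (fst c) (E c))"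
    and eq: "\<And>e. Jc e ==> P (fst e) e = Q e"
  shows "R0 Q"
  unfolding R0_def RelD_def
proof (intro allI impI)
  fix Ts Bs and E :: "canon => canon" and ys
  assume E: "Env fst Ts Bs 0 (ne + s) E"
  show "D KK fst (%c. Jc (E c)) Ts Bs (%c. Q (E c))"
    by (rule D_eq_cong[OF D[OF E]]) (use eq Env_fst[OF E] in metis)
qed

lemma gd_less: "gd N W Ts Bs c ==> t \<in> set Ts ==> t c < N * length (W c)"
  by (simp add: gd_def)

lemma R1I:
  assumes D: "\<And>Ts Bs E t. Env fst Ts Bs 0 (ne + s) E ==> t \<in> set Ts ==> D KK fst (%c::canon. Jc (E c)) Ts Bs (%c. P (fst c) (E c) (t c))"
    and eq: "\<And>e t. Jc e ==> t < KK * length (fst e) ==> P (fst e) e t = Q e t"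
  shows "R1 Q"
  unfolding R1_def RelD_def
proof (intro allI impI)
  fix Ts Bs and E :: "canon => canon" and ys
  assume E: "Env fst Ts Bs 0 (ne + s) E" and ys: "length ys = 1" "set ys \<subseteq> set Ts"
  obtain t where t: "ys = [t]" "t \<in> set Ts" using ys by (auto simp: length_Suc_conv)
  show "D KK fst (%c. Jc (E c)) Ts Bs (%c. Q (E c) (map (%t. t c) ys ! 0))"
    by (rule D_eq_cong[OF D[OF E t(2)]]) (use eq Env_fst[OF E] gd_less[OF _ t(2)] in \<open>simp add: t(1), metis\<close>)
qed

lemma R2I:
  assumes D: "\<And>Ts Bs E t x. Env fst Ts Bs 0 (ne + s) E ==> t \<in> set Ts ==> x \<in> set Ts ==> D KK fst (%c::canon. Jc (E c)) Ts Bs (%c. P (fst c) (E c) (t c) (x c))"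
    and eq: "\<And>e t x. Jc e ==> t < KK * length (fst e) ==> x < KK * length (fst e) ==> P (fst e) e t x = Q e t x"
  shows "R2 Q"
  unfolding R2_def RelD_def
proof (intro allI impI)
  fix Ts Bs and E :: "canon => canon" and ys
  assume E: "Env fst Ts Bs 0 (ne + s) E" and ys: "length ys = 2" "set ys \<subseteq> set Ts"
  obtain t x where t: "ys = [t, x]" "t \<in> set Ts" "x \<in> set Ts" using ys by (auto simp: numeral_2_eq_2 length_Suc_conv)
  show "D KK fst (%c. Jc (E c)) Ts Bs (%c. Q (E c) (map (%t. t c) ys ! 0) (map (%t. t c) ys ! 1))"
    by (rule D_eq_cong[OF D[OF E t(2,3)]]) (use eq Env_fst[OF E] gd_less[OF _ t(2)] gd_less[OF _ t(3)] in \<open>simp add: t(1), metis\<close>)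
qed

lemma R0_use: "R0 Q ==> Env W Ts Bs 0 (ne + s) E ==> (\<And>c. I c ==> Jc (E c)) ==> D KK W I Ts Bs (%c. Q (E c))"
  unfolding R0_def using RelD_use[of KK 0 "ne + s" 0 Jc "%e ys. Q e" W Ts Bs E "[]" I] by simp

lemma R1_use: "R1 Q ==> Env W Ts Bs 0 (ne + s) E ==> t \<in> set Ts ==> (\<And>c. I c ==> Jc (E c)) ==> D KK W I Ts Bs (%c. Q (E c) (t c))"
  unfolding R1_def using RelD_use[of KK 0 "ne + s" 1 Jc "%e ys. Q e (ys ! 0)" W Ts Bs E "[t]" I] by simp

lemma R2_use: "R2 Q ==> Env W Ts Bs 0 (ne + s) E ==> t \<in> set Ts ==> x \<in> set Ts ==> (\<And>c. I c ==> Jc (E c)) ==>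
   D KK W I Ts Bs (%c. Q (E c) (t c) (x c))"
  unfolding R2_def using RelD_use[of KK 0 "ne + s" 2 Jc "%e ys. Q e (ys ! 0) (ys ! 1)" W Ts Bs E "[t, x]" I] by simp

lemma Jc_facts:
  assumes "Jc e"
  shows "0 < length (fst e)" "0 < TT e" "TT e < (K1 + 1) * length (fst e)" "(K1 + 1) * length (fst e) < KK * length (fst e)" "TT e < KK * length (fst e)"
    "set (es e) \<subseteq> Evs" "length (es e) = TT e" "inp e \<in> lists {..<s}" "wfc (init_config M (inp e))" "length (AS e) = ne"
    "length (snd (snd e)) = ne + s" "part (TT e) (AS e)"
proof -
  show n: "0 < length (fst e)" using assms by (simp add: Jc_def)
  then show "0 < TT e" by (simp add: TT_def K1_def)
  show 1: "TT e < (K1 + 1) * length (fst e)" using n by (simp add: TT_def)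
  show 2: "(K1 + 1) * length (fst e) < KK * length (fst e)"
  proof -
    have "0 < (K1 + 1) * length (fst e)" using n by simp
    moreover have "KK * length (fst e) = 4 * ((K1 + 1) * length (fst e))" by (simp only: KK_def mult.assoc)
    ultimately show ?thesis by linarith
  qed
  show "TT e < KK * length (fst e)" using 1 2 by (rule less_trans)
  show l: "length (AS e) = ne" and "length (snd (snd e)) = ne + s" and p: "part (TT e) (AS e)" using assms by (simp_all add: Jc_def AS_def)
  show le: "length (es e) = TT e" by (simp add: es_def)
  show "set (es e) \<subseteq> Evs" using evs_nth(1)[OF p l] le unfolding es_def by (metis in_set_conv_nth subsetI)
  have "length (drop ne (snd (snd e))) = s" using assms by (simp add: Jc_def)
  then show i: "inp e \<in> lists {..<s}" using wd_props(4)[of "drop ne (snd (snd e))" "K * length (fst e)"] assms unfolding inp_def Jc_def by simp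
  show "wfc (init_config M (inp e))" by (rule init_wfc[OF s i])
qed

definition SM :: "nat => canon => nat => bool" where
  "SM a e t \<longleftrightarrow> a < ne + s \<and> t \<in> snd (snd e) ! a"

lemma D_SM: assumes "Env W Ts Bs 0 (ne + s) E" "t \<in> set Ts" shows "D KK W I Ts Bs (%c. SM a (E c) (t c))"
proof (cases "a < ne + s")
  case True
  obtain bs where bs: "length bs = ne + s" "set bs \<subseteq> set Bs" "\<And>c. E c = (W c, [], map (%B. B c) bs)" using assms(1) by (auto simp: Env_def)
  have "bs ! a \<in> set Bs" using bs True by auto
  from D_mem[OF assms(2) this] show ?thesis using True bs by (simp add: SM_def)
qed (simp add: SM_def D_const)

lemmas D_fin = D_const D_ball D_bex D_intros D_SM finite_lessThan finite_atLeastLessThan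
lemmas Ds = D_fin D_mems Env_lift

definition EV :: "(event => bool) => canon => nat => bool" where
  "EV A e t \<longleftrightarrow> t < TT e \<and> A (es e ! t)"

lemma R1_EV: "R1 (EV A)"
proof (rule R1I[where P = "%w e t. \<exists>a\<in>{..<ne}. A (evl ! a) \<and> SM a e t"])
  fix Ts Bs and E :: "canon => canon" and t assume "Env fst Ts Bs 0 (ne + s) E" "t \<in> set Ts"
  then show "D KK fst (%c::canon. Jc (E c)) Ts Bs (%c. \<exists>a\<in>{..<ne}. A (evl ! a) \<and> SM a (E c) (t c))" by (intro Ds)
next
  fix e t assume J: "Jc e"
  note f = Jc_facts[OF J]
  have sm: "SM a e t \<longleftrightarrow> t \<in> AS e ! a" if "a < ne" for a using that by (simp add: SM_def AS_def)
  have "t < TT e" if "a < ne" "t \<in> AS e ! a" for a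
  proof -
    have "AS e ! a \<in> set (AS e)" using that f(10) by simp
    moreover have "\<forall>B\<in>set (AS e). B \<subseteq> {..<TT e}" using f(12) by (simp add: part_def)
    ultimately show ?thesis using that(2) by auto
  qed
  then show "(\<exists>a\<in>{..<ne}. A (evl ! a) \<and> SM a e t) = EV A e t"
  proof (cases "t < TT e")
    case True
    have "EV A e t \<longleftrightarrow> (\<exists>a\<in>{a. a < ne \<and> A (evl ! a)}. t \<in> AS e ! a)"
      using True evs_nth(2)[OF f(12,10) True, of A] by (simp add: EV_def es_def)
    then show ?thesis using sm by auto
  next
    case False
    then have "\<not> SM a e t" if "a < ne" for a using sm[OF that] \<open>\<And>a. a < ne ==> t \<in> AS e ! a ==> t < TT e\<close> that by auto
    then show ?thesis using False by (auto simp: EV_def)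
  qed
qed

text \<open>The value 0 outside the running time makes the step total and bounded. On a run the head
  never exceeds the elapsed time, so the guard holds at every step before
  \<open>TT e\<close>.\<close>

definition Fh :: "nat => canon => nat => nat => nat" where
  "Fh i e t p = (if t < TT e \<and> p < TT e then if reset (es e ! t) i then 0 else nat (int p + mv (es e ! t) i) else 0)"

definition hh :: "nat => canon => nat => nat" where
  "hh i e t = rec_nat 0 (Fh i e) t"

lemma iter_head: assumes i: "i \<in> {..<k}" shows "iteration G Md KK (K1 + 1) 0 (ne + s) Jc (Fh i) (hh i)"
proof unfold_locales
  show "0 < K1 + 1" "4 * (K1 + 1) \<le> KK" by (simp_all add: KK_def)
  have ik: "i < k" using i by simp
  have mvi: "mv (es e ! t) i \<in> {-1, 0, 1}" if "Jc e" "t < TT e" for e t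
    using mv_le[OF _ ik] Jc_facts(6,7)[OF that(1)] that(2) by (metis nth_mem subsetD)
  show "Fh i e t p < (K1 + 1) * length (fst e)" if J: "Jc e" for e t p
    using mvi[OF J, of t] Jc_facts(2,3)[OF J] by (auto simp: Fh_def)
  show "hh i e 0 = 0" "hh i e (Suc t) = Fh i e t (hh i e t)" for e t by (simp_all add: hh_def)
  show "RelD KK 0 (ne + s) 3 Jc (%e ys. ys ! 2 = Fh i e (ys ! 0) (ys ! 1))"
    unfolding RelD_def
  proof (intro allI impI)
    fix Ts Bs and E :: "canon => canon" and ys
    assume E: "Env fst Ts Bs 0 (ne + s) E" and ys: "length ys = 3" "set ys \<subseteq> set Ts"
    obtain t p q where tq: "ys = [t, p, q]" using ys(1) by (auto simp: numeral_3_eq_3 length_Suc_conv)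
    have mem: "t \<in> set Ts" "p \<in> set Ts" "q \<in> set Ts" using ys tq by auto
    have "D KK fst (%c. Jc (E c)) Ts Bs (%c.
       (t c < K1 * length (fst c) \<and> p c < K1 * length (fst c) \<and> (EV (%ev. reset ev i) (E c) (t c) \<and> q c = 0 \<or>
         EV (%ev. \<not> reset ev i \<and> mv ev i = 0) (E c) (t c) \<and> p c = q c \<or>
         EV (%ev. \<not> reset ev i \<and> mv ev i = 1) (E c) (t c) \<and> Suc (p c) = q c \<or>
         EV (%ev. \<not> reset ev i \<and> mv ev i = -1) (E c) (t c) \<and> (Suc (q c) = p c \<or> p c = 0 \<and> q c = 0))) \<or>
       \<not> (t c < K1 * length (fst c) \<and> p c < K1 * length (fst c)) \<and> q c = 0)"
      by (intro Ds R1_use[OF R1_EV] mem E)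
    then show "D KK fst (%c. Jc (E c)) Ts Bs (%c. map (%t. t c) ys ! 2 = Fh i (E c) (map (%t. t c) ys ! 0) (map (%t. t c) ys ! 1))"
    proof (rule D_eq_cong)
      fix c assume J: "Jc (E c)"
      have T: "K1 * length (fst c) = TT (E c)" using Env_fst[OF E, of c] by (simp add: TT_def)
      show "((t c < K1 * length (fst c) \<and> p c < K1 * length (fst c) \<and> (EV (%ev. reset ev i) (E c) (t c) \<and> q c = 0 \<or>
         EV (%ev. \<not> reset ev i \<and> mv ev i = 0) (E c) (t c) \<and> p c = q c \<or>
         EV (%ev. \<not> reset ev i \<and> mv ev i = 1) (E c) (t c) \<and> Suc (p c) = q c \<or>
         EV (%ev. \<not> reset ev i \<and> mv ev i = -1) (E c) (t c) \<and> (Suc (q c) = p c \<or> p c = 0 \<and> q c = 0))) \<or>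
       \<not> (t c < K1 * length (fst c) \<and> p c < K1 * length (fst c)) \<and> q c = 0) =
       (map (%t. t c) ys ! 2 = Fh i (E c) (map (%t. t c) ys ! 0) (map (%t. t c) ys ! 1))"
      proof (cases "t c < TT (E c) \<and> p c < TT (E c)")
        case True
        show ?thesis using True mvi[OF J, of "t c"] unfolding T tq EV_def Fh_def
          by (cases "reset (es (E c) ! t c) i") (auto simp: numeral_2_eq_2)
      next
        case False
        then show ?thesis unfolding T tq by (auto simp: Fh_def)
      qed
    qed
  qed
qed

definition HD :: "nat => canon => nat => nat => bool" where
  "HD i e t x \<longleftrightarrow> t < (K1 + 1) * length (fst e) \<and> x = hh i e t"

lemma R2_HD: "i \<in> {..<k} ==> R2 (HD i)"
  unfolding R2_def HD_def by (rule iteration.RelD_iter[OF iter_head])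

lemma hh_head: "Jc e ==> i \<in> {..<k} ==> t \<le> TT e ==> hh i e t = head (inp e) (es e) i t"
proof (induction t)
  case 0
  then show ?case using Cf_0(3)[of i "inp e" "es e"] by (simp add: hh_def)
next
  case (Suc t)
  note f = Jc_facts[OF Suc.prems(1)]
  have "head (inp e) (es e) i t \<le> t" using head_le[OF f(6), of t i "inp e"] f(7) Suc.prems by simp
  then have "Fh i e t (head (inp e) (es e) i t) = head (inp e) (es e) i (Suc t)"
    using Suc.prems f(7) Cf_Suc'(2)[of t "es e" i "inp e"] by (simp add: Fh_def)
  then show ?case using Suc by (simp add: hh_def)
qed

lemma HD_iff: "Jc e ==> i \<in> {..<k} ==> t \<le> TT e ==> HD i e t x \<longleftrightarrow> x = head (inp e) (es e) i t"
  using hh_head Jc_facts(3)[of e] by (auto simp: HD_def)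

definition TA :: "nat => canon => nat => nat => bool" where
  "TA i e u x \<longleftrightarrow> u < TT e \<and> (reset (es e ! u) i \<or> x = head (inp e) (es e) i u)"

definition TO :: "nat => nat => canon => nat => nat => bool" where
  "TO i b e u x \<longleftrightarrow> TA i e u x \<and> (if reset (es e ! u) i then 0 else wr (es e ! u) i) = b"

lemma R2_TA: assumes i: "i \<in> {..<k}" shows "R2 (TA i)"
proof (rule R2I[where P = "%w e u x. EV (%ev. reset ev i) e u \<or> u < K1 * length w \<and> HD i e u x"])
  fix Ts Bs and E :: "canon => canon" and t x assume "Env fst Ts Bs 0 (ne + s) E" "t \<in> set Ts" "x \<in> set Ts"
  then show "D KK fst (%c::canon. Jc (E c)) Ts Bs (%c. EV (%ev. reset ev i) (E c) (t c) \<or> t c < K1 * length (fst c) \<and> HD i (E c) (t c) (x c))"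
    by (intro Ds R1_use[OF R1_EV] R2_use[OF R2_HD] i)
next
  fix e u x assume "Jc e"
  then show "(EV (%ev. reset ev i) e u \<or> u < K1 * length (fst e) \<and> HD i e u x) = TA i e u x"
    using HD_iff[of e i u x] i by (auto simp: EV_def TA_def TT_def)
qed

lemma R2_TO: assumes i: "i \<in> {..<k}" shows "R2 (TO i b)"
proof (rule R2I[where P = "%w e u x. EV (%ev. reset ev i \<and> b = 0) e u \<or> EV (%ev. \<not> reset ev i \<and> wr ev i = b) e u \<and> HD i e u x"])
  fix Ts Bs and E :: "canon => canon" and t x assume "Env fst Ts Bs 0 (ne + s) E" "t \<in> set Ts" "x \<in> set Ts"
  then show "D KK fst (%c::canon. Jc (E c)) Ts Bs (%c. EV (%ev. reset ev i \<and> b = 0) (E c) (t c) \<or>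
     EV (%ev. \<not> reset ev i \<and> wr ev i = b) (E c) (t c) \<and> HD i (E c) (t c) (x c))"
    by (intro Ds R1_use[OF R1_EV] R2_use[OF R2_HD] i)
next
  fix e u x assume "Jc e"
  then show "(EV (%ev. reset ev i \<and> b = 0) e u \<or> EV (%ev. \<not> reset ev i \<and> wr ev i = b) e u \<and> HD i e u x) = TO i b e u x"
    using HD_iff[of e i u x] i by (auto simp: EV_def TA_def TO_def)
qed

definition CT0 :: "nat => nat => canon => nat => bool" where
  "CT0 i b e x \<longleftrightarrow> cont (inp e) (es e) i 0 x = b"

text \<open>An input letter \<open>a\<close> is written as \<open>a + 1\<close>, hence the index
  \<open>b - 1\<close>. A cell lies inside the input iff every position up to it belongs to some
  letter set, because \<open>wd\<close> stops at the first gap.\<close>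

lemma R1_CT0: assumes i: "i \<in> {..<k}" shows "R1 (CT0 i b)"
proof (rule R1I[where P = "%w e x. (i = 0 \<and> 0 < b \<and> b \<le> s) \<and> (\<forall>y<KK * length w. \<not> x < y --> (\<exists>a\<in>{..<s}. SM (ne + a) e y)) \<and> SM (ne + (b - 1)) e x \<and>
     (\<forall>a\<in>{..<b - 1}. \<not> SM (ne + a) e x) \<or> b = 0 \<and> (i \<noteq> 0 \<or> \<not> (\<forall>y<KK * length w. \<not> x < y --> (\<exists>a\<in>{..<s}. SM (ne + a) e y)))"])
  fix Ts Bs and E :: "canon => canon" and t assume "Env fst Ts Bs 0 (ne + s) E" "t \<in> set Ts"
  then show "D KK fst (%c::canon. Jc (E c)) Ts Bs (%c. (i = 0 \<and> 0 < b \<and> b \<le> s) \<and> (\<forall>y<KK * length (fst c). \<not> t c < y --> (\<exists>a\<in>{..<s}. SM (ne + a) (E c) y)) \<and> SM (ne + (b - 1)) (E c) (t c) \<and>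
     (\<forall>a\<in>{..<b - 1}. \<not> SM (ne + a) (E c) (t c)) \<or> b = 0 \<and> (i \<noteq> 0 \<or> \<not> (\<forall>y<KK * length (fst c). \<not> t c < y --> (\<exists>a\<in>{..<s}. SM (ne + a) (E c) y))))"
    by (intro Ds)
next
  fix e x assume J: "Jc e" and x: "x < KK * length (fst e)"
  let ?U = "drop ne (snd (snd e))"
  have l: "length ?U = s" using Jc_facts(11)[OF J] by simp
  have sub: "\<forall>B\<in>set ?U. B \<subseteq> {..<K * length (fst e)}" using J by (simp add: Jc_def)
  have sm: "SM (ne + a) e y \<longleftrightarrow> y \<in> ?U ! a" if "a < s" for a y using that Jc_facts(11)[OF J] by (simp add: SM_def)
  have c: "(\<forall>y<KK * length (fst e). \<not> x < y --> (\<exists>a\<in>{..<s}. SM (ne + a) e y)) \<longleftrightarrow> x < length (inp e)"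
  proof -
    have "(\<forall>y<KK * length (fst e). \<not> x < y --> A y) \<longleftrightarrow> (\<forall>y\<le>x. A y)" for A :: "nat => bool"
      using x by (auto simp: not_less)
    moreover have "(\<exists>a\<in>{..<s}. SM (ne + a) e y) \<longleftrightarrow> (\<exists>a<s. y \<in> ?U ! a)" for y using sm by auto
    ultimately show ?thesis unfolding inp_def wd_props(2)[OF sub] l by simp
  qed
  have nth: "inp e ! x = b - 1 \<longleftrightarrow> SM (ne + (b - 1)) e x \<and> (\<forall>a\<in>{..<b - 1}. \<not> SM (ne + a) e x)" if "x < length (inp e)" "0 < b" "b \<le> s"
  proof -
    have "inp e ! x = d \<longleftrightarrow> SM (ne + d) e x \<and> (\<forall>a\<in>{..<d}. \<not> SM (ne + a) e x)" if "x < length (inp e)" "d < s" for d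
      using wd_props(3)[OF sub that(1)[unfolded inp_def], of d] that(2) sm unfolding inp_def l by auto
    from this[of "b - 1"] show ?thesis using that by simp
  qed
  have lt: "inp e ! x < s" if "x < length (inp e)" using Jc_facts(8)[OF J] that nth_mem by (auto simp: in_lists_conv_set)
  have ik: "i < k" using i by simp
  show "((i = 0 \<and> 0 < b \<and> b \<le> s) \<and> (\<forall>y<KK * length (fst e). \<not> x < y --> (\<exists>a\<in>{..<s}. SM (ne + a) e y)) \<and> SM (ne + (b - 1)) e x \<and>
     (\<forall>a\<in>{..<b - 1}. \<not> SM (ne + a) e x) \<or> b = 0 \<and> (i \<noteq> 0 \<or> \<not> (\<forall>y<KK * length (fst e). \<not> x < y --> (\<exists>a\<in>{..<s}. SM (ne + a) e y)))) = CT0 i b e x"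
    unfolding c CT0_def Cf_0(4)[OF ik]
  proof (cases "i = 0 \<and> x < length (inp e)")
    case True
    have "SM (ne + (b - 1)) e x \<and> (\<forall>a\<in>{..<b - 1}. \<not> SM (ne + a) e x) \<longleftrightarrow> inp e ! x + 1 = b" if "0 < b" "b \<le> s"
      using nth[of] True that by auto
    then show "((i = 0 \<and> 0 < b \<and> b \<le> s) \<and> x < length (inp e) \<and> SM (ne + (b - 1)) e x \<and> (\<forall>a\<in>{..<b - 1}. \<not> SM (ne + a) e x) \<or>
        b = 0 \<and> (i \<noteq> 0 \<or> \<not> x < length (inp e))) = ((if i = 0 \<and> x < length (inp e) then inp e ! x + 1 else 0) = b)"
      using True lt by (cases "0 < b \<and> b \<le> s") auto
  qed auto
qed

definition CT :: "nat => nat => canon => nat => nat => bool" where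
  "CT i b e t x \<longleftrightarrow> t \<le> TT e \<and> cont (inp e) (es e) i t x = b"

lemma R2_CT: assumes i: "i \<in> {..<k}" shows "R2 (CT i b)"
proof (rule R2I[where P = "%w e t x. (\<forall>y<KK * length w. y < t --> y < K1 * length w) \<and>
    ((\<exists>u<KK * length w. u < t \<and> TO i b e u x \<and> (\<forall>v<KK * length w. u < v \<and> v < t --> \<not> TA i e v x)) \<or>
     (\<forall>u<KK * length w. u < t --> \<not> TA i e u x) \<and> CT0 i b e x)"])
  fix Ts Bs and E :: "canon => canon" and t x assume "Env fst Ts Bs 0 (ne + s) E" "t \<in> set Ts" "x \<in> set Ts"
  then show "D KK fst (%c::canon. Jc (E c)) Ts Bs (%c. (\<forall>y<KK * length (fst c). y < t c --> y < K1 * length (fst c)) \<and>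
    ((\<exists>u<KK * length (fst c). u < t c \<and> TO i b (E c) u (x c) \<and> (\<forall>v<KK * length (fst c). u < v \<and> v < t c --> \<not> TA i (E c) v (x c))) \<or>
     (\<forall>u<KK * length (fst c). u < t c --> \<not> TA i (E c) u (x c)) \<and> CT0 i b (E c) (x c)))"
    by (intro Ds R2_use[OF R2_TA] R2_use[OF R2_TO] R1_use[OF R1_CT0] i)
next
  fix e t x assume J: "Jc e" and t: "t < KK * length (fst e)"
  note f = Jc_facts[OF J]
  have ik: "i < k" using i by simp
  have a: "(\<forall>y<KK * length (fst e). y < t --> y < K1 * length (fst e)) \<longleftrightarrow> t \<le> TT e"
  proof
    assume "\<forall>y<KK * length (fst e). y < t --> y < K1 * length (fst e)"
    from this[rule_format, OF f(5)] show "t \<le> TT e" by (metis TT_def less_irrefl not_le)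
  qed (auto simp: TT_def)
  show "((\<forall>y<KK * length (fst e). y < t --> y < K1 * length (fst e)) \<and>
    ((\<exists>u<KK * length (fst e). u < t \<and> TO i b e u x \<and> (\<forall>v<KK * length (fst e). u < v \<and> v < t --> \<not> TA i e v x)) \<or>
     (\<forall>u<KK * length (fst e). u < t --> \<not> TA i e u x) \<and> CT0 i b e x)) = CT i b e t x"
  proof (cases "t \<le> TT e")
    case True
    have TA: "TA i e u x \<longleftrightarrow> reset (es e ! u) i \<or> x = head (inp e) (es e) i u" if "u < t" for u using that True by (simp add: TA_def)
    have TO: "TO i b e u x \<longleftrightarrow> (reset (es e ! u) i \<or> x = head (inp e) (es e) i u) \<and> (if reset (es e ! u) i then 0 else wr (es e ! u) i) = b" if "u < t" for u
      using TA[OF that] by (simp add: TO_def)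
    have lt: "u < KK * length (fst e)" if "u < t" for u using that t by simp
    have "(\<exists>u<KK * length (fst e). u < t \<and> TO i b e u x \<and> (\<forall>v<KK * length (fst e). u < v \<and> v < t --> \<not> TA i e v x)) =
      (\<exists>u<t. (reset (es e ! u) i \<or> x = head (inp e) (es e) i u) \<and> (if reset (es e ! u) i then 0 else wr (es e ! u) i) = b \<and>
       (\<forall>v. u < v \<and> v < t --> \<not> (reset (es e ! v) i \<or> x = head (inp e) (es e) i v)))" using lt TA TO by blast
    moreover have "(\<forall>u<KK * length (fst e). u < t --> \<not> TA i e u x) = (\<forall>u<t. \<not> (reset (es e ! u) i \<or> x = head (inp e) (es e) i u))"
      using lt TA by blast
    ultimately show ?thesis unfolding a CT_def CT0_def using True cont_iff[of t "es e" i "inp e" x b] f(7) ik by simp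
  next
    case False
    then show ?thesis unfolding a by (simp add: CT_def)
  qed
qed

text \<open>The cells with symbol \<open>Suc a\<close> form the set of letter \<open>a\<close>, and
  both decodings stop at the first blank. A symbol above \<open>s'\<close> would stop
  \<open>wd\<close> too early, hence the second hypothesis.\<close>

lemma query_word_enc:
  assumes fin: "f N = 0" and ok: "\<And>x. x < (LEAST m. f m = 0) ==> f x \<le> s'"
  shows "wd (map (%a. {x. x < N \<and> f x = Suc a}) [0..<s']) = query_word f"
proof -
  define m where "m = (LEAST m. f m = 0)"
  have m: "f m = 0" "m \<le> N" using LeastI[of "%m. f m = 0", OF fin] Least_le[of "%m. f m = 0", OF fin] by (auto simp: m_def)
  have pos: "0 < f x" if "x < m" for x using not_less_Least[OF that[unfolded m_def]] by simp
  let ?w = "map (%i. f i - 1) [0..<m]"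
  have w: "?w \<in> lists {..<s'}"
  proof -
    have "f x - 1 < s'" if "x < m" for x using pos[OF that] ok[of x] that by (simp add: m_def)
    then show ?thesis by auto
  qed
  let ?V = "map (%a. {x. x < N \<and> f x = Suc a}) [0..<s']"
  have sub: "\<forall>B\<in>set ?V. B \<subseteq> {..<N}" by auto
  have len: "x < length (wd ?V) \<longleftrightarrow> x < m" for x
  proof -
    have "x < length (wd ?V) \<longleftrightarrow> (\<forall>y\<le>x. \<exists>a<s'. y < N \<and> f y = Suc a)" unfolding wd_props(2)[OF sub] by (simp cong: conj_cong)
    also have "\<dots> \<longleftrightarrow> x < m"
    proof
      assume a: "\<forall>y\<le>x. \<exists>a<s'. y < N \<and> f y = Suc a"
      show "x < m"
      proof (rule ccontr)
        assume "\<not> x < m"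
        then show False using a[rule_format, of m] m by auto
      qed
    next
      assume x: "x < m"
      show "\<forall>y\<le>x. \<exists>a<s'. y < N \<and> f y = Suc a"
      proof (intro allI impI)
        fix y assume "y \<le> x"
        then have y: "y < m" using x by simp
        show "\<exists>a<s'. y < N \<and> f y = Suc a" using pos[OF y] ok[of y] y m by (intro exI[of _ "f y - 1"]) (auto simp: m_def)
      qed
    qed
    finally show ?thesis .
  qed
  have l: "length (wd ?V) = m" using len[of m] len[of "length (wd ?V)"] by simp
  have "wd ?V = ?w"
  proof (rule nth_equalityI)
    fix x assume "x < length (wd ?V)"
    then have x: "x < length (wd ?V)" "x < m" using len by auto
    have "f x - 1 < s'" using pos[OF x(2)] ok[of x] x(2) by (simp add: m_def)
    moreover have "x < N" "f x = Suc (f x - 1)" using x m pos[OF x(2)] by auto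
    ultimately have "wd ?V ! x = f x - 1" unfolding wd_props(3)[OF sub x(1)] by auto
    then show "wd ?V ! x = ?w ! x" using x by simp
  qed (simp add: l)
  then show ?thesis by (simp add: query_word_def m_def)
qed

end

context flogic
begin

text \<open>\<open>D_exs\<close> needs at least one set, but an alphabet may be empty; a spare last
  set avoids the case distinction.\<close>

lemma D_exs_Suc:
  assumes "K > 0"
    and P: "D K (%p. W (fst p)) (%p. I (fst p)) (liftT Ts) (liftT Bs @ setp (Suc m))
       (%p. P (fst p) (snd p) (map (snd p) [0..<m]))"
    and PP: "\<And>c f g. (\<And>a. a < m ==> f a = g a) ==> P c f = P c g"
  shows "D K W I Ts Bs (%c. \<exists>As\<in>tuples (K * length (W c)) (Suc m). P c ((!) As) (map ((!) As) [0..<m]))"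
proof (rule D_exs)
  have 1: "P c ((!) (map f [0..<Suc m])) = P c f" for c f
    by (rule PP) (simp add: nth_append)
  have 2: "map ((!) (map f [0..<Suc m])) [0..<m] = map f [0..<m]" for f :: "nat => nat set"
    by (simp add: nth_append)
  show "D K (%p. W (fst p)) (%p. I (fst p)) (liftT Ts) (liftT Bs @ setp (Suc m))
     (%p. P (fst p) ((!) (map (snd p) [0..<Suc m])) (map ((!) (map (snd p) [0..<Suc m])) [0..<m]))"
    unfolding 1 2 by (rule P)
qed (rule zero_less_Suc, rule assms(1))

lemma D_wd:
  assumes "defD G s L"
  shows "D K W I Ts (liftT Bs @ setp (Suc s)) (%p. wd (map (snd p) [0..<s]) \<in> L)"
proof -
  have R: "RelD K 0 s 0 (%_. True) (%e _. wd (snd (snd e)) \<in> L)" using assms by (simp add: defD_def)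
  have "Env W Ts (liftT Bs @ setp (Suc s)) 0 s (%p. (W p, map (%t. t p) [], map (%B. B p) (map (%j p. snd p j) [0..<s])))"
    by (rule EnvI) (auto simp: setp_def)
  from RelD_use[OF R this, of "[]" I] show ?thesis by (simp add: comp_def)
qed

end

context tx
begin

definition QY :: "canon => nat => bool" where
  "QY e t \<longleftrightarrow> t \<le> TT e \<and> query_word (cont (inp e) (es e) (k - 1) t) \<in> Or"

lemma km: "k - 1 \<in> {..<k}" and KKp: "0 < KK"
  using wf' by (auto simp: KK_def)

lemma Or_sub: "Or \<subseteq> lists {..<s'}"
  using def_Or by (simp add: defD_def)

lemma le_TT: "Jc e ==> (\<forall>y<KK * length (fst e). y < t --> y < K1 * length (fst e)) \<longleftrightarrow> t \<le> TT e"
proof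
  assume J: "Jc e" and "\<forall>y<KK * length (fst e). y < t --> y < K1 * length (fst e)"
  from this(2)[rule_format, OF Jc_facts(5)[OF J]] show "t \<le> TT e" by (metis TT_def less_irrefl not_le)
qed (auto simp: TT_def)

text \<open>The letter sets of the query word are guessed and compared with the tape. The last
  conjunct excludes symbols outside the oracle alphabet before the first blank: such a word is not
  in \<open>Or\<close>, but its decoding would be cut off there and might be.\<close>

lemma R1_QY: "R1 QY"
proof (rule R1I[where P = "%w e t. (\<forall>y<KK * length w. y < t --> y < K1 * length w) \<and>
    (\<exists>V\<in>tuples (KK * length w) (Suc s'). (\<forall>x<KK * length w. \<forall>a\<in>{..<s'}. x \<in> V ! a \<longleftrightarrow> CT (k - 1) (Suc a) e t x) \<and> wd (map ((!) V) [0..<s']) \<in> Or) \<and>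
    (\<forall>x<KK * length w. (\<exists>b\<in>{Suc s'..<nsyms M}. CT (k - 1) b e t x) --> (\<exists>y<KK * length w. y < x \<and> CT (k - 1) 0 e t y))"])
  fix Ts Bs and E :: "canon => canon" and t assume a: "Env fst Ts Bs 0 (ne + s) E" "t \<in> set Ts"
  show "D KK fst (%c::canon. Jc (E c)) Ts Bs (%c. (\<forall>y<KK * length (fst c). y < t c --> y < K1 * length (fst c)) \<and>
    (\<exists>V\<in>tuples (KK * length (fst c)) (Suc s'). (\<forall>x<KK * length (fst c). \<forall>a\<in>{..<s'}. x \<in> V ! a \<longleftrightarrow> CT (k - 1) (Suc a) (E c) (t c) x) \<and> wd (map ((!) V) [0..<s']) \<in> Or) \<and>
    (\<forall>x<KK * length (fst c). (\<exists>b\<in>{Suc s'..<nsyms M}. CT (k - 1) b (E c) (t c) x) --> (\<exists>y<KK * length (fst c). y < x \<and> CT (k - 1) 0 (E c) (t c) y)))"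
    apply (rule D_and)
     apply ((intro Ds a | assumption)+)[1]
    apply (rule D_and)
     apply (rule D_exs_Suc[OF KKp, where P = "%c V l. (\<forall>x<KK * length (fst c). \<forall>a\<in>{..<s'}. x \<in> V a \<longleftrightarrow> CT (k - 1) (Suc a) (E c) (t c) x) \<and> wd l \<in> Or"])
      apply (rule D_and)
       apply (rule D_all, rule D_ball, rule finite_lessThan)
       apply (rule D_iff)
        apply (rule D_mem, (intro D_mems)[1], intro in_liftT in_setp, simp)
       apply (intro Ds R2_use[OF R2_CT] km a, assumption)
      apply (rule D_wd[OF def_Or])
     apply (intro ext, simp)
    apply ((intro Ds R2_use[OF R2_CT] km a | assumption)+)[1]
    done
next
  fix e t assume J: "Jc e" and t: "t < KK * length (fst e)"
  note f = Jc_facts[OF J]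
  let ?N = "KK * length (fst e)"
  show "((\<forall>y<?N. y < t --> y < K1 * length (fst e)) \<and>
    (\<exists>V\<in>tuples ?N (Suc s'). (\<forall>x<?N. \<forall>a\<in>{..<s'}. x \<in> V ! a \<longleftrightarrow> CT (k - 1) (Suc a) e t x) \<and> wd (map ((!) V) [0..<s']) \<in> Or) \<and>
    (\<forall>x<?N. (\<exists>b\<in>{Suc s'..<nsyms M}. CT (k - 1) b e t x) --> (\<exists>y<?N. y < x \<and> CT (k - 1) 0 e t y))) = QY e t"
  proof (cases "t \<le> TT e")
    case False
    then show ?thesis unfolding le_TT[OF J] by (simp add: QY_def)
  next
    case True
    define g where "g = cont (inp e) (es e) (k - 1) t"
    have ct: "CT (k - 1) b e t x \<longleftrightarrow> g x = b" for b x using True by (simp add: CT_def g_def)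
    have k1: "k - 1 < k" "k - 1 \<noteq> 0" using wf' by auto
    have gs: "g x < nsyms M" for x unfolding g_def by (rule cont_less[OF f(6,9) k1(1)])
    have g0: "g (TT e) = 0" unfolding g_def by (rule cont_blank[OF f(6) _ k1]) (use True f(7) in auto)
    have gN: "g ?N = 0" unfolding g_def by (rule cont_blank[OF f(6) _ k1]) (use True f(5,7) in auto)
    define m where "m = (LEAST m. g m = 0)"
    have m: "g m = 0" "m \<le> TT e" using LeastI[of "%m. g m = 0", OF g0] Least_le[of "%m. g m = 0", OF g0] by (auto simp: m_def)
    have mN: "m < ?N" using m(2) f(5) by simp
    have pos: "g x \<noteq> 0" if "x < m" for x using not_less_Least[OF that[unfolded m_def]] .
    let ?Vs = "map (%a. {x. x < ?N \<and> g x = Suc a}) [0..<s']"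
    have V: "(\<exists>V\<in>tuples ?N (Suc s'). (\<forall>x<?N. \<forall>a\<in>{..<s'}. x \<in> V ! a \<longleftrightarrow> g x = Suc a) \<and> wd (map ((!) V) [0..<s']) \<in> Or) \<longleftrightarrow> wd ?Vs \<in> Or"
    proof
      assume "\<exists>V\<in>tuples ?N (Suc s'). (\<forall>x<?N. \<forall>a\<in>{..<s'}. x \<in> V ! a \<longleftrightarrow> g x = Suc a) \<and> wd (map ((!) V) [0..<s']) \<in> Or"
      then obtain V where V: "V \<in> tuples ?N (Suc s')" "\<forall>x<?N. \<forall>a\<in>{..<s'}. x \<in> V ! a \<longleftrightarrow> g x = Suc a" "wd (map ((!) V) [0..<s']) \<in> Or" by blast
      have "V ! a = {x. x < ?N \<and> g x = Suc a}" if "a < s'" for a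
      proof -
        have "V ! a \<in> set V" using V(1) that by (simp add: tuples_def)
        then have "V ! a \<subseteq> {..<?N}" using V(1) by (auto simp: tuples_def)
        then show ?thesis using V(2) that by auto
      qed
      then have mv: "map ((!) V) [0..<s'] = ?Vs" by simp
      show "wd ?Vs \<in> Or" using V(3) unfolding mv .
    next
      assume w: "wd ?Vs \<in> Or"
      have tup: "?Vs @ [{}] \<in> tuples ?N (Suc s')" by (auto simp: tuples_def)
      have n: "(?Vs @ [{}]) ! a = {x. x < ?N \<and> g x = Suc a}" if "a < s'" for a using that by (simp add: nth_append)
      then have mv: "map ((!) (?Vs @ [{}])) [0..<s'] = ?Vs" by simp
      then show "\<exists>V\<in>tuples ?N (Suc s'). (\<forall>x<?N. \<forall>a\<in>{..<s'}. x \<in> V ! a \<longleftrightarrow> g x = Suc a) \<and> wd (map ((!) V) [0..<s']) \<in> Or"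
      proof (intro bexI[OF _ tup] conjI)
        show "wd (map ((!) (?Vs @ [{}])) [0..<s']) \<in> Or" unfolding mv by (rule w)
      qed (use n in auto)
    qed
    have C: "(\<forall>x<?N. (\<exists>b\<in>{Suc s'..<nsyms M}. g x = b) --> (\<exists>y<?N. y < x \<and> g y = 0)) \<longleftrightarrow> (\<forall>x<m. g x \<le> s')"
    proof
      assume a: "\<forall>x<?N. (\<exists>b\<in>{Suc s'..<nsyms M}. g x = b) --> (\<exists>y<?N. y < x \<and> g y = 0)"
      show "\<forall>x<m. g x \<le> s'"
      proof (intro allI impI, rule ccontr)
        fix x assume x: "x < m" "\<not> g x \<le> s'"
        then have "\<exists>b\<in>{Suc s'..<nsyms M}. g x = b" using gs by auto
        then obtain y where "y < x" "g y = 0" using a x mN by (meson less_trans)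
        then show False using pos[of y] x by simp
      qed
    next
      assume a: "\<forall>x<m. g x \<le> s'"
      show "\<forall>x<?N. (\<exists>b\<in>{Suc s'..<nsyms M}. g x = b) --> (\<exists>y<?N. y < x \<and> g y = 0)"
      proof (intro allI impI)
        fix x assume "\<exists>b\<in>{Suc s'..<nsyms M}. g x = b"
        then have "\<not> x < m" "x \<noteq> m" using a m(1) by auto
        then show "\<exists>y<?N. y < x \<and> g y = 0" using m(1) mN by (intro exI[of _ m]) simp
      qed
    qed
    have "(wd ?Vs \<in> Or \<and> (\<forall>x<m. g x \<le> s')) = (query_word g \<in> Or)"
    proof (cases "\<forall>x<m. g x \<le> s'")
      case True
      then show ?thesis using query_word_enc[of g ?N, OF gN] by (simp add: m_def)
    next
      case False
      then obtain x where x: "x < m" "s' < g x" by (auto simp: not_le)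
      have "g x - 1 \<in> set (query_word g)" using x by (auto simp: query_word_def m_def)
      have "query_word g \<notin> Or"
      proof
        assume "query_word g \<in> Or"
        then have "query_word g \<in> lists {..<s'}" using Or_sub by blast
        then have "g x - 1 < s'" using \<open>g x - 1 \<in> set (query_word g)\<close> by (metis in_listsD lessThan_iff)
        then show False using x(2) by linarith
      qed
      then show ?thesis using False by simp
    qed
    then show ?thesis unfolding le_TT[OF J] ct V C QY_def g_def[symmetric] using True by simp
  qed
qed

definition VAL :: "canon => bool" where
  "VAL e \<longleftrightarrow> valid (init_config M (inp e)) (es e)"

definition FIN :: "(nat => bool) => canon => bool" where
  "FIN A e \<longleftrightarrow> A (fst (fold ap (es e) (init_config M (inp e))))"

text \<open>Events record the state before their step, so the final state is the successor state of
  the event at \<open>TT e - 1\<close>, the last time inside the running time.\<close>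

lemma R0_FIN: "R0 (FIN A)"
proof (rule R0I[where P = "%w e. \<exists>t<KK * length w. EV (%ev. A (fst (nx ev))) e t \<and> (\<forall>y<KK * length w. t < y --> \<not> y < K1 * length w)"])
  fix Ts Bs and E :: "canon => canon" assume a: "Env fst Ts Bs 0 (ne + s) E"
  show "D KK fst (%c::canon. Jc (E c)) Ts Bs (%c. \<exists>t<KK * length (fst c). EV (%ev. A (fst (nx ev))) (E c) t \<and> (\<forall>y<KK * length (fst c). t < y --> \<not> y < K1 * length (fst c)))"
    by (intro Ds R1_use[OF R1_EV] a)
next
  fix e assume J: "Jc e"
  note f = Jc_facts[OF J]
  have l: "(\<forall>y<KK * length (fst e). t < y --> \<not> y < K1 * length (fst e)) \<longleftrightarrow> t = TT e - 1" if "t < TT e" for t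
  proof
    assume a: "\<forall>y<KK * length (fst e). t < y --> \<not> y < K1 * length (fst e)"
    show "t = TT e - 1"
    proof (rule ccontr)
      assume "t \<noteq> TT e - 1"
      then have st: "Suc t < TT e" using that by simp
      then have "Suc t < KK * length (fst e)" using f(5) by (rule less_trans)
      then show False using a st by (auto simp: TT_def)
    qed
  qed (use that in \<open>auto simp: TT_def\<close>)
  have "FIN A e \<longleftrightarrow> A (fst (Cf (inp e) (es e) (TT e)))" using f(7) by (simp add: FIN_def Cf_def)
  also have "fst (Cf (inp e) (es e) (TT e)) = fst (nx (es e ! (TT e - 1)))" using Cf_Suc'(1)[of "TT e - 1" "es e" "inp e"] f(2,7) by simp
  finally have F: "FIN A e \<longleftrightarrow> A (fst (nx (es e ! (TT e - 1))))" .
  show "(\<exists>t<KK * length (fst e). EV (%ev. A (fst (nx ev))) e t \<and> (\<forall>y<KK * length (fst e). t < y --> \<not> y < K1 * length (fst e))) = FIN A e"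
  proof
    assume "\<exists>t<KK * length (fst e). EV (%ev. A (fst (nx ev))) e t \<and> (\<forall>y<KK * length (fst e). t < y --> \<not> y < K1 * length (fst e))"
    then show "FIN A e" using l F by (auto simp: EV_def)
  next
    assume "FIN A e"
    then show "\<exists>t<KK * length (fst e). EV (%ev. A (fst (nx ev))) e t \<and> (\<forall>y<KK * length (fst e). t < y --> \<not> y < K1 * length (fst e))"
      using l[of "TT e - 1"] F f(2,5) by (intro exI[of _ "TT e - 1"]) (auto simp: EV_def)
  qed
qed

lemma R0_VAL: "R0 VAL"
proof (rule R0I[where P = "%w e. \<forall>t<KK * length w. t < K1 * length w -->
    (t = 0 \<and> EV (%ev. fst ev = q_init M) e t \<or> (\<exists>u<KK * length w. Suc u = t \<and> (\<exists>q\<in>{..<nstates M}. EV (%ev. fst (nx ev) = q) e u \<and> EV (%ev. fst ev = q) e t))) \<and>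
    (\<forall>i\<in>{..<k}. \<exists>x<KK * length w. \<exists>b\<in>{..<nsyms M}. HD i e t x \<and> EV (%ev. fst (snd ev) ! i = b) e t \<and> CT i b e t x) \<and>
    (EV (%ev. fst ev = q_qry M) e t --> (EV (%ev. snd (snd ev) = 0) e t \<longleftrightarrow> QY e t))"])
  fix Ts Bs and E :: "canon => canon" assume a: "Env fst Ts Bs 0 (ne + s) E"
  show "D KK fst (%c::canon. Jc (E c)) Ts Bs (%c. \<forall>t<KK * length (fst c). t < K1 * length (fst c) -->
    (t = 0 \<and> EV (%ev. fst ev = q_init M) (E c) t \<or> (\<exists>u<KK * length (fst c). Suc u = t \<and> (\<exists>q\<in>{..<nstates M}. EV (%ev. fst (nx ev) = q) (E c) u \<and> EV (%ev. fst ev = q) (E c) t))) \<and>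
    (\<forall>i\<in>{..<k}. \<exists>x<KK * length (fst c). \<exists>b\<in>{..<nsyms M}. HD i (E c) t x \<and> EV (%ev. fst (snd ev) ! i = b) (E c) t \<and> CT i b (E c) t x) \<and>
    (EV (%ev. fst ev = q_qry M) (E c) t --> (EV (%ev. snd (snd ev) = 0) (E c) t \<longleftrightarrow> QY (E c) t)))"
    by (intro Ds R1_use[OF R1_EV] R1_use[OF R1_QY] R2_use[OF R2_HD] R2_use[OF R2_CT] a | assumption)+
next
  fix e assume J: "Jc e"
  note f = Jc_facts[OF J]
  have nxs: "fst (nx (es e ! u)) < nstates M" if "u < TT e" for u
  proof -
    obtain q ys j where ev: "es e ! u = (q, ys, j)" by (cases "es e ! u")
    have "es e ! u \<in> Evs" using f(6,7) that by auto
    then show ?thesis using nx_wf(1)[of q ys j] by (simp add: ev)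
  qed
  have T: "K1 * length (fst e) = TT e" by (simp add: TT_def)
  have lt: "u < KK * length (fst e)" if "u \<le> TT e" for u using that f(5) by simp
  have 1: "(\<exists>u<KK * length (fst e). Suc u = t \<and> (\<exists>q\<in>{..<nstates M}. EV (%ev. fst (nx ev) = q) e u \<and> EV (%ev. fst ev = q) e t)) \<longleftrightarrow>
     (\<exists>u. Suc u = t \<and> fst (es e ! t) = fst (nx (es e ! u)))" if "t < TT e" for t
    using that nxs lt by (auto simp: EV_def)
  have 2: "(\<exists>x<KK * length (fst e). \<exists>b\<in>{..<nsyms M}. HD i e t x \<and> EV (%ev. fst (snd ev) ! i = b) e t \<and> CT i b e t x) \<longleftrightarrow>
      fst (snd (es e ! t)) ! i = cont (inp e) (es e) i t (head (inp e) (es e) i t)" if t: "t < TT e" and i: "i < k" for t i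
  proof -
    have h: "HD i e t x \<longleftrightarrow> x = head (inp e) (es e) i t" for x using HD_iff[OF J, of i t] t i by simp
    have hl: "head (inp e) (es e) i t < KK * length (fst e)" using head_le[OF f(6), of t i "inp e"] f(7) t i lt[of t] by simp
    have "cont (inp e) (es e) i t (head (inp e) (es e) i t) < nsyms M" by (rule cont_less[OF f(6,9) i])
    then show ?thesis using t hl by (auto simp: h EV_def CT_def)
  qed
  have A: "(\<forall>t<KK * length (fst e). t < TT e --> A t) \<longleftrightarrow> (\<forall>t<TT e. A t)" for A using lt by auto
  have m1: "(t = 0 \<and> EV (%ev. fst ev = q_init M) e t \<or> (\<exists>u<KK * length (fst e). Suc u = t \<and> (\<exists>q\<in>{..<nstates M}. EV (%ev. fst (nx ev) = q) e u \<and> EV (%ev. fst ev = q) e t))) \<longleftrightarrow>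
     (t = 0 \<and> fst (es e ! t) = q_init M \<or> (\<exists>u. Suc u = t \<and> fst (es e ! t) = fst (nx (es e ! u))))" if t: "t < TT e" for t
    unfolding 1[OF t] using t by (simp add: EV_def)
  have m2: "(\<forall>i\<in>{..<k}. \<exists>x<KK * length (fst e). \<exists>b\<in>{..<nsyms M}. HD i e t x \<and> EV (%ev. fst (snd ev) ! i = b) e t \<and> CT i b e t x) \<longleftrightarrow>
     (\<forall>i<k. fst (snd (es e ! t)) ! i = cont (inp e) (es e) i t (head (inp e) (es e) i t))" if t: "t < TT e" for t
    unfolding Ball_def[of "{..<k}"] by (intro all_cong1 imp_cong) (simp, erule 2[OF t])
  have m3: "(EV (%ev. fst ev = q_qry M) e t --> (EV (%ev. snd (snd ev) = 0) e t \<longleftrightarrow> QY e t)) \<longleftrightarrow>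
     (fst (es e ! t) = q_qry M --> (snd (snd (es e ! t)) = 0 \<longleftrightarrow> query_word (cont (inp e) (es e) (k - 1) t) \<in> Or))" if t: "t < TT e" for t
    using t by (simp add: EV_def QY_def)
  show "(\<forall>t<KK * length (fst e). t < K1 * length (fst e) -->
    (t = 0 \<and> EV (%ev. fst ev = q_init M) e t \<or> (\<exists>u<KK * length (fst e). Suc u = t \<and> (\<exists>q\<in>{..<nstates M}. EV (%ev. fst (nx ev) = q) e u \<and> EV (%ev. fst ev = q) e t))) \<and>
    (\<forall>i\<in>{..<k}. \<exists>x<KK * length (fst e). \<exists>b\<in>{..<nsyms M}. HD i e t x \<and> EV (%ev. fst (snd ev) ! i = b) e t \<and> CT i b e t x) \<and>
    (EV (%ev. fst ev = q_qry M) e t --> (EV (%ev. snd (snd ev) = 0) e t \<longleftrightarrow> QY e t))) = VAL e"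
    unfolding VAL_def valid_Cf[OF f(6)] f(7) T A
    by (intro all_cong1 imp_cong refl) (simp only: m1 m2 m3)
qed

lemma D_part:
  fixes W :: "'c => nat list"
  assumes E: "Env W Ts Bs 0 (ne + s) E"
  shows "D KK W I Ts Bs (%c. part (TT (E c)) (AS (E c)))"
proof (rule D_eq_cong)
  let ?P = "%c. \<forall>t<KK * length (W c). (t < K1 * length (W c) \<and> (\<exists>a\<in>{..<ne}. SM a (E c) t \<and> (\<forall>b\<in>{..<ne}. SM b (E c) t --> b = a))) \<or>
     (\<not> t < K1 * length (W c) \<and> (\<forall>a\<in>{..<ne}. \<not> SM a (E c) t))"
  show "D KK W I Ts Bs ?P" by (intro Ds E)
  fix c assume gd: "gd KK W Ts Bs c"
  obtain bs where bs: "length bs = ne + s" "set bs \<subseteq> set Bs" "\<And>c. E c = (W c, [], map (%B. B c) bs)" using E by (auto simp: Env_def)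
  have la: "length (AS (E c)) = ne" using bs by (simp add: AS_def)
  have sm: "SM a (E c) t \<longleftrightarrow> t \<in> AS (E c) ! a" if "a < ne" for a t using that bs by (simp add: SM_def AS_def)
  have sub: "B \<subseteq> {..<KK * length (W c)}" if "B \<in> set (AS (E c))" for B
  proof -
    have "B \<in> set (snd (snd (E c)))" using that unfolding AS_def by (rule in_set_takeD)
    then obtain B' where "B' \<in> set Bs" "B = B' c" using bs by auto
    then show ?thesis using gd by (simp add: gd_def)
  qed
  have T: "K1 * length (W c) = TT (E c)" using bs(3) by (simp add: TT_def)
  have TN: "TT (E c) \<le> KK * length (W c)" unfolding T[symmetric] KK_def by (intro mult_le_mono1) simp
  have 1: "(\<exists>a\<in>{..<ne}. SM a (E c) t \<and> (\<forall>b\<in>{..<ne}. SM b (E c) t --> b = a)) \<longleftrightarrow> (\<exists>a<ne. t \<in> AS (E c) ! a \<and> (\<forall>b<ne. t \<in> AS (E c) ! b --> b = a))" for t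
    using sm by auto
  have 2: "(\<forall>B\<in>set (AS (E c)). B \<subseteq> {..<TT (E c)}) \<longleftrightarrow> (\<forall>t<KK * length (W c). \<not> t < TT (E c) --> (\<forall>a\<in>{..<ne}. \<not> SM a (E c) t))"
  proof
    assume a: "\<forall>B\<in>set (AS (E c)). B \<subseteq> {..<TT (E c)}"
    have "AS (E c) ! i \<subseteq> {..<TT (E c)}" if "i < ne" for i using a that la nth_mem by metis
    then show "\<forall>t<KK * length (W c). \<not> t < TT (E c) --> (\<forall>a\<in>{..<ne}. \<not> SM a (E c) t)" using sm by blast
  next
    assume a: "\<forall>t<KK * length (W c). \<not> t < TT (E c) --> (\<forall>a\<in>{..<ne}. \<not> SM a (E c) t)"
    show "\<forall>B\<in>set (AS (E c)). B \<subseteq> {..<TT (E c)}"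
    proof (intro ballI subsetI)
      fix B t assume B: "B \<in> set (AS (E c))" "t \<in> B"
      then obtain i where "i < ne" "B = AS (E c) ! i" by (metis in_set_conv_nth la)
      then have "SM i (E c) t" "i \<in> {..<ne}" using sm B(2) by auto
      moreover have "t < KK * length (W c)" using sub[OF B(1)] B(2) by auto
      ultimately show "t \<in> {..<TT (E c)}" using a by blast
    qed
  qed
  have "?P c \<longleftrightarrow> (\<forall>t<TT (E c). \<exists>a\<in>{..<ne}. SM a (E c) t \<and> (\<forall>b\<in>{..<ne}. SM b (E c) t --> b = a)) \<and>
     (\<forall>t<KK * length (W c). \<not> t < TT (E c) --> (\<forall>a\<in>{..<ne}. \<not> SM a (E c) t))"
    unfolding T using TN by (meson order_less_le_trans)
  then show "?P c \<longleftrightarrow> part (TT (E c)) (AS (E c))" unfolding part_def la 1 2 .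
qed

text \<open>Two counts of event tuples are compared, those of valid paths ending inside and outside
  the accepting state. The formula is built for the factor \<open>KK\<close>, which leaves room for
  time and heads, and is brought back to \<open>K\<close> by \<open>D_K\<close>.\<close>

theorem RelD_machine:
  assumes md: "md \<in> Md"
    and L: "\<And>x. x \<in> lists {..<s} ==> halts_within M Or (cc * (length x + 1)) (init_config M x) \<and>
           (x \<in> L \<longleftrightarrow> mode_accepts md (acc_paths M Or (cc * (length x + 1)) (init_config M x)) (rej_paths M Or (cc * (length x + 1)) (init_config M x)))"
  shows "RelD K 0 s 0 (%_. True) (%e _. wd (snd (snd e)) \<in> L)"
  unfolding RelD_def
proof (intro allI impI)
  fix Ts Bs and E :: "canon => canon" and ys :: "(canon => nat) list"
  assume E: "Env fst Ts Bs 0 s E"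
  let ?I = "%c. fst c \<noteq> [] \<and> (\<forall>B\<in>set (snd (snd (E c))). B \<subseteq> {..<K * length (fst c)})"
  let ?mk = "%(c :: canon) As. (fst c, [] :: nat list, As @ snd (snd (E c)))"
  let ?P = "%A c As. part (TT (?mk c As)) (AS (?mk c As)) \<and> (FIN A (?mk c As) \<and> VAL (?mk c As))"
  obtain bs where bs: "length bs = s" "set bs \<subseteq> set Bs" "\<And>c. E c = (fst c, [], map (%B. B c) bs)" using E by (auto simp: Env_def)
  have DP: "D KK (%p. fst (fst p)) (%p. ?I (fst p)) (liftT Ts) (liftT Bs @ setp ne) (%p. ?P A (fst p) (map (snd p) [0..<ne]))" for A
  proof -
    have "Env (%p. fst (fst p)) (liftT Ts) (liftT Bs @ setp ne) 0 (ne + s)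
      (%p. (fst (fst p), map (%t. t p) [], map (%B. B p) (setp ne @ liftT bs)))"
      by (rule EnvI) (use bs in \<open>auto simp: liftT_def\<close>)
    moreover have "(%p. (fst (fst p), map (%t. t p) [], map (%B. B p) (setp ne @ liftT bs))) = (%p. ?mk (fst p) (map (snd p) [0..<ne]))"
      by (auto simp: fun_eq_iff bs(3) setp_def liftT_def)
    ultimately have E2: "Env (%p. fst (fst p)) (liftT Ts) (liftT Bs @ setp ne) 0 (ne + s) (%p. ?mk (fst p) (map (snd p) [0..<ne]))" by simp
    \<comment> \<open>The partition test comes first in \<open>?P\<close>, so that
      \<open>FIN\<close> and \<open>VAL\<close> may rely on \<open>Jc\<close>.\<close>
    have JC: "Jc (?mk (fst p) (map (snd p) [0..<ne]))"
      if "?I (fst p) \<and> part (TT (?mk (fst p) (map (snd p) [0..<ne]))) (AS (?mk (fst p) (map (snd p) [0..<ne])))"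
      for p :: "canon \<times> (nat => nat set)"
      using that bs by (simp add: Jc_def)
    show ?thesis
      by (rule D_conj[OF D_part[OF E2]], rule D_and; rule R0_use[OF _ E2]) (rule R0_FIN R0_VAL JC | assumption)+
  qed
  have "D KK fst ?I Ts Bs (%c. mode_accepts md (card {As \<in> tuples (KK * length (fst c)) ne. ?P (%q. q = q_acc M) c As}) (card {As \<in> tuples (KK * length (fst c)) ne. ?P (%q. q \<noteq> q_acc M) c As}))"
    by (rule D_cnt[OF md evl(3) KKp DP DP])
  then have D1: "D KK fst ?I Ts Bs (%c. wd (snd (snd (E c))) \<in> L)"
  proof (rule D_eq_cong)
    fix c assume I: "?I c"
    let ?x = "wd (snd (snd (E c)))" and ?N = "KK * length (fst c)" and ?T = "K1 * length (fst c)"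
    have sub: "\<forall>B\<in>set (snd (snd (E c))). B \<subseteq> {..<K * length (fst c)}" and n: "0 < length (fst c)" using I by auto
    have x: "?x \<in> lists {..<s}" using wd_props(4)[OF sub] bs by simp
    have le: "cc * (length ?x + 1) \<le> ?T"
    proof -
      have "length ?x + 1 \<le> (K + 1) * length (fst c)" using wd_props(1)[OF sub] n unfolding distrib_right mult_1 by linarith
      then have "cc * (length ?x + 1) \<le> (cc + 1) * ((K + 1) * length (fst c))" by (intro mult_le_mono) simp_all
      then show ?thesis by (simp only: K1_def mult.assoc)
    qed
    have wfc: "wfc (init_config M ?x)" by (rule init_wfc[OF s x])
    have TN: "?T \<le> ?N" unfolding KK_def by (intro mult_le_mono1) simp
    have P: "{As \<in> tuples ?N ne. ?P A c As} = {As \<in> tuples ?N (length evl). part ?T As \<and> valid (init_config M ?x) (evs ?T As) \<and> A (fst (fold ap (evs ?T As) (init_config M ?x)))}" for A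
      by (auto simp: tuples_def TT_def AS_def FIN_def VAL_def es_def inp_def)
    have C: "card {As \<in> tuples ?N ne. ?P A c As} = card (paths A ?T (init_config M ?x))" for A
      unfolding P by (rule card_paths_sets[OF wfc TN, symmetric])
    show "mode_accepts md (card {As \<in> tuples ?N ne. ?P (%q. q = q_acc M) c As}) (card {As \<in> tuples ?N ne. ?P (%q. q \<noteq> q_acc M) c As}) = (?x \<in> L)"
      unfolding C[of "%q. q = q_acc M"] C[of "%q. q \<noteq> q_acc M"]
      using L[OF x] card_paths[OF conjunct1[OF L[OF x]] le wfc] by simp
  qed
  have "K \<le> KK" by (simp add: KK_def K1_def)
  from D_K[OF D1 this] show "D K fst (%c. True) Ts Bs (%c. wd (snd (snd (E c))) \<in> L)"
  proof (rule D_cong)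
    fix c assume gd: "gd K fst Ts Bs c"
    then show "?I c \<and> (wd (snd (snd (E c))) \<in> L) = (wd (snd (snd (E c))) \<in> L)" using bs by (auto simp: gd_def)
  qed
qed

end

subsection \<open>The hierarchies are definable\<close>

context flogic
begin

lemma RelD0I:
  assumes "\<And>Ts Bs (E :: canon => canon). Env fst Ts Bs 0 s E ==> D K fst (%_. True) Ts Bs (%c. R (E c))"
  shows "RelD K 0 s 0 (%_. True) (%e _. R e)"
  unfolding RelD_def by (intro allI impI) (rule assms)

lemma RelD0D:
  fixes E :: "canon => canon"
  assumes "RelD K 0 s 0 (%_. True) (%e _. R e)" "Env fst Ts Bs 0 s E"
  shows "D K fst (%_. True) Ts Bs (%c. R (E c))"
  using RelD_use[OF assms, of "[]" "%_. True"] by simp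

lemma defD_compl:
  assumes d: "defD G s L"
  shows "defD G s (lists {..<s} - L)"
  unfolding defD_def
proof (intro conjI allI RelD0I)
  fix K Ts Bs and E :: "canon => canon" assume E: "Env fst Ts Bs 0 s E"
  have "D K fst (%_. True) Ts Bs (%c. wd (snd (snd (E c))) \<in> L)" by (rule RelD0D[OF _ E]) (use d in \<open>simp add: defD_def\<close>)
  from D_neg[OF this] show "D K fst (%_. True) Ts Bs (%c. wd (snd (snd (E c))) \<in> lists {..<s} - L)"
  proof (rule D_eq_cong)
    fix c assume gd: "gd K fst Ts Bs c"
    obtain bs where bs: "length bs = s" "set bs \<subseteq> set Bs" "\<And>c. E c = (fst c, [], map (%B. B c) bs)" using E by (auto simp: Env_def)
    have "\<forall>B\<in>set (snd (snd (E c))). B \<subseteq> {..<K * length (fst c)}" using gd bs by (auto simp: gd_def)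
    from wd_props(4)[OF this] show "(wd (snd (snd (E c))) \<notin> L) = (wd (snd (snd (E c))) \<in> lists {..<s} - L)" using bs by simp
  qed
qed simp

lemma defD_union:
  assumes d: "defD G s L" "defD G s L'"
  shows "defD G s (L \<union> L')"
  unfolding defD_def
proof (intro conjI allI RelD0I)
  fix K Ts Bs and E :: "canon => canon" assume E: "Env fst Ts Bs 0 s E"
  have "D K fst (%_. True) Ts Bs (%c. wd (snd (snd (E c))) \<in> L'')" if "defD G s L''" for L''
    by (rule RelD0D[OF _ E]) (use that in \<open>simp add: defD_def\<close>)
  from D_disj[OF this[OF d(1)] this[OF d(2)]]
  show "D K fst (%_. True) Ts Bs (%c. wd (snd (snd (E c))) \<in> L \<union> L')" by simp
qed (use d in \<open>auto simp: defD_def\<close>)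

lemma defD_empty: "defD G s {}"
  unfolding defD_def by (intro conjI allI RelD0I) (simp_all add: D_const)

lemma defD_lin_class:
  assumes "\<forall>p\<in>Os. defD G (fst p) (snd p)" "md \<in> Md" "(s, L) \<in> lin_class md Os"
  shows "defD G s L"
proof -
  obtain M Or s' c where o: "L \<subseteq> lists {..<s}" "(s', Or) \<in> Os" "wf_tm M" "s < nsyms M"
    and L: "\<And>x. x \<in> lists {..<s} ==> halts_within M Or (c * (length x + 1)) (init_config M x) \<and>
           (x \<in> L \<longleftrightarrow> mode_accepts md (acc_paths M Or (c * (length x + 1)) (init_config M x)) (rej_paths M Or (c * (length x + 1)) (init_config M x)))"
    using assms(3) unfolding lin_class_def by blast
  have dO: "defD G s' Or" using assms(1) o(2) by auto
  have "RelD K 0 s 0 (%_. True) (%e _. wd (snd (snd e)) \<in> L)" for K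
  proof -
    interpret tx G Md M Or s s' K c
      by (intro tx.intro tx_axioms.intro machine.intro flogic_axioms o dO)
    show ?thesis by (rule RelD_machine[OF assms(2) L])
  qed
  then show ?thesis using o(1) by (simp add: defD_def)
qed

lemma defD_bool_closure:
  assumes "\<forall>p\<in>C. defD G (fst p) (snd p)" "p \<in> bool_closure C"
  shows "defD G (fst p) (snd p)"
  using assms(2) by (induction rule: bool_closure.induct) (use assms(1) defD_compl defD_union in auto)

lemma defD_CH:
  assumes "PPm \<in> Md"
  shows "\<forall>p\<in>CH_level n. defD G (fst p) (snd p)"
proof (induction n)
  case (Suc n)
  then show ?case using defD_lin_class[OF Suc assms] by auto
qed (simp add: defD_empty)

lemma defD_MODPH:
  assumes "\<And>q. 1 < q ==> ModPm q \<in> Md"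
  shows "\<forall>p\<in>MODPH_level n. defD G (fst p) (snd p)"
proof (induction n)
  case (Suc n)
  have b: "\<forall>p\<in>bool_closure (MODPH_level n). defD G (fst p) (snd p)" using defD_bool_closure[OF Suc] by blast
  show ?case
  proof
    fix p assume "p \<in> MODPH_level (Suc n)"
    then obtain md where "md \<in> Md" "p \<in> lin_class md (bool_closure (MODPH_level n))"
      using NPm assms by (force simp del: One_nat_def)
    then show "defD G (fst p) (snd p)" using defD_lin_class[OF b, of md "fst p" "snd p"] by simp
  qed
qed (simp add: defD_empty)

text \<open>With factor 1 the letter sets of the structure itself encode its word; they are guessed
  and pinned down by the letter predicates.\<close>

lemma defD_formula:
  assumes d: "defD G s L"
  shows "\<exists>f. G f \<and> fv_fo f = {} \<and> (\<forall>w\<in>lists {..<s}. w \<noteq> [] --> sat w (%_. 0) (%_. {}) f = (w \<in> L))"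
proof -
  let ?I = "%w :: nat list. w \<in> lists {..<s}"
  let ?Ts = "[] :: (nat list => nat) list" and ?Bs = "[] :: (nat list => nat set) list"
  have "D 1 (%w. w) ?I ?Ts ?Bs (%w. \<exists>V\<in>tuples (1 * length w) (Suc s).
      (\<forall>x<1 * length w. \<forall>a\<in>{..<s}. x \<in> V ! a \<longleftrightarrow> x < length w \<and> w ! x = a) \<and> wd (map ((!) V) [0..<s]) \<in> L)"
    apply (rule D_exs_Suc[OF zero_less_one, where P = "%w V l. (\<forall>x<1 * length w. \<forall>a\<in>{..<s}. x \<in> V a \<longleftrightarrow> x < length w \<and> w ! x = a) \<and> wd l \<in> L"])
     apply (rule D_and)
      apply (rule D_all, rule D_ball, rule finite_lessThan, rule D_iff)
       apply (rule D_mem, (intro D_mems)[1], intro in_liftT in_setp, simp)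
      apply (rule D_letter, (intro D_mems)[1])
     apply (rule D_wd[OF d])
    apply (intro ext, simp)
    done
  then have "D 1 (%w. w) ?I ?Ts ?Bs (%w. w \<in> L)"
  proof (rule D_eq_cong)
    fix w :: "nat list" assume w: "w \<in> lists {..<s}"
    show "(\<exists>V\<in>tuples (1 * length w) (Suc s). (\<forall>x<1 * length w. \<forall>a\<in>{..<s}. x \<in> V ! a \<longleftrightarrow> x < length w \<and> w ! x = a) \<and> wd (map ((!) V) [0..<s]) \<in> L) = (w \<in> L)"
    proof
      assume "\<exists>V\<in>tuples (1 * length w) (Suc s). (\<forall>x<1 * length w. \<forall>a\<in>{..<s}. x \<in> V ! a \<longleftrightarrow> x < length w \<and> w ! x = a) \<and> wd (map ((!) V) [0..<s]) \<in> L"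
      then obtain V where V: "V \<in> tuples (length w) (Suc s)" "\<forall>x<length w. \<forall>a\<in>{..<s}. x \<in> V ! a \<longleftrightarrow> x < length w \<and> w ! x = a"
        "wd (map ((!) V) [0..<s]) \<in> L" by auto
      have "V ! a = {t. t < length w \<and> w ! t = a}" if "a < s" for a
      proof -
        have "V ! a \<in> set V" using V(1) that by (simp add: tuples_def)
        then have "V ! a \<subseteq> {..<length w}" using V(1) by (auto simp: tuples_def)
        then show ?thesis using V(2) that by auto
      qed
      then have e: "map ((!) V) [0..<s] = lsets s w" by (simp add: lsets_def)
      show "w \<in> L" using V(3) unfolding e wd_lsets[OF w] .
    next
      assume wL: "w \<in> L"
      have tup: "lsets s w @ [{}] \<in> tuples (1 * length w) (Suc s)" by (auto simp: tuples_def lsets_def)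
      have e: "map ((!) (lsets s w @ [{}])) [0..<s] = lsets s w" by (rule nth_equalityI) (auto simp: nth_append)
      show "\<exists>V\<in>tuples (1 * length w) (Suc s). (\<forall>x<1 * length w. \<forall>a\<in>{..<s}. x \<in> V ! a \<longleftrightarrow> x < length w \<and> w ! x = a) \<and> wd (map ((!) V) [0..<s]) \<in> L"
      proof (intro bexI[OF _ tup] conjI)
        show "wd (map ((!) (lsets s w @ [{}])) [0..<s]) \<in> L" unfolding e wd_lsets[OF w] by (rule wL)
      qed (auto simp: nth_append lsets_def)
    qed
  qed
  then obtain f where f: "Dfor 1 (%w. w) ?I ?Ts ?Bs (%w. w \<in> L) [] f" by (rule DE) auto
  have "sat w (%_. 0) (%_. {}) f = (w \<in> L)" if "w \<in> lists {..<s}" "w \<noteq> []" for w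
  proof -
    have "gd 1 (%w. w) ?Ts ?Bs w" using that(2) by (simp add: gd_def)
    moreover have "fenv (length w) ?Ts w = (%_. 0)" "senv (length w) ?Bs w = (%_. {})" by (auto simp: fenv_def senv_def)
    ultimately show ?thesis using f that(1) unfolding Dfor_def by (metis length_0_conv not_less_zero list.size(3))
  qed
  then show ?thesis using f by (intro exI[of _ f]) (auto simp: Dfor_def)
qed

end

text \<open>Structures are nonempty, so the empty word must be absent from \<open>L\<close>. Free
  set variables left over from the block encoding are closed off by
  \<open>ex_closed\<close>.\<close>

lemma definable_if_defD:
  assumes "flogic (in_logic ar al) Md" "defD (in_logic ar al) s L" "[] \<notin> L"
  shows "definable ar al s L"
proof -
  obtain f where f: "in_logic ar al f" "fv_fo f = {}" "\<And>w. w \<in> lists {..<s} ==> w \<noteq> [] ==> sat w (%_. 0) (%_. {}) f = (w \<in> L)"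
    using flogic.defD_formula[OF assms(1,2)] by blast
  obtain g where g: "\<And>ar al. in_logic ar al g = in_logic ar al f" "fv_fo g = fv_fo f" "fv_so g = {}" "\<And>w fo so. sat w fo so g = sat w fo (%_. {}) f"
    using ex_closed[of f] by blast
  have "L \<subseteq> lists {..<s}" using assms(2) by (simp add: defD_def)
  then have "w \<in> L \<longleftrightarrow> w \<in> lists {..<s} \<and> w \<noteq> [] \<and> sat w (%_. 0) (%_. {}) g" for w
    unfolding g(4) using f(3)[of w] assms(3) by (cases "w = []") auto
  then have "L = {w \<in> lists {..<s}. w \<noteq> [] \<and> sat w (%_. 0) (%_. {}) g}" by blast
  moreover have "in_logic ar al g" "fv_fo g = {}" using f g by simp_all
  ultimately show ?thesis unfolding definable_def sentence_def using g(3) by (intro exI[of _ g] conjI)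
qed

lemma G_cnt_NPm:
  "\<exists>h. in_logic ar al h = in_logic ar al f \<and> fv_fo h = fv_fo f \<and>
       (\<forall>w fo so. w \<noteq> [] --> sat w fo so h = mode_accepts NPm
          (card {As \<in> tuples (length w) (length Xs). sat w fo (upds so Xs As) f}) r)"
  by (intro exI[of _ "foldr ExS Xs f"]) (auto simp: nested_ExS simp del: mode_accepts.simps)

section \<open>Counting quantifiers from symmetric languages\<close>

definition Lmod :: "nat => lang" where
  "Lmod q = {w \<in> lists {..<2}. count (mset w) 0 mod q \<noteq> 0}"

lemma REG_Lmod: assumes "1 < q" shows "REG_sym 2 (Lmod q)"
proof -
  let ?\<delta> = "%(x :: nat) (a :: nat). if a = 0 then Suc x mod q else x"
  have fold: "fold (%a x. ?\<delta> x a) w x = (x + count (mset w) 0) mod q" if "x < q" for w x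
    using that assms by (induction w arbitrary: x) (auto simp: mod_Suc_eq_mod_add3 mod_simps)
  have "Lmod q = {w \<in> lists {..<2}. fold (%a x. ?\<delta> x a) w 0 \<in> {x. x \<noteq> 0}}"
    unfolding Lmod_def using fold[of 0] assms by auto
  moreover have "0 < q" "\<forall>x<q. \<forall>a<2. ?\<delta> x a < q" using assms by auto
  moreover have "Lmod q \<subseteq> lists {..<2}" by (auto simp: Lmod_def)
  ultimately have "regular_lang 2 (Lmod q)" unfolding regular_lang_def
    by (intro conjI exI[of _ q] exI[of _ 0] exI[of _ ?\<delta>] exI[of _ "{x. x \<noteq> 0}"])
  moreover have "symmetric_lang (Lmod q)"
    unfolding symmetric_lang_def Lmod_def by (auto simp: in_lists_conv_set dest: mset_eq_setD)
  ultimately show ?thesis by (simp add: REG_sym_def)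
qed

text \<open>With a single formula, letter 0 marks the satisfying assignments and letter 1 all
  others, so a counter of the letter 0 modulo \<open>q\<close> is enough.\<close>

lemma G_cnt_ModPm:
  assumes "1 < q" "in_logic ar REG_sym f" "distinct Xs" "Xs \<noteq> []"
  shows "\<exists>h. in_logic ar REG_sym h \<and> fv_fo h = fv_fo f \<and>
       (\<forall>w fo so. sat w fo so h = mode_accepts (ModPm q) (card {As \<in> tuples (length w) (length Xs). sat w fo (upds so Xs As) f}) r)"
proof (intro exI[of _ "QStar 2 (Lmod q) Xs [f]"] conjI allI)
  show "in_logic ar REG_sym (QStar 2 (Lmod q) Xs [f])" using assms REG_Lmod[OF assms(1)] by (auto simp: Lmod_def)
  fix w fo so
  have "symmetric_lang (Lmod q)" using REG_Lmod[OF assms(1)] by (simp add: REG_sym_def)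
  from sat_QStar_counts[OF this, of "[f]" 2 w fo so Xs] obtain u where u: "u \<in> lists {..<2}" "sat w fo so (QStar 2 (Lmod q) Xs [f]) \<longleftrightarrow> u \<in> Lmod q"
    "count (mset u) 0 = card {As \<in> tuples (length w) (length Xs). letter w fo [f] (upds so Xs As) = 0}" by auto
  have "letter w fo [f] so' = 0 \<longleftrightarrow> sat w fo so' f" for so' by (simp add: letter_def)
  then show "sat w fo so (QStar 2 (Lmod q) Xs [f]) = mode_accepts (ModPm q) (card {As \<in> tuples (length w) (length Xs). sat w fo (upds so Xs As) f}) r"
    unfolding u(2) using u(1,3) by (simp add: Lmod_def)
qed simp

lemma flogic_REG: "flogic (in_logic True REG_sym) (insert NPm (ModPm ` {q. 1 < q}))"
proof
  show "\<exists>f. in_logic True REG_sym f \<and> fv_fo f \<subseteq> {i, j, k} \<and>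
       (\<forall>w fo so. fo i < length w --> fo j < length w --> fo k < length w --> sat w fo so f = (fo i + fo j = fo k))" for i j k
    by (intro exI[of _ "Plus (V i) (V j) (V k)"]) auto
  fix md f g and Xs :: "nat list"
  assume a: "md \<in> insert NPm (ModPm ` {q. 1 < q})" "in_logic True REG_sym f" "distinct Xs" "Xs \<noteq> []"
  show "\<exists>h. in_logic True REG_sym h \<and> fv_fo h \<subseteq> fv_fo f \<union> fv_fo g \<and>
       (\<forall>w fo so. w \<noteq> [] --> sat w fo so h = mode_accepts md
          (card {As \<in> tuples (length w) (length Xs). sat w fo (upds so Xs As) f})
          (card {As \<in> tuples (length w) (length Xs). sat w fo (upds so Xs As) g}))"
  proof (cases "md = NPm")
    case True
    obtain h where "in_logic True REG_sym h = in_logic True REG_sym f" "fv_fo h = fv_fo f"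
      "\<And>w fo so r. w \<noteq> [] ==> sat w fo so h = mode_accepts NPm (card {As \<in> tuples (length w) (length Xs). sat w fo (upds so Xs As) f}) 0"
      using G_cnt_NPm[of True REG_sym f Xs 0] by blast
    then show ?thesis using True a(2) by (intro exI[of _ h]) auto
  next
    case False
    then obtain q where q: "md = ModPm q" "1 < q" using a(1) by auto
    obtain h where "in_logic True REG_sym h" "fv_fo h = fv_fo f"
      "\<And>w fo so. sat w fo so h = mode_accepts (ModPm q) (card {As \<in> tuples (length w) (length Xs). sat w fo (upds so Xs As) f}) 0"
      using G_cnt_ModPm[OF q(2) a(2-4), of 0] by blast
    then show ?thesis using q(1) by (intro exI[of _ h]) auto
  qed
qed auto

text \<open>Letter 2 is neutral: it will stand for assignments on which the two compared formulas
  agree.\<close>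

definition Lmaj :: lang where
  "Lmaj = {w \<in> lists {..<3}. count (mset w) 1 < count (mset w) 0}"

text \<open>\<open>Inl 0\<close>, \<open>Inl 1\<close> and \<open>Inl 2\<close> generate the words in which the number of zeros minus the number of ones is
  at least \<open>1\<close>, \<open>0\<close> and \<open>-1\<close>, respectively.\<close>

definition Pmaj :: "(nat \<times> (nat + nat) list) set" where
  "Pmaj = {(0, [Inr 2, Inl 0]), (0, [Inr 0, Inl 1]), (0, [Inr 1, Inl 0, Inl 0]),
     (1, []), (1, [Inr 2, Inl 1]), (1, [Inr 0, Inl 2]), (1, [Inr 1, Inl 0]),
     (2, []), (2, [Inr 2, Inl 2]), (2, [Inr 1, Inl 1]), (2, [Inr 0, Inl 2, Inl 2])}"

definition bal :: "nat list => int" where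
  "bal w = int (count (mset w) 0) - int (count (mset w) 1)"

lemma bal_simps [simp]: "bal [] = 0" "bal (a # w) = (if a = 0 then 1 else if a = 1 then -1 else 0) + bal w" "bal (v @ w) = bal v + bal w"
  by (auto simp: bal_def)

text \<open>Discrete intermediate value argument: the balance of prefixes starts at 0 and changes by
  at most 1 per letter.\<close>

lemma bal_split:
  assumes "0 \<le> c \<and> c \<le> bal w \<or> bal w \<le> c \<and> c \<le> 0"
  shows "\<exists>u v. w = u @ v \<and> bal u = c"
  using assms
proof (induction w arbitrary: c)
  case (Cons a w)
  let ?d = "if a = 0 then 1 else if a = 1 then -1 else 0 :: int"
  show ?case
  proof (cases "c = 0")
    case True
    then show ?thesis by - (rule exI[of _ "[] :: nat list"], rule exI[of _ "a # w"], simp)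
  next
    case False
    have "0 \<le> c - ?d \<and> c - ?d \<le> bal w \<or> bal w \<le> c - ?d \<and> c - ?d \<le> 0" using Cons.prems False by auto
    from Cons.IH[OF this] obtain u v where "w = u @ v" "bal u = c - ?d" by blast
    then show ?thesis by (intro exI[of _ "a # u"] exI[of _ v]) simp
  qed
next
  case Nil
  then show ?case by (intro exI[of _ "[]"]) auto
qed

lemma cfg_append:
  "(cfg_step P)\<^sup>*\<^sup>* u v ==> (cfg_step P)\<^sup>*\<^sup>* (l @ u @ r) (l @ v @ r)"
proof (induction rule: rtranclp_induct)
  case (step v v')
  then obtain xs ys A rhs where "(A, rhs) \<in> P" "v = xs @ [Inl A] @ ys" "v' = xs @ rhs @ ys" unfolding cfg_step_def by blast
  then have "cfg_step P (l @ v @ r) (l @ v' @ r)" unfolding cfg_step_def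
    by (intro exI[of _ "l @ xs"] exI[of _ "ys @ r"] exI[of _ A] exI[of _ rhs]) simp
  with step.IH show ?case by (rule rtranclp.rtrancl_into_rtrancl)
qed simp

lemma cfg_rule1: "(A, Inr a # [Inl B]) \<in> P ==> (cfg_step P)\<^sup>*\<^sup>* [Inl B] v ==> (cfg_step P)\<^sup>*\<^sup>* [Inl A] (Inr a # v)"
proof -
  assume "(A, Inr a # [Inl B]) \<in> P" and d: "(cfg_step P)\<^sup>*\<^sup>* [Inl B] v"
  then have "cfg_step P [Inl A] [Inr a, Inl B]" unfolding cfg_step_def by (intro exI[of _ "[]"]) auto
  then show ?thesis using cfg_append[OF d, of "[Inr a]" "[]"] by (simp add: converse_rtranclp_into_rtranclp)
qed

lemma cfg_rule2: "(A, [Inr a, Inl B, Inl C]) \<in> P ==> (cfg_step P)\<^sup>*\<^sup>* [Inl B] u ==> (cfg_step P)\<^sup>*\<^sup>* [Inl C] v ==> (cfg_step P)\<^sup>*\<^sup>* [Inl A] (Inr a # u @ v)"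
proof -
  assume "(A, [Inr a, Inl B, Inl C]) \<in> P" and d: "(cfg_step P)\<^sup>*\<^sup>* [Inl B] u" "(cfg_step P)\<^sup>*\<^sup>* [Inl C] v"
  then have "cfg_step P [Inl A] [Inr a, Inl B, Inl C]" unfolding cfg_step_def by (intro exI[of _ "[]"]) auto
  moreover have "(cfg_step P)\<^sup>*\<^sup>* [Inr a, Inl B, Inl C] (Inr a # u @ [Inl C])" using cfg_append[OF d(1), of "[Inr a]" "[Inl C]"] by simp
  moreover have "(cfg_step P)\<^sup>*\<^sup>* (Inr a # u @ [Inl C]) (Inr a # u @ v)" using cfg_append[OF d(2), of "Inr a # u" "[]"] by simp
  ultimately show ?thesis by (meson converse_rtranclp_into_rtranclp rtranclp_trans)
qed

lemma cfg_eps: "(A, []) \<in> P ==> (cfg_step P)\<^sup>*\<^sup>* [Inl A] []"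
  by (rule r_into_rtranclp) (force simp: cfg_step_def)

text \<open>Strong induction on the length. Where the first letter leaves a bound of 2 or -2 on the
  balance of the rest, no single nonterminal fits in general, and \<open>bal_split\<close> cuts the
  rest into words for two nonterminals.\<close>

lemma Pmaj_complete:
  "w \<in> lists {..<3} ==> (1 \<le> bal w --> (cfg_step Pmaj)\<^sup>*\<^sup>* [Inl 0] (map Inr w)) \<and>
     (0 \<le> bal w --> (cfg_step Pmaj)\<^sup>*\<^sup>* [Inl 1] (map Inr w)) \<and> (-1 \<le> bal w --> (cfg_step Pmaj)\<^sup>*\<^sup>* [Inl 2] (map Inr w))"
proof (induction w rule: length_induct)
  case (1 w)
  show ?case
  proof (cases w)
    case Nil
    have "(cfg_step Pmaj)\<^sup>*\<^sup>* [Inl 1] []" "(cfg_step Pmaj)\<^sup>*\<^sup>* [Inl 2] []" by (rule cfg_eps, simp add: Pmaj_def)+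
    then show ?thesis using Nil by simp
  next
    case (Cons a v)
    have IH: "(1 \<le> bal u --> (cfg_step Pmaj)\<^sup>*\<^sup>* [Inl 0] (map Inr u)) \<and>
     (0 \<le> bal u --> (cfg_step Pmaj)\<^sup>*\<^sup>* [Inl 1] (map Inr u)) \<and> (-1 \<le> bal u --> (cfg_step Pmaj)\<^sup>*\<^sup>* [Inl 2] (map Inr u))"
      if "length u \<le> length v" "u \<in> lists {..<3}" for u using 1 that Cons by simp
    have v: "v \<in> lists {..<3}" and a: "a = 0 \<or> a = 1 \<or> a = 2" using "1.prems" Cons by auto
    note IHv = IH[OF order_refl v]
    have r1: "(A, [Inr a, Inl B]) \<in> Pmaj ==> (cfg_step Pmaj)\<^sup>*\<^sup>* [Inl B] (map Inr v) ==> (cfg_step Pmaj)\<^sup>*\<^sup>* [Inl A] (map Inr w)" for A B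
      using cfg_rule1[of A a B Pmaj "map Inr v"] Cons by simp
    have r2: "(A, [Inr a, Inl B, Inl C]) \<in> Pmaj ==> v = u @ u' ==> (cfg_step Pmaj)\<^sup>*\<^sup>* [Inl B] (map Inr u) ==> (cfg_step Pmaj)\<^sup>*\<^sup>* [Inl C] (map Inr u') ==>
       (cfg_step Pmaj)\<^sup>*\<^sup>* [Inl A] (map Inr w)" for A B C u u'
      using cfg_rule2[of A a B C Pmaj "map Inr u" "map Inr u'"] Cons by simp
    from a show ?thesis
    proof (elim disjE)
      assume a0: "a = 0"
      have "(cfg_step Pmaj)\<^sup>*\<^sup>* [Inl 0] (map Inr w)" if "1 \<le> bal w"
        by (rule r1[of 0 1]) (use IHv that Cons a0 in \<open>auto simp: Pmaj_def\<close>)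
      moreover have "(cfg_step Pmaj)\<^sup>*\<^sup>* [Inl 1] (map Inr w)" if "0 \<le> bal w"
        by (rule r1[of 1 2]) (use IHv that Cons a0 in \<open>auto simp: Pmaj_def\<close>)
      moreover have "(cfg_step Pmaj)\<^sup>*\<^sup>* [Inl 2] (map Inr w)" if "-1 \<le> bal w"
      proof -
        have "-2 \<le> bal v" using that Cons a0 by simp
        then obtain u u' where u: "v = u @ u'" "-1 \<le> bal u" "-1 \<le> bal u'"
        proof (cases "-1 \<le> bal v")
          case True
          then show ?thesis using that[of v "[]"] by simp
        next
          case False
          then obtain u u' where "v = u @ u'" "bal u = -1" using bal_split[of "-1" v] by auto
          then show ?thesis using that[of u u'] \<open>-2 \<le> bal v\<close> by simp
        qed
        show ?thesis by (rule r2[OF _ u(1), of 2 2 2]) (use IH[of u] IH[of u'] u v a0 in \<open>auto simp: Pmaj_def\<close>)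
      qed
      ultimately show ?thesis by blast
    next
      assume a1: "a = 1"
      have "(cfg_step Pmaj)\<^sup>*\<^sup>* [Inl 0] (map Inr w)" if "1 \<le> bal w"
      proof -
        have "2 \<le> bal v" using that Cons a1 by simp
        then obtain u u' where u: "v = u @ u'" "bal u = 1" using bal_split[of 1 v] by auto
        then have "1 \<le> bal u'" using \<open>2 \<le> bal v\<close> by simp
        then show ?thesis by (intro r2[OF _ u(1), of 0 0 0]) (use IH[of u] IH[of u'] u v a1 in \<open>auto simp: Pmaj_def\<close>)
      qed
      moreover have "(cfg_step Pmaj)\<^sup>*\<^sup>* [Inl 1] (map Inr w)" if "0 \<le> bal w"
        by (rule r1[of 1 0]) (use IHv that Cons a1 in \<open>auto simp: Pmaj_def\<close>)
      moreover have "(cfg_step Pmaj)\<^sup>*\<^sup>* [Inl 2] (map Inr w)" if "-1 \<le> bal w"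
        by (rule r1[of 2 1]) (use IHv that Cons a1 in \<open>auto simp: Pmaj_def\<close>)
      ultimately show ?thesis by blast
    next
      assume a2: "a = 2"
      have "(cfg_step Pmaj)\<^sup>*\<^sup>* [Inl 0] (map Inr w)" if "1 \<le> bal w"
        by (rule r1[of 0 0]) (use IHv that Cons a2 in \<open>auto simp: Pmaj_def\<close>)
      moreover have "(cfg_step Pmaj)\<^sup>*\<^sup>* [Inl 1] (map Inr w)" if "0 \<le> bal w"
        by (rule r1[of 1 1]) (use IHv that Cons a2 in \<open>auto simp: Pmaj_def\<close>)
      moreover have "(cfg_step Pmaj)\<^sup>*\<^sup>* [Inl 2] (map Inr w)" if "-1 \<le> bal w"
        by (rule r1[of 2 2]) (use IHv that Cons a2 in \<open>auto simp: Pmaj_def\<close>)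
      ultimately show ?thesis by blast
    qed
  qed
qed

text \<open>The weight of a nonterminal is the least balance that it may generate; no rule lowers
  the total weight, which proves soundness of the grammar.\<close>

definition wt :: "nat + nat => int" where
  "wt x = (case x of Inl A => if A = 0 then 1 else if A = 1 then 0 else -1 | Inr a => if a = 0 then 1 else if a = 1 then -1 else 0)"

lemma Pmaj_sound: "(cfg_step Pmaj)\<^sup>*\<^sup>* u v ==> sum_list (map wt u) \<le> sum_list (map wt v)"
proof (induction rule: rtranclp_induct)
  case (step v v')
  then obtain xs ys A rhs where P: "(A, rhs) \<in> Pmaj" and v: "v = xs @ [Inl A] @ ys" "v' = xs @ rhs @ ys" unfolding cfg_step_def by blast
  have "wt (Inl A) \<le> sum_list (map wt rhs)" using P by (auto simp: Pmaj_def wt_def)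
  then show ?case using step.IH v by simp
qed simp

lemma CFL_Lmaj: "CFL_sym 3 Lmaj"
proof -
  have bal: "sum_list (map wt (map Inr w)) = bal w" for w by (induction w) (auto simp: wt_def)
  have "(cfg_step Pmaj)\<^sup>*\<^sup>* [Inl 0] (map Inr w) \<longleftrightarrow> count (mset w) 1 < count (mset w) 0" if w: "w \<in> lists {..<3}" for w
  proof -
    have "1 \<le> bal w" if "(cfg_step Pmaj)\<^sup>*\<^sup>* [Inl 0] (map Inr w)"
      using Pmaj_sound[OF that] unfolding bal by (simp add: wt_def)
    then have "(cfg_step Pmaj)\<^sup>*\<^sup>* [Inl 0] (map Inr w) \<longleftrightarrow> 1 \<le> bal w" using Pmaj_complete[OF w] by blast
    then show ?thesis by (auto simp: bal_def)
  qed
  then have "Lmaj = {w \<in> lists {..<3}. (cfg_step Pmaj)\<^sup>*\<^sup>* [Inl 0] (map Inr w)}" by (auto simp: Lmaj_def)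
  moreover have "finite Pmaj" by (simp add: Pmaj_def)
  ultimately have "context_free_lang 3 Lmaj" unfolding context_free_lang_def by (auto simp: Lmaj_def)
  moreover have "symmetric_lang Lmaj"
    unfolding symmetric_lang_def Lmaj_def by (auto simp: in_lists_conv_set dest: mset_eq_setD)
  ultimately show ?thesis by (simp add: CFL_sym_def)
qed

text \<open>Assignments satisfying both formulas contribute equally to both counts. Comparing the
  two set differences is therefore the same as comparing the counts, and the differences are
  disjoint, as letters have to be.\<close>

lemma G_cnt_PPm:
  assumes "in_logic ar CFL_sym f" "in_logic ar CFL_sym g" "distinct Xs" "Xs \<noteq> []"
  shows "\<exists>h. in_logic ar CFL_sym h \<and> fv_fo h = fv_fo f \<union> fv_fo g \<and>
       (\<forall>w fo so. sat w fo so h \<longleftrightarrow> card {As \<in> tuples (length w) (length Xs). sat w fo (upds so Xs As) g} <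
          card {As \<in> tuples (length w) (length Xs). sat w fo (upds so Xs As) f})"
proof -
  define fs where "fs = [Conj f (Neg g), Conj g (Neg f)]"
  show ?thesis
  proof (intro exI[of _ "QStar 3 Lmaj Xs fs"] conjI allI)
    show "in_logic ar CFL_sym (QStar 3 Lmaj Xs fs)" using assms CFL_Lmaj by (auto simp: Lmaj_def fs_def)
    show "fv_fo (QStar 3 Lmaj Xs fs) = fv_fo f \<union> fv_fo g" by (auto simp: fs_def)
    fix w :: "nat list" and fo so
    let ?U = "tuples (length w) (length Xs)"
    let ?F = "{As \<in> ?U. sat w fo (upds so Xs As) f}" and ?G = "{As \<in> ?U. sat w fo (upds so Xs As) g}"
    have "symmetric_lang Lmaj" "length fs = 3 - 1" using CFL_Lmaj by (simp_all add: CFL_sym_def fs_def)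
    from sat_QStar_counts[OF this, of w fo so Xs] obtain u where u: "u \<in> lists {..<3}" "sat w fo so (QStar 3 Lmaj Xs fs) \<longleftrightarrow> u \<in> Lmaj"
      "\<And>a. count (mset u) a = card {As \<in> ?U. letter w fo fs (upds so Xs As) = a}" by auto
    have l: "letter w fo fs so' = 0 \<longleftrightarrow> sat w fo so' f \<and> \<not> sat w fo so' g" "letter w fo fs so' = 1 \<longleftrightarrow> sat w fo so' g \<and> \<not> sat w fo so' f" for so'
      by (auto simp: letter_def fs_def)
    have e: "{As \<in> ?U. letter w fo fs (upds so Xs As) = 0} = ?F - ?G" "{As \<in> ?U. letter w fo fs (upds so Xs As) = 1} = ?G - ?F" unfolding l by auto
    have fin: "finite ?F" "finite ?G" using finite_tuples by auto
    have "card (?F - ?G) + card (?F \<inter> ?G) = card ?F" "card (?G - ?F) + card (?F \<inter> ?G) = card ?G"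
      using card_Diff_subset_Int[of ?F ?G] card_Diff_subset_Int[of ?G ?F] fin card_mono[OF fin(1), of "?F \<inter> ?G"] card_mono[OF fin(2), of "?F \<inter> ?G"]
      by (simp_all add: Int_commute)
    moreover have "u \<in> Lmaj \<longleftrightarrow> card (?G - ?F) < card (?F - ?G)"
      unfolding Lmaj_def mem_Collect_eq u(3) e using u(1) by blast
    ultimately show "sat w fo so (QStar 3 Lmaj Xs fs) \<longleftrightarrow> card ?G < card ?F"
      unfolding u(2) by linarith
  qed
qed

text \<open>Addition without the built-in predicate: compare \<open>2\<^sup>i \<cdot> 2\<^sup>j\<close> pairs of sets with \<open>2\<^sup>k\<close> pairs.\<close>

lemma plus_CFL:
  "\<exists>f. in_logic ar CFL_sym f \<and> fv_fo f \<subseteq> {i, j, k} \<and>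
       (\<forall>w fo so. fo i < length w --> fo j < length w --> fo k < length w --> sat w fo so f = (fo i + fo j = fo k))"
proof -
  define z where "z = Suc (i + j + k)"
  have z: "z \<noteq> i" "z \<noteq> j" "z \<noteq> k" by (auto simp: z_def)
  let ?below = "%X t. All z (Disj (Neg (Mem X (V z))) (Lt (V z) t))"
  \<comment> \<open>\<open>Lt (V z) TMin\<close> never holds, so in \<open>?g\<close> the second set
    is forced to be empty and only the exponent of \<open>V k\<close> remains.\<close>
  let ?f = "Conj (?below 0 (V i)) (?below 1 (V j))" and ?g = "Conj (?below 0 (V k)) (?below 1 TMin)"
  have L: "in_logic ar CFL_sym ?f" "in_logic ar CFL_sym ?g" "distinct [0, 1 :: nat]" "[0, 1 :: nat] \<noteq> []" by simp_all
  obtain h where h: "in_logic ar CFL_sym h" "fv_fo h = fv_fo ?f \<union> fv_fo ?g"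
    "\<And>w fo so. sat w fo so h \<longleftrightarrow> card {As \<in> tuples (length w) (length [0, 1 :: nat]). sat w fo (upds so [0, 1] As) ?g} <
      card {As \<in> tuples (length w) (length [0, 1 :: nat]). sat w fo (upds so [0, 1] As) ?f}" using G_cnt_PPm[OF L] by blast
  obtain h' where h': "in_logic ar CFL_sym h'" "fv_fo h' = fv_fo ?g \<union> fv_fo ?f"
    "\<And>w fo so. sat w fo so h' \<longleftrightarrow> card {As \<in> tuples (length w) (length [0, 1 :: nat]). sat w fo (upds so [0, 1] As) ?f} <
      card {As \<in> tuples (length w) (length [0, 1 :: nat]). sat w fo (upds so [0, 1] As) ?g}" using G_cnt_PPm[OF L(2,1,3,4)] by blast
  have c: "card {As \<in> tuples n 2. As ! 0 \<subseteq> {..<a} \<and> As ! 1 \<subseteq> {..<b}} = 2 ^ (a + b)" if "a \<le> n" "b \<le> n" for n a b :: nat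
  proof -
    have "{As \<in> tuples n 2. As ! 0 \<subseteq> {..<a} \<and> As ! 1 \<subseteq> {..<b}} = (%(X, Y). [X, Y]) ` (Pow {..<a} \<times> Pow {..<b})"
    proof (intro subset_antisym subsetI)
      fix As assume a: "As \<in> {As \<in> tuples n 2. As ! 0 \<subseteq> {..<a} \<and> As ! 1 \<subseteq> {..<b}}"
      then have "length As = 2" by (simp add: tuples_def)
      then obtain X Y where "As = [X, Y]" by (auto simp: numeral_2_eq_2 length_Suc_conv)
      then show "As \<in> (%(X, Y). [X, Y]) ` (Pow {..<a} \<times> Pow {..<b})" using a by auto
    next
      fix As assume "As \<in> (%(X, Y). [X, Y]) ` (Pow {..<a} \<times> Pow {..<b})"
      then obtain X Y where "As = [X, Y]" "X \<subseteq> {..<a}" "Y \<subseteq> {..<b}" by auto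
      moreover have "{..<a} \<subseteq> {..<n}" "{..<b} \<subseteq> {..<n}" using that by auto
      ultimately show "As \<in> {As \<in> tuples n 2. As ! 0 \<subseteq> {..<a} \<and> As ! 1 \<subseteq> {..<b}}" by (auto simp: tuples_def)
    qed
    then have "card {As \<in> tuples n 2. As ! 0 \<subseteq> {..<a} \<and> As ! 1 \<subseteq> {..<b}} = card (Pow {..<a} \<times> Pow {..<b})"
      by (simp add: card_image inj_on_def)
    then show ?thesis by (simp add: card_cartesian_product card_Pow power_add)
  qed
  have "sat w fo so (Conj (Neg h) (Neg h')) = (fo i + fo j = fo k)" if fo: "fo i < length w" "fo j < length w" "fo k < length w" for w fo so
  proof -
    have b: "(\<forall>a<length w. a \<in> A --> a < m) \<longleftrightarrow> A \<subseteq> {..<m}" if "A \<subseteq> {..<length w}" for A m using that by auto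
    have el: "As ! 0 \<subseteq> {..<length w}" "As ! 1 \<subseteq> {..<length w}" "upds so [0, 1] As 0 = As ! 0" "upds so [0, 1] As 1 = As ! 1" if "As \<in> tuples (length w) 2" for As
    proof -
      have "length As = 2" using that by (simp add: tuples_def)
      then obtain X Y where "As = [X, Y]" by (auto simp: numeral_2_eq_2 length_Suc_conv)
      then show "As ! 0 \<subseteq> {..<length w}" "As ! 1 \<subseteq> {..<length w}" "upds so [0, 1] As 0 = As ! 0" "upds so [0, 1] As 1 = As ! 1"
        using that by (auto simp: tuples_def upds_def)
    qed
    have "{As \<in> tuples (length w) 2. sat w fo (upds so [0, 1] As) ?f} = {As \<in> tuples (length w) 2. As ! 0 \<subseteq> {..<fo i} \<and> As ! 1 \<subseteq> {..<fo j}}"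
    proof (intro Collect_cong conj_cong refl)
      fix As assume a: "As \<in> tuples (length w) 2"
      show "sat w fo (upds so [0, 1] As) ?f = (As ! 0 \<subseteq> {..<fo i} \<and> As ! 1 \<subseteq> {..<fo j})"
        using b[OF el(1)[OF a], of "fo i"] b[OF el(2)[OF a], of "fo j"] z el(3,4)[OF a] by auto
    qed
    moreover have "{As \<in> tuples (length w) 2. sat w fo (upds so [0, 1] As) ?g} = {As \<in> tuples (length w) 2. As ! 0 \<subseteq> {..<fo k} \<and> As ! 1 \<subseteq> {..<0}}"
    proof (intro Collect_cong conj_cong refl)
      fix As assume a: "As \<in> tuples (length w) 2"
      show "sat w fo (upds so [0, 1] As) ?g = (As ! 0 \<subseteq> {..<fo k} \<and> As ! 1 \<subseteq> {..<0})"
        using b[OF el(1)[OF a], of "fo k"] b[OF el(2)[OF a], of 0] z el(3,4)[OF a] by auto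
    qed
    moreover have two: "length [0, 1 :: nat] = 2" by simp
    ultimately have "sat w fo so (Conj (Neg h) (Neg h')) \<longleftrightarrow> \<not> (2::nat) ^ (fo k + 0) < 2 ^ (fo i + fo j) \<and> \<not> (2::nat) ^ (fo i + fo j) < 2 ^ (fo k + 0)"
      using fo by (simp only: sat.simps(7,8) h(3) h'(3) two c less_imp_le_nat le0)
    then show ?thesis by auto
  qed
  then show ?thesis using h(1,2) h'(1,2) by (intro exI[of _ "Conj (Neg h) (Neg h')"]) auto
qed

lemma flogic_CFL: "flogic (in_logic False CFL_sym) {NPm, PPm}"
proof
  show "\<exists>f. in_logic False CFL_sym f \<and> fv_fo f \<subseteq> {i, j, k} \<and>
       (\<forall>w fo so. fo i < length w --> fo j < length w --> fo k < length w --> sat w fo so f = (fo i + fo j = fo k))" for i j k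
    by (rule plus_CFL)
  fix md f g and Xs :: "nat list"
  assume a: "md \<in> {NPm, PPm}" "in_logic False CFL_sym f" "in_logic False CFL_sym g" "distinct Xs" "Xs \<noteq> []"
  show "\<exists>h. in_logic False CFL_sym h \<and> fv_fo h \<subseteq> fv_fo f \<union> fv_fo g \<and>
       (\<forall>w fo so. w \<noteq> [] --> sat w fo so h = mode_accepts md
          (card {As \<in> tuples (length w) (length Xs). sat w fo (upds so Xs As) f})
          (card {As \<in> tuples (length w) (length Xs). sat w fo (upds so Xs As) g}))"
  proof (cases "md = NPm")
    case True
    obtain h where "in_logic False CFL_sym h = in_logic False CFL_sym f" "fv_fo h = fv_fo f"
      "\<And>w fo so r. w \<noteq> [] ==> sat w fo so h = mode_accepts NPm (card {As \<in> tuples (length w) (length Xs). sat w fo (upds so Xs As) f}) 0"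
      using G_cnt_NPm[of False CFL_sym f Xs 0] by blast
    then show ?thesis using True a(2) by (intro exI[of _ h]) auto
  next
    case False
    then have md: "md = PPm" using a(1) by simp
    obtain h where "in_logic False CFL_sym h" "fv_fo h = fv_fo f \<union> fv_fo g"
      "\<And>w fo so. sat w fo so h \<longleftrightarrow> card {As \<in> tuples (length w) (length Xs). sat w fo (upds so Xs As) g} <
          card {As \<in> tuples (length w) (length Xs). sat w fo (upds so Xs As) f}" using G_cnt_PPm[OF a(2-5)] by blast
    then show ?thesis unfolding md by (intro exI[of _ h]) auto
  qed
qed auto

theorem theorem5p7:
  shows "(\<forall>s L. 1 \<le> s --> L \<subseteq> lists {..<s} - {[]} -->
            (definable True REG_sym s L \<longleftrightarrow> (s, L) \<in> LIN_MODPH)) \<and>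
         (\<forall>s L. 1 \<le> s --> L \<subseteq> lists {..<s} - {[]} -->
            (definable False CFL_sym s L \<longleftrightarrow> (s, L) \<in> LIN_CH))"
proof (intro conjI allI impI iffI)
  fix s :: nat and L :: lang assume L: "L \<subseteq> lists {..<s} - {[]}"
  show "(s, L) \<in> LIN_MODPH" if "definable True REG_sym s L"
    using that counting_modes.trl_times[OF counting_modes_MOD] by (rule definable_REG_in_MODPH)
  show "(s, L) \<in> LIN_CH" if "definable False CFL_sym s L"
    using that by (rule definable_CFL_in_CH)
  show "definable True REG_sym s L" if m: "(s, L) \<in> LIN_MODPH"
  proof (rule definable_if_defD[OF flogic_REG])
    obtain n where "(s, L) \<in> MODPH_level (Suc n)" using m by (auto simp: LIN_MODPH_def simp del: MODPH_level.simps)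
    then show "defD (in_logic True REG_sym) s L" using flogic.defD_MODPH[OF flogic_REG, of "Suc n"] by force
  qed (use L in auto)
  show "definable False CFL_sym s L" if m: "(s, L) \<in> LIN_CH"
  proof (rule definable_if_defD[OF flogic_CFL])
    obtain n where "(s, L) \<in> CH_level (Suc n)" using m by (auto simp: LIN_CH_def simp del: CH_level.simps)
    then show "defD (in_logic False CFL_sym) s L" using flogic.defD_CH[OF flogic_CFL, of "Suc n"] by force
  qed (use L in auto)
qed

end
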